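(* Let $n\ge 3$ be an integer. (A) Assume $n$ is odd. Let $u$ be an $\mathcal H$-harmonic function on $\mathbb B_n$ having a boundary distribution. Then the following assertions are equivalent: 1. $u$ is constant; 2. $N^{n-1}u$ has a boundary distribution; 3. for every $\Phi\in\mathcal C^\infty(\mathbb S^{n-1})$, $\displaystyle\int_{\mathbb S^{n-1}}N^{n-1}u(r\zeta)\Phi(\zeta)\,d\sigma(\zeta)=o\left(\log\frac1{1-r}\right)$ as $r\to1$. (B) Assume $n$ is even. If $\varphi\in\mathcal C^\infty(\mathbb S^{n-1})$, then $\mathbb P_h[\varphi]\in\mathcal C^\infty(\overline{\mathbb B_n})$. In particular, if $u$ is $\mathcal H$-harmonic on $\mathbb B_n$ with a boundary distribution, then for every integer $k\ge0$, $N^ku$ has a boundary distribution.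
   Context: $\mathbb B_n=\{x\in\mathbb R^n:|x|<1\}$, $\mathbb S^{n-1}=\partial\mathbb B_n$, $\sigma$ is the surface measure on $\mathbb S^{n-1}$. $N=\sum_{i=1}^n x_i\frac{\partial}{\partial x_i}=r\frac{d}{dr}$ (with $r=|x|$) is the normal derivation operator, $\Delta$ is the Euclidean Laplacian, and $D=(1-|x|^2)^2\Delta+2(n-2)(1-|x|^2)N$ is the invariant (hyperbolic) Laplacian. A function $u$ on $\mathbb B_n$ is $\mathcal H$-harmonic if $Du=0$ on $\mathbb B_n$. A function $w$ on $\mathbb B_n$ has a boundary distribution (distribution boundary value) if for every $\Phi\in\mathcal C^\infty(\mathbb S^{n-1})$ the limit $\lim_{r\to1}\int_{\mathbb S^{n-1}}w(r\zeta)\Phi(\zeta)\,d\sigma(\zeta)$ exists. The hyperbolic Poisson kernel is $\mathbb P_h(x,\xi)=\left(\frac{1-|x|^2}{1+|x|^2-2\langle x,\xi\rangle}\right)^{n-1}$ for $x\in\mathbb B_n$, $\xi\in\mathbb S^{n-1}$, and $\mathbb P_h[\varphi](x)=\int_{\mathbb S^{n-1}}\varphi(\xi)\mathbb P_h(x,\xi)\,d\sigma(\xi)$. *)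

theory Defs
  imports
    "HOL-Analysis.Analysis"
    "HOL-Library.Extended_Nat"
    "HOL-Library.Landau_Symbols"
begin

section \<open>Partial derivatives and smoothness\<close>

definition partial :: "'a::euclidean_space \<Rightarrow> ('a \<Rightarrow> 'b::real_normed_vector) \<Rightarrow> 'a \<Rightarrow> 'b" where
  "partial b f x = frechet_derivative f (at x) b"

text \<open>
  A list of basis vectors plays the role of a multi-index, so that \<open>foldr partial bs f\<close> is a
  partial derivative of order \<open>length bs\<close>. On an open set, being of class \<open>C^k\<close> amounts to the
  partial derivatives of order at most \<open>k\<close> being continuous, and those of order less than \<open>k\<close>
  are then (totally) differentiable. The differentiability has to be demanded explicitly because
  \<^const>\<open>frechet_derivative\<close> is total.
\<close>

definition Ck_on :: "enat \<Rightarrow> 'a::euclidean_space set \<Rightarrow> ('a \<Rightarrow> 'b::real_normed_vector) \<Rightarrow> bool" where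
  "Ck_on k U f \<longleftrightarrow>
     (\<forall>bs\<in>lists Basis.
        (enat (length bs) < k \<longrightarrow> (\<forall>x\<in>U. foldr partial bs f differentiable (at x))) \<and>
        (enat (length bs) \<le> k \<longrightarrow> continuous_on U (foldr partial bs f)))"

text \<open>
  For an open set \<open>U\<close>: smoothness up to the boundary, i.e. all partial derivatives of \<open>f\<close> on \<open>U\<close>
  extend continuously to the closure. Only the values of \<open>f\<close> on \<open>U\<close> matter.
\<close>

definition smooth_on_closure :: "'a::euclidean_space set \<Rightarrow> ('a \<Rightarrow> 'b::real_normed_vector) \<Rightarrow> bool" where
  "smooth_on_closure U f \<longleftrightarrow>
     Ck_on \<infinity> U f \<and>
     (\<forall>bs\<in>lists Basis. \<exists>g. continuous_on (closure U) g \<and> (\<forall>x\<in>U. g x = foldr partial bs f x))"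

text \<open>
  Smoothness on the unit sphere, as an embedded submanifold: restriction of a smooth function
  defined near the sphere. Only the values on the sphere matter.
\<close>

definition smooth_on_sphere :: "('a::euclidean_space \<Rightarrow> 'b::real_normed_vector) \<Rightarrow> bool" where
  "smooth_on_sphere \<Phi> \<longleftrightarrow>
     (\<exists>U F. open U \<and> sphere 0 1 \<subseteq> U \<and> Ck_on \<infinity> U F \<and> (\<forall>\<zeta>\<in>sphere 0 1. F \<zeta> = \<Phi> \<zeta>))"


section \<open>Surface measure and boundary distributions\<close>

text \<open>
  The surface measure of polar coordinates: \<open>\<sigma>(A) = n * \<lambda>({r \<zeta>. 0 < r < 1 \<and> \<zeta> \<in> A})\<close> for Borel
  subsets \<open>A\<close> of the unit sphere. It is not normalised. The underlying space is the sphere itself,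
  so integrands may be arbitrary off the sphere.
\<close>

definition sphere_measure :: "'a::euclidean_space measure" where
  "sphere_measure =
     distr (scale_measure (of_nat DIM('a)) (restrict_space lborel (ball 0 1 - {0})))
           (restrict_space borel (sphere 0 1)) sgn"

definition sphere_pairing :: "('a::euclidean_space \<Rightarrow> complex) \<Rightarrow> ('a \<Rightarrow> complex) \<Rightarrow> real \<Rightarrow> complex" where
  "sphere_pairing w \<Phi> r = (LINT \<zeta>|sphere_measure. w (r *\<^sub>R \<zeta>) * \<Phi> \<zeta>)"

definition has_boundary_distribution :: "('a::euclidean_space \<Rightarrow> complex) \<Rightarrow> bool" where
  "has_boundary_distribution w \<longleftrightarrow>
     (\<forall>\<Phi>. smooth_on_sphere \<Phi> \<longrightarrow> (\<exists>L. (sphere_pairing w \<Phi> \<longlongrightarrow> L) (at_left 1)))"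


section \<open>The invariant Laplacian and the hyperbolic Poisson kernel\<close>

definition laplacian :: "('a::euclidean_space \<Rightarrow> 'b::real_normed_vector) \<Rightarrow> 'a \<Rightarrow> 'b" where
  "laplacian f x = (\<Sum>b\<in>Basis. partial b (partial b f) x)"

definition normal_deriv :: "('a::euclidean_space \<Rightarrow> 'b::real_normed_vector) \<Rightarrow> 'a \<Rightarrow> 'b" where
  "normal_deriv f x = (\<Sum>b\<in>Basis. (x \<bullet> b) *\<^sub>R partial b f x)"

definition hyp_laplacian :: "('a::euclidean_space \<Rightarrow> 'b::real_normed_vector) \<Rightarrow> 'a \<Rightarrow> 'b" where
  "hyp_laplacian f x =
     (1 - (norm x)\<^sup>2)\<^sup>2 *\<^sub>R laplacian f x
     + (2 * (real DIM('a) - 2) * (1 - (norm x)\<^sup>2)) *\<^sub>R normal_deriv f x"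

definition H_harmonic :: "('a::euclidean_space \<Rightarrow> 'b::real_normed_vector) \<Rightarrow> bool" where
  "H_harmonic u \<longleftrightarrow> Ck_on 2 (ball 0 1) u \<and> (\<forall>x\<in>ball 0 1. hyp_laplacian u x = 0)"

definition hyp_poisson_kernel :: "'a::euclidean_space \<Rightarrow> 'a \<Rightarrow> real" where
  "hyp_poisson_kernel x \<xi> =
     ((1 - (norm x)\<^sup>2) / (1 + (norm x)\<^sup>2 - 2 * (x \<bullet> \<xi>))) ^ (DIM('a) - 1)"

definition hyp_poisson :: "('a::euclidean_space \<Rightarrow> complex) \<Rightarrow> 'a \<Rightarrow> complex" where
  "hyp_poisson \<phi> x = (LINT \<xi>|sphere_measure. \<phi> \<xi> * complex_of_real (hyp_poisson_kernel x \<xi>))"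

end

theory Submission
  imports Defs
begin

text \<open>
  Write \<open>m = n - 2\<close>, \<open>r = exp (- t)\<close>, and \<open>\<Lambda>\<close> for the Laplacian of the sphere, taken as half the sum of
  the squares of the rotation fields \<open>x\<^sub>b \<partial>\<^sub>c - x\<^sub>c \<partial>\<^sub>b\<close>. For an \<open>\<H>\<close>-harmonic \<open>u\<close> and a test function \<open>F\<close>
  let \<open>\<ell>\<^sub>F(t) = \<integral> u(exp (- t) \<zeta>) F(\<zeta>) d\<sigma>(\<zeta>)\<close>. Since \<open>N = - d/dt\<close> along rays, the pairing of \<open>N^k u\<close> with
  \<open>F\<close> is the \<open>k\<close>-th derivative of \<open>\<ell>\<^sub>F\<close> up to sign, so both parts of the theorem are statements about
  \<open>\<ell>\<^sub>F\<close> as \<open>t \<rightarrow> 0\<close>. The polar form of the Laplacian and integration by parts on the sphere turn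
  \<open>D u = 0\<close> into
    \<open>sinh t (\<ell>\<^sub>F'' + \<ell>\<^sub>G) = m cosh t \<ell>\<^sub>F'\<close>  with  \<open>G = \<Lambda> F\<close>  (lemma \<open>pairing_equation\<close>).
  Existence of the boundary distribution says that \<open>\<ell>\<close> is bounded near \<open>0\<close> for \<open>F, \<Lambda> F, \<Lambda>\<^sup>2 F, \<dots>\<close>
  simultaneously, which is all that is needed to analyse the singular point \<open>t = 0\<close>; no expansion in
  spherical harmonics occurs. The analysis runs on the iterates of \<open>(1 / sinh t) d/dt\<close>, for which the
  equation becomes a three-term recursion (locale \<open>ray_ode\<close>).

  Even \<open>n\<close>. The exponents \<open>0\<close> and \<open>m + 1\<close> of the singular point have different parity and the
  recursion never degenerates, so all derivatives of \<open>\<ell>\<^sub>F\<close> are bounded near \<open>0\<close>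
  (\<open>even_all_derivatives_bounded\<close>), hence have limits. This gives the statement on boundary
  distributions. For the Poisson integral the same theorem is applied to the functions
  \<open>t \<mapsto> \<P>[\<Lambda>^j \<phi>](exp (- t) \<zeta>)\<close>, uniformly in \<open>\<zeta>\<close>: the kernel commutes with rotations, so \<open>\<Lambda> \<P>[\<phi>] = \<P>[\<Lambda> \<phi>]\<close>,
  and \<open>\<P>[1]\<close> bounds \<open>\<P>[\<phi>]\<close>. Every partial derivative is, near the sphere, a combination of \<open>N\<close> and
  rotation fields with smooth coefficients, so all partial derivatives of \<open>\<P>[\<phi>]\<close> are bounded, thus
  uniformly continuous, and extend to the closed ball.

  Odd \<open>n\<close>. With \<open>p = (n - 1) / 2\<close>, the derivative of order \<open>2 p = n - 1\<close> contains a term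
  \<open>c \<beta>(Q F) log (1 / t)\<close> where \<open>c \<noteq> 0\<close>, \<open>\<beta>\<close> is the boundary distribution and
  \<open>Q = \<Lambda> \<Prod>\<^sub>i (\<Lambda> - i (m - i))\<close>, \<open>1 \<le> i < p\<close> (\<open>odd_log_term_vanishes\<close>). Assertion (3) therefore forces
  \<open>\<beta>(Q F) = 0\<close>. As \<open>\<Lambda>\<close> is negative semidefinite on polynomials (\<open>sph_lap_negative\<close>) and \<open>i (m - i) > 0\<close>,
  the factors other than \<open>\<Lambda>\<close> can be cancelled, and \<open>\<beta>(\<Lambda> F) = 0\<close> for all polynomials \<open>F\<close>. An energy
  estimate, using regularity at the centre of the ball, propagates this from the boundary to
  \<open>\<ell>\<^sub>G(t) = 0\<close> for \<open>G = \<Lambda> F\<close> and all \<open>t > 0\<close>. Then \<open>\<ell>\<^sub>F'\<close> is a multiple of \<open>sinh^m\<close> that is bounded at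
  infinity, hence zero, and by the density of polynomials \<open>u\<close> is constant.

  The hypothesis of \<open>\<H>\<close>-harmonicity asks for second derivatives only, whereas the argument differentiates
  freely; \<open>H_harmonic_imp_smooth\<close> supplies the regularity by a mean value formula for hyperbolic balls.
\<close>

section \<open>Calculus of smooth functions\<close>

text \<open>
  The conditions on \<open>foldr partial bs f\<close>, regrouped by peeling off the innermost derivative: in this form
  closure properties of smooth functions are proved by induction on the order.
\<close>

primrec ndiff :: "nat \<Rightarrow> 'a::euclidean_space set \<Rightarrow> ('a \<Rightarrow> 'b::real_normed_vector) \<Rightarrow> bool" where
  "ndiff 0 U f = True"
| "ndiff (Suc k) U f = ((\<forall>x\<in>U. f differentiable (at x)) \<and> (\<forall>b\<in>Basis. ndiff k U (partial b f)))"

abbreviation smooth_on :: "'a::euclidean_space set \<Rightarrow> ('a \<Rightarrow> 'b::real_normed_vector) \<Rightarrow> bool" where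
  "smooth_on U f \<equiv> Ck_on \<infinity> U f"

text \<open>
  Differentiability of all iterated derivatives already gives their continuity.
\<close>

lemma smooth_on_alt:
  "smooth_on U f \<longleftrightarrow> (\<forall>bs\<in>lists Basis. \<forall>x\<in>U. foldr partial bs f differentiable (at x))"
proof -
  have "continuous_on U g" if "\<forall>x\<in>U. g differentiable (at x)" for g :: "'a \<Rightarrow> 'b"
    using that differentiable_imp_continuous_within[of g _ UNIV]
    by (simp add: continuous_at_imp_continuous_on)
  then show ?thesis unfolding Ck_on_def by simp blast
qed

text \<open>
  \<open>foldr\<close> puts new derivatives on the outside; lists can be split at their last element, which is the
  derivative taken first.
\<close>

lemma smooth_on_partial_iff:
  "smooth_on U f \<longleftrightarrow>
     (\<forall>x\<in>U. f differentiable (at x)) \<and> (\<forall>b\<in>Basis. smooth_on U (partial b f))"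
proof -
  have eq: "foldr partial (bs @ [b]) f = foldr partial bs (partial b f)" for bs b by simp
  show ?thesis
  proof
    assume L: "smooth_on U f"
    have "\<forall>x\<in>U. f differentiable (at x)"
      using L unfolding smooth_on_alt by (metis foldr.simps(1) id_apply lists.Nil)
    moreover have "smooth_on U (partial b f)" if "b \<in> Basis" for b
      unfolding smooth_on_alt
    proof (intro ballI)
      fix bs x assume "bs \<in> lists (Basis::'a set)" "x \<in> U"
      then have "foldr partial (bs @ [b]) f differentiable (at x)"
        using L that unfolding smooth_on_alt by (metis append_in_lists_conv lists.Cons lists.Nil)
      then show "foldr partial bs (partial b f) differentiable (at x)" by simp
    qed
    ultimately show "(\<forall>x\<in>U. f differentiable (at x)) \<and> (\<forall>b\<in>Basis. smooth_on U (partial b f))"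
      by blast
  next
    assume R: "(\<forall>x\<in>U. f differentiable (at x)) \<and> (\<forall>b\<in>Basis. smooth_on U (partial b f))"
    show "smooth_on U f"
      unfolding smooth_on_alt
    proof (intro ballI)
      fix bs x assume bs: "bs \<in> lists (Basis::'a set)" and x: "x \<in> U"
      show "foldr partial bs f differentiable (at x)"
      proof (cases bs rule: rev_cases)
        case Nil then show ?thesis using R x by simp
      next
        case (snoc cs b)
        then have "b \<in> Basis" "cs \<in> lists Basis" using bs by auto
        then have "foldr partial cs (partial b f) differentiable (at x)"
          using R x unfolding smooth_on_alt by blast
        then show ?thesis by (simp add: snoc)
      qed
    qed
  qed
qed

lemma smooth_on_ndiff: "smooth_on U f \<longleftrightarrow> (\<forall>k. ndiff k U f)"
proof
  assume "smooth_on U f"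
  then have "ndiff k U f" for k
  proof (induction k arbitrary: f)
    case (Suc k)
    then show ?case using iffD1[OF smooth_on_partial_iff Suc.prems] by simp
  qed simp
  then show "\<forall>k. ndiff k U f" by blast
next
  have *: "foldr partial bs f differentiable (at x)"
    if "ndiff (Suc (length bs)) U f" "bs \<in> lists Basis" "x \<in> U" for f :: "'a \<Rightarrow> 'b" and bs x
    using that
  proof (induction bs arbitrary: f rule: rev_induct)
    case Nil then show ?case by simp
  next
    case (snoc b bs)
    then have "ndiff (Suc (length bs)) U (partial b f)" by auto
    then show ?case using snoc by auto
  qed
  assume R: "\<forall>k. ndiff k U f"
  show "smooth_on U f" unfolding smooth_on_alt
    by (intro ballI *[OF R[rule_format]])
qed

lemma has_derivative_partial:
  assumes "(f has_derivative f') (at x)"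
  shows "partial b f x = f' b"
  unfolding partial_def using frechet_derivative_at[OF assms] by simp

lemma differentiable_has_derivative_partial:
  assumes "f differentiable (at x)"
  shows "(f has_derivative (\<lambda>h. \<Sum>b\<in>Basis. (h \<bullet> b) *\<^sub>R partial b f x)) (at x)"
proof -
  let ?f' = "frechet_derivative f (at x)"
  have d: "(f has_derivative ?f') (at x)" using assms frechet_derivative_works by blast
  then have lin: "linear ?f'" using has_derivative_linear by blast
  have "?f' h = (\<Sum>b\<in>Basis. (h \<bullet> b) *\<^sub>R partial b f x)" for h
  proof -
    have "?f' h = ?f' (\<Sum>b\<in>Basis. (h \<bullet> b) *\<^sub>R b)" by (simp add: euclidean_representation)
    also have "\<dots> = (\<Sum>b\<in>Basis. (h \<bullet> b) *\<^sub>R ?f' b)"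
      using lin by (simp add: linear_sum linear_cmul)
    finally show ?thesis by (simp add: partial_def)
  qed
  then have "?f' = (\<lambda>h. \<Sum>b\<in>Basis. (h \<bullet> b) *\<^sub>R partial b f x)" by blast
  with d show ?thesis by simp
qed

lemma differentiable_cong_open:
  assumes "open U" "x \<in> U" "\<And>y. y \<in> U \<Longrightarrow> f y = g y" "f differentiable (at x)"
  shows "g differentiable (at x)"
  using assms has_derivative_transform_within_open unfolding differentiable_def by blast

lemma has_derivative_cong_open:
  assumes "open U" "x \<in> U" "\<And>y. y \<in> U \<Longrightarrow> f y = g y"
  shows "(f has_derivative D) (at x) \<longleftrightarrow> (g has_derivative D) (at x)"
  using assms has_derivative_transform_within_open[of _ _ _ UNIV]
  by (metis has_derivative_transform_within_open)

lemma partial_cong_open: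
  assumes "open U" "x \<in> U" "\<And>y. y \<in> U \<Longrightarrow> f y = g y"
  shows "partial b f x = partial b g x"
proof -
  have "(f has_derivative D) (at x) \<longleftrightarrow> (g has_derivative D) (at x)" for D
    using has_derivative_cong_open[OF assms] .
  then show ?thesis unfolding partial_def frechet_derivative_def by simp
qed

lemma ndiff_cong:
  assumes "open U" "\<And>x. x \<in> U \<Longrightarrow> f x = g x" "ndiff k U f"
  shows "ndiff k U g"
  using assms(2,3)
proof (induction k arbitrary: f g)
  case (Suc k)
  have "ndiff k U (partial b g)" if "b \<in> Basis" for b
    using Suc.IH[of "partial b f" "partial b g"] Suc.prems that partial_cong_open[OF assms(1), of _ f g]
    by auto
  moreover have "\<forall>x\<in>U. g differentiable (at x)"
    using Suc.prems differentiable_cong_open[OF assms(1)] by (metis ndiff.simps(2))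
  ultimately show ?case by simp
qed simp

lemma smooth_on_cong:
  assumes "open U" "\<And>x. x \<in> U \<Longrightarrow> f x = g x" "smooth_on U f"
  shows "smooth_on U g"
  using assms ndiff_cong unfolding smooth_on_ndiff by metis

lemma ndiff_mono: "ndiff (Suc k) U f \<Longrightarrow> ndiff k U f"
  by (induction k arbitrary: f) auto

lemma ndiff_subset: "ndiff k U f \<Longrightarrow> V \<subseteq> U \<Longrightarrow> ndiff k V f"
  by (induction k arbitrary: f) auto

lemma smooth_on_subset: "smooth_on U f \<Longrightarrow> V \<subseteq> U \<Longrightarrow> smooth_on V f"
  using ndiff_subset unfolding smooth_on_ndiff by metis

lemma smooth_on_Un: "smooth_on U f \<Longrightarrow> smooth_on V f \<Longrightarrow> smooth_on (U \<union> V) f"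
  unfolding smooth_on_alt by blast

lemma smooth_on_differentiable: "smooth_on U f \<Longrightarrow> x \<in> U \<Longrightarrow> f differentiable (at x)"
  using smooth_on_partial_iff by blast

lemma smooth_on_partial: "smooth_on U f \<Longrightarrow> b \<in> Basis \<Longrightarrow> smooth_on U (partial b f)"
  using smooth_on_partial_iff by blast

lemma smooth_on_continuous: "smooth_on U f \<Longrightarrow> continuous_on U f"
  unfolding Ck_on_def by (metis foldr.simps(1) id_apply lists.Nil enat_ord_simps(3))

lemma partial_const [simp]: "partial b (\<lambda>x. c) = (\<lambda>x. 0)"
  by (rule ext) (rule has_derivative_partial[OF has_derivative_const])

lemma ndiff_const [simp]: "ndiff k U (\<lambda>x. c)"
  by (induction k arbitrary: c) auto

lemma smooth_on_const [simp]: "smooth_on U (\<lambda>x. c)"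
  unfolding smooth_on_ndiff by simp

lemma partial_linear:
  assumes "bounded_linear L"
  shows "partial b L = (\<lambda>x. L b)"
  by (rule ext) (rule has_derivative_partial[OF bounded_linear_imp_has_derivative[OF assms]])

lemma smooth_on_linear:
  assumes "bounded_linear L"
  shows "smooth_on U L"
  by (rule iffD2[OF smooth_on_partial_iff])
    (use assms in \<open>simp add: partial_linear bounded_linear_imp_differentiable\<close>)

lemma partial_compose_linear:
  assumes "bounded_linear L" "f differentiable (at x)"
  shows "partial b (\<lambda>x. L (f x)) x = L (partial b f x)"
proof -
  have "(f has_derivative frechet_derivative f (at x)) (at x)"
    using assms(2) frechet_derivative_works by blast
  then have "((\<lambda>x. L (f x)) has_derivative (\<lambda>h. L (frechet_derivative f (at x) h))) (at x)"
    by (rule bounded_linear.has_derivative[OF assms(1)])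
  then show ?thesis using has_derivative_partial by (fastforce simp: partial_def)
qed

lemma ndiff_compose_linear:
  assumes "open U" "bounded_linear L" "ndiff k U f"
  shows "ndiff k U (\<lambda>x. L (f x))"
  using assms(3)
proof (induction k arbitrary: f)
  case (Suc k)
  have "ndiff k U (partial b (\<lambda>x. L (f x)))" if "b \<in> Basis" for b
  proof (rule ndiff_cong[OF assms(1)])
    show "ndiff k U (\<lambda>x. L (partial b f x))" using Suc that by simp
  qed (use Suc.prems in \<open>simp add: partial_compose_linear[OF assms(2)]\<close>)
  moreover have "(\<lambda>x. L (f x)) differentiable (at x)" if "x \<in> U" for x
  proof -
    have "f differentiable (at x)" using Suc.prems that by simp
    then show ?thesis
      unfolding differentiable_def using bounded_linear.has_derivative[OF assms(2)] by blast
  qed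
  ultimately show ?case by simp
qed simp

lemma smooth_on_compose_linear:
  assumes "open U" "bounded_linear L" "smooth_on U f"
  shows "smooth_on U (\<lambda>x. L (f x))"
  using assms ndiff_compose_linear unfolding smooth_on_ndiff by blast

lemma partial_add:
  assumes "f differentiable (at x)" "g differentiable (at x)"
  shows "partial b (\<lambda>x. f x + g x) x = partial b f x + partial b g x"
  using has_derivative_partial[OF has_derivative_add] assms
  unfolding frechet_derivative_works by (auto simp: partial_def)

lemma ndiff_add:
  assumes "open U" "ndiff k U f" "ndiff k U g"
  shows "ndiff k U (\<lambda>x. f x + g x)"
  using assms(2,3)
proof (induction k arbitrary: f g)
  case (Suc k)
  have "ndiff k U (partial b (\<lambda>x. f x + g x))" if "b \<in> Basis" for b
  proof (rule ndiff_cong[OF assms(1)])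
    show "ndiff k U (\<lambda>x. partial b f x + partial b g x)" using Suc that by simp
  qed (use Suc.prems in \<open>simp add: partial_add\<close>)
  then show ?case using Suc.prems by auto
qed simp

lemma smooth_on_add:
  assumes "open U" "smooth_on U f" "smooth_on U g"
  shows "smooth_on U (\<lambda>x. f x + g x)"
  using assms ndiff_add unfolding smooth_on_ndiff by blast

lemma partial_sum:
  assumes "\<And>i. i \<in> I \<Longrightarrow> f i differentiable (at x)"
  shows "partial b (\<lambda>x. \<Sum>i\<in>I. f i x) x = (\<Sum>i\<in>I. partial b (f i) x)"
proof -
  have "((\<lambda>x. \<Sum>i\<in>I. f i x) has_derivative (\<lambda>h. \<Sum>i\<in>I. frechet_derivative (f i) (at x) h)) (at x)"
    by (rule has_derivative_sum) (use assms frechet_derivative_works in blast)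
  then show ?thesis using has_derivative_partial by (fastforce simp: partial_def)
qed

lemma smooth_on_sum:
  assumes "open U" "\<And>i. i \<in> I \<Longrightarrow> smooth_on U (f i)"
  shows "smooth_on U (\<lambda>x. \<Sum>i\<in>I. f i x)"
proof (cases "finite I")
  case True
  then show ?thesis using assms(2)
    by (induction I rule: finite_induct) (auto intro: smooth_on_add[OF assms(1)])
qed simp

lemma differentiable_bilinear:
  assumes B: "bounded_bilinear B" and f: "f differentiable (at x)" and g: "g differentiable (at x)"
  shows "(\<lambda>x. B (f x) (g x)) differentiable (at x)"
proof -
  obtain f' g' where "(f has_derivative f') (at x)" "(g has_derivative g') (at x)"
    using f g unfolding differentiable_def by blast
  from bounded_bilinear.FDERIV[OF B this] show ?thesis unfolding differentiable_def by blast
qed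

lemma partial_bilinear:
  assumes B: "bounded_bilinear B" and f: "f differentiable (at x)" and g: "g differentiable (at x)"
  shows "partial b (\<lambda>x. B (f x) (g x)) x = B (f x) (partial b g x) + B (partial b f x) (g x)"
  using has_derivative_partial[OF bounded_bilinear.FDERIV[OF B]] f g
  unfolding frechet_derivative_works by (auto simp: partial_def)

lemma ndiff_bilinear:
  assumes "open U" and B: "bounded_bilinear B" and "ndiff k U f" "ndiff k U g"
  shows "ndiff k U (\<lambda>x. B (f x) (g x))"
  using assms(3,4)
proof (induction k arbitrary: f g)
  case (Suc k)
  have "ndiff k U (partial b (\<lambda>x. B (f x) (g x)))" if "b \<in> Basis" for b
  proof (rule ndiff_cong[OF assms(1)])
    show "ndiff k U (\<lambda>x. B (f x) (partial b g x) + B (partial b f x) (g x))"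
      using Suc.IH Suc.prems that ndiff_mono[OF Suc.prems(1)] ndiff_mono[OF Suc.prems(2)]
      by (auto intro!: ndiff_add[OF assms(1)])
  qed (use Suc.prems in \<open>simp add: partial_bilinear[OF B]\<close>)
  moreover have "(\<lambda>x. B (f x) (g x)) differentiable (at x)" if "x \<in> U" for x
    using Suc.prems that by (intro differentiable_bilinear[OF B]) auto
  ultimately show ?case by simp
qed simp

lemma smooth_on_bilinear:
  assumes "open U" "bounded_bilinear B" "smooth_on U f" "smooth_on U g"
  shows "smooth_on U (\<lambda>x. B (f x) (g x))"
  using assms ndiff_bilinear unfolding smooth_on_ndiff by blast

lemmas smooth_on_mult = smooth_on_bilinear[OF _ bounded_bilinear_mult]
lemmas smooth_on_scaleR = smooth_on_bilinear[OF _ bounded_bilinear_scaleR]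
lemmas smooth_on_inner = smooth_on_bilinear[OF _ bounded_bilinear_inner]
lemmas partial_mult = partial_bilinear[OF bounded_bilinear_mult]
lemmas partial_scaleR = partial_bilinear[OF bounded_bilinear_scaleR]

lemma smooth_on_minus: "open U \<Longrightarrow> smooth_on U f \<Longrightarrow> smooth_on U (\<lambda>x. - f x)"
  using smooth_on_compose_linear[OF _ bounded_linear_minus[OF bounded_linear_ident]] by blast

lemma smooth_on_diff:
  assumes "open U" "smooth_on U f" "smooth_on U g"
  shows "smooth_on U (\<lambda>x. f x - g x)"
  using smooth_on_add[OF assms(1,2) smooth_on_minus[OF assms(1,3)]] by simp

lemma smooth_on_power:
  fixes f :: "'a::euclidean_space \<Rightarrow> 'b::real_normed_field"
  assumes "open U" "smooth_on U f"
  shows "smooth_on U (\<lambda>x. f x ^ k)"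
  using smooth_on_mult[OF assms(1)] assms by (induction k) auto

lemma smooth_on_of_real:
  "open U \<Longrightarrow> smooth_on U f \<Longrightarrow> smooth_on U (\<lambda>x. complex_of_real (f x))"
  using smooth_on_compose_linear[OF _ bounded_linear_of_real] by blast

lemma partial_compose:
  assumes f: "f differentiable (at x)" and g: "g differentiable (at (f x))"
  shows "partial b (\<lambda>x. g (f x)) x = (\<Sum>c\<in>Basis. partial b (\<lambda>x. f x \<bullet> c) x *\<^sub>R partial c g (f x))"
proof -
  have 1: "(f has_derivative frechet_derivative f (at x)) (at x)"
    using f frechet_derivative_works by blast
  have 2: "((\<lambda>x. g (f x)) has_derivative
      (\<lambda>h. \<Sum>c\<in>Basis. (frechet_derivative f (at x) h \<bullet> c) *\<^sub>R partial c g (f x))) (at x)"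
    using diff_chain_at[OF 1 differentiable_has_derivative_partial[OF g]] by (simp add: comp_def)
  have 3: "partial b (\<lambda>x. f x \<bullet> c) x = partial b f x \<bullet> c" for c
    using partial_compose_linear[OF bounded_linear_inner_left f] .
  show ?thesis unfolding has_derivative_partial[OF 2] 3 by (simp add: partial_def)
qed

text \<open>
  Only the components of the inner function are required to be smooth, because its range may lie in a
  space of different dimension. By the chain rule each derivative of a composition is a sum of products of
  derivatives of the components with compositions of the same shape.
\<close>

lemma smooth_on_compose:
  assumes U: "open U" and f: "\<And>c. c \<in> Basis \<Longrightarrow> smooth_on U (\<lambda>x. f x \<bullet> c)"
    and g: "smooth_on V g" and fU: "\<And>x. x \<in> U \<Longrightarrow> f x \<in> V"
  shows "smooth_on U (\<lambda>x. g (f x))"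
proof -
  have fd: "f differentiable (at x)" if "x \<in> U" for x
    using differentiable_componentwise_within[of f x UNIV] f smooth_on_differentiable that
    by blast
  have "ndiff k U (\<lambda>x. g (f x))" for k
    using g
  proof (induction k arbitrary: g)
    case (Suc k)
    have gd: "g differentiable (at (f x))" if "x \<in> U" for x
      using Suc.prems fU that smooth_on_differentiable by blast
    have "ndiff k U (partial b (\<lambda>x. g (f x)))" if "b \<in> Basis" for b
    proof (rule ndiff_cong[OF U])
      have "ndiff k U (\<lambda>x. \<Sum>c\<in>C. partial b (\<lambda>x. f x \<bullet> c) x *\<^sub>R partial c g (f x))"
        if "finite C" "C \<subseteq> Basis" for C
        using that
      proof (induction C rule: finite_induct)
        case (insert c C)
        have "ndiff k U (\<lambda>x. partial b (\<lambda>x. f x \<bullet> c) x *\<^sub>R partial c g (f x))"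
        proof (rule ndiff_bilinear[OF U bounded_bilinear_scaleR])
          show "ndiff k U (partial b (\<lambda>x. f x \<bullet> c))"
            using f smooth_on_partial insert.prems \<open>b \<in> Basis\<close> smooth_on_ndiff by blast
          show "ndiff k U (\<lambda>x. partial c g (f x))"
            using Suc.IH smooth_on_partial Suc.prems insert.prems by blast
        qed
        then show ?case using insert by (auto intro!: ndiff_add[OF U])
      qed simp
      then show "ndiff k U (\<lambda>x. \<Sum>c\<in>Basis. partial b (\<lambda>x. f x \<bullet> c) x *\<^sub>R partial c g (f x))"
        by simp
    qed (use fd gd in \<open>auto intro!: partial_compose[symmetric]\<close>)
    moreover have "(\<lambda>x. g (f x)) differentiable (at x)" if "x \<in> U" for x
      using differentiable_chain_at[OF fd gd] that by (simp add: comp_def)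
    ultimately show ?case by simp
  qed simp
  then show ?thesis unfolding smooth_on_ndiff by simp
qed

lemma smooth_on_compose_real:
  fixes f :: "'a::euclidean_space \<Rightarrow> real"
  assumes "open U" "smooth_on U f" "smooth_on V g" "\<And>x. x \<in> U \<Longrightarrow> f x \<in> V"
  shows "smooth_on U (\<lambda>x. g (f x))"
  by (rule smooth_on_compose[OF assms(1) _ assms(3,4)]) (use assms(2) in auto)

lemma partial_real:
  fixes f :: "real \<Rightarrow> 'b::real_normed_vector"
  assumes "(f has_vector_derivative f') (at x)"
  shows "partial 1 f x = f'"
  using has_derivative_partial[of f "\<lambda>h. h *\<^sub>R f'" x 1] assms
  by (simp add: has_vector_derivative_def)

text \<open>
  Coinduction: a class of functions of one variable that is closed under differentiation consists of smooth
  functions.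
\<close>

lemma smooth_on_realI:
  fixes P :: "(real \<Rightarrow> 'b::real_normed_vector) \<Rightarrow> bool"
  assumes U: "open U" and P: "P f"
    and step: "\<And>f. P f \<Longrightarrow> \<exists>g. P g \<and> (\<forall>x\<in>U. (f has_vector_derivative g x) (at x))"
  shows "smooth_on U f"
proof -
  have "ndiff k U f" if "P f" for k f
    using that
  proof (induction k arbitrary: f)
    case (Suc k)
    obtain g where g: "P g" "\<forall>x\<in>U. (f has_vector_derivative g x) (at x)"
      using step[OF Suc.prems] by (elim exE conjE) (rule that)
    have "ndiff k U (partial 1 f)"
      by (rule ndiff_cong[OF U _ Suc.IH[OF g(1)]]) (use g(2) partial_real in force)
    moreover have "\<forall>x\<in>U. f differentiable (at x)"
      using g(2) unfolding has_vector_derivative_def by (blast intro: differentiableI)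
    ultimately show ?case by simp
  qed simp
  then show ?thesis unfolding smooth_on_ndiff using P by simp
qed

text \<open>
  The class of the functions \<open>x \<mapsto> c x^b\<close> is closed under differentiation.
\<close>

lemma smooth_on_powr: "smooth_on {0<..} (\<lambda>x::real. x powr a)"
proof (rule smooth_on_realI[where P="\<lambda>f. \<exists>c a. f = (\<lambda>x. c * x powr a)"])
  show "\<exists>c b. (\<lambda>x::real. x powr a) = (\<lambda>x. c * x powr b)" by (intro exI[of _ 1] exI[of _ a]) simp
  fix f :: "real \<Rightarrow> real" assume "\<exists>c a. f = (\<lambda>x. c * x powr a)"
  then obtain c a where f: "f = (\<lambda>x. c * x powr a)" by blast
  have "(f has_vector_derivative (c * a) * x powr (a - 1)) (at x)" if "x \<in> {0<..}" for x
    unfolding f has_real_derivative_iff_has_vector_derivative[symmetric]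
    using that by (auto intro!: derivative_eq_intros)
  then show "\<exists>g. (\<exists>c a. g = (\<lambda>x. c * x powr a)) \<and> (\<forall>x\<in>{0<..}. (f has_vector_derivative g x) (at x))"
    by (intro exI[of _ "\<lambda>x. (c * a) * x powr (a - 1)"]) auto
qed simp

lemma smooth_on_inverse:
  fixes f :: "'a::euclidean_space \<Rightarrow> real"
  assumes "open U" "smooth_on U f" "\<And>x. x \<in> U \<Longrightarrow> f x > 0"
  shows "smooth_on U (\<lambda>x. inverse (f x))"
proof (rule smooth_on_cong[OF assms(1)])
  show "smooth_on U (\<lambda>x. f x powr (-1))"
    by (rule smooth_on_compose_real[OF assms(1,2) smooth_on_powr]) (use assms(3) in auto)
qed (use assms(3) in \<open>auto simp: powr_minus less_imp_le\<close>)

lemma smooth_on_divide: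
  fixes f :: "'a::euclidean_space \<Rightarrow> real"
  assumes "open U" "smooth_on U g" "smooth_on U f" "\<And>x. x \<in> U \<Longrightarrow> f x > 0"
  shows "smooth_on U (\<lambda>x. g x / f x)"
  using smooth_on_mult[OF assms(1,2) smooth_on_inverse[OF assms(1,3,4)]] by (simp add: divide_inverse)

section \<open>Differentiation under the integral sign\<close>

lemma continuous_on_compact_bound:
  fixes f :: "'a::topological_space \<Rightarrow> 'b::real_normed_vector"
  assumes "continuous_on K f" "compact K"
  obtains B where "\<forall>x\<in>K. norm (f x) \<le> B"
proof -
  have "bounded (f ` K)" by (intro compact_imp_bounded compact_continuous_image assms)
  then show thesis unfolding bounded_iff by (elim exE) (rule that, simp)
qed

text \<open>
  The two measures for which differentiation under the integral sign is needed, the surface measure and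
  Lebesgue measure on a closed ball, are finite measures on compact sets whose continuous functions are
  measurable.
\<close>

definition compact_measure :: "'a::euclidean_space measure \<Rightarrow> 'a set \<Rightarrow> bool" where
  "compact_measure M Y \<longleftrightarrow>
     finite_measure M \<and> compact Y \<and> space M = Y \<and> sets M = sets (restrict_space borel Y)"

lemma compact_measure_measurable:
  fixes f :: "'a::euclidean_space \<Rightarrow> 'b::topological_space"
  assumes "compact_measure M Y" "continuous_on Y f"
  shows "f \<in> borel_measurable M"
proof -
  have "f \<in> borel_measurable (restrict_space borel Y)"
    using assms(2) by (rule borel_measurable_continuous_on_restrict)
  moreover have "measurable M borel = measurable (restrict_space borel Y) (borel :: 'b measure)"
    by (rule measurable_cong_sets) (use assms(1) in \<open>simp_all add: compact_measure_def\<close>)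
  ultimately show ?thesis by simp
qed

lemma compact_measure_integrable:
  fixes f :: "'a::euclidean_space \<Rightarrow> complex"
  assumes "compact_measure M Y" "continuous_on Y f"
  shows "integrable M f"
proof -
  have "compact Y" using assms(1) by (simp add: compact_measure_def)
  then obtain B where "\<forall>x\<in>Y. norm (f x) \<le> B"
    by (rule continuous_on_compact_bound[OF assms(2)])
  then have "AE x in M. norm (f x) \<le> B"
    using assms(1) unfolding compact_measure_def by (intro AE_I2) auto
  then show ?thesis
    by (rule finite_measure.integrable_const_bound[rotated])
      (use compact_measure_measurable[OF assms] assms(1) in \<open>simp_all add: compact_measure_def\<close>)
qed

text \<open>
  By the mean value inequality the difference quotients of \<open>k\<close> are bounded by a multiple of \<open>B\<close>, which is
  integrable because the measure is finite, so dominated convergence applies.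
\<close>

lemma has_derivative_integral:
  fixes k :: "'x::euclidean_space \<Rightarrow> 'y \<Rightarrow> complex" and kp :: "'x \<Rightarrow> 'x \<Rightarrow> 'y \<Rightarrow> complex"
  assumes M: "finite_measure M" and r: "r > 0"
    and d: "\<And>x y. x \<in> ball x0 r \<Longrightarrow> y \<in> space M \<Longrightarrow>
              ((\<lambda>x. k x y) has_derivative (\<lambda>h. \<Sum>b\<in>Basis. (h \<bullet> b) *\<^sub>R kp b x y)) (at x)"
    and B: "\<And>b x y. b \<in> Basis \<Longrightarrow> x \<in> ball x0 r \<Longrightarrow> y \<in> space M \<Longrightarrow> norm (kp b x y) \<le> B"
    and int: "\<And>x. x \<in> ball x0 r \<Longrightarrow> integrable M (k x)"
    and intp: "\<And>b. b \<in> Basis \<Longrightarrow> integrable M (kp b x0)"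
  shows "((\<lambda>x. LINT y|M. k x y) has_derivative
           (\<lambda>h. \<Sum>b\<in>Basis. (h \<bullet> b) *\<^sub>R (LINT y|M. kp b x0 y))) (at x0)"
proof -
  interpret finite_measure M by fact
  let ?D = "\<lambda>x y h. \<Sum>b\<in>Basis. (h \<bullet> b) *\<^sub>R kp b x y"
  let ?C = "real DIM('x) * \<bar>B\<bar>"
  have Dle: "norm (?D x y h) \<le> ?C * norm h" if "x \<in> ball x0 r" "y \<in> space M" for x y h
  proof -
    have "norm (?D x y h) \<le> (\<Sum>b\<in>(Basis::'x set). norm h * \<bar>B\<bar>)"
    proof (rule sum_norm_le)
      fix b :: 'x assume b: "b \<in> Basis"
      have "norm (kp b x y) \<le> \<bar>B\<bar>" using B[OF b that] by linarith
      then show "norm ((h \<bullet> b) *\<^sub>R kp b x y) \<le> norm h * \<bar>B\<bar>"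
        unfolding norm_scaleR real_norm_def using Basis_le_norm[OF b, of h]
        by (intro mult_mono) simp_all
    qed
    then show ?thesis by (simp add: mult.commute mult.left_commute)
  qed
  have lip: "norm (k x y - k x0 y) \<le> ?C * norm (x - x0)" if "x \<in> ball x0 r" "y \<in> space M" for x y
  proof (rule differentiable_bound[where S="ball x0 r" and f'="\<lambda>x. ?D x y"])
    show "((\<lambda>x. k x y) has_derivative ?D z y) (at z within ball x0 r)" if "z \<in> ball x0 r" for z
      using d[OF that \<open>y \<in> space M\<close>] has_derivative_at_withinI by blast
    show "onorm (?D z y) \<le> ?C" if "z \<in> ball x0 r" for z
      using Dle[OF that \<open>y \<in> space M\<close>] by (intro onorm_le) auto
  qed (use that r in auto)
  have intD: "integrable M (\<lambda>y. ?D x0 y h)" for h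
    by (intro Bochner_Integration.integrable_sum integrable_scaleR_right) (use intp in auto)
  have intDeq: "(LINT y|M. ?D x0 y h) = (\<Sum>b\<in>Basis. (h \<bullet> b) *\<^sub>R (LINT y|M. kp b x0 y))" for h
    using intp by (subst Bochner_Integration.integral_sum) (auto intro!: integrable_scaleR_right sum.cong)
  have x0: "x0 \<in> ball x0 r" using r by simp
  have "((\<lambda>x. LINT y|M. k x y) has_derivative (\<lambda>h. LINT y|M. ?D x0 y h)) (at x0 within ball x0 r)"
    unfolding has_derivative_iff_norm
  proof
    show "bounded_linear (\<lambda>h. LINT y|M. ?D x0 y h)"
      unfolding intDeq
      by (intro bounded_linear_sum bounded_linear_scaleR_const bounded_linear_inner_left)
    show "((\<lambda>x. norm ((LINT y|M. k x y) - (LINT y|M. k x0 y) - (LINT y|M. ?D x0 y (x - x0)))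
             / norm (x - x0)) \<longlongrightarrow> 0) (at x0 within ball x0 r)"
      unfolding tendsto_at_iff_sequentially comp_def
    proof (intro allI impI)
      fix X assume X: "\<forall>i. X i \<in> ball x0 r - {x0}" "X \<longlonglongrightarrow> x0"
      let ?q = "\<lambda>i y. (k (X i) y - k x0 y - ?D x0 y (X i - x0)) /\<^sub>R norm (X i - x0)"
      have Xi: "X i \<in> ball x0 r" for i using X by blast
      have "(\<lambda>i. LINT y|M. ?q i y) \<longlonglongrightarrow> (LINT y|M. 0)"
      proof (rule integral_dominated_convergence[where w="\<lambda>_. 2 * ?C"])
        show "?q i \<in> borel_measurable M" for i
          using int[OF Xi] int[OF x0] intD by (intro borel_measurable_integrable) auto
        show "AE y in M. (\<lambda>i. ?q i y) \<longlonglongrightarrow> 0"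
        proof (rule AE_I2)
          fix y assume y: "y \<in> space M"
          have "((\<lambda>x. norm (k x y - k x0 y - ?D x0 y (x - x0)) / norm (x - x0)) \<longlongrightarrow> 0) (at x0)"
            using d[OF x0 y] unfolding has_derivative_iff_norm by blast
          then have "(\<lambda>i. norm (k (X i) y - k x0 y - ?D x0 y (X i - x0)) / norm (X i - x0)) \<longlonglongrightarrow> 0"
            unfolding tendsto_at_iff_sequentially comp_def using X by simp
          then have "(\<lambda>i. norm (?q i y)) \<longlonglongrightarrow> 0" by (simp add: divide_inverse mult.commute)
          then show "(\<lambda>i. ?q i y) \<longlonglongrightarrow> 0" by (rule tendsto_norm_zero_cancel)
        qed
        show "AE y in M. norm (?q i y) \<le> 2 * ?C" for i
        proof (rule AE_I2)
          fix y assume y: "y \<in> space M"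
          have pos: "norm (X i - x0) > 0" using X(1)[rule_format, of i] by simp
          have "norm (k (X i) y - k x0 y - ?D x0 y (X i - x0)) \<le> 2 * ?C * norm (X i - x0)"
            using order_trans[OF norm_triangle_ineq4 add_mono[OF lip[OF Xi y, of i] Dle[OF x0 y, of "X i - x0"]]]
            by (simp add: mult.assoc mult.left_commute)
          then show "norm (?q i y) \<le> 2 * ?C" using pos by (simp add: divide_simps)
        qed
      qed auto
      then have "(\<lambda>i. norm (LINT y|M. ?q i y)) \<longlonglongrightarrow> 0"
        unfolding Bochner_Integration.integral_zero by (rule tendsto_norm_zero)
      moreover have "norm (LINT y|M. ?q i y) =
        norm ((LINT y|M. k (X i) y) - (LINT y|M. k x0 y) - (LINT y|M. ?D x0 y (X i - x0)))
           / norm (X i - x0)" for i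
        using int[OF Xi] int[OF x0] intD by (simp add: divide_inverse mult.commute)
      ultimately show "(\<lambda>i. norm ((LINT y|M. k (X i) y) - (LINT y|M. k x0 y)
             - (LINT y|M. ?D x0 y (X i - x0))) / norm (X i - x0)) \<longlonglongrightarrow> 0" by simp
    qed
  qed
  then show ?thesis unfolding intDeq by (simp only: at_within_open[OF x0 open_ball])
qed

lemma has_derivative_fst_arg:
  fixes k :: "'x::euclidean_space \<times> 'y::euclidean_space \<Rightarrow> 'b::real_normed_vector"
  assumes "k differentiable (at (x, y))"
  shows "((\<lambda>x. k (x, y)) has_derivative (\<lambda>h. \<Sum>b\<in>Basis. (h \<bullet> b) *\<^sub>R partial (b, 0) k (x, y))) (at x)"
proof -
  let ?k' = "frechet_derivative k (at (x, y))"
  have k: "(k has_derivative ?k') (at (x, y))" using assms frechet_derivative_works by blast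
  have "((\<lambda>x. (x, y)) has_derivative (\<lambda>h. (h, 0))) (at x)"
    by (auto intro!: derivative_eq_intros)
  from diff_chain_at[OF this k]
  have d: "((\<lambda>x. k (x, y)) has_derivative (\<lambda>h. ?k' (h, 0))) (at x)" by (simp add: comp_def)
  have "partial b (\<lambda>x. k (x, y)) x = partial (b, 0) k (x, y)" for b
    using has_derivative_partial[OF d] by (simp add: partial_def)
  then show ?thesis
    using differentiable_has_derivative_partial[of "\<lambda>x. k (x, y)" x] d
    by (auto simp: differentiable_def)
qed

text \<open>
  The derivatives of the kernel are again smooth kernels, so formula and smoothness follow together from one
  derivative.
\<close>

lemma
  fixes k :: "'x::euclidean_space \<times> 'y::euclidean_space \<Rightarrow> complex"
  assumes M: "compact_measure M Y" and f: "continuous_on Y f"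
    and U: "open U" and W: "open W" "U \<times> Y \<subseteq> W" and k: "smooth_on W k"
  shows partial_integral: "\<And>b x. b \<in> Basis \<Longrightarrow> x \<in> U \<Longrightarrow>
      partial b (\<lambda>x. LINT y|M. f y * k (x, y)) x = (LINT y|M. f y * partial (b, 0) k (x, y))"
    and smooth_on_integral: "smooth_on U (\<lambda>x. LINT y|M. f y * k (x, y))"
proof -
  have Y: "compact Y" and sp: "space M = Y" and fin: "finite_measure M"
    using M by (auto simp: compact_measure_def)
  have *: "((\<lambda>x. LINT y|M. f y * k (x, y)) has_derivative
      (\<lambda>h. \<Sum>b\<in>Basis. (h \<bullet> b) *\<^sub>R (LINT y|M. f y * partial (b, 0) k (x0, y)))) (at x0)"
    if k: "smooth_on W k" and x0: "x0 \<in> U" for k :: "'x \<times> 'y \<Rightarrow> complex" and x0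
  proof -
    obtain r where r: "r > 0" "cball x0 r \<subseteq> U" using U x0 open_contains_cball by blast
    let ?K = "cball x0 r \<times> Y"
    have KW: "?K \<subseteq> W" using Sigma_mono[OF r(2), of "\<lambda>_. Y" "\<lambda>_. Y"] W(2) by simp
    have bK: "(b, 0) \<in> Basis" if "b \<in> Basis" for b :: 'x using that by (auto simp: Basis_prod_def)
    have cf: "continuous_on Y (\<lambda>y. f y * g (x, y))"
      if "x \<in> cball x0 r" "continuous_on ?K g" for x and g :: "'x \<times> 'y \<Rightarrow> complex"
    proof (rule continuous_on_mult[OF f])
      show "continuous_on Y (\<lambda>y. g (x, y))"
        using that by (intro continuous_on_compose2[OF that(2)] continuous_intros) auto
    qed
    have ck: "continuous_on ?K k" "continuous_on ?K (partial (b, 0) k)" if "b \<in> Basis" for b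
      using continuous_on_subset[OF smooth_on_continuous[OF k] KW]
        continuous_on_subset[OF smooth_on_continuous[OF smooth_on_partial[OF k bK[OF that]]] KW] by simp_all
    have "\<exists>B. \<forall>x\<in>cball x0 r. \<forall>y\<in>Y. norm (f y * partial (b, 0) k (x, y)) \<le> B" if "b \<in> Basis" for b
    proof -
      have "continuous_on ?K (\<lambda>z. f (snd z) * partial (b, 0) k z)"
        by (intro continuous_on_mult ck that continuous_on_compose2[OF f] continuous_intros) auto
      then obtain B where B: "\<forall>z\<in>?K. norm (f (snd z) * partial (b, 0) k z) \<le> B"
        by (rule continuous_on_compact_bound[OF _ compact_Times[OF compact_cball Y]])
      have "norm (f y * partial (b, 0) k (x, y)) \<le> B" if "x \<in> cball x0 r" "y \<in> Y" for x y
        using B[rule_format, of "(x, y)"] that by simp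
      then show ?thesis by (intro exI[of _ B]) simp
    qed
    then obtain Bf where Bf: "\<And>b x y. b \<in> Basis \<Longrightarrow> x \<in> cball x0 r \<Longrightarrow> y \<in> Y \<Longrightarrow>
        norm (f y * partial (b, 0) k (x, y)) \<le> Bf b" by metis
    show ?thesis
    proof (rule has_derivative_integral[OF fin r(1), where B="\<Sum>b\<in>Basis. \<bar>Bf b\<bar>"
        and kp = "\<lambda>b x y. f y * partial (b, 0) k (x, y)"])
      fix x y assume x: "x \<in> ball x0 r" and y: "y \<in> space M"
      then have "(x, y) \<in> W" using KW sp by auto
      then have "((\<lambda>x. k (x, y)) has_derivative (\<lambda>h. \<Sum>b\<in>Basis. (h \<bullet> b) *\<^sub>R partial (b, 0) k (x, y))) (at x)"
        by (intro has_derivative_fst_arg smooth_on_differentiable[OF k])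
      from has_derivative_mult_right[OF this, of "f y"]
      show "((\<lambda>x. f y * k (x, y)) has_derivative
          (\<lambda>h. \<Sum>b\<in>Basis. (h \<bullet> b) *\<^sub>R (f y * partial (b, 0) k (x, y)))) (at x)"
        by (simp add: sum_distrib_left)
    next
      fix b :: 'x and x y assume b: "b \<in> Basis" and x: "x \<in> ball x0 r" and y: "y \<in> space M"
      have "norm (f y * partial (b, 0) k (x, y)) \<le> \<bar>Bf b\<bar>"
        using Bf[OF b, of x y] x y sp by simp
      also have "\<dots> \<le> (\<Sum>b\<in>Basis. \<bar>Bf b\<bar>)" using b by (intro member_le_sum) auto
      finally show "norm (f y * partial (b, 0) k (x, y)) \<le> (\<Sum>b\<in>Basis. \<bar>Bf b\<bar>)" .
    next
      fix x assume "x \<in> ball x0 r"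
      then show "integrable M (\<lambda>y. f y * k (x, y))"
        by (intro compact_measure_integrable[OF M] cf ck[OF SOME_Basis]) auto
    next
      fix b :: 'x assume b: "b \<in> Basis"
      show "integrable M (\<lambda>y. f y * partial (b, 0) k (x0, y))"
        using r by (intro compact_measure_integrable[OF M] cf ck b) auto
    qed
  qed
  have p: "partial b (\<lambda>x. LINT y|M. f y * k (x, y)) x = (LINT y|M. f y * partial (b, 0) k (x, y))"
    if "smooth_on W k" "b \<in> Basis" "x \<in> U" for k :: "'x \<times> 'y \<Rightarrow> complex" and b x
    using has_derivative_partial[OF *[OF that(1,3)], of b] that(2)
    by (simp add: inner_Basis if_distrib[of "\<lambda>a. a *\<^sub>R _"] sum.delta cong: if_cong)
  show "partial b (\<lambda>x. LINT y|M. f y * k (x, y)) x = (LINT y|M. f y * partial (b, 0) k (x, y))"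
    if "b \<in> Basis" "x \<in> U" for b x using p[OF k that] .
  have "ndiff j U (\<lambda>x. LINT y|M. f y * k (x, y))" for j
    using k
  proof (induction j arbitrary: k)
    case (Suc j)
    have "ndiff j U (partial b (\<lambda>x. LINT y|M. f y * k (x, y)))" if b: "b \<in> Basis" for b
    proof (rule ndiff_cong[OF U])
      show "ndiff j U (\<lambda>x. LINT y|M. f y * partial (b, 0) k (x, y))"
        using b by (intro Suc.IH smooth_on_partial[OF Suc.prems]) (auto simp: Basis_prod_def)
    qed (use p[OF Suc.prems b] in simp)
    moreover have "(\<lambda>x. LINT y|M. f y * k (x, y)) differentiable (at x)" if "x \<in> U" for x
      using *[OF Suc.prems that] by (rule differentiableI)
    ultimately show ?case by simp
  qed simp
  then show "smooth_on U (\<lambda>x. LINT y|M. f y * k (x, y))" unfolding smooth_on_ndiff by simp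
qed

lemma compact_measure_lborel:
  assumes "compact Y"
  shows "compact_measure (restrict_space lborel Y) Y"
proof -
  have "Y \<in> sets borel" using assms by (simp add: compact_imp_closed)
  then have "finite_measure (restrict_space lborel Y)"
    using emeasure_bounded_finite[OF compact_imp_bounded[OF assms]]
    by (intro finite_measureI) (simp add: space_restrict_space emeasure_restrict_space)
  then show ?thesis
    using assms by (auto simp: compact_measure_def space_restrict_space sets_restrict_space)
qed

text \<open>
  The integral of a translate of \<open>f\<close> does not depend on the translation; differentiating it in the direction
  \<open>b\<close> gives the integral of the derivative.
\<close>

lemma integral_partial_eq_0:
  fixes f :: "'a::euclidean_space \<Rightarrow> complex"
  assumes d: "\<And>x. f differentiable (at x)" and c: "continuous_on UNIV (partial b f)"
    and z: "\<And>x. norm x > R \<Longrightarrow> f x = 0" and b: "b \<in> Basis"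
  shows "(LINT x|lborel. partial b f x) = 0"
proof -
  let ?Y = "cball 0 (\<bar>R\<bar> + 1) :: 'a set"
  let ?M = "restrict_space lborel ?Y"
  have M: "compact_measure ?M ?Y" by (rule compact_measure_lborel) simp
  have Ym: "?Y \<in> sets borel" by simp
  have fc: "continuous_on UNIV f"
    using d by (simp add: continuous_at_imp_continuous_on differentiable_imp_continuous_within)
  have restr: "(LINT x|?M. g x) = (LINT x|lborel. g x)"
    if "\<And>x. x \<notin> ?Y \<Longrightarrow> g x = 0" for g :: "'a \<Rightarrow> complex"
    using that by (subst integral_restrict_space)
      (auto simp: indicator_def intro!: Bochner_Integration.integral_cong)
  have pz: "partial b f x = 0" if "norm x > R" for x
  proof -
    have "partial b f x = partial b (\<lambda>x. 0) x"
      by (rule partial_cong_open[of "{x. norm x > R}"])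
        (use that z in \<open>auto intro!: open_Collect_less continuous_intros\<close>)
    then show ?thesis by simp
  qed
  have const: "(LINT x|?M. f (x + t *\<^sub>R b)) = (LINT x|lborel. f x)" if "\<bar>t\<bar> < 1" for t
  proof -
    have "(LINT x|?M. f (x + t *\<^sub>R b)) = (LINT x|lborel. f (x + t *\<^sub>R b))"
    proof (rule restr)
      fix x assume "x \<notin> ?Y"
      then have "norm x > \<bar>R\<bar> + 1" by simp
      moreover have "norm x \<le> norm (x + t *\<^sub>R b) + norm (t *\<^sub>R b)"
        using norm_triangle_ineq4[of "x + t *\<^sub>R b" "t *\<^sub>R b"] by simp
      ultimately show "f (x + t *\<^sub>R b) = 0" using that b by (intro z) simp
    qed
    also have "\<dots> = (LINT x|distr lborel borel ((+) (t *\<^sub>R b)). f x)"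
      using borel_measurable_continuous_onI[OF fc]
      by (subst integral_distr) (auto simp: add.commute)
    finally show ?thesis by (simp add: lborel_distr_plus)
  qed
  have cpy: "continuous_on ?Y (\<lambda>x. g (x + t *\<^sub>R b))" if "continuous_on UNIV g"
    for g :: "'a \<Rightarrow> complex" and t
    by (rule continuous_on_compose2[OF that]) (auto intro!: continuous_intros)
  obtain B where B: "\<forall>x\<in>cball 0 (\<bar>R\<bar> + 2). norm (partial b f x) \<le> B"
    by (rule continuous_on_compact_bound[OF continuous_on_subset[OF c subset_UNIV] compact_cball])
  have "((\<lambda>t. LINT x|?M. f (x + t *\<^sub>R b)) has_derivative
      (\<lambda>h. \<Sum>i\<in>Basis. (h \<bullet> i) *\<^sub>R (LINT x|?M. partial b f (x + 0 *\<^sub>R b)))) (at (0::real))"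
  proof (rule has_derivative_integral[where r=1 and B=B and kp="\<lambda>i t x. partial b f (x + t *\<^sub>R b)"])
    show "finite_measure ?M" using M by (simp add: compact_measure_def)
    fix t :: real and x assume t: "t \<in> ball 0 1" and x: "x \<in> space ?M"
    have "((\<lambda>t. x + t *\<^sub>R b) has_derivative (\<lambda>h. h *\<^sub>R b)) (at t)"
      by (auto intro!: derivative_eq_intros)
    from diff_chain_at[OF this d[unfolded frechet_derivative_works]]
    have "((\<lambda>t. f (x + t *\<^sub>R b)) has_derivative
        (\<lambda>h. frechet_derivative f (at (x + t *\<^sub>R b)) (h *\<^sub>R b))) (at t)" by (simp add: comp_def)
    moreover have "frechet_derivative f (at (x + t *\<^sub>R b)) (h *\<^sub>R b) = h *\<^sub>R partial b f (x + t *\<^sub>R b)" for h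
      unfolding partial_def using linear_frechet_derivative[OF d] linear_cmul by blast
    ultimately show "((\<lambda>t. f (x + t *\<^sub>R b)) has_derivative
        (\<lambda>h. \<Sum>i\<in>Basis. (h \<bullet> i) *\<^sub>R partial b f (x + t *\<^sub>R b))) (at t)" by simp
    have "norm (x + t *\<^sub>R b) \<le> norm x + norm (t *\<^sub>R b)" by (rule norm_triangle_ineq)
    also have "\<dots> \<le> \<bar>R\<bar> + 2" using t x b by (auto simp: space_restrict_space)
    finally show "norm (partial b f (x + t *\<^sub>R b)) \<le> B" by (intro B[rule_format]) simp
  qed (use compact_measure_integrable[OF M cpy[OF fc]] compact_measure_integrable[OF M cpy[OF c]]
      compact_measure_integrable[OF M continuous_on_subset[OF c]] in \<open>simp_all\<close>)
  note d1 = this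
  have d2: "((\<lambda>t. LINT x|?M. f (x + t *\<^sub>R b)) has_derivative (\<lambda>h. 0)) (at (0::real))"
    by (rule has_derivative_transform_within_open[OF has_derivative_const[of "LINT x|lborel. f x"] open_ball[of 0 1]])
      (use const in auto)
  have "(\<lambda>h. \<Sum>i\<in>Basis. (h \<bullet> i) *\<^sub>R (LINT x|?M. partial b f (x + 0 *\<^sub>R b))) = (\<lambda>h::real. 0)"
    by (rule has_derivative_unique[OF d1 d2])
  from fun_cong[OF this, of 1] have "(LINT x|?M. partial b f x) = 0" by simp
  moreover have "(LINT x|?M. partial b f x) = (LINT x|lborel. partial b f x)"
    by (rule restr) (use pz in auto)
  ultimately show ?thesis by simp
qed

section \<open>The surface measure\<close>

lemma scale_measure_density: "scale_measure r M = density M (\<lambda>_. r)"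
  by (rule measure_eqI) (auto simp: emeasure_density_const)

lemma sgn_in_sphere: "(x::'a::euclidean_space) \<noteq> 0 \<Longrightarrow> sgn x \<in> sphere 0 1"
  by (simp add: norm_sgn)

lemma measurable_sgn_ball:
  "sgn \<in> measurable (restrict_space lborel (ball 0 1 - {0::'a::euclidean_space}))
           (restrict_space borel (sphere 0 1))"
proof (rule measurable_restrict_space2)
  show "sgn \<in> space (restrict_space lborel (ball 0 1 - {0::'a})) \<rightarrow> sphere 0 1"
    by (auto simp: space_restrict_space norm_sgn)
  have "continuous_on (ball 0 1 - {0::'a}) sgn"
    by (auto simp: sgn_div_norm[abs_def] intro!: continuous_intros)
  from borel_measurable_continuous_on_restrict[OF this]
  show "sgn \<in> measurable (restrict_space lborel (ball 0 1 - {0::'a})) borel"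
    by (subst measurable_cong_sets[where M'="restrict_space borel (ball 0 1 - {0::'a})"])
      (auto simp: sets_restrict_space)
qed

text \<open>
  The surface measure as the image of a density, the form in which the transformation rules for integrals
  apply.
\<close>

lemma sphere_measure_alt:
  "sphere_measure = distr (density (restrict_space lborel (ball 0 1 - {0::'a::euclidean_space}))
      (\<lambda>_. ennreal (real DIM('a)))) (restrict_space borel (sphere 0 1)) sgn"
  by (simp add: sphere_measure_def scale_measure_density ennreal_of_nat_eq_real_of_nat)

lemma compact_measure_sphere:
  "compact_measure (sphere_measure :: 'a::euclidean_space measure) (sphere 0 1)"
proof -
  have "emeasure lborel (ball 0 1 - {0::'a}) \<le> emeasure lborel (ball (0::'a) 1)"
    by (intro emeasure_mono) auto
  also have "\<dots> < \<infinity>" using emeasure_bounded_finite bounded_ball by blast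
  finally have "emeasure lborel (ball 0 1 - {0::'a}) < \<infinity>" .
  moreover have "ball 0 1 - {0::'a} \<in> sets (restrict_space lborel (ball 0 1 - {0::'a}))"
    by (simp add: sets_restrict_space_iff)
  ultimately have "finite_measure (density (restrict_space lborel (ball 0 1 - {0::'a})) (\<lambda>_. ennreal (real DIM('a))))"
    by (intro finite_measureI)
      (simp add: space_restrict_space emeasure_density_const emeasure_restrict_space ennreal_mult_eq_top_iff)
  then have "finite_measure (sphere_measure :: 'a measure)"
    unfolding sphere_measure_alt
    by (rule finite_measure.finite_measure_distr) (simp add: measurable_sgn_ball)
  then show ?thesis
    unfolding compact_measure_def by (auto simp: sphere_measure_def space_restrict_space)
qed

text \<open>
  Spherical integrals are integrals over the ball of functions that are constant along rays. Through this formula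
  the rotation invariance and the full support of the surface measure are inherited from Lebesgue measure.
\<close>

lemma integral_sphere_measure:
  fixes f :: "'a::euclidean_space \<Rightarrow> complex"
  assumes "continuous_on (sphere 0 1) f"
  shows "(LINT \<zeta>|sphere_measure. f \<zeta>) =
    real DIM('a) *\<^sub>R (LINT x|lborel. indicator (ball 0 1 - {0}) x *\<^sub>R f (sgn x))"
proof -
  let ?N = "restrict_space lborel (ball 0 1 - {0::'a})"
  have f: "f \<in> borel_measurable (restrict_space borel (sphere 0 1))"
    using assms by (rule borel_measurable_continuous_on_restrict)
  have sg: "sgn \<in> measurable (density ?N (\<lambda>_. ennreal (real DIM('a)))) (restrict_space borel (sphere 0 1))"
    using measurable_sgn_ball by simp
  have fs: "(\<lambda>x. f (sgn x)) \<in> borel_measurable ?N"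
    using measurable_compose[OF measurable_sgn_ball f] .
  have "(LINT \<zeta>|sphere_measure. f \<zeta>) = (LINT x|density ?N (\<lambda>_. ennreal (real DIM('a))). f (sgn x))"
    unfolding sphere_measure_alt by (rule integral_distr[OF sg f])
  also have "\<dots> = (LINT x|?N. real DIM('a) *\<^sub>R f (sgn x))"
    by (rule integral_density) (use fs in auto)
  also have "\<dots> = real DIM('a) *\<^sub>R (LINT x|?N. f (sgn x))" by simp
  also have "(LINT x|?N. f (sgn x)) = (LINT x|lborel. indicator (ball 0 1 - {0}) x *\<^sub>R f (sgn x))"
    by (rule integral_restrict_space) auto
  finally show ?thesis .
qed

section \<open>A flat function and rotation fields\<close>

text \<open>
  The standard smooth function that vanishes exactly on the nonpositive reals; products of its translates
  serve as cutoff functions.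
\<close>

definition flat :: "real \<Rightarrow> real" where
  "flat x = (if x > 0 then exp (- inverse x) else 0)"

lemma tendsto_poly_flat:
  "((\<lambda>x. poly p (inverse x) * exp (- inverse x)) \<longlongrightarrow> (0::real)) (at_right 0)"
proof -
  have *: "((\<lambda>y::real. poly p y * exp (- y)) \<longlongrightarrow> 0) at_top"
  proof -
    have "((\<lambda>y::real. \<Sum>i\<le>degree p. coeff p i * (y ^ i / exp y)) \<longlongrightarrow> (\<Sum>i\<le>degree p. coeff p i * 0)) at_top"
      by (intro tendsto_sum tendsto_mult tendsto_const tendsto_power_div_exp_0)
    then show ?thesis
      by (simp add: poly_altdef sum_distrib_right exp_minus divide_inverse mult.assoc)
  qed
  show ?thesis using filterlim_compose[OF * filterlim_inverse_at_top_right] .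
qed

text \<open>
  For positive arguments all derivatives are polynomials in \<open>1 / x\<close> times \<open>exp (- 1 / x)\<close>, and these tend to \<open>0\<close>
  faster than any power of \<open>x\<close>; so the class of such functions, extended by zero, is closed under
  differentiation.
\<close>

lemma smooth_on_flat: "smooth_on UNIV flat"
proof (rule smooth_on_realI[where P="\<lambda>f. \<exists>p. f = (\<lambda>x. if x > 0 then poly p (inverse x) * exp (- inverse x) else 0)"])
  show "\<exists>p. flat = (\<lambda>x. if x > 0 then poly p (inverse x) * exp (- inverse x) else 0)"
    by (intro exI[of _ 1]) (auto simp: flat_def)
  fix f :: "real \<Rightarrow> real"
  assume "\<exists>p. f = (\<lambda>x. if x > 0 then poly p (inverse x) * exp (- inverse x) else 0)"
  then obtain p where f: "f = (\<lambda>x. if x > 0 then poly p (inverse x) * exp (- inverse x) else 0)" by blast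
  let ?q = "[:0, 0, 1:] * (p - pderiv p)"
  let ?g = "\<lambda>x::real. if x > 0 then poly ?q (inverse x) * exp (- inverse x) else 0"
  have "(f has_real_derivative ?g x) (at x)" for x
  proof (cases x "0::real" rule: linorder_cases)
    case less
    have "(f has_real_derivative 0) (at x)"
      by (rule has_field_derivative_transform_within_open[where S="{..<0}" and f="\<lambda>_. 0"])
        (use less in \<open>auto simp: f\<close>)
    then show ?thesis using less by simp
  next
    case greater
    have "((\<lambda>x. poly p (inverse x) * exp (- inverse x)) has_real_derivative
        poly ?q (inverse x) * exp (- inverse x)) (at x)"
      using greater
      by (auto intro!: derivative_eq_intros simp: algebra_simps power2_eq_square)
    then have "(f has_real_derivative poly ?q (inverse x) * exp (- inverse x)) (at x)"
      by (rule has_field_derivative_transform_within_open[where S="{0<..}"])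
        (use greater in \<open>auto simp: f\<close>)
    then show ?thesis using greater by simp
  next
    case equal
    have "((\<lambda>h. f h / h) \<longlongrightarrow> 0) (at_left 0)"
      by (rule Lim_transform_eventually[OF tendsto_const], rule eventually_at_leftI[of "-1"]) (auto simp: f)
    moreover have "((\<lambda>h. f h / h) \<longlongrightarrow> 0) (at_right 0)"
      by (rule Lim_transform_eventually[OF tendsto_poly_flat[of "[:0,1:] * p"]], rule eventually_at_rightI[of 0 1])
        (auto simp: f divide_inverse mult_ac)
    ultimately have "((\<lambda>h. f h / h) \<longlongrightarrow> 0) (at 0)" by (simp add: filterlim_split_at)
    moreover have "f 0 = 0" by (simp add: f)
    ultimately have "(f has_real_derivative 0) (at 0)" by (simp add: DERIV_def)
    then show ?thesis using equal by simp
  qed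
  then show "\<exists>g. (\<exists>p. g = (\<lambda>x. if x > 0 then poly p (inverse x) * exp (- inverse x) else 0)) \<and>
      (\<forall>x\<in>UNIV. (f has_vector_derivative g x) (at x))"
    by (intro exI[of _ ?g]) (auto simp: has_real_derivative_iff_has_vector_derivative[symmetric] simp del: poly_mult)
qed simp

lemma flat_nonneg: "0 \<le> flat x" and flat_le_1: "flat x \<le> 1" and flat_eq_0: "x \<le> 0 \<Longrightarrow> flat x = 0"
  and flat_pos: "x > 0 \<Longrightarrow> flat x > 0"
  by (auto simp: flat_def)

lemma flat_tendsto_1: "(flat \<longlongrightarrow> 1) at_top"
proof -
  have "((\<lambda>x::real. exp (- inverse x)) \<longlongrightarrow> exp (- 0)) at_top"
    by (intro tendsto_intros tendsto_inverse_0_at_top filterlim_ident)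
  then show ?thesis
    by (simp add: Lim_transform_eventually eventually_at_top_dense flat_def
        tendsto_cong[of flat "\<lambda>x. exp (- inverse x)" at_top] exI[of _ 0])
qed

lemma smooth_on_component [simp]: "smooth_on U (\<lambda>x. x \<bullet> b)"
  by (rule smooth_on_linear) (rule bounded_linear_inner_left)

lemma smooth_on_norm_sq [simp]: "open U \<Longrightarrow> smooth_on U (\<lambda>x::'a::euclidean_space. x \<bullet> x)"
  using smooth_on_inner[of U "\<lambda>x. x" "\<lambda>x. x"] smooth_on_linear[OF bounded_linear_ident] by blast

lemma smooth_on_sgn:
  assumes "b \<in> Basis"
  shows "smooth_on (- {0::'a::euclidean_space}) (\<lambda>x. sgn x \<bullet> b)"
proof (rule smooth_on_cong[where f="\<lambda>x. (x \<bullet> x) powr (-1/2) * (x \<bullet> b)"])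
  show "smooth_on (- {0::'a}) (\<lambda>x. (x \<bullet> x) powr (-1/2) * (x \<bullet> b))"
    by (intro smooth_on_mult smooth_on_compose_real[OF _ _ smooth_on_powr] smooth_on_norm_sq smooth_on_component) auto
  fix x :: 'a assume "x \<in> - {0}"
  then have "(x \<bullet> x) powr (-1/2) = inverse (norm x)"
    by (simp add: norm_eq_sqrt_inner powr_minus powr_half_sqrt[symmetric])
  then show "(x \<bullet> x) powr (-1/2) * (x \<bullet> b) = sgn x \<bullet> b" by (simp add: sgn_div_norm)
qed auto

text \<open>
  The rotation field in the plane of \<open>b\<close> and \<open>c\<close>. These fields are tangent to all spheres about the origin,
  so that they act on functions on the sphere irrespective of the choice of an extension.
\<close>

definition rot :: "'a::euclidean_space \<Rightarrow> 'a \<Rightarrow> ('a \<Rightarrow> 'b::real_normed_vector) \<Rightarrow> 'a \<Rightarrow> 'b" where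
  "rot b c f x = (x \<bullet> b) *\<^sub>R partial c f x - (x \<bullet> c) *\<^sub>R partial b f x"

text \<open>
  The Laplace-Beltrami operator of the sphere as the Casimir element of the rotation group; the factor \<open>1/2\<close>
  is there because every plane occurs twice, as \<open>(b, c)\<close> and as \<open>(c, b)\<close>.
\<close>

definition sph_lap :: "('a::euclidean_space \<Rightarrow> 'b::real_normed_vector) \<Rightarrow> 'a \<Rightarrow> 'b" where
  "sph_lap f x = (1/2) *\<^sub>R (\<Sum>b\<in>Basis. \<Sum>c\<in>Basis. rot b c (rot b c f) x)"

lemma smooth_on_rot:
  assumes "open U" "smooth_on U f" "b \<in> Basis" "c \<in> Basis"
  shows "smooth_on U (rot b c f)"
  unfolding rot_def[abs_def]
  by (intro smooth_on_diff smooth_on_scaleR smooth_on_component smooth_on_partial assms)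

lemma smooth_on_sph_lap:
  assumes "open U" "smooth_on U f"
  shows "smooth_on U (sph_lap f)"
  unfolding sph_lap_def[abs_def]
  by (intro smooth_on_scaleR smooth_on_sum smooth_on_rot assms smooth_on_const)

lemma smooth_on_normal_deriv:
  assumes "open U" "smooth_on U f"
  shows "smooth_on U (normal_deriv f)"
  unfolding normal_deriv_def[abs_def]
  by (intro smooth_on_sum smooth_on_scaleR smooth_on_component smooth_on_partial assms)

lemma rot_cong_open:
  assumes "open U" "x \<in> U" "\<And>y. y \<in> U \<Longrightarrow> f y = g y"
  shows "rot b c f x = rot b c g x"
  unfolding rot_def by (simp only: partial_cong_open[OF assms])

lemma rot_has_derivative:
  assumes "(f has_derivative f') (at x)"
  shows "rot b c f x = f' ((x \<bullet> b) *\<^sub>R c - (x \<bullet> c) *\<^sub>R b)"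
  using has_derivative_linear[OF assms]
  by (simp add: rot_def has_derivative_partial[OF assms] linear_diff linear_cmul)

lemma partial_scaleR_component:
  assumes "f differentiable (at x)" "c \<in> Basis" "b \<in> Basis"
  shows "partial c (\<lambda>x. (x \<bullet> b) *\<^sub>R f x) x = (x \<bullet> b) *\<^sub>R partial c f x + (if b = c then f x else 0)"
proof -
  have "partial c (\<lambda>x. (x \<bullet> b) *\<^sub>R f x) x = (x \<bullet> b) *\<^sub>R partial c f x + partial c (\<lambda>x. x \<bullet> b) x *\<^sub>R f x"
    by (rule partial_scaleR) (use assms in \<open>auto intro!: bounded_linear_imp_differentiable bounded_linear_inner_left\<close>)
  then show ?thesis using assms
    by (simp add: partial_linear[OF bounded_linear_inner_left] inner_Basis)
qed

lemma partial_diff: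
  assumes "f differentiable (at x)" "g differentiable (at x)"
  shows "partial b (\<lambda>x. f x - g x) x = partial b f x - partial b g x"
  using has_derivative_partial[OF has_derivative_diff] assms
  unfolding frechet_derivative_works by (auto simp: partial_def)

lemma differentiable_scaleR_component:
  assumes "f differentiable (at x)"
  shows "(\<lambda>x. (x \<bullet> b) *\<^sub>R f x) differentiable (at x)"
  by (rule differentiable_bilinear[OF bounded_bilinear_scaleR])
    (use assms in \<open>auto intro!: bounded_linear_imp_differentiable bounded_linear_inner_left\<close>)

text \<open>
  Expanding the squares of the rotation fields produces \<open>|x|\<^sup>2\<close> times the Laplacian, the second-order part of
  \<open>N\<^sup>2\<close> and a first-order term; collecting them yields the usual polar decomposition. In this form it needs no
  polar coordinates and also holds at the origin.
\<close>

lemma laplacian_polar: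
  fixes f :: "'a::euclidean_space \<Rightarrow> 'b::real_normed_vector"
  assumes d: "\<And>b. b \<in> Basis \<Longrightarrow> partial b f differentiable (at x)"
  shows "(norm x)\<^sup>2 *\<^sub>R laplacian f x =
    normal_deriv (normal_deriv f) x + (real DIM('a) - 2) *\<^sub>R normal_deriv f x + sph_lap f x"
proof -
  let ?S = "\<Sum>b\<in>Basis. \<Sum>c\<in>Basis. ((x \<bullet> b) * (x \<bullet> c)) *\<^sub>R partial c (partial b f) x"
  let ?N = "normal_deriv f x"
  have NN: "normal_deriv (normal_deriv f) x = ?N + ?S"
  proof -
    have p: "partial c (normal_deriv f) x = (\<Sum>b\<in>Basis. (x \<bullet> b) *\<^sub>R partial c (partial b f) x) + partial c f x"
      if c: "c \<in> Basis" for c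
    proof -
      have "partial c (normal_deriv f) x = (\<Sum>b\<in>Basis. partial c (\<lambda>x. (x \<bullet> b) *\<^sub>R partial b f x) x)"
        unfolding normal_deriv_def[abs_def]
        by (rule partial_sum) (intro differentiable_scaleR_component d)
      also have "\<dots> = (\<Sum>b\<in>Basis. (x \<bullet> b) *\<^sub>R partial c (partial b f) x + (if b = c then partial b f x else 0))"
        by (intro sum.cong refl partial_scaleR_component d c)
      finally show ?thesis using c by (simp add: sum.distrib sum.delta)
    qed
    have "normal_deriv (normal_deriv f) x =
        (\<Sum>c\<in>Basis. (x \<bullet> c) *\<^sub>R ((\<Sum>b\<in>Basis. (x \<bullet> b) *\<^sub>R partial c (partial b f) x) + partial c f x))"
      unfolding normal_deriv_def[of "normal_deriv f"] by (intro sum.cong refl) (simp add: p)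
    also have "\<dots> = (\<Sum>c\<in>Basis. \<Sum>b\<in>Basis. ((x \<bullet> b) * (x \<bullet> c)) *\<^sub>R partial c (partial b f) x) + ?N"
      by (simp add: scaleR_right_distrib sum.distrib scaleR_sum_right normal_deriv_def mult.commute)
    also have "(\<Sum>c\<in>Basis. \<Sum>b\<in>Basis. ((x \<bullet> b) * (x \<bullet> c)) *\<^sub>R partial c (partial b f) x) = ?S"
      by (rule sum.swap)
    finally show ?thesis by (simp add: add.commute)
  qed
  have rr: "rot b c (rot b c f) x =
      (x \<bullet> b)\<^sup>2 *\<^sub>R partial c (partial c f) x + (x \<bullet> c)\<^sup>2 *\<^sub>R partial b (partial b f) x
      - ((x \<bullet> b) * (x \<bullet> c)) *\<^sub>R partial c (partial b f) x - ((x \<bullet> b) * (x \<bullet> c)) *\<^sub>R partial b (partial c f) x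
      - (x \<bullet> b) *\<^sub>R partial b f x - (x \<bullet> c) *\<^sub>R partial c f x
      + (if b = c then (x \<bullet> b) *\<^sub>R partial b f x + (x \<bullet> b) *\<^sub>R partial b f x else 0)"
    if b: "b \<in> Basis" and c: "c \<in> Basis" for b c
  proof -
    have 1: "partial e (rot b c f) x = (x \<bullet> b) *\<^sub>R partial e (partial c f) x + (if b = e then partial c f x else 0)
        - (x \<bullet> c) *\<^sub>R partial e (partial b f) x - (if c = e then partial b f x else 0)"
      if e: "e \<in> Basis" for e
      unfolding rot_def[abs_def]
      by (subst partial_diff)
        (auto intro!: differentiable_scaleR_component d b c simp: partial_scaleR_component[OF d] b c e)
    show ?thesis
      unfolding rot_def[of b c "rot b c f"] 1[OF b] 1[OF c]
      by (auto simp: algebra_simps power2_eq_square)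
  qed
  have nx: "(norm x)\<^sup>2 = (\<Sum>b\<in>Basis. (x \<bullet> b)\<^sup>2)"
    by (subst power2_norm_eq_inner, subst euclidean_inner) (simp add: power2_eq_square)
  have L: "(\<Sum>b\<in>Basis. \<Sum>c\<in>Basis. (x \<bullet> b)\<^sup>2 *\<^sub>R partial c (partial c f) x) = (norm x)\<^sup>2 *\<^sub>R laplacian f x"
    by (simp add: nx laplacian_def scaleR_sum_left scaleR_sum_right) (rule sum.swap)
  have L': "(\<Sum>b\<in>Basis. \<Sum>c\<in>Basis. (x \<bullet> c)\<^sup>2 *\<^sub>R partial b (partial b f) x) = (norm x)\<^sup>2 *\<^sub>R laplacian f x"
    by (subst sum.swap) (rule L)
  have S': "(\<Sum>b\<in>Basis. \<Sum>c\<in>Basis. ((x \<bullet> b) * (x \<bullet> c)) *\<^sub>R partial b (partial c f) x) = ?S"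
    by (subst sum.swap) (simp add: mult.commute)
  have N1: "(\<Sum>b\<in>Basis. \<Sum>c\<in>(Basis::'a set). (x \<bullet> b) *\<^sub>R partial b f x) = real DIM('a) *\<^sub>R ?N"
    by (simp add: normal_deriv_def sum_constant_scaleR scaleR_sum_right)
  have N2: "(\<Sum>b\<in>(Basis::'a set). \<Sum>c\<in>Basis. (x \<bullet> c) *\<^sub>R partial c f x) = real DIM('a) *\<^sub>R ?N"
    by (simp add: normal_deriv_def sum_constant_scaleR)
  have N3: "(\<Sum>b\<in>Basis. \<Sum>c\<in>Basis. (if b = c then (x \<bullet> b) *\<^sub>R partial b f x + (x \<bullet> b) *\<^sub>R partial b f x else 0)) = ?N + ?N"
    by (simp add: normal_deriv_def sum.delta sum.distrib)
  have "(\<Sum>b\<in>Basis. \<Sum>c\<in>Basis. rot b c (rot b c f) x) =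
      (norm x)\<^sup>2 *\<^sub>R laplacian f x + (norm x)\<^sup>2 *\<^sub>R laplacian f x - ?S - ?S
      - real DIM('a) *\<^sub>R ?N - real DIM('a) *\<^sub>R ?N + (?N + ?N)"
    by (simp only: rr sum.distrib sum_subtractf L L' S' N1 N2 N3 cong: sum.cong)
  also have "\<dots> = 2 *\<^sub>R ((norm x)\<^sup>2 *\<^sub>R laplacian f x - ?S - real DIM('a) *\<^sub>R ?N + ?N)"
    unfolding scaleR_2 by (simp add: algebra_simps)
  finally have "sph_lap f x = (norm x)\<^sup>2 *\<^sub>R laplacian f x - ?S - real DIM('a) *\<^sub>R ?N + ?N"
    unfolding sph_lap_def by simp
  then show ?thesis unfolding NN by (simp add: algebra_simps scaleR_2)
qed

lemma rot_mult:
  fixes f g :: "'a::euclidean_space \<Rightarrow> 'b::real_normed_algebra"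
  assumes "f differentiable (at x)" "g differentiable (at x)"
  shows "rot b c (\<lambda>x. f x * g x) x = f x * rot b c g x + rot b c f x * g x"
  by (simp add: rot_def partial_mult[OF assms] scaleR_right_distrib right_diff_distrib left_diff_distrib)

text \<open>
  Dilations commute with rotations, hence with the rotation fields.
\<close>

lemma rot_scaleR_dom:
  assumes "f differentiable (at (r *\<^sub>R x))"
  shows "rot b c (\<lambda>x. f (r *\<^sub>R x)) x = rot b c f (r *\<^sub>R x)"
proof -
  have "((\<lambda>x. r *\<^sub>R x) has_derivative (\<lambda>h. r *\<^sub>R h)) (at x)"
    by (auto intro!: derivative_eq_intros)
  from diff_chain_at[OF this assms[unfolded frechet_derivative_works]]
  have d: "((\<lambda>x. f (r *\<^sub>R x)) has_derivative (\<lambda>h. frechet_derivative f (at (r *\<^sub>R x)) (r *\<^sub>R h))) (at x)"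
    by (simp add: comp_def)
  show ?thesis
    unfolding rot_has_derivative[OF d] rot_has_derivative[OF assms[unfolded frechet_derivative_works]]
    by (simp add: scaleR_diff_right)
qed

lemma smooth_on_scale_dom:
  assumes "smooth_on V f" "open U" "\<And>x. x \<in> U \<Longrightarrow> r *\<^sub>R x \<in> V"
  shows "smooth_on U (\<lambda>x. f (r *\<^sub>R x))"
proof (rule smooth_on_compose[OF assms(2) _ assms(1) assms(3)])
  show "smooth_on U (\<lambda>x. (r *\<^sub>R x) \<bullet> c)" for c
    unfolding inner_scaleR_left by (intro smooth_on_mult assms(2) smooth_on_const smooth_on_component)
qed

text \<open>
  The radial projection commutes with rotations.
\<close>

lemma rot_comp_sgn:
  fixes G :: "'a::euclidean_space \<Rightarrow> 'b::real_normed_vector"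
  assumes "G differentiable (at (sgn x))" "x \<noteq> 0"
  shows "rot b c (\<lambda>x. G (sgn x)) x = rot b c G (sgn x)"
proof -
  have nd: "(norm has_derivative (\<lambda>h. h \<bullet> sgn x)) (at x)"
    using has_derivative_norm[OF assms(2)] by simp
  have "((\<lambda>x. inverse (norm x) *\<^sub>R x) has_derivative
      (\<lambda>h. inverse (norm x) *\<^sub>R h + (- (inverse (norm x) * (h \<bullet> sgn x) * inverse (norm x))) *\<^sub>R x)) (at x)"
    by (rule derivative_eq_intros nd refl | use assms(2) in simp)+
  then have "(sgn has_derivative
      (\<lambda>h. inverse (norm x) *\<^sub>R h + (- (inverse (norm x) * (h \<bullet> sgn x) * inverse (norm x))) *\<^sub>R x)) (at x)"
    by (simp add: sgn_div_norm[abs_def])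
  from diff_chain_at[OF this assms(1)[unfolded frechet_derivative_works]]
  have d: "((\<lambda>x. G (sgn x)) has_derivative (\<lambda>h. frechet_derivative G (at (sgn x))
      (inverse (norm x) *\<^sub>R h + (- (inverse (norm x) * (h \<bullet> sgn x) * inverse (norm x))) *\<^sub>R x))) (at x)"
    by (simp add: comp_def)
  have "((x \<bullet> b) *\<^sub>R c - (x \<bullet> c) *\<^sub>R b) \<bullet> sgn x = 0"
    by (simp add: sgn_div_norm inner_diff_left inner_commute[of b] inner_commute[of c])
  note eq0 = this
  show ?thesis
    unfolding rot_has_derivative[OF d] rot_has_derivative[OF assms(1)[unfolded frechet_derivative_works]] eq0
    by (simp add: sgn_div_norm scaleR_diff_right)
qed

lemma rot_norm_sq:
  fixes g :: "real \<Rightarrow> 'b::real_normed_vector"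
  assumes "g differentiable (at (x \<bullet> x))"
  shows "rot b c (\<lambda>x. g (x \<bullet> x)) x = 0"
proof -
  have "((\<lambda>x. x \<bullet> x) has_derivative (\<lambda>h. x \<bullet> h + h \<bullet> x)) (at x)"
    by (auto intro!: derivative_eq_intros)
  from diff_chain_at[OF this assms[unfolded frechet_derivative_works]]
  have d: "((\<lambda>x. g (x \<bullet> x)) has_derivative (\<lambda>h. frechet_derivative g (at (x \<bullet> x)) (x \<bullet> h + h \<bullet> x))) (at x)"
    by (simp add: comp_def)
  have "x \<bullet> ((x \<bullet> b) *\<^sub>R c - (x \<bullet> c) *\<^sub>R b) = 0" by (simp add: inner_diff_right)
  then show ?thesis
    unfolding rot_has_derivative[OF d]
    using linear_0[OF linear_frechet_derivative[OF assms]] by (simp add: inner_commute)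
qed

text \<open>
  The coefficient of each derivative in a rotation field is constant in its direction, so the field is a sum
  of derivatives of compactly supported functions.
\<close>

lemma integral_rot_eq_0:
  fixes F :: "'a::euclidean_space \<Rightarrow> complex"
  assumes F: "smooth_on UNIV F" and z: "\<And>x. norm x > R \<Longrightarrow> F x = 0"
    and b: "b \<in> Basis" and c: "c \<in> Basis"
  shows "(LINT x|lborel. rot b c F x) = 0"
proof -
  have sm: "smooth_on UNIV (\<lambda>x. (x \<bullet> e) *\<^sub>R F x)" for e
    by (intro smooth_on_scaleR smooth_on_component F) auto
  have i0: "(LINT x|lborel. partial e' (\<lambda>x. (x \<bullet> e) *\<^sub>R F x) x) = 0" if "e' \<in> Basis" for e e'
    by (rule integral_partial_eq_0[where R=R])
      (use sm z that smooth_on_partial[OF sm that] in \<open>auto intro: smooth_on_differentiable[OF sm] smooth_on_continuous\<close>)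
  have int: "integrable lborel (partial e' (\<lambda>x. (x \<bullet> e) *\<^sub>R F x))" if "e' \<in> Basis" for e e'
  proof -
    let ?g = "partial e' (\<lambda>x. (x \<bullet> e) *\<^sub>R F x)"
    have "?g x = 0" if "norm x > R" for x
    proof -
      have "?g x = partial e' (\<lambda>x. 0) x"
        by (rule partial_cong_open[of "{x. norm x > R}"])
          (use that z in \<open>auto intro!: open_Collect_less continuous_intros\<close>)
      then show ?thesis by simp
    qed
    then have "integrable lborel (\<lambda>x. indicator (cball 0 R) x *\<^sub>R ?g x) \<longleftrightarrow> integrable lborel ?g"
      by (intro Bochner_Integration.integrable_cong) (auto simp: indicator_def)
    moreover have "integrable lborel (\<lambda>x. indicator (cball 0 R) x *\<^sub>R ?g x)"
      by (rule borel_integrable_compact)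
        (use continuous_on_subset[OF smooth_on_continuous[OF smooth_on_partial[OF sm that]]] in auto)
    ultimately show ?thesis by simp
  qed
  have "rot b c F x = partial c (\<lambda>x. (x \<bullet> b) *\<^sub>R F x) x - partial b (\<lambda>x. (x \<bullet> c) *\<^sub>R F x) x" for x
    using smooth_on_differentiable[OF F, of x] b c by (auto simp: rot_def partial_scaleR_component)
  then show ?thesis using int[OF b] int[OF c] i0[OF b] i0[OF c] by simp
qed

text \<open>
  Extend \<open>G\<close> to be constant along rays and multiply by a radial cutoff. Rotation fields do not differentiate
  the cutoff, so the integral over space vanishes by \<open>integral_rot_eq_0\<close>, and letting the cutoffs increase to
  the indicator of the punctured ball gives the claim.
\<close>

theorem integral_sphere_rot:
  fixes G :: "'a::euclidean_space \<Rightarrow> complex"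
  assumes U: "open U" "sphere 0 1 \<subseteq> U" and G: "smooth_on U G" and b: "b \<in> Basis" and c: "c \<in> Basis"
  shows "(LINT \<zeta>|sphere_measure. rot b c G \<zeta>) = 0"
proof -
  (* as a function of the squared norm: zero near the origin and outside the ball, and increasing to 1 with k *)
  define g where "g k s = flat (real (Suc k) * s - 1) * flat (real (Suc k) * (1 - s))" for k s
  have g: "smooth_on UNIV (g k)" for k
    unfolding g_def
    by (intro smooth_on_mult smooth_on_compose_real[OF _ _ smooth_on_flat] smooth_on_diff smooth_on_const
        smooth_on_linear bounded_linear_ident) auto
  define F where "F k x = complex_of_real (g k (x \<bullet> x)) * G (sgn x)" for k and x :: 'a
  have Gs: "smooth_on (- {0}) (\<lambda>x. G (sgn x))"
  proof (rule smooth_on_compose[OF _ _ G])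
    show "smooth_on (- {0}) (\<lambda>x. sgn x \<bullet> e)" if "e \<in> Basis" for e :: 'a
      by (rule smooth_on_sgn[OF that])
    show "sgn x \<in> U" if "x \<in> - {0}" for x :: 'a
      using that U(2) sgn_in_sphere[of x] by auto
  qed auto
  have gs: "smooth_on V (\<lambda>x. complex_of_real (g k (x \<bullet> x)))" if "open V" for k and V :: "'a set"
    by (intro smooth_on_of_real smooth_on_compose_real[OF _ _ g] smooth_on_norm_sq that) auto
  have F0: "F k x = 0" if "norm x < 1 / real (Suc k)" for k x
  proof -
    have "x \<bullet> x = norm x * norm x" by (simp add: power2_eq_square flip: power2_norm_eq_inner)
    also have "\<dots> \<le> (1 / real (Suc k)) * 1"
      using that order_trans[OF less_imp_le[OF that], of 1] by (intro mult_mono) simp_all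
    finally have "real (Suc k) * (x \<bullet> x) \<le> 1" by (simp add: field_simps)
    then show ?thesis by (simp add: F_def g_def flat_eq_0)
  qed
  have F1: "F k x = 0" if "norm x > 1" for k x
  proof -
    have "x \<bullet> x \<ge> 1" using that by (simp flip: power2_norm_eq_inner)
    then have "real (Suc k) * (1 - x \<bullet> x) \<le> 0" by (intro mult_nonneg_nonpos) auto
    then show ?thesis by (simp add: F_def g_def flat_eq_0)
  qed
  have Fs: "smooth_on UNIV (F k)" for k
  proof -
    have "smooth_on (- {0}) (F k)" unfolding F_def
      by (intro smooth_on_mult gs Gs) auto
    moreover have "smooth_on (ball 0 (1 / real (Suc k))) (F k)"
      by (rule smooth_on_cong[OF _ _ smooth_on_const[of _ 0]]) (use F0 in auto)
    ultimately have "smooth_on (- {0} \<union> ball 0 (1 / real (Suc k))) (F k)" by (rule smooth_on_Un)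
    moreover have "- {0} \<union> ball 0 (1 / real (Suc k)) = (UNIV :: 'a set)" by auto
    ultimately show ?thesis by simp
  qed
  have rF: "rot b c (F k) x = complex_of_real (g k (x \<bullet> x)) * rot b c G (sgn x)" if "x \<noteq> 0" for k x
  proof -
    have gd: "(\<lambda>s. complex_of_real (g k s)) differentiable (at s)" for s
      using smooth_on_differentiable[OF smooth_on_of_real[OF open_UNIV g]] by simp
    have "rot b c (F k) x = complex_of_real (g k (x \<bullet> x)) * rot b c (\<lambda>x. G (sgn x)) x
        + rot b c (\<lambda>x. complex_of_real (g k (x \<bullet> x))) x * G (sgn x)"
      unfolding F_def
      by (rule rot_mult) (use that smooth_on_differentiable[OF Gs] smooth_on_differentiable[OF gs[OF open_UNIV]] in auto)
    moreover have "rot b c (\<lambda>x. complex_of_real (g k (x \<bullet> x))) x = 0"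
      by (rule rot_norm_sq[OF gd])
    moreover have "rot b c (\<lambda>x. G (sgn x)) x = rot b c G (sgn x)"
      by (rule rot_comp_sgn[OF _ that]) (use that U(2) sgn_in_sphere[of x] smooth_on_differentiable[OF G] in auto)
    ultimately show ?thesis by simp
  qed
  have cG: "continuous_on (sphere 0 1) (rot b c G)"
    using smooth_on_continuous[OF smooth_on_rot[OF U(1) G b c]] U(2) continuous_on_subset by auto
  let ?h = "\<lambda>x. indicator (ball 0 1 - {0}) x *\<^sub>R rot b c G (sgn x)"
  obtain C where C: "\<forall>\<zeta>\<in>sphere 0 1. norm (rot b c G \<zeta>) \<le> C"
    by (rule continuous_on_compact_bound[OF cG compact_sphere])
  have hm: "?h \<in> borel_measurable borel"
    by (rule borel_measurable_continuous_on_indicator)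
      (auto intro!: continuous_on_compose2[OF cG] continuous_on_sgn continuous_intros simp: norm_sgn split: if_splits)
  have Fc: "continuous_on UNIV (rot b c (F k))" for k
    using smooth_on_continuous[OF smooth_on_rot[OF open_UNIV Fs b c]] .
  have rF0: "rot b c (F k) 0 = 0" for k by (simp add: rot_def)
  have rF1: "rot b c (F k) x = complex_of_real (g k (x \<bullet> x)) * ?h x" for k x
  proof (cases "x = 0 \<or> norm x \<ge> 1")
    case True
    then have "x = 0 \<or> g k (x \<bullet> x) = 0"
    proof
      assume "norm x \<ge> 1"
      then have "x \<bullet> x \<ge> 1" by (simp flip: power2_norm_eq_inner)
      then have "real (Suc k) * (1 - x \<bullet> x) \<le> 0" by (intro mult_nonneg_nonpos) auto
      then show ?thesis by (simp add: g_def flat_eq_0)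
    qed simp
    then show ?thesis using rF0 rF by (cases "x = 0") auto
  qed (auto simp: rF)
  have "(\<lambda>k. LINT x|lborel. rot b c (F k) x) \<longlonglongrightarrow> (LINT x|lborel. ?h x)"
  proof (rule integral_dominated_convergence[where w="\<lambda>x. indicator (ball 0 1) x *\<^sub>R \<bar>C\<bar>"])
    show "integrable lborel (\<lambda>x::'a. indicator (ball 0 1) x *\<^sub>R \<bar>C\<bar>)"
      using emeasure_bounded_finite[OF bounded_ball, of "0::'a" 1]
      by (intro integrable_scaleR_left integrable_real_indicator) auto
    show "AE x in lborel. (\<lambda>k. rot b c (F k) x) \<longlonglongrightarrow> ?h x"
    proof (rule AE_I2)
      fix x :: 'a
      show "(\<lambda>k. rot b c (F k) x) \<longlonglongrightarrow> ?h x"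
      proof (cases "x \<in> ball 0 1 - {0}")
        case True
        then have s: "x \<bullet> x > 0" "x \<bullet> x < 1" by (auto simp: norm_eq_sqrt_inner)
        have "(\<lambda>k. g k (x \<bullet> x)) \<longlonglongrightarrow> 1 * 1"
          unfolding g_def
        proof (intro tendsto_mult filterlim_compose[OF flat_tendsto_1])
          have r: "filterlim (\<lambda>k. real (Suc k)) at_top sequentially"
            using filterlim_real_sequentially filterlim_sequentially_Suc by blast
          show "filterlim (\<lambda>k. real (Suc k) * (x \<bullet> x) - 1) at_top sequentially"
            using filterlim_tendsto_add_at_top[OF tendsto_const[of "-1"] filterlim_at_top_mult_tendsto_pos[OF tendsto_const s(1) r]]
            by simp
          show "filterlim (\<lambda>k. real (Suc k) * (1 - x \<bullet> x)) at_top sequentially"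
            by (rule filterlim_at_top_mult_tendsto_pos[OF tendsto_const _ r]) (use s in simp)
        qed
        then have "(\<lambda>k. complex_of_real (g k (x \<bullet> x)) * ?h x) \<longlonglongrightarrow> complex_of_real 1 * ?h x"
          by (intro tendsto_mult tendsto_of_real tendsto_const) simp
        then show ?thesis unfolding rF1 by simp
      qed (simp add: rF1)
    qed
    show "AE x in lborel. norm (rot b c (F k) x) \<le> indicator (ball 0 1) x *\<^sub>R \<bar>C\<bar>" for k
    proof (rule AE_I2)
      fix x :: 'a
      have "\<bar>g k (x \<bullet> x)\<bar> \<le> 1 * 1"
        unfolding g_def abs_mult
        by (intro mult_mono) (auto simp: flat_nonneg flat_le_1)
      moreover have "norm (?h x) \<le> indicator (ball 0 1) x *\<^sub>R \<bar>C\<bar>"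
        using C sgn_in_sphere[of x] by (auto simp: indicator_def intro: order_trans[OF _ abs_ge_self])
      ultimately have "\<bar>g k (x \<bullet> x)\<bar> * norm (?h x) \<le> 1 * (indicator (ball 0 1) x *\<^sub>R \<bar>C\<bar>)"
        by (intro mult_mono) auto
      then show "norm (rot b c (F k) x) \<le> indicator (ball 0 1) x *\<^sub>R \<bar>C\<bar>"
        unfolding rF1 norm_mult by simp
    qed
  qed (use hm Fc in \<open>auto intro: borel_measurable_continuous_onI\<close>)
  moreover have "(LINT x|lborel. rot b c (F k) x) = 0" for k
    by (rule integral_rot_eq_0[OF Fs _ b c, of 1]) (use F1 in auto)
  ultimately have "(LINT x|lborel. ?h x) = 0" by (simp add: LIMSEQ_const_iff)
  then show ?thesis using integral_sphere_measure[OF cG] by simp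
qed

section \<open>Integration by parts on the sphere\<close>

text \<open>
  The test functions. Those of \<^const>\<open>smooth_on_sphere\<close> agree on the sphere with one of these; here the
  derivatives on the sphere, and therefore \<open>rot\<close> and \<open>sph_lap\<close>, are meaningful.
\<close>

definition smooth_near :: "('a::euclidean_space \<Rightarrow> complex) \<Rightarrow> bool" where
  "smooth_near F \<longleftrightarrow> (\<exists>U. open U \<and> sphere 0 1 \<subseteq> U \<and> smooth_on U F)"

lemma smooth_near_continuous: "smooth_near F \<Longrightarrow> continuous_on (sphere 0 1) F"
  unfolding smooth_near_def using smooth_on_continuous continuous_on_subset by metis

lemma smooth_near_rot: "smooth_near F \<Longrightarrow> b \<in> Basis \<Longrightarrow> c \<in> Basis \<Longrightarrow> smooth_near (rot b c F)"
  unfolding smooth_near_def using smooth_on_rot by metis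

lemma smooth_near_sph_lap: "smooth_near F \<Longrightarrow> smooth_near (sph_lap F)"
  unfolding smooth_near_def using smooth_on_sph_lap by metis

lemma smooth_near_sph_lap_pow: "smooth_near F \<Longrightarrow> smooth_near ((sph_lap ^^ j) F)"
  by (induction j) (auto intro: smooth_near_sph_lap)

lemma smooth_near_mult:
  assumes "smooth_near F" "smooth_near G" shows "smooth_near (\<lambda>x. F x * G x)"
proof -
  obtain U V where "open U" "sphere 0 1 \<subseteq> U" "smooth_on U F" "open V" "sphere 0 1 \<subseteq> V" "smooth_on V G"
    using assms unfolding smooth_near_def by metis
  then show ?thesis
    unfolding smooth_near_def
    by (intro exI[of _ "U \<inter> V"] conjI smooth_on_mult)
      (auto intro: smooth_on_subset[OF \<open>smooth_on U F\<close>] smooth_on_subset[OF \<open>smooth_on V G\<close>])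
qed

lemma smooth_near_scale:
  assumes "smooth_on (ball 0 1) u" "0 \<le> r" "r < 1"
  shows "smooth_near (\<lambda>x. u (r *\<^sub>R x))"
proof -
  let ?U = "(\<lambda>x. r *\<^sub>R x) -` ball 0 1 :: 'a set"
  have "open ?U" by (intro open_vimage open_ball continuous_intros)
  moreover have "sphere 0 1 \<subseteq> ?U" using assms by auto
  moreover have "smooth_on ?U (\<lambda>x. u (r *\<^sub>R x))"
    by (rule smooth_on_scale_dom[OF assms(1) \<open>open ?U\<close>]) auto
  ultimately show ?thesis unfolding smooth_near_def by metis
qed

lemma smooth_near_const [simp]: "smooth_near (\<lambda>x. c)"
  unfolding smooth_near_def by (intro exI[of _ UNIV]) auto

lemma integrable_sphere:
  "continuous_on (sphere 0 1) f \<Longrightarrow> integrable sphere_measure (f :: 'a::euclidean_space \<Rightarrow> complex)"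
  by (rule compact_measure_integrable[OF compact_measure_sphere])

lemma smooth_near_differentiable: "smooth_near F \<Longrightarrow> x \<in> sphere 0 1 \<Longrightarrow> F differentiable (at x)"
  unfolding smooth_near_def using smooth_on_differentiable by (metis subset_eq)

lemma space_sphere_measure: "space (sphere_measure :: 'a::euclidean_space measure) = sphere 0 1"
  using compact_measure_sphere unfolding compact_measure_def by metis

lemma smooth_near_integrable: "smooth_near f \<Longrightarrow> smooth_near g \<Longrightarrow> integrable sphere_measure (\<lambda>x. f x * g x)"
  by (intro integrable_sphere continuous_on_mult smooth_near_continuous)

lemma integral_rot_parts:
  assumes f: "smooth_near f" and g: "smooth_near g" and b: "b \<in> Basis" and c: "c \<in> Basis"
  shows "(LINT x|sphere_measure. rot b c f x * g x) = - (LINT x|sphere_measure. f x * rot b c g x)"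
proof -
  obtain U where U: "open U" "sphere 0 1 \<subseteq> U" "smooth_on U (\<lambda>x. f x * g x)"
    using smooth_near_mult[OF f g] unfolding smooth_near_def by metis
  have "0 = (LINT x|sphere_measure. rot b c (\<lambda>x. f x * g x) x)"
    using integral_sphere_rot[OF U b c] by simp
  also have "\<dots> = (LINT x|sphere_measure. f x * rot b c g x + rot b c f x * g x)"
    by (rule Bochner_Integration.integral_cong)
      (auto simp: space_sphere_measure intro!: rot_mult smooth_near_differentiable[OF f] smooth_near_differentiable[OF g])
  also have "\<dots> = (LINT x|sphere_measure. f x * rot b c g x) + (LINT x|sphere_measure. rot b c f x * g x)"
    by (intro Bochner_Integration.integral_add smooth_near_integrable f g smooth_near_rot b c)
  finally show ?thesis by (simp add: add_eq_0_iff)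
qed

lemma integral_sph_lap_sum:
  assumes f: "smooth_near f" and g: "smooth_near g"
  shows "(LINT x|sphere_measure. sph_lap f x * g x) =
     (1/2) *\<^sub>R (\<Sum>b\<in>Basis. \<Sum>c\<in>Basis. (LINT x|sphere_measure. rot b c (rot b c f) x * g x))"
proof -
  have "(LINT x|sphere_measure. sph_lap f x * g x) =
     (LINT x|sphere_measure. ((1/2) *\<^sub>R (\<Sum>b\<in>Basis. \<Sum>c\<in>Basis. rot b c (rot b c f) x * g x)))"
    by (simp add: sph_lap_def sum_distrib_right)
  also have "\<dots> = (1/2) *\<^sub>R (\<Sum>b\<in>Basis. (LINT x|sphere_measure. (\<Sum>c\<in>Basis. rot b c (rot b c f) x * g x)))"
    by (subst Bochner_Integration.integral_scaleR_right, subst Bochner_Integration.integral_sum)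
      (intro Bochner_Integration.integrable_sum smooth_near_integrable smooth_near_rot f g | simp)+
  also have "\<dots> = (1/2) *\<^sub>R (\<Sum>b\<in>Basis. \<Sum>c\<in>Basis. (LINT x|sphere_measure. rot b c (rot b c f) x * g x))"
    by (intro arg_cong[where f="\<lambda>x. (1/2) *\<^sub>R x"] sum.cong refl Bochner_Integration.integral_sum
        smooth_near_integrable smooth_near_rot f g)
  finally show ?thesis .
qed

text \<open>
  \<open>\<Lambda>\<close> is symmetric because the rotation fields are antisymmetric and occur twice.
\<close>

lemma integral_sph_lap_parts:
  assumes f: "smooth_near f" and g: "smooth_near g"
  shows "(LINT x|sphere_measure. sph_lap f x * g x) = (LINT x|sphere_measure. f x * sph_lap g x)"
proof -
  have "(LINT x|sphere_measure. rot b c (rot b c f) x * g x) = (LINT x|sphere_measure. rot b c (rot b c g) x * f x)"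
    if "b \<in> Basis" "c \<in> Basis" for b c
    using integral_rot_parts[OF smooth_near_rot[OF f that] g that]
      integral_rot_parts[OF f smooth_near_rot[OF g that] that] by (simp add: mult.commute)
  then have "(LINT x|sphere_measure. sph_lap f x * g x) = (LINT x|sphere_measure. sph_lap g x * f x)"
    unfolding integral_sph_lap_sum[OF f g] integral_sph_lap_sum[OF g f] by (simp cong: sum.cong)
  then show ?thesis by (simp add: mult.commute)
qed

text \<open>
  The surface measure has full support.
\<close>

lemma sphere_integral_eq_0:
  fixes f :: "'a::euclidean_space \<Rightarrow> complex"
  assumes f: "continuous_on (sphere 0 1) f" and 0: "(LINT x|sphere_measure. f x * cnj (f x)) = 0"
    and z: "z \<in> sphere 0 1"
  shows "f z = 0"
proof (rule ccontr)
  assume nz: "f z \<noteq> 0"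
  let ?h = "\<lambda>x::'a. indicator (ball 0 1 - {0}) x *\<^sub>R (norm (f (sgn x)))\<^sup>2"
  have ff: "continuous_on (sphere 0 1) (\<lambda>x. f x * cnj (f x))" by (intro continuous_intros f)
  have "0 = (LINT x|lborel. indicator (ball 0 1 - {0}) x *\<^sub>R (f (sgn x) * cnj (f (sgn x))))"
    using integral_sphere_measure[OF ff] 0 by simp
  also have "\<dots> = (LINT x|lborel. complex_of_real (?h x))"
    by (intro Bochner_Integration.integral_cong refl)
      (auto simp: indicator_def simp flip: complex_norm_square)
  also have "\<dots> = complex_of_real (LINT x|lborel. ?h x)" by (rule integral_complex_of_real)
  finally have i0: "(LINT x|lborel. ?h x) = 0" by simp
  have sc: "continuous_on (ball 0 1 - {0}) (\<lambda>x. f (sgn x))"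
    by (auto intro!: continuous_on_compose2[OF f] continuous_on_sgn continuous_intros simp: norm_sgn split: if_splits)
  obtain C where C: "\<forall>x\<in>sphere 0 1. norm (f x) \<le> C"
    by (rule continuous_on_compact_bound[OF f compact_sphere])
  have int: "integrable lborel ?h"
  proof (rule Bochner_Integration.integrable_bound)
    show "integrable lborel (\<lambda>x::'a. indicator (ball 0 1) x *\<^sub>R C\<^sup>2)"
      using emeasure_bounded_finite[OF bounded_ball, of "0::'a" 1]
      by (intro integrable_scaleR_left integrable_real_indicator) auto
    have "?h \<in> borel_measurable borel"
      by (rule borel_measurable_continuous_on_indicator) (auto intro!: continuous_intros sc)
    then show "?h \<in> borel_measurable lborel" by simp
    show "AE x in lborel. norm (?h x) \<le> norm (indicator (ball 0 1) x *\<^sub>R C\<^sup>2)"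
      using sgn_in_sphere by (intro AE_I2) (auto simp: indicator_def norm_sgn intro!: power_mono C[rule_format])
  qed
  have "AE x in lborel. ?h x = 0"
    using integral_nonneg_eq_0_iff_AE[OF int] i0 by simp
  then have AE: "AE x in lborel. \<not> (x \<in> ball 0 1 - {0} \<and> f (sgn x) \<noteq> 0)"
    by eventually_elim (auto simp: indicator_def split: if_splits)
  let ?A = "{x \<in> ball 0 1 - {0}. f (sgn x) \<noteq> 0}"
  have oA: "open ?A"
  proof -
    have "open ((\<lambda>x. f (sgn x)) -` (- {0}) \<inter> (ball 0 1 - {0}))"
      by (rule continuous_on_open_vimage[THEN iffD1, rule_format, OF _ sc]) auto
    moreover have "(\<lambda>x. f (sgn x)) -` (- {0}) \<inter> (ball 0 1 - {0}) = ?A" by auto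
    ultimately show ?thesis by simp
  qed
  have "z /\<^sub>R 2 \<in> ?A"
  proof -
    have "sgn (z /\<^sub>R 2) = z" "z \<noteq> 0" "norm z = 1" using z by (auto simp: sgn_div_norm)
    then show ?thesis using nz by simp
  qed
  moreover have "emeasure lborel ?A = 0"
    using AE oA by (subst (asm) AE_iff_measurable[where N="?A"]) auto
  then have "?A \<in> null_sets lborel" using oA by (simp add: null_sets_def)
  then have "negligible ?A" by (simp add: negligible_iff_null_sets null_sets_completionI)
  ultimately show False using open_not_negligible[OF oA] by blast
qed

section \<open>Mean value estimates and symmetry of second derivatives\<close>

lemma mv_bound:
  fixes f :: "real \<Rightarrow> 'b::real_normed_vector"
  assumes "a \<le> b" "\<And>x. x \<in> {a..b} \<Longrightarrow> (f has_vector_derivative f' x) (at x)"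
    and "\<And>x. x \<in> {a..b} \<Longrightarrow> norm (f' x) \<le> B"
  shows "norm (f b - f a) \<le> B * (b - a)"
proof -
  have "norm (f b - f a) \<le> B * norm (b - a)"
  proof (rule differentiable_bound[where S="{a..b}" and f'="\<lambda>x h. h *\<^sub>R f' x"])
    show "(f has_derivative (\<lambda>h. h *\<^sub>R f' x)) (at x within {a..b})" if "x \<in> {a..b}" for x
      using assms(2)[OF that] has_derivative_at_withinI unfolding has_vector_derivative_def by metis
    show "onorm (\<lambda>h. h *\<^sub>R f' x) \<le> B" if "x \<in> {a..b}" for x
      by (rule onorm_le) (use assms(3)[OF that] in \<open>simp add: mult.commute[of B] mult_left_mono\<close>)
  qed (use assms(1) in auto)
  then show ?thesis using assms(1) by simp
qed

lemma line_derivative: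
  assumes "f differentiable (at (x + s *\<^sub>R b))"
  shows "((\<lambda>s. f (x + s *\<^sub>R b)) has_vector_derivative partial b f (x + s *\<^sub>R b)) (at s)"
proof -
  have "((\<lambda>s. x + s *\<^sub>R b) has_derivative (\<lambda>h. h *\<^sub>R b)) (at s)"
    by (auto intro!: derivative_eq_intros)
  from diff_chain_at[OF this assms[unfolded frechet_derivative_works]]
  show ?thesis
    unfolding has_vector_derivative_def partial_def
    by (simp add: comp_def linear_cmul[OF linear_frechet_derivative[OF assms]])
qed

text \<open>
  The second difference in the directions \<open>b\<close> and \<open>c\<close>, which is symmetric in the two, approximates the mixed
  derivative taken in either order; hence the symmetry of second derivatives.
\<close>

lemma second_difference:
  fixes f :: "'a::euclidean_space \<Rightarrow> 'b::real_normed_vector"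
  assumes U: "open U" "x \<in> U" and f: "smooth_on U f" and b: "b \<in> Basis" and c: "c \<in> Basis" and e: "e > 0"
  shows "\<exists>d>0. \<forall>h. 0 < h \<and> h < d \<longrightarrow>
    norm (f (x + h *\<^sub>R b + h *\<^sub>R c) - f (x + h *\<^sub>R b) - f (x + h *\<^sub>R c) + f x
       - (h * h) *\<^sub>R partial c (partial b f) x) \<le> e * h * h"
proof -
  let ?D = "partial c (partial b f)"
  have "isCont ?D x"
    using smooth_on_continuous[OF smooth_on_partial[OF smooth_on_partial[OF f b] c]] U
    by (simp add: continuous_on_eq_continuous_at)
  then obtain d1 where d1: "d1 > 0" "\<And>y. dist y x < d1 \<Longrightarrow> dist (?D y) (?D x) < e"
    unfolding continuous_at_eps_delta using e by metis
  obtain d2 where d2: "d2 > 0" "ball x d2 \<subseteq> U" using U openE by metis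
  define d where "d = min d1 d2 / 2"
  have d: "d > 0" using d1 d2 by (simp add: d_def)
  have nn: "dist (x + s *\<^sub>R b + t *\<^sub>R c) x < min d1 d2" if "0 \<le> s" "s < d" "0 \<le> t" "t < d" for s t
  proof -
    have "dist (x + s *\<^sub>R b + t *\<^sub>R c) x = norm (s *\<^sub>R b + t *\<^sub>R c)" by (simp add: dist_norm)
    also have "\<dots> \<le> norm (s *\<^sub>R b) + norm (t *\<^sub>R c)" by (rule norm_triangle_ineq)
    also have "\<dots> = s + t" using b c that by simp
    finally show ?thesis using that by (simp add: d_def)
  qed
  have inU: "x + s *\<^sub>R b + t *\<^sub>R c \<in> U" if "0 \<le> s" "s < d" "0 \<le> t" "t < d" for s t
    using nn[OF that] d2(2) by (auto simp: dist_commute subset_eq)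
  have De: "norm (?D (x + s *\<^sub>R b + t *\<^sub>R c) - ?D x) \<le> e" if "0 \<le> s" "s < d" "0 \<le> t" "t < d" for s t
    using d1(2)[of "x + s *\<^sub>R b + t *\<^sub>R c"] nn[OF that] by (simp add: dist_norm)
  have "norm (f (x + h *\<^sub>R b + h *\<^sub>R c) - f (x + h *\<^sub>R b) - f (x + h *\<^sub>R c) + f x
       - (h * h) *\<^sub>R ?D x) \<le> e * h * h" if h: "0 < h" "h < d" for h
  proof -
    have psi: "norm (partial b f (x + s *\<^sub>R b + h *\<^sub>R c) - partial b f (x + s *\<^sub>R b) - h *\<^sub>R ?D x) \<le> e * h"
      if s: "0 \<le> s" "s < d" for s
    proof -
      have "norm ((partial b f (x + s *\<^sub>R b + h *\<^sub>R c) - h *\<^sub>R ?D x) - (partial b f (x + s *\<^sub>R b + 0 *\<^sub>R c) - 0 *\<^sub>R ?D x))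
          \<le> e * (h - 0)"
      proof (rule mv_bound[where f'="\<lambda>t. ?D (x + s *\<^sub>R b + t *\<^sub>R c) - ?D x"])
        fix t assume t: "t \<in> {0..h}"
        have "partial b f differentiable at (x + s *\<^sub>R b + t *\<^sub>R c)"
          by (rule smooth_on_differentiable[OF smooth_on_partial[OF f b] inU]) (use s t h in auto)
        then have "((\<lambda>t. partial b f (x + s *\<^sub>R b + t *\<^sub>R c)) has_vector_derivative ?D (x + s *\<^sub>R b + t *\<^sub>R c)) (at t)"
          by (rule line_derivative)
        then show "((\<lambda>t. partial b f (x + s *\<^sub>R b + t *\<^sub>R c) - t *\<^sub>R ?D x) has_vector_derivative
            ?D (x + s *\<^sub>R b + t *\<^sub>R c) - ?D x) (at t)"
          by (auto intro!: derivative_eq_intros)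
        show "norm (?D (x + s *\<^sub>R b + t *\<^sub>R c) - ?D x) \<le> e" using De s t h by simp
      qed (use h in simp)
      then show ?thesis by (simp add: algebra_simps)
    qed
    let ?p = "\<lambda>s. f (x + h *\<^sub>R c + s *\<^sub>R b) - f (x + s *\<^sub>R b) - s *\<^sub>R (h *\<^sub>R ?D x)"
    have "norm (?p h - ?p 0) \<le> e * h * (h - 0)"
    proof (rule mv_bound[where f'="\<lambda>s. partial b f (x + h *\<^sub>R c + s *\<^sub>R b) - partial b f (x + s *\<^sub>R b) - h *\<^sub>R ?D x"])
      fix s assume s: "s \<in> {0..h}"
      have "f differentiable at (x + h *\<^sub>R c + s *\<^sub>R b)" "f differentiable at (x + s *\<^sub>R b)"
        using smooth_on_differentiable[OF f inU[of s h]] smooth_on_differentiable[OF f inU[of s 0]] s h d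
        by (simp_all add: add.assoc add.commute[of "h *\<^sub>R c"])
      note line_derivative[OF this(1)] line_derivative[OF this(2)]
      then show "(?p has_vector_derivative
          (partial b f (x + h *\<^sub>R c + s *\<^sub>R b) - partial b f (x + s *\<^sub>R b) - h *\<^sub>R ?D x)) (at s)"
        by (auto intro!: derivative_eq_intros)
      show "norm (partial b f (x + h *\<^sub>R c + s *\<^sub>R b) - partial b f (x + s *\<^sub>R b) - h *\<^sub>R ?D x) \<le> e * h"
        using psi[of s] s h by (simp add: add.assoc add.commute[of "h *\<^sub>R c"])
    qed (use h in simp)
    then show ?thesis by (simp add: algebra_simps)
  qed
  then show ?thesis using d by (intro exI[of _ d]) simp
qed

theorem partial_commute:
  fixes f :: "'a::euclidean_space \<Rightarrow> 'b::real_normed_vector"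
  assumes U: "open U" "x \<in> U" and f: "smooth_on U f" and b: "b \<in> Basis" and c: "c \<in> Basis"
  shows "partial b (partial c f) x = partial c (partial b f) x"
proof -
  let ?n = "norm (partial b (partial c f) x - partial c (partial b f) x)"
  have "?n \<le> e" if e: "e > 0" for e
  proof -
    obtain d1 where d1: "d1 > 0" "\<And>h. 0 < h \<and> h < d1 \<Longrightarrow>
      norm (f (x + h *\<^sub>R b + h *\<^sub>R c) - f (x + h *\<^sub>R b) - f (x + h *\<^sub>R c) + f x
       - (h * h) *\<^sub>R partial c (partial b f) x) \<le> (e/2) * h * h"
      using second_difference[OF U f b c half_gt_zero[OF e]] by metis
    obtain d2 where d2: "d2 > 0" "\<And>h. 0 < h \<and> h < d2 \<Longrightarrow>
      norm (f (x + h *\<^sub>R c + h *\<^sub>R b) - f (x + h *\<^sub>R c) - f (x + h *\<^sub>R b) + f x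
       - (h * h) *\<^sub>R partial b (partial c f) x) \<le> (e/2) * h * h"
      using second_difference[OF U f c b half_gt_zero[OF e]] by metis
    define h where "h = min d1 d2 / 2"
    have h: "0 < h \<and> h < d1" "0 < h \<and> h < d2" using d1 d2 by (auto simp: h_def)
    let ?S = "f (x + h *\<^sub>R b + h *\<^sub>R c) - f (x + h *\<^sub>R b) - f (x + h *\<^sub>R c) + f x"
    have "norm ((?S - (h * h) *\<^sub>R partial c (partial b f) x) - (?S - (h * h) *\<^sub>R partial b (partial c f) x))
        \<le> (e/2) * h * h + (e/2) * h * h"
    proof (rule order_trans[OF norm_triangle_ineq4 add_mono])
      show "norm (?S - (h * h) *\<^sub>R partial c (partial b f) x) \<le> (e/2) * h * h"
        using d1(2)[OF h(1)] .
      have eq: "x + h *\<^sub>R b + h *\<^sub>R c = x + h *\<^sub>R c + h *\<^sub>R b" by simp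
      have S_eq: "?S = f (x + h *\<^sub>R c + h *\<^sub>R b) - f (x + h *\<^sub>R c) - f (x + h *\<^sub>R b) + f x"
        by (simp only: eq) simp
      show "norm (?S - (h * h) *\<^sub>R partial b (partial c f) x) \<le> (e/2) * h * h"
        unfolding S_eq using d2(2)[OF h(2)] .
    qed
    also have "(?S - (h * h) *\<^sub>R partial c (partial b f) x) - (?S - (h * h) *\<^sub>R partial b (partial c f) x)
        = (h * h) *\<^sub>R (partial b (partial c f) x - partial c (partial b f) x)"
      by (simp add: algebra_simps)
    also have "norm \<dots> = (h * h) * ?n" using h by simp
    finally have "(h * h) * ?n \<le> (h * h) * e" by (simp add: field_simps)
    then show ?thesis using h by simp
  qed
  then have "?n \<le> 0" by (rule field_le_epsilon[of _ 0, simplified])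
  then show ?thesis by simp
qed

lemma partial_normal_deriv:
  assumes "\<And>e. e \<in> Basis \<Longrightarrow> partial e f differentiable (at x)" "c \<in> Basis"
  shows "partial c (normal_deriv f) x = (\<Sum>e\<in>Basis. (x \<bullet> e) *\<^sub>R partial c (partial e f) x) + partial c f x"
proof -
  have "partial c (normal_deriv f) x = (\<Sum>b\<in>Basis. partial c (\<lambda>x. (x \<bullet> b) *\<^sub>R partial b f x) x)"
    unfolding normal_deriv_def[abs_def]
    by (rule partial_sum) (intro differentiable_scaleR_component assms)
  also have "\<dots> = (\<Sum>b\<in>Basis. (x \<bullet> b) *\<^sub>R partial c (partial b f) x + (if b = c then partial b f x else 0))"
    by (intro sum.cong refl partial_scaleR_component assms)
  finally show ?thesis using assms(2) by (simp add: sum.distrib sum.delta)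
qed

text \<open>
  Rotations commute with dilations, whose generator is \<open>N\<close>. In coordinates this uses the symmetry of second
  derivatives.
\<close>

lemma rot_normal_deriv_commute:
  fixes f :: "'a::euclidean_space \<Rightarrow> 'b::real_normed_vector"
  assumes U: "open U" "x \<in> U" and f: "smooth_on U f" and b: "b \<in> Basis" and c: "c \<in> Basis"
  shows "rot b c (normal_deriv f) x = normal_deriv (rot b c f) x"
proof -
  have d: "partial e f differentiable (at x)" if "e \<in> Basis" for e
    by (rule smooth_on_differentiable[OF smooth_on_partial[OF f that] U(2)])
  have 1: "partial e (rot b c f) x = (x \<bullet> b) *\<^sub>R partial c (partial e f) x + (if b = e then partial c f x else 0)
        - ((x \<bullet> c) *\<^sub>R partial b (partial e f) x + (if c = e then partial b f x else 0))"
    if e: "e \<in> Basis" for e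
    unfolding rot_def[abs_def] partial_commute[OF U f c e] partial_commute[OF U f b e]
    by (subst partial_diff)
      (auto intro!: differentiable_scaleR_component d b c simp: partial_scaleR_component[OF d] b c e)
  have "normal_deriv (rot b c f) x = (\<Sum>e\<in>Basis. (x \<bullet> e) *\<^sub>R
      ((x \<bullet> b) *\<^sub>R partial c (partial e f) x + (if b = e then partial c f x else 0)
        - ((x \<bullet> c) *\<^sub>R partial b (partial e f) x + (if c = e then partial b f x else 0))))"
    unfolding normal_deriv_def[of "rot b c f"] by (intro sum.cong refl) (simp add: 1)
  also have "\<dots> = (x \<bullet> b) *\<^sub>R (\<Sum>e\<in>Basis. (x \<bullet> e) *\<^sub>R partial c (partial e f) x) + (x \<bullet> b) *\<^sub>R partial c f x
      - ((x \<bullet> c) *\<^sub>R (\<Sum>e\<in>Basis. (x \<bullet> e) *\<^sub>R partial b (partial e f) x) + (x \<bullet> c) *\<^sub>R partial b f x)"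
    using b c
    by (simp add: scaleR_right_diff_distrib scaleR_right_distrib sum.distrib sum_subtractf scaleR_sum_right
        if_distrib[of "\<lambda>y. _ *\<^sub>R y"] sum.delta sum.delta' mult.commute cong: if_cong)
  finally show ?thesis
    by (simp add: rot_def partial_normal_deriv[OF d] b c scaleR_right_distrib)
qed

section \<open>The equation along rays\<close>

text \<open>
  With the parameter \<open>t = - log r\<close> the normal derivative becomes \<open>- d/dt\<close>, and the boundary is at \<open>t = 0\<close>.
\<close>

definition ray :: "('a::euclidean_space \<Rightarrow> complex) \<Rightarrow> 'a \<Rightarrow> real \<Rightarrow> complex" where
  "ray u z t = u (exp (- t) *\<^sub>R z)"

lemma ray_in_ball: "(z::'a::euclidean_space) \<in> sphere 0 1 \<Longrightarrow> t > 0 \<Longrightarrow> exp (- t) *\<^sub>R z \<in> ball 0 1"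
  by (simp add: dist_norm)

lemma ray_derivative:
  assumes "smooth_on (ball 0 1) u" "z \<in> sphere 0 1" "t > 0"
  shows "(ray u z has_vector_derivative - ray (normal_deriv u) z t) (at t)"
proof -
  let ?x = "exp (- t) *\<^sub>R z"
  have d: "u differentiable (at ?x)"
    by (rule smooth_on_differentiable[OF assms(1) ray_in_ball[OF assms(2,3)]])
  have "((\<lambda>t. exp (- t) *\<^sub>R z) has_derivative (\<lambda>h. (- h * exp (- t)) *\<^sub>R z)) (at t)"
    by (auto intro!: derivative_eq_intros simp: mult.commute)
  from diff_chain_at[OF this differentiable_has_derivative_partial[OF d]]
  have "(ray u z has_derivative (\<lambda>h. \<Sum>b\<in>Basis. ((- h * exp (- t)) *\<^sub>R z \<bullet> b) *\<^sub>R partial b u ?x)) (at t)"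
    by (simp add: ray_def[abs_def] comp_def)
  moreover have "(\<Sum>b\<in>Basis. ((- h * exp (- t)) *\<^sub>R z \<bullet> b) *\<^sub>R partial b u ?x) = h *\<^sub>R (- ray (normal_deriv u) z t)" for h
    by (simp add: ray_def normal_deriv_def scaleR_sum_right sum_negf mult.assoc)
  ultimately show ?thesis by (simp add: has_vector_derivative_def)
qed

definition pairing :: "('a::euclidean_space \<Rightarrow> complex) \<Rightarrow> ('a \<Rightarrow> complex) \<Rightarrow> real \<Rightarrow> complex" where
  "pairing u F t = sphere_pairing u F (exp (- t))"

lemma pairing_alt: "pairing u F t = (LINT z|sphere_measure. ray u z t * F z)"
  by (simp add: pairing_def sphere_pairing_def ray_def)

lemma ray_continuous_on_sphere:
  assumes "continuous_on (ball 0 1) u" "t > 0"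
  shows "continuous_on (sphere 0 1) (\<lambda>z. ray u z t)"
  unfolding ray_def
  by (rule continuous_on_compose2[OF assms(1)]) (use assms(2) in \<open>auto intro!: continuous_intros\<close>)

lemma pairing_derivative:
  fixes u :: "'a::euclidean_space \<Rightarrow> complex"
  assumes u: "smooth_on (ball 0 1) u" and F: "continuous_on (sphere 0 1) F" and t: "t > 0"
  shows "(pairing u F has_vector_derivative - pairing (normal_deriv u) F t) (at t)"
proof -
  let ?N = "normal_deriv u"
  have Ns: "smooth_on (ball 0 1) ?N" by (rule smooth_on_normal_deriv[OF open_ball u])
  obtain C where C: "\<forall>x\<in>cball 0 (exp (- (t/2))). norm (?N x) \<le> C"
    by (rule continuous_on_compact_bound[OF continuous_on_subset[OF smooth_on_continuous[OF Ns]] compact_cball])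
      (use t le_less_trans[of _ "exp (- (t/2))" 1] in auto)
  obtain B where B: "\<forall>z\<in>sphere 0 1. norm (F z) \<le> B"
    by (rule continuous_on_compact_bound[OF F compact_sphere])
  have fin: "finite_measure (sphere_measure :: 'a measure)"
    using compact_measure_sphere[where 'a='a] by (simp add: compact_measure_def)
  have "((\<lambda>s. LINT z|sphere_measure. ray u z s * F z) has_derivative
      (\<lambda>h. \<Sum>i\<in>Basis. (h \<bullet> i) *\<^sub>R (LINT z|sphere_measure. - (ray ?N z t * F z)))) (at t)"
  proof (rule has_derivative_integral[OF fin, where r="t/2" and B="\<bar>C\<bar> * \<bar>B\<bar>"
      and kp="\<lambda>i s z. - (ray ?N z s * F z)"])
    fix s z assume s: "s \<in> ball t (t/2)" and z: "z \<in> space (sphere_measure :: 'a measure)"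
    have sp: "s > t/2" using s by (simp add: dist_real_def abs_if split: if_splits)
    have z1: "z \<in> sphere 0 1" using z by (simp add: space_sphere_measure)
    have "(ray u z has_vector_derivative - ray ?N z s) (at s)"
      by (rule ray_derivative[OF u z1]) (use sp t in simp)
    from has_vector_derivative_mult_left[OF this, of "F z"]
    show "((\<lambda>s. ray u z s * F z) has_derivative (\<lambda>h. \<Sum>i\<in>Basis. (h \<bullet> i) *\<^sub>R - (ray ?N z s * F z))) (at s)"
      by (simp add: has_vector_derivative_def)
    have "exp (- s) *\<^sub>R z \<in> cball 0 (exp (- (t/2)))" using sp z1 by simp
    then have "norm (ray ?N z s) \<le> \<bar>C\<bar>" using C unfolding ray_def by fastforce
    moreover have "norm (F z) \<le> \<bar>B\<bar>" using B z1 by fastforce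
    ultimately show "norm (- (ray ?N z s * F z)) \<le> \<bar>C\<bar> * \<bar>B\<bar>"
      unfolding norm_minus_cancel norm_mult by (intro mult_mono) auto
  next
    fix s assume "s \<in> ball t (t/2)"
    then have "s > 0" using t by (auto simp: dist_real_def abs_if split: if_splits)
    then show "integrable sphere_measure (\<lambda>z. ray u z s * F z)"
      by (intro integrable_sphere continuous_on_mult F ray_continuous_on_sphere smooth_on_continuous[OF u])
  next
    show "integrable sphere_measure (\<lambda>z. - (ray ?N z t * F z))"
      by (intro integrable_sphere continuous_on_minus continuous_on_mult F ray_continuous_on_sphere smooth_on_continuous[OF Ns] t)
  qed (use t in simp)
  then show ?thesis by (simp add: has_vector_derivative_def pairing_alt[abs_def])
qed

lemma sph_lap_scale_dom:
  assumes "smooth_on (ball 0 1) u" "0 \<le> r" "r < 1" "x \<in> sphere 0 1"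
  shows "sph_lap (\<lambda>x. u (r *\<^sub>R x)) x = sph_lap u (r *\<^sub>R x)"
proof -
  let ?U = "(\<lambda>x. r *\<^sub>R x) -` ball 0 1 :: 'a set"
  have U: "open ?U" by (intro open_vimage open_ball continuous_intros)
  have x: "x \<in> ?U" using assms by simp
  have 1: "rot b c (\<lambda>x. u (r *\<^sub>R x)) y = rot b c u (r *\<^sub>R y)" if "y \<in> ?U" for b c y
    by (rule rot_scaleR_dom[OF smooth_on_differentiable[OF assms(1)]]) (use that in simp)
  have "rot b c (rot b c (\<lambda>x. u (r *\<^sub>R x))) x = rot b c (rot b c u) (r *\<^sub>R x)"
    if "b \<in> Basis" "c \<in> Basis" for b c
  proof -
    have "rot b c (rot b c (\<lambda>x. u (r *\<^sub>R x))) x = rot b c (\<lambda>x. rot b c u (r *\<^sub>R x)) x"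
      by (rule rot_cong_open[OF U x]) (rule 1)
    also have "\<dots> = rot b c (rot b c u) (r *\<^sub>R x)"
      by (rule rot_scaleR_dom[OF smooth_on_differentiable[OF smooth_on_rot[OF open_ball assms(1) that]]])
        (use x in simp)
    finally show ?thesis .
  qed
  then show ?thesis by (simp add: sph_lap_def cong: sum.cong)
qed

lemma pairing_sph_lap:
  assumes u: "smooth_on (ball 0 1) u" and F: "smooth_near F" and t: "t > 0"
  shows "pairing (sph_lap u) F t = pairing u (sph_lap F) t"
proof -
  let ?v = "\<lambda>x. u (exp (- t) *\<^sub>R x)"
  have v: "smooth_near ?v" by (rule smooth_near_scale[OF u]) (use t in auto)
  have "pairing (sph_lap u) F t = (LINT z|sphere_measure. sph_lap ?v z * F z)"
    unfolding pairing_alt ray_def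
    by (rule Bochner_Integration.integral_cong)
      (use t in \<open>auto simp: space_sphere_measure sph_lap_scale_dom[OF u]\<close>)
  also have "\<dots> = (LINT z|sphere_measure. ?v z * sph_lap F z)"
    by (rule integral_sph_lap_parts[OF v F])
  finally show ?thesis by (simp add: pairing_alt ray_def)
qed

text \<open>
  In polar form \<open>r\<^sup>2 D = (1 - r\<^sup>2)\<^sup>2 (N\<^sup>2 + m N + \<Lambda>) + 2 m r\<^sup>2 (1 - r\<^sup>2) N\<close>. Dividing by \<open>(1 - r\<^sup>2)\<close> and using
  \<open>1 - r\<^sup>2 = 2 r sinh t\<close> and \<open>1 + r\<^sup>2 = 2 r cosh t\<close> leaves \<open>sinh t (N\<^sup>2 + \<Lambda>) + m cosh t N\<close>,
  up to the factor \<open>2 r\<close>.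
\<close>

lemma ray_equation:
  fixes u :: "'a::euclidean_space \<Rightarrow> complex"
  assumes u: "smooth_on (ball 0 1) u" and D: "\<And>x. x \<in> ball 0 1 \<Longrightarrow> hyp_laplacian u x = 0"
    and z: "z \<in> sphere 0 1" and t: "t > 0"
  shows "sinh t *\<^sub>R (ray (normal_deriv (normal_deriv u)) z t + ray (sph_lap u) z t)
      + ((real DIM('a) - 2) * cosh t) *\<^sub>R ray (normal_deriv u) z t = 0"
proof -
  let ?r = "exp (- t)" and ?x = "exp (- t) *\<^sub>R z" and ?m = "real DIM('a) - 2"
  have x: "?x \<in> ball 0 1" by (rule ray_in_ball[OF z t])
  have nx: "norm ?x = ?r" using z by simp
  let ?N = "normal_deriv u ?x" and ?NN = "normal_deriv (normal_deriv u) ?x" and ?S = "sph_lap u ?x"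
  have r1: "1 - ?r\<^sup>2 > 0" using t by (simp add: power_less_one_iff)
  have "(1 - ?r\<^sup>2) *\<^sub>R ((1 - ?r\<^sup>2) *\<^sub>R laplacian u ?x + (2 * ?m) *\<^sub>R ?N) = 0"
    using D[OF x] unfolding hyp_laplacian_def nx
    by (simp only: scaleR_right_distrib scaleR_scaleR power2_eq_square mult.commute mult.left_commute)
  then have "(1 - ?r\<^sup>2) *\<^sub>R laplacian u ?x + (2 * ?m) *\<^sub>R ?N = 0" using r1 by simp
  then have "?r\<^sup>2 *\<^sub>R ((1 - ?r\<^sup>2) *\<^sub>R laplacian u ?x + (2 * ?m) *\<^sub>R ?N) = 0" by simp
  moreover have "?r\<^sup>2 *\<^sub>R ((1 - ?r\<^sup>2) *\<^sub>R laplacian u ?x + (2 * ?m) *\<^sub>R ?N)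
      = (1 - ?r\<^sup>2) *\<^sub>R (?r\<^sup>2 *\<^sub>R laplacian u ?x) + (2 * ?m * ?r\<^sup>2) *\<^sub>R ?N"
    by (simp add: scaleR_right_distrib mult.commute mult.left_commute)
  moreover have "?r\<^sup>2 *\<^sub>R laplacian u ?x = ?NN + ?m *\<^sub>R ?N + ?S"
    using laplacian_polar[of u ?x] smooth_on_differentiable[OF smooth_on_partial[OF u] x] nx by simp
  ultimately have "(1 - ?r\<^sup>2) *\<^sub>R (?NN + ?m *\<^sub>R ?N + ?S) + (2 * ?m * ?r\<^sup>2) *\<^sub>R ?N = 0" by simp
  moreover have "(1 - ?r\<^sup>2) *\<^sub>R (?NN + ?m *\<^sub>R ?N + ?S) + (2 * ?m * ?r\<^sup>2) *\<^sub>R ?N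
      = (1 - ?r\<^sup>2) *\<^sub>R (?NN + ?S) + (?m * (1 + ?r\<^sup>2)) *\<^sub>R ?N"
    by (simp add: scaleR_conv_of_real algebra_simps)
  moreover have "1 - ?r\<^sup>2 = (2 * ?r) * sinh t" "1 + ?r\<^sup>2 = (2 * ?r) * cosh t"
    by (simp_all add: sinh_def cosh_def power2_eq_square algebra_simps flip: exp_add)
  ultimately have "(2 * ?r) *\<^sub>R (sinh t *\<^sub>R (?NN + ?S) + (?m * cosh t) *\<^sub>R ?N) = 0"
    by (simp add: scaleR_right_distrib mult.assoc mult.left_commute)
  then show ?thesis by (simp add: ray_def)
qed

text \<open>
  The equation of the rays, integrated against \<open>F\<close>; \<open>\<Lambda>\<close> is moved from \<open>u\<close> to the test function, after which
  only functions of \<open>t\<close> remain.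
\<close>

lemma pairing_equation:
  fixes u :: "'a::euclidean_space \<Rightarrow> complex"
  assumes u: "smooth_on (ball 0 1) u" and D: "\<And>x. x \<in> ball 0 1 \<Longrightarrow> hyp_laplacian u x = 0"
    and F: "smooth_near F" and t: "t > 0"
  shows "sinh t *\<^sub>R (pairing (normal_deriv (normal_deriv u)) F t + pairing u (sph_lap F) t)
      + ((real DIM('a) - 2) * cosh t) *\<^sub>R pairing (normal_deriv u) F t = 0"
proof -
  have Ns: "smooth_on (ball 0 1) (normal_deriv u)" "smooth_on (ball 0 1) (normal_deriv (normal_deriv u))"
    "smooth_on (ball 0 1) (sph_lap u)"
    by (intro smooth_on_normal_deriv smooth_on_sph_lap open_ball u)+
  have int: "integrable sphere_measure (\<lambda>z. ray v z t * F z)" if "smooth_on (ball 0 1) v" for v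
    by (intro integrable_sphere continuous_on_mult ray_continuous_on_sphere smooth_on_continuous[OF that]
        smooth_near_continuous[OF F] t)
  have "0 = (LINT z|sphere_measure. (sinh t *\<^sub>R (ray (normal_deriv (normal_deriv u)) z t + ray (sph_lap u) z t)
      + ((real DIM('a) - 2) * cosh t) *\<^sub>R ray (normal_deriv u) z t) * F z)"
    by (subst Bochner_Integration.integral_cong[where N=sphere_measure and g="\<lambda>_. 0"])
      (use ray_equation[OF u D _ t] in \<open>auto simp: space_sphere_measure\<close>)
  also have "\<dots> = (LINT z|sphere_measure. sinh t *\<^sub>R (ray (normal_deriv (normal_deriv u)) z t * F z)
      + sinh t *\<^sub>R (ray (sph_lap u) z t * F z)
      + ((real DIM('a) - 2) * cosh t) *\<^sub>R (ray (normal_deriv u) z t * F z))"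
    by (simp add: distrib_right scaleR_right_distrib)
  also have "\<dots> = sinh t *\<^sub>R pairing (normal_deriv (normal_deriv u)) F t + sinh t *\<^sub>R pairing (sph_lap u) F t
      + ((real DIM('a) - 2) * cosh t) *\<^sub>R pairing (normal_deriv u) F t"
    unfolding pairing_alt using int[OF Ns(1)] int[OF Ns(2)] int[OF Ns(3)]
    by (simp add: Bochner_Integration.integral_add integrable_scaleR_right)
  finally show ?thesis
    unfolding pairing_sph_lap[OF u F t] by (simp add: scaleR_right_distrib)
qed

section \<open>The radial equation near the boundary\<close>

lemma norm_diff_le_of_derivative:
  fixes f :: "real \<Rightarrow> 'b::real_inner"
  assumes "a \<le> b" and f: "\<And>x. x \<in> {a..b} \<Longrightarrow> (f has_vector_derivative f' x) (at x)"
    and p: "\<And>x. x \<in> {a..b} \<Longrightarrow> (p has_real_derivative p' x) (at x)"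
    and le: "\<And>x. x \<in> {a..b} \<Longrightarrow> norm (f' x) \<le> p' x"
  shows "norm (f b - f a) \<le> p b - p a"
proof -
  let ?w = "sgn (f b - f a)"
  have nw: "norm ?w \<le> 1" by (simp add: norm_sgn)
  have "p a - f a \<bullet> ?w \<le> p b - f b \<bullet> ?w"
  proof (rule DERIV_nonneg_imp_nondecreasing[OF assms(1)])
    fix x assume x: "a \<le> x" "x \<le> b"
    have "((\<lambda>x. f x \<bullet> ?w) has_vector_derivative f' x \<bullet> ?w) (at x)"
      using bounded_linear.has_vector_derivative[OF bounded_linear_inner_left f] x by auto
    then have "((\<lambda>x. p x - f x \<bullet> ?w) has_real_derivative p' x - f' x \<bullet> ?w) (at x)"
      unfolding has_real_derivative_iff_has_vector_derivative[symmetric]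
      using p x by (auto intro!: derivative_eq_intros)
    moreover have "f' x \<bullet> ?w \<le> norm (f' x) * norm ?w" by (rule norm_cauchy_schwarz)
    moreover have "norm (f' x) * norm ?w \<le> norm (f' x) * 1" using nw by (intro mult_left_mono) auto
    ultimately show "\<exists>y. ((\<lambda>x. p x - f x \<bullet> ?w) has_real_derivative y) (at x) \<and> 0 \<le> y"
      using le[of x] x by (intro exI[of _ "p' x - f' x \<bullet> ?w"]) auto
  qed
  moreover have "(f b - f a) \<bullet> ?w = norm (f b - f a)"
    by (cases "f b = f a") (simp_all add: sgn_div_norm power2_norm_eq_inner[symmetric] power2_eq_square)
  ultimately show ?thesis by (simp add: inner_diff_left)
qed

text \<open>
  Boundedness as \<open>t \<rightarrow> 0\<close>, uniformly in a parameter. The parameter is a boundary point in the application to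
  the Poisson integral and trivial for pairings.
\<close>

definition bd :: "'p set \<Rightarrow> real \<Rightarrow> ('p \<Rightarrow> real \<Rightarrow> complex) \<Rightarrow> bool" where
  "bd T t0 f \<longleftrightarrow> (\<exists>M. \<forall>q\<in>T. \<forall>t\<in>{0<..t0}. norm (f q t) \<le> M)"

lemma bdI: "(\<And>q t. q \<in> T \<Longrightarrow> 0 < t \<Longrightarrow> t \<le> t0 \<Longrightarrow> norm (f q t) \<le> M) \<Longrightarrow> bd T t0 f"
  unfolding bd_def by (intro exI[of _ M]) simp

lemma bdE:
  assumes "bd T t0 f"
  obtains M where "0 \<le> M" "\<forall>q\<in>T. \<forall>t\<in>{0<..t0}. norm (f q t) \<le> M"
proof -
  obtain M where M: "\<forall>q\<in>T. \<forall>t\<in>{0<..t0}. norm (f q t) \<le> M" using assms unfolding bd_def by metis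
  have "\<forall>q\<in>T. \<forall>t\<in>{0<..t0}. norm (f q t) \<le> \<bar>M\<bar>" using M by (meson abs_ge_self order_trans)
  then show thesis by (rule that[of "\<bar>M\<bar>", rotated]) simp
qed

lemma bd_add: "bd T t0 f \<Longrightarrow> bd T t0 g \<Longrightarrow> bd T t0 (\<lambda>q t. f q t + g q t)"
proof (elim bdE)
  fix M N assume "\<forall>q\<in>T. \<forall>t\<in>{0<..t0}. norm (f q t) \<le> M" "\<forall>q\<in>T. \<forall>t\<in>{0<..t0}. norm (g q t) \<le> N"
  then show ?thesis by (intro bdI[where M="M+N"] order_trans[OF norm_triangle_ineq] add_mono) simp_all
qed

lemma bd_scaleR:
  assumes "continuous_on {0..t0} c" "bd T t0 f"
  shows "bd T t0 (\<lambda>q t. c t *\<^sub>R f q t)"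
proof -
  obtain C where C: "\<forall>t\<in>{0..t0}. norm (c t) \<le> C"
    by (rule continuous_on_compact_bound[OF assms(1) compact_Icc])
  obtain M where M: "0 \<le> M" "\<forall>q\<in>T. \<forall>t\<in>{0<..t0}. norm (f q t) \<le> M" by (rule bdE[OF assms(2)])
  show ?thesis
    unfolding bd_def norm_scaleR
  proof (intro exI[of _ "\<bar>C\<bar> * M"] ballI mult_mono)
    fix t assume "t \<in> {0<..t0}"
    then have "\<bar>c t\<bar> \<le> C" using C by simp
    then show "\<bar>c t\<bar> \<le> \<bar>C\<bar>" by linarith
  qed (use M in auto)
qed

lemma bd_const_scaleR: "bd T t0 f \<Longrightarrow> bd T t0 (\<lambda>q t. c *\<^sub>R f q t)"
  by (rule bd_scaleR) (rule continuous_on_const)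

lemma bd_minus: "bd T t0 f \<Longrightarrow> bd T t0 (\<lambda>q t. - f q t)"
  using bd_const_scaleR[of T t0 f "-1"] by simp

lemma bd_cong: "(\<And>q t. q \<in> T \<Longrightarrow> 0 < t \<Longrightarrow> t \<le> t0 \<Longrightarrow> f q t = g q t) \<Longrightarrow> bd T t0 f \<Longrightarrow> bd T t0 g"
  unfolding bd_def by simp

lemma bd_of_derivative:
  assumes d: "\<And>q t. q \<in> T \<Longrightarrow> t > 0 \<Longrightarrow> (f q has_vector_derivative f' q t) (at t)"
    and f': "bd T t0 f'" and b0: "\<And>q. q \<in> T \<Longrightarrow> norm (f q t0) \<le> C"
  shows "bd T t0 f"
proof -
  obtain M where M: "0 \<le> M" "\<forall>q\<in>T. \<forall>t\<in>{0<..t0}. norm (f' q t) \<le> M" by (rule bdE[OF f'])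
  show ?thesis
  proof (rule bdI)
    fix q t assume q: "q \<in> T" and t: "0 < t" "t \<le> t0"
    have "norm (f q t0 - f q t) \<le> M * (t0 - t)"
      by (rule mv_bound[OF t(2) d]) (use q t M in auto)
    also have "\<dots> \<le> M * t0" using M t by (intro mult_left_mono) auto
    finally show "norm (f q t) \<le> C + M * t0"
      using b0[OF q] norm_triangle_ineq4[of "f q t0" "f q t0 - f q t"] by simp
  qed
qed

lemma sinh_pos: "t > 0 \<Longrightarrow> sinh t > (0::real)" by simp

text \<open>
  The quotient \<open>y / sinh^a\<close> has derivative \<open>- R / sinh^(a + 1)\<close>, which is dominated by the derivative of
  \<open>M / sinh^a\<close> since \<open>cosh \<ge> 1\<close>. Integrating from \<open>t\<close> to \<open>t0\<close> bounds \<open>y / sinh^a\<close> by a multiple of \<open>sinh^(- a)\<close>.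
  Only a positive exponent \<open>a\<close> works: for \<open>a = 0\<close> a logarithm appears.
\<close>

lemma bd_first_order:
  assumes a: "a \<ge> (1::nat)"
    and d: "\<And>q t. q \<in> T \<Longrightarrow> t > 0 \<Longrightarrow> (y q has_vector_derivative y' q t) (at t)"
    and eq: "\<And>q t. q \<in> T \<Longrightarrow> t > 0 \<Longrightarrow> sinh t *\<^sub>R y' q t = (real a * cosh t) *\<^sub>R y q t - R q t"
    and R: "bd T t0 R" and b0: "\<And>q. q \<in> T \<Longrightarrow> norm (y q t0) \<le> C"
  shows "bd T t0 y"
proof -
  obtain M where M: "0 \<le> M" "\<forall>q\<in>T. \<forall>t\<in>{0<..t0}. norm (R q t) \<le> M" by (rule bdE[OF R])
  show ?thesis
  proof (rule bdI)
    fix q t assume q: "q \<in> T" and t: "0 < t" "t \<le> t0"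
    let ?z = "\<lambda>t. inverse (sinh t ^ a) *\<^sub>R y q t"
    let ?p = "\<lambda>t. - M * inverse (sinh t ^ a)"
    have inv: "((\<lambda>t. inverse (sinh t ^ a)) has_real_derivative
        - (real a * cosh s) * inverse (sinh s ^ Suc a)) (at s)" if "s > 0" for s
    proof -
      have "((\<lambda>t. inverse (sinh t ^ a)) has_real_derivative
        - (real a * (sinh s ^ (a - 1)) * cosh s * inverse (sinh s ^ a * sinh s ^ a))) (at s)"
        using sinh_pos[OF that] by (auto intro!: derivative_eq_intros simp: field_simps)
      moreover have "sinh s ^ a = sinh s * sinh s ^ (a - 1)" using a by (cases a) auto
      ultimately show ?thesis using sinh_pos[OF that] by (simp add: field_simps)
    qed
    have "norm (?z t0 - ?z t) \<le> ?p t0 - ?p t"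
    proof (rule norm_diff_le_of_derivative[OF t(2),
          where f'="\<lambda>s. - inverse (sinh s ^ Suc a) *\<^sub>R R q s"
          and p'="\<lambda>s. M * (real a * cosh s * inverse (sinh s ^ Suc a))"])
      fix s assume s: "s \<in> {t..t0}"
      then have s0: "s > 0" using t by simp
      note sp = sinh_pos[OF s0]
      have "(?z has_vector_derivative inverse (sinh s ^ a) *\<^sub>R y' q s
          + (- (real a * cosh s) * inverse (sinh s ^ Suc a)) *\<^sub>R y q s) (at s)"
        by (rule has_vector_derivative_scaleR[OF inv[OF s0] d[OF q s0]])
      moreover have "inverse (sinh s ^ a) *\<^sub>R y' q s = inverse (sinh s ^ Suc a) *\<^sub>R (sinh s *\<^sub>R y' q s)"
        using sp by (simp add: field_simps)
      ultimately show "(?z has_vector_derivative - inverse (sinh s ^ Suc a) *\<^sub>R R q s) (at s)"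
        unfolding eq[OF q s0] by (simp add: scaleR_diff_right mult.commute)
      show "(?p has_real_derivative M * (real a * cosh s * inverse (sinh s ^ Suc a))) (at s)"
        using DERIV_cmult[OF inv[OF s0], of "- M"] by simp
      have "norm (R q s) \<le> M" using M q s t by simp
      moreover have "1 * 1 \<le> real a * cosh s" using a cosh_real_ge_1[of s] by (intro mult_mono) auto
      ultimately have "norm (R q s) * 1 \<le> M * (real a * cosh s)" using M by (intro mult_mono) auto
      then have "norm (R q s) * inverse (sinh s ^ Suc a) \<le> M * (real a * cosh s) * inverse (sinh s ^ Suc a)"
        using sp by (intro mult_right_mono) auto
      then show "norm (- inverse (sinh s ^ Suc a) *\<^sub>R R q s) \<le> M * (real a * cosh s * inverse (sinh s ^ Suc a))"
        using sp by (simp add: mult_ac)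
    qed
    also have "\<dots> \<le> M * inverse (sinh t ^ a)" using M t by simp
    finally have "norm (?z t) \<le> norm (?z t0) + M * inverse (sinh t ^ a)"
      using norm_triangle_ineq4[of "?z t0" "?z t0 - ?z t"] by simp
    then have "sinh t ^ a * norm (?z t) \<le> sinh t ^ a * (norm (?z t0) + M * inverse (sinh t ^ a))"
      using t by (intro mult_left_mono) auto
    moreover have "sinh t ^ a * norm (?z t) = norm (y q t)" using t by simp
    moreover have "sinh t ^ a * (norm (?z t0) + M * inverse (sinh t ^ a)) = sinh t ^ a * norm (?z t0) + M"
      using t by (simp add: distrib_left)
    moreover have "sinh t ^ a * norm (?z t0) \<le> sinh t0 ^ a * norm (?z t0)"
      using t by (intro mult_right_mono power_mono) auto
    moreover have "sinh t0 ^ a * norm (?z t0) = norm (y q t0)" using t by simp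
    ultimately show "norm (y q t) \<le> C + M" using b0[OF q] by linarith
  qed
qed

section \<open>The iterates of the radial derivative\<close>

text \<open>
  The iterates of \<open>(1 / sinh t) d/dt\<close> on the functions \<open>G j\<close>. Differentiating the second-order equation \<open>i\<close> times
  expresses iterate \<open>i + 2\<close> by the two preceding ones, and that relation is taken as the definition;
  \<open>H_derivative\<close> shows that it yields the iterates.
\<close>

fun Hseq :: "nat \<Rightarrow> (nat \<Rightarrow> 'p \<Rightarrow> real \<Rightarrow> complex) \<Rightarrow> (nat \<Rightarrow> 'p \<Rightarrow> real \<Rightarrow> complex) \<Rightarrow>
    nat \<Rightarrow> nat \<Rightarrow> 'p \<Rightarrow> real \<Rightarrow> complex" where
  "Hseq m G G1 0 j q t = G j q t"
| "Hseq m G G1 (Suc 0) j q t = inverse (sinh t) *\<^sub>R G1 j q t"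
| "Hseq m G G1 (Suc (Suc i)) j q t = inverse ((sinh t)\<^sup>2) *\<^sub>R
     (- Hseq m G G1 i (Suc j) q t - ((2 * real i + 1 - real m) * cosh t) *\<^sub>R Hseq m G G1 (Suc i) j q t
      - (real i * (real i - real m)) *\<^sub>R Hseq m G G1 i j q t)"

definition coef_a :: "nat \<Rightarrow> nat \<Rightarrow> real" where "coef_a m i = 2 * real i + 1 - real m"
definition coef_b :: "nat \<Rightarrow> nat \<Rightarrow> real" where "coef_b m i = real i * (real i - real m)"

text \<open>
  The system satisfied by \<open>\<ell>\<close> for the test functions \<open>\<Lambda>^j F\<close>, with the derivatives \<open>G1\<close>, \<open>G2\<close> as parameters. The
  boundedness of \<open>G j\<close> for all \<open>j\<close> replaces growth estimates on eigenfunctions.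
\<close>

locale ray_ode =
  fixes m :: nat and T :: "'p set" and t0 :: real and G G1 G2 :: "nat \<Rightarrow> 'p \<Rightarrow> real \<Rightarrow> complex"
  assumes t0: "t0 > 0"
    and dG: "q \<in> T \<Longrightarrow> t > 0 \<Longrightarrow> (G j q has_vector_derivative G1 j q t) (at t)"
    and dG1: "q \<in> T \<Longrightarrow> t > 0 \<Longrightarrow> (G1 j q has_vector_derivative G2 j q t) (at t)"
    and ode: "q \<in> T \<Longrightarrow> t > 0 \<Longrightarrow> sinh t *\<^sub>R (G2 j q t + G (Suc j) q t) = (real m * cosh t) *\<^sub>R G1 j q t"
    and bdG: "bd T t0 (G j)"
    and bdG1: "\<exists>C. \<forall>q\<in>T. norm (G1 j q t0) \<le> C"
begin

abbreviation H :: "nat \<Rightarrow> nat \<Rightarrow> 'p \<Rightarrow> real \<Rightarrow> complex" where "H \<equiv> Hseq m G G1"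

abbreviation ca :: "nat \<Rightarrow> real" where "ca \<equiv> coef_a m"
abbreviation cb :: "nat \<Rightarrow> real" where "cb \<equiv> coef_b m"

lemma cb_Suc: "cb (Suc i) = cb i + ca i" and ca_Suc: "ca (Suc i) = ca i + 2"
  by (simp_all add: coef_a_def coef_b_def algebra_simps)

lemma H_rec: "H (Suc (Suc i)) j q t = inverse ((sinh t)\<^sup>2) *\<^sub>R
     (- H i (Suc j) q t - (ca i * cosh t) *\<^sub>R H (Suc i) j q t - cb i *\<^sub>R H i j q t)"
  by (simp add: coef_a_def coef_b_def)

lemma H_eq:
  assumes "t > 0"
  shows "(sinh t)\<^sup>2 *\<^sub>R H (Suc (Suc i)) j q t =
     - H i (Suc j) q t - (ca i * cosh t) *\<^sub>R H (Suc i) j q t - cb i *\<^sub>R H i j q t"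
  unfolding H_rec using sinh_pos[OF assms] by simp

text \<open>
  This is the compatibility of the recursion with differentiation, a consequence of \<open>cosh\<^sup>2 - sinh\<^sup>2 = 1\<close> and the
  relations between the coefficients of neighbouring steps.
\<close>

lemma H_derivative:
  assumes q: "q \<in> T" and t: "t > 0"
  shows "(H i j q has_vector_derivative sinh t *\<^sub>R H (Suc i) j q t) (at t)"
  using t
proof (induction i arbitrary: j t rule: less_induct)
  case (less i)
  note t = less.prems
  have sp: "sinh t > 0" using sinh_pos[OF t] .
  have inv: "((\<lambda>t. inverse (sinh t)) has_real_derivative - cosh t * inverse ((sinh t)\<^sup>2)) (at t)"
    using sp by (auto intro!: derivative_eq_intros simp: power2_eq_square field_simps)
  have inv2: "((\<lambda>t. inverse ((sinh t)\<^sup>2)) has_real_derivative - 2 * cosh t * inverse (sinh t) * inverse ((sinh t)\<^sup>2)) (at t)"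
    using sp by (auto intro!: derivative_eq_intros simp: power2_eq_square field_simps)
  consider "i = 0" | "i = 1" | k where "i = Suc (Suc k)"
    by (metis One_nat_def not0_implies_Suc)
  then show ?case
  proof cases
    case 1
    then show ?thesis using dG[OF q t, of j] sp by simp
  next
    case 2
    have "(H (Suc 0) j q has_vector_derivative
        inverse (sinh t) *\<^sub>R G2 j q t + (- cosh t * inverse ((sinh t)\<^sup>2)) *\<^sub>R G1 j q t) (at t)"
      using has_vector_derivative_scaleR[OF inv dG1[OF q t, of j]] by (simp add: Hseq.simps(2)[abs_def] eta_contract_eq)
    moreover have "sinh t *\<^sub>R H (Suc (Suc 0)) j q t =
        inverse (sinh t) *\<^sub>R G2 j q t + (- cosh t * inverse ((sinh t)\<^sup>2)) *\<^sub>R G1 j q t"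
    proof -
      have "inverse (sinh t) *\<^sub>R (sinh t *\<^sub>R (G2 j q t + G (Suc j) q t))
          = inverse (sinh t) *\<^sub>R ((real m * cosh t) *\<^sub>R G1 j q t)" using ode[OF q t] by simp
      then have G2: "G2 j q t = (real m * cosh t * inverse (sinh t)) *\<^sub>R G1 j q t - G (Suc j) q t"
        using sp by (simp add: algebra_simps)
      show ?thesis unfolding G2
        using sp by (simp add: power2_eq_square scaleR_conv_of_real field_simps)
    qed
    ultimately show ?thesis unfolding 2 One_nat_def by (simp del: Hseq.simps)
  next
    case 3
    let ?A = "\<lambda>t. - H k (Suc j) q t - (ca k * cosh t) *\<^sub>R H (Suc k) j q t - cb k *\<^sub>R H k j q t"
    let ?A' = "- (sinh t *\<^sub>R H (Suc k) (Suc j) q t)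
       - ((ca k * cosh t) *\<^sub>R (sinh t *\<^sub>R H (Suc (Suc k)) j q t) + (ca k * sinh t) *\<^sub>R H (Suc k) j q t)
       - cb k *\<^sub>R (sinh t *\<^sub>R H (Suc k) j q t)"
    have ch: "((\<lambda>t. ca k * cosh t) has_real_derivative ca k * sinh t) (at t)"
      by (auto intro!: derivative_eq_intros)
    have A: "(?A has_vector_derivative ?A') (at t)"
      by (intro has_vector_derivative_diff has_vector_derivative_minus has_vector_derivative_scaleR[OF ch]
          bounded_linear.has_vector_derivative[OF bounded_linear_scaleR_right] less.IH t)
        (use 3 in simp_all)
    have eq: "H i j q = (\<lambda>t. inverse ((sinh t)\<^sup>2) *\<^sub>R ?A t)"
      unfolding 3 by (rule ext) (rule H_rec)
    have "(H i j q has_vector_derivative inverse ((sinh t)\<^sup>2) *\<^sub>R ?A'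
        + (- 2 * cosh t * inverse (sinh t) * inverse ((sinh t)\<^sup>2)) *\<^sub>R ?A t) (at t)"
      unfolding eq by (rule has_vector_derivative_scaleR[OF inv2 A])
    moreover have "sinh t *\<^sub>R H (Suc i) j q t = inverse ((sinh t)\<^sup>2) *\<^sub>R ?A'
        + (- 2 * cosh t * inverse (sinh t) * inverse ((sinh t)\<^sup>2)) *\<^sub>R ?A t"
    proof -
      have e1: "?A t = (sinh t)\<^sup>2 *\<^sub>R H i j q t" unfolding 3 using H_eq[OF t] by simp
      show ?thesis
        unfolding e1 3 H_rec[of "Suc k"] cb_Suc ca_Suc
        using sp by (simp add: power2_eq_square scaleR_conv_of_real field_simps del: Hseq.simps)
    qed
    ultimately show ?thesis by simp
  qed
qed

lemma H_bounded_t0: "\<exists>C. \<forall>q\<in>T. norm (H i j q t0) \<le> C"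
proof (induction i arbitrary: j rule: less_induct)
  case (less i)
  consider "i = 0" | "i = 1" | k where "i = Suc (Suc k)"
    by (metis One_nat_def not0_implies_Suc)
  then show ?case
  proof cases
    case 1
    then show ?thesis using bdG[of j] t0 unfolding bd_def by fastforce
  next
    case 2
    obtain C where C: "\<forall>q\<in>T. norm (G1 j q t0) \<le> C" using bdG1 by metis
    then have "\<forall>q\<in>T. norm (H i j q t0) \<le> inverse (sinh t0) * C"
      using 2 t0 by (auto intro!: mult_left_mono)
    then show ?thesis by metis
  next
    case 3
    obtain C1 C2 C3 where C: "\<forall>q\<in>T. norm (H k (Suc j) q t0) \<le> C1" "\<forall>q\<in>T. norm (H (Suc k) j q t0) \<le> C2"
      "\<forall>q\<in>T. norm (H k j q t0) \<le> C3" using less.IH 3 by (metis less_Suc_eq)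
    have "norm (H i j q t0) \<le> inverse ((sinh t0)\<^sup>2) * (C1 + (\<bar>ca k\<bar> * cosh t0) * C2 + \<bar>cb k\<bar> * C3)"
      if q: "q \<in> T" for q
    proof -
      have "norm (H i j q t0) \<le> inverse ((sinh t0)\<^sup>2) * norm
        (- H k (Suc j) q t0 - (ca k * cosh t0) *\<^sub>R H (Suc k) j q t0 - cb k *\<^sub>R H k j q t0)"
        unfolding 3 H_rec using t0 by (simp del: Hseq.simps)
      also have "\<dots> \<le> inverse ((sinh t0)\<^sup>2) * (norm (H k (Suc j) q t0)
          + norm ((ca k * cosh t0) *\<^sub>R H (Suc k) j q t0) + norm (cb k *\<^sub>R H k j q t0))"
        by (intro mult_left_mono order_trans[OF norm_triangle_ineq4] add_mono order_refl)
          (simp_all del: Hseq.simps)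
      also have "\<dots> \<le> inverse ((sinh t0)\<^sup>2) * (C1 + (\<bar>ca k\<bar> * cosh t0) * C2 + \<bar>cb k\<bar> * C3)"
        using C q t0 unfolding norm_scaleR abs_mult
        by (intro mult_left_mono add_mono mult_mono) (simp_all del: Hseq.simps)
      finally show ?thesis .
    qed
    then show ?thesis by metis
  qed
qed

text \<open>
  Iterate \<open>i + 1\<close> solves a first-order equation as in \<open>bd_first_order\<close> with exponent \<open>m - 1 - 2 i\<close>, which is
  positive in this range; the inhomogeneity consists of earlier iterates.
\<close>

lemma bd_H_below:
  assumes "2 * i < m"
  shows "bd T t0 (H i j)"
  using assms
proof (induction i arbitrary: j)
  case 0
  show ?case using bdG[of j] by (rule bd_cong[rotated]) simp
next
  case (Suc i)
  obtain C where C: "\<forall>q\<in>T. norm (H (Suc i) j q t0) \<le> C" using H_bounded_t0 by metis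
  define a where "a = m - 1 - 2 * i"
  have a: "a \<ge> 1" "real a = - ca i" using Suc.prems by (auto simp: a_def coef_a_def of_nat_diff)
  have R: "bd T t0 (\<lambda>q t. H i (Suc j) q t + cb i *\<^sub>R H i j q t)"
    using Suc by (intro bd_add bd_const_scaleR) auto
  show ?case
  proof (rule bd_first_order[OF a(1) H_derivative _ R])
    fix q t assume "q \<in> T" "(0::real) < t"
    have "sinh t *\<^sub>R (sinh t *\<^sub>R H (Suc (Suc i)) j q t) = (sinh t)\<^sup>2 *\<^sub>R H (Suc (Suc i)) j q t"
      by (simp add: power2_eq_square)
    also have "\<dots> = (real a * cosh t) *\<^sub>R H (Suc i) j q t - (H i (Suc j) q t + cb i *\<^sub>R H i j q t)"
      unfolding H_eq[OF \<open>0 < t\<close>] a(2) by simp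
    finally show "sinh t *\<^sub>R (sinh t *\<^sub>R H (Suc (Suc i)) j q t)
        = (real a * cosh t) *\<^sub>R H (Suc i) j q t - (H i (Suc j) q t + cb i *\<^sub>R H i j q t)" .
  qed (use C in auto)
qed

end

inductive_set hyp_span :: "('p \<Rightarrow> real \<Rightarrow> complex) set \<Rightarrow> ('p \<Rightarrow> real \<Rightarrow> complex) set"
  for B where
  base: "f \<in> B \<Longrightarrow> f \<in> hyp_span B"
| add: "f \<in> hyp_span B \<Longrightarrow> g \<in> hyp_span B \<Longrightarrow> (\<lambda>q t. f q t + g q t) \<in> hyp_span B"
| const: "f \<in> hyp_span B \<Longrightarrow> (\<lambda>q t. c *\<^sub>R f q t) \<in> hyp_span B"
| sinh: "f \<in> hyp_span B \<Longrightarrow> (\<lambda>q t. sinh t *\<^sub>R f q t) \<in> hyp_span B"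
| cosh: "f \<in> hyp_span B \<Longrightarrow> (\<lambda>q t. cosh t *\<^sub>R f q t) \<in> hyp_span B"

lemma hyp_span_bd:
  assumes "f \<in> hyp_span B" "\<And>f. f \<in> B \<Longrightarrow> bd T t0 f"
  shows "bd T t0 f"
  using assms(1)
proof induction
  case (sinh f)
  then show ?case by (intro bd_scaleR) (auto intro!: continuous_intros)
next
  case (cosh f)
  then show ?case by (intro bd_scaleR) (auto intro!: continuous_intros)
qed (auto intro: assms(2) bd_add bd_const_scaleR)

lemma hyp_span_derivative:
  assumes "f \<in> hyp_span B"
    and B: "\<And>f. f \<in> B \<Longrightarrow> \<exists>g\<in>hyp_span B. \<forall>q\<in>T. \<forall>t>0. (f q has_vector_derivative g q t) (at t)"
  shows "\<exists>g\<in>hyp_span B. \<forall>q\<in>T. \<forall>t>0. (f q has_vector_derivative g q t) (at t)"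
  using assms(1)
proof induction
  case (base f)
  then show ?case by (rule B)
next
  case (add f g)
  then obtain f' g' where "f' \<in> hyp_span B" "\<forall>q\<in>T. \<forall>t>0. (f q has_vector_derivative f' q t) (at t)"
    "g' \<in> hyp_span B" "\<forall>q\<in>T. \<forall>t>0. (g q has_vector_derivative g' q t) (at t)" by metis
  then show ?case
    by (intro bexI[of _ "\<lambda>q t. f' q t + g' q t"]) (auto intro: hyp_span.add has_vector_derivative_add)
next
  case (const f c)
  then obtain f' where "f' \<in> hyp_span B" "\<forall>q\<in>T. \<forall>t>0. (f q has_vector_derivative f' q t) (at t)" by metis
  then show ?case
    by (intro bexI[of _ "\<lambda>q t. c *\<^sub>R f' q t"])
      (auto intro: hyp_span.const bounded_linear.has_vector_derivative[OF bounded_linear_scaleR_right])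
next
  case (sinh f)
  then obtain f' where f': "f' \<in> hyp_span B" "\<forall>q\<in>T. \<forall>t>0. (f q has_vector_derivative f' q t) (at t)" by metis
  have "(sinh has_real_derivative cosh t) (at t)" for t :: real by (auto intro!: derivative_eq_intros)
  then show ?case using f' sinh
    by (intro bexI[of _ "\<lambda>q t. sinh t *\<^sub>R f' q t + cosh t *\<^sub>R f q t"])
      (auto intro: hyp_span.intros has_vector_derivative_scaleR)
next
  case (cosh f)
  then obtain f' where f': "f' \<in> hyp_span B" "\<forall>q\<in>T. \<forall>t>0. (f q has_vector_derivative f' q t) (at t)" by metis
  have "(cosh has_real_derivative sinh t) (at t)" for t :: real by (auto intro!: derivative_eq_intros)
  then show ?case using f' cosh
    by (intro bexI[of _ "\<lambda>q t. cosh t *\<^sub>R f' q t + sinh t *\<^sub>R f q t"])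
      (auto intro: hyp_span.intros has_vector_derivative_scaleR)
qed

context ray_ode
begin

text \<open>
  For \<open>m = 2 e\<close> the iterates up to \<open>e\<close> are bounded, since \<open>m - 1 - 2 i\<close>, being odd, does not vanish before it
  becomes negative. The derivative of \<open>sinh t\<close> times iterate \<open>e + 1\<close> is a combination of iterate \<open>e\<close> for two
  values of \<open>j\<close>, because the first-order coefficient at this step is \<open>1\<close> and cancels the derivative of \<open>sinh\<close>.
  So the span of all these functions over the ring generated by \<open>sinh\<close> and \<open>cosh\<close> is closed under
  differentiation and consists of bounded functions.
\<close>

theorem even_all_derivatives_bounded:
  assumes m: "even m" "m \<ge> 2"
    and g0: "\<And>q t. q \<in> T \<Longrightarrow> t > 0 \<Longrightarrow> g 0 q t = G j q t"
    and g: "\<And>k q t. q \<in> T \<Longrightarrow> t > 0 \<Longrightarrow> (g k q has_vector_derivative g (Suc k) q t) (at t)"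
  shows "bd T t0 (g k)"
proof -
  obtain e where e: "m = 2 * e" using m(1) by (rule evenE)
  have me: "m = 2 * e" "e \<ge> 1" using e m(2) by auto
  let ?K = "\<lambda>j q t. sinh t *\<^sub>R H (Suc e) j q t"
  let ?B = "{H i j |i j. i \<le> e} \<union> {?K j |j. True}"
  have dK: "(?K j q has_vector_derivative - (H e (Suc j) q t + cb e *\<^sub>R H e j q t)) (at t)"
    if "q \<in> T" "t > 0" for q t j
  proof -
    have "(sinh has_real_derivative cosh t) (at t)" by (auto intro!: derivative_eq_intros)
    from has_vector_derivative_scaleR[OF this H_derivative[OF that]]
    have "(?K j q has_vector_derivative sinh t *\<^sub>R (sinh t *\<^sub>R H (Suc (Suc e)) j q t)
        + cosh t *\<^sub>R H (Suc e) j q t) (at t)" .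
    moreover have "sinh t *\<^sub>R (sinh t *\<^sub>R H (Suc (Suc e)) j q t) = (sinh t)\<^sup>2 *\<^sub>R H (Suc (Suc e)) j q t"
      by (simp add: power2_eq_square)
    moreover have "ca e = 1" by (simp add: coef_a_def me)
    ultimately show ?thesis unfolding H_eq[OF that(2)] by simp
  qed
  have bH: "bd T t0 (H i j)" if "i \<le> e" for i j
  proof (cases "i < e")
    case True
    then show ?thesis using bd_H_below me by simp
  next
    case False
    then have "i = e" using that by simp
    then obtain i' where i': "i = Suc i'" "e = Suc i'" using me(2) by (cases e) auto
    obtain C where C: "\<forall>q\<in>T. norm (H (Suc i') j q t0) \<le> C" using H_bounded_t0 by metis
    have R: "bd T t0 (\<lambda>q t. H i' (Suc j) q t + cb i' *\<^sub>R H i' j q t)"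
      using me i' by (intro bd_add bd_const_scaleR bd_H_below) auto
    have a: "real 1 = - ca i'" using me i' by (simp add: coef_a_def)
    show ?thesis unfolding i'
    proof (rule bd_first_order[OF order_refl H_derivative _ R])
      fix q t assume "q \<in> T" "(0::real) < t"
      have "sinh t *\<^sub>R (sinh t *\<^sub>R H (Suc (Suc i')) j q t) = (sinh t)\<^sup>2 *\<^sub>R H (Suc (Suc i')) j q t"
        by (simp add: power2_eq_square)
      also have "\<dots> = (real 1 * cosh t) *\<^sub>R H (Suc i') j q t - (H i' (Suc j) q t + cb i' *\<^sub>R H i' j q t)"
        unfolding H_eq[OF \<open>0 < t\<close>] a by simp
      finally show "sinh t *\<^sub>R (sinh t *\<^sub>R H (Suc (Suc i')) j q t)
        = (real 1 * cosh t) *\<^sub>R H (Suc i') j q t - (H i' (Suc j) q t + cb i' *\<^sub>R H i' j q t)" .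
    qed (use C in auto)
  qed
  have bK: "bd T t0 (?K j)" for j
  proof -
    obtain C where C: "\<forall>q\<in>T. norm (H (Suc e) j q t0) \<le> C" using H_bounded_t0 by metis
    show ?thesis
    proof (rule bd_of_derivative[OF dK, where C="sinh t0 * C"])
      show "bd T t0 (\<lambda>q t. - (H e (Suc j) q t + cb e *\<^sub>R H e j q t))"
        by (intro bd_minus bd_add bd_const_scaleR bH) auto
      show "norm (?K j q t0) \<le> sinh t0 * C" if "q \<in> T" for q
        using C that t0 by (auto intro!: mult_left_mono simp del: Hseq.simps)
    qed
  qed
  have bB: "bd T t0 f" if "f \<in> ?B" for f using that bH bK by auto
  have dB: "\<exists>g\<in>hyp_span ?B. \<forall>q\<in>T. \<forall>t>0. (f q has_vector_derivative g q t) (at t)" if "f \<in> ?B" for f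
  proof -
    have inB: "H i j \<in> hyp_span ?B" if "i \<le> e" for i j using that by (intro hyp_span.base) auto
    consider i j where "f = H i j" "i < e" | j where "f = H e j" | j where "f = ?K j"
      using \<open>f \<in> ?B\<close> by (auto simp del: Hseq.simps) (metis le_neq_implies_less)
    then show ?thesis
    proof cases
      case 1
      then show ?thesis
        by (intro bexI[of _ "\<lambda>q t. sinh t *\<^sub>R H (Suc i) j q t"] hyp_span.sinh inB ballI allI impI)
          (auto intro!: H_derivative simp del: Hseq.simps)
    next
      case 2
      have "?K j \<in> hyp_span ?B" by (intro hyp_span.base) auto
      then show ?thesis unfolding 2
        by (intro bexI[of _ "?K j"] ballI allI impI H_derivative)
    next
      case 3
      have "(\<lambda>q t. (-1) *\<^sub>R (H e (Suc j) q t + cb e *\<^sub>R H e j q t)) \<in> hyp_span ?B"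
        by (intro hyp_span.const hyp_span.add inB) auto
      then show ?thesis unfolding 3 using dK[of _ _ j]
        by (intro bexI[of _ "\<lambda>q t. (-1) *\<^sub>R (H e (Suc j) q t + cb e *\<^sub>R H e j q t)"]) auto
    qed
  qed
  have "\<exists>f\<in>hyp_span ?B. \<forall>q\<in>T. \<forall>t>0. g k q t = f q t"
  proof (induction k)
    case 0
    have "H 0 j \<in> hyp_span ?B" by (intro hyp_span.base) auto
    then show ?case by (intro bexI[of _ "H 0 j"]) (auto simp: g0)
  next
    case (Suc k)
    then obtain f where f: "f \<in> hyp_span ?B" "\<forall>q\<in>T. \<forall>t>0. g k q t = f q t" by (elim bexE) (rule that)
    have "\<exists>f'\<in>hyp_span ?B. \<forall>q\<in>T. \<forall>t>0. (f q has_vector_derivative f' q t) (at t)"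
      by (rule hyp_span_derivative[OF f(1)]) (rule dB)
    then obtain f' where f': "f' \<in> hyp_span ?B" "\<forall>q\<in>T. \<forall>t>0. (f q has_vector_derivative f' q t) (at t)"
      by (elim bexE) (rule that)
    have "g (Suc k) q t = f' q t" if q: "q \<in> T" and t: "t > 0" for q t
    proof (rule vector_derivative_unique_at)
      show "(g k q has_vector_derivative g (Suc k) q t) (at t)" by (rule g[OF q t])
      show "(g k q has_vector_derivative f' q t) (at t)"
        by (rule has_vector_derivative_transform_within_open[where S="{0<..}" and f="f q"])
          (use f(2) f'(2) q t in auto)
    qed
    then show ?case using f'(1) by (intro bexI[of _ f']) simp_all
  qed
  then obtain f where f: "f \<in> hyp_span ?B" "\<forall>q\<in>T. \<forall>t>0. g k q t = f q t" by (elim bexE) (rule that)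
  have "bd T t0 f" by (rule hyp_span_bd[OF f(1)]) (rule bB)
  then show ?thesis by (rule bd_cong[rotated]) (use f(2) in auto)
qed

end

lemma limit_of_bounded_derivative:
  fixes f :: "real \<Rightarrow> complex"
  assumes t0: "t0 > 0" and d: "\<And>t. t > 0 \<Longrightarrow> (f has_vector_derivative f' t) (at t)"
    and b: "\<And>t. 0 < t \<Longrightarrow> t \<le> t0 \<Longrightarrow> norm (f' t) \<le> M"
  shows "\<exists>L. (f \<longlongrightarrow> L) (at_right 0)"
proof -
  have le: "norm (f y - f x) \<le> M * (y - x)" if "0 < x" "x \<le> y" "y \<le> t0" for x y
    by (rule mv_bound[OF that(2) d]) (use that b in auto)
  have M: "0 \<le> M" using b[of t0] t0 norm_ge_zero order_trans by blast
  have "M-lipschitz_on {0<..t0} f"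
    by (rule lipschitz_on_leI) (use le M in \<open>auto simp: dist_norm norm_minus_commute\<close>)
  then have "uniformly_continuous_on {0<..t0} f" by (rule lipschitz_on_uniformly_continuous)
  from uniformly_continuous_on_extension_on_closure[OF this]
  obtain g where g: "uniformly_continuous_on (closure {0<..t0}) g" "\<And>x. x \<in> {0<..t0} \<Longrightarrow> f x = g x"
    by metis
  have "closure {0<..t0} = {0..t0}" using t0 by simp
  then have "continuous_on {0..t0} g" using g(1) uniformly_continuous_imp_continuous by metis
  then have "(g \<longlongrightarrow> g 0) (at 0 within {0..t0})" using t0 by (simp add: continuous_on_def)
  then have "(g \<longlongrightarrow> g 0) (at_right 0)"
    using t0 by (simp add: at_within_Icc_at_right)
  then have "(f \<longlongrightarrow> g 0) (at_right 0)"
    by (rule Lim_transform_eventually, intro eventually_at_rightI[of 0 t0]) (use t0 g(2) in auto)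
  then show ?thesis by metis
qed

section \<open>The logarithmic term\<close>

text \<open>
  The combinations of \<open>(cosh t - 1)^k h\<^sub>i\<close> with \<open>i \<le> k + q\<close> and nonnegative coefficients, together with the
  coefficient of the extreme term \<open>h\<^sub>q\<close>. Since \<open>(cosh t - 1)^k\<close> compensates the growth of \<open>h\<^sub>i\<close>, that term is the
  only one that can be unbounded for \<open>q = p\<close>.
\<close>

inductive lead :: "(nat \<Rightarrow> 'p \<Rightarrow> real \<Rightarrow> complex) \<Rightarrow> nat \<Rightarrow> real \<Rightarrow> ('p \<Rightarrow> real \<Rightarrow> complex) \<Rightarrow> bool"
  for h where
  mono: "i \<le> k + q \<Longrightarrow> lead h q (if k = 0 \<and> i = q then 1 else 0) (\<lambda>p t. ((cosh t - 1) ^ k) *\<^sub>R h i p t)"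
| add: "lead h q c f \<Longrightarrow> lead h q d g \<Longrightarrow> lead h q (c + d) (\<lambda>p t. f p t + g p t)"
| scale: "e \<ge> 0 \<Longrightarrow> lead h q c f \<Longrightarrow> lead h q (e * c) (\<lambda>p t. e *\<^sub>R f p t)"

lemma lead_algebra:
  fixes X S C :: real and u v w :: complex
  assumes S: "S * S = X * (X + 2)" and C: "C = X + 1"
  shows "S *\<^sub>R (real k *\<^sub>R (S *\<^sub>R ((real (k - 1) * X ^ (k - 1 - 1)) *\<^sub>R u + X ^ (k - 1) *\<^sub>R v))
        + S *\<^sub>R ((real k * X ^ (k - 1)) *\<^sub>R v + X ^ k *\<^sub>R w))
      + C *\<^sub>R (real k *\<^sub>R (X ^ (k - 1) *\<^sub>R u) + X ^ k *\<^sub>R v)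
    = (real k)\<^sup>2 *\<^sub>R (X ^ k *\<^sub>R u) + (real k * (2 * real k - 1)) *\<^sub>R (X ^ (k - 1) *\<^sub>R u)
      + (2 * real k + 1) *\<^sub>R (X ^ Suc k *\<^sub>R v) + (4 * real k + 1) *\<^sub>R (X ^ k *\<^sub>R v)
      + X ^ Suc (Suc k) *\<^sub>R w + 2 *\<^sub>R (X ^ Suc k *\<^sub>R w)"
proof -
  have L: "S *\<^sub>R (real k *\<^sub>R (S *\<^sub>R ((real (k - 1) * X ^ (k - 1 - 1)) *\<^sub>R u + X ^ (k - 1) *\<^sub>R v))
        + S *\<^sub>R ((real k * X ^ (k - 1)) *\<^sub>R v + X ^ k *\<^sub>R w))
    = (X * (X + 2)) *\<^sub>R (real k *\<^sub>R ((real (k - 1) * X ^ (k - 1 - 1)) *\<^sub>R u + X ^ (k - 1) *\<^sub>R v)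
        + ((real k * X ^ (k - 1)) *\<^sub>R v + X ^ k *\<^sub>R w))"
    unfolding S[symmetric] by (simp add: scaleR_right_distrib mult_ac)
  consider "k = 0" | "k = 1" | l where "k = Suc (Suc l)" by (metis One_nat_def not0_implies_Suc)
  then show ?thesis unfolding L C
    by cases (simp_all add: scaleR_conv_of_real algebra_simps power2_eq_square)
qed

text \<open>
  In the variable \<open>X = cosh t - 1\<close> one has \<open>(d/dt)\<^sup>2 = (X\<^sup>2 + 2 X) (d/dX)\<^sup>2 + (1 + X) d/dX\<close>. All coefficients are
  nonnegative, so the extreme coefficient cannot decrease; in particular it stays positive under repeated
  differentiation.
\<close>

lemma lead_second_derivative:
  fixes h :: "nat \<Rightarrow> 'p \<Rightarrow> real \<Rightarrow> complex"
  assumes dh: "\<And>i p t. p \<in> T \<Longrightarrow> t > 0 \<Longrightarrow> (h i p has_vector_derivative sinh t *\<^sub>R h (Suc i) p t) (at t)"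
    and "lead h q c f"
  shows "\<exists>f1 f2 c'. c \<le> c' \<and> lead h (Suc q) c' f2 \<and>
    (\<forall>p\<in>T. \<forall>t>0. (f p has_vector_derivative f1 p t) (at t) \<and> (f1 p has_vector_derivative f2 p t) (at t))"
  using assms(2)
proof induction
  case (mono i k q)
  let ?x = "\<lambda>t::real. cosh t - 1"
  have xk: "((\<lambda>t. ?x t ^ k) has_real_derivative real k * ?x t ^ (k - 1) * sinh t) (at t)" for k t
    by (auto intro!: derivative_eq_intros)
  have dx: "((\<lambda>t. ?x t ^ k *\<^sub>R h i p t) has_vector_derivative
      sinh t *\<^sub>R ((real k * ?x t ^ (k - 1)) *\<^sub>R h i p t + ?x t ^ k *\<^sub>R h (Suc i) p t)) (at t)"
    if "p \<in> T" "t > 0" for k i p t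
  proof -
    have eq: "?x t ^ k *\<^sub>R (sinh t *\<^sub>R h (Suc i) p t) + (real k * ?x t ^ (k - 1) * sinh t) *\<^sub>R h i p t
      = sinh t *\<^sub>R ((real k * ?x t ^ (k - 1)) *\<^sub>R h i p t + ?x t ^ k *\<^sub>R h (Suc i) p t)"
      by (simp add: scaleR_right_distrib mult_ac)
    show ?thesis unfolding eq[symmetric] by (rule has_vector_derivative_scaleR[OF xk dh[OF that]])
  qed
  let ?f1 = "\<lambda>p t. sinh t *\<^sub>R (real k *\<^sub>R (?x t ^ (k - 1) *\<^sub>R h i p t) + ?x t ^ k *\<^sub>R h (Suc i) p t)"
  let ?f2 = "\<lambda>p t. (real k)\<^sup>2 *\<^sub>R (?x t ^ k *\<^sub>R h i p t)
      + (real k * (2 * real k - 1)) *\<^sub>R (?x t ^ (k - 1) *\<^sub>R h i p t)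
      + (2 * real k + 1) *\<^sub>R (?x t ^ Suc k *\<^sub>R h (Suc i) p t) + (4 * real k + 1) *\<^sub>R (?x t ^ k *\<^sub>R h (Suc i) p t)
      + ?x t ^ Suc (Suc k) *\<^sub>R h (Suc (Suc i)) p t + 2 *\<^sub>R (?x t ^ Suc k *\<^sub>R h (Suc (Suc i)) p t)"
  let ?I = "\<lambda>k i. if k = 0 \<and> i = Suc q then 1 else 0 :: real"
  let ?c = "(real k)\<^sup>2 * ?I k i + (real k * (2 * real k - 1)) * ?I (k - 1) i
      + (2 * real k + 1) * ?I (Suc k) (Suc i) + (4 * real k + 1) * ?I k (Suc i)
      + ?I (Suc (Suc k)) (Suc (Suc i)) + 2 * ?I (Suc k) (Suc (Suc i))"
  have kk: "0 \<le> real k * (2 * real k - 1)" by (cases k) auto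
  have A: "lead h (Suc q) ?c ?f2"
    by (intro lead.add lead.scale lead.mono kk) (use mono in auto)
 have B: "(if k = 0 \<and> i = q then 1 else 0) \<le> ?c" using kk by (cases k) auto
  have D: "((\<lambda>t. ?x t ^ k *\<^sub>R h i p t) has_vector_derivative ?f1 p t) (at t)"
    "(?f1 p has_vector_derivative ?f2 p t) (at t)" if pt: "p \<in> T" "t > 0" for p t
  proof -
    show "((\<lambda>t. ?x t ^ k *\<^sub>R h i p t) has_vector_derivative ?f1 p t) (at t)"
      using dx[OF pt, of k i] by simp
    have sh: "(sinh has_real_derivative cosh t) (at t)" by (auto intro!: derivative_eq_intros)
    have d: "(?f1 p has_vector_derivative
       sinh t *\<^sub>R (real k *\<^sub>R (sinh t *\<^sub>R ((real (k - 1) * ?x t ^ (k - 1 - 1)) *\<^sub>R h i p t + ?x t ^ (k - 1) *\<^sub>R h (Suc i) p t))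
        + sinh t *\<^sub>R ((real k * ?x t ^ (k - 1)) *\<^sub>R h (Suc i) p t + ?x t ^ k *\<^sub>R h (Suc (Suc i)) p t))
      + cosh t *\<^sub>R (real k *\<^sub>R (?x t ^ (k - 1) *\<^sub>R h i p t) + ?x t ^ k *\<^sub>R h (Suc i) p t)) (at t)"
      by (intro has_vector_derivative_scaleR[OF sh] has_vector_derivative_add dx pt
          bounded_linear.has_vector_derivative[OF bounded_linear_scaleR_right])
    have s: "sinh t * sinh t = ?x t * (?x t + 2)" and c: "cosh t = ?x t + 1"
      using hyperbolic_pythagoras[of t] by (auto simp: algebra_simps power2_eq_square)
    show "(?f1 p has_vector_derivative ?f2 p t) (at t)"
      using d unfolding lead_algebra[OF s c] .
  qed
  show ?case
    by (intro exI[of _ ?f1] exI[of _ ?f2] exI[of _ ?c] conjI ballI allI impI A B D)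
next
  case (add q c f d g)
  from add.IH(1) obtain f1 f2 c' where f: "c \<le> c'" "lead h (Suc q) c' f2"
    "\<forall>p\<in>T. \<forall>t>0. (f p has_vector_derivative f1 p t) (at t) \<and> (f1 p has_vector_derivative f2 p t) (at t)"
    by (elim exE conjE) (rule that)
  from add.IH(2) obtain g1 g2 d' where g: "d \<le> d'" "lead h (Suc q) d' g2"
    "\<forall>p\<in>T. \<forall>t>0. (g p has_vector_derivative g1 p t) (at t) \<and> (g1 p has_vector_derivative g2 p t) (at t)"
    by (elim exE conjE) (rule that)
  from f g show ?case
    by (intro exI[of _ "\<lambda>p t. f1 p t + g1 p t"] exI[of _ "\<lambda>p t. f2 p t + g2 p t"] exI[of _ "c' + d'"])
      (auto intro: lead.add has_vector_derivative_add)
next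
  case (scale e q c f)
  from scale.IH obtain f1 f2 c' where f: "c \<le> c'" "lead h (Suc q) c' f2"
    "\<forall>p\<in>T. \<forall>t>0. (f p has_vector_derivative f1 p t) (at t) \<and> (f1 p has_vector_derivative f2 p t) (at t)"
    by (elim exE conjE) (rule that)
  from f show ?case using scale(1)
    by (intro exI[of _ "\<lambda>p t. e *\<^sub>R f1 p t"] exI[of _ "\<lambda>p t. e *\<^sub>R f2 p t"] exI[of _ "e * c'"])
      (auto intro: lead.scale mult_left_mono bounded_linear.has_vector_derivative[OF bounded_linear_scaleR_right])
qed

text \<open>
  The antiderivative \<open>log (tanh (t / 2))\<close> of \<open>1 / sinh t\<close>.
\<close>

definition lam :: "real \<Rightarrow> real" where "lam t = ln (1 - exp (- t)) - ln (1 + exp (- t))"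

lemma lam_derivative:
  assumes "t > 0" shows "(lam has_real_derivative inverse (sinh t)) (at t)"
proof -
  have e: "exp (- t) < 1" using assms by simp
  have "(lam has_real_derivative exp (- t) / (1 - exp (- t)) + exp (- t) / (1 + exp (- t))) (at t)"
    unfolding lam_def[abs_def] using e by (auto intro!: derivative_eq_intros simp: add_pos_pos)
  moreover have "exp (- t) / (1 - exp (- t)) + exp (- t) / (1 + exp (- t)) = inverse (sinh t)"
  proof -
    define e where "e = exp (- t)"
    have e01: "0 < e" "e < 1" using e by (auto simp: e_def)
    have "1 - e * e = 2 * e * sinh t"
      unfolding e_def by (simp add: sinh_def algebra_simps flip: exp_add)
    moreover have "e / (1 - e) + e / (1 + e) = 2 * e / (1 - e * e)"
    proof -
      have "1 - e * e = (1 - e) * (1 + e)" by (simp add: algebra_simps)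
      then show ?thesis using e01 by (simp add: divide_simps) (simp add: algebra_simps)
    qed
    ultimately have "e / (1 - e) + e / (1 + e) = (2 * e) * 1 / ((2 * e) * sinh t)" by simp
    also have "\<dots> = inverse (sinh t)" using e01 by (subst mult_divide_mult_cancel_left) (auto simp: inverse_eq_divide)
    finally show ?thesis unfolding e_def .
  qed
  ultimately show ?thesis by simp
qed

lemma lam_at_bot: "filterlim lam at_bot (at_right 0)"
proof -
  have "filterlim (\<lambda>t::real. 1 - exp (- t)) (at_right 0) (at_right 0)"
    unfolding filterlim_at
  proof
    show "\<forall>\<^sub>F x in at_right 0. 1 - exp (- x) \<in> {0<..} \<and> 1 - exp (- x) \<noteq> (0::real)"
      by (rule eventually_at_rightI[of 0 1]) auto
    have "((\<lambda>t::real. 1 - exp (- t)) \<longlongrightarrow> 1 - exp (- 0)) (at_right 0)" by (intro tendsto_intros)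
    then show "((\<lambda>t::real. 1 - exp (- t)) \<longlongrightarrow> 0) (at_right 0)" by simp
  qed
  from filterlim_compose[OF ln_at_0 this]
  have 1: "filterlim (\<lambda>t::real. ln (1 - exp (- t))) at_bot (at_right 0)" .
  have "filterlim (\<lambda>t. - lam t) at_top (at_right 0)"
  proof -
    have "((\<lambda>t::real. ln (1 + exp (- t))) \<longlongrightarrow> ln (1 + exp (- 0))) (at_right 0)"
      by (intro tendsto_intros) (simp add: add_pos_pos)
    from filterlim_tendsto_add_at_top[OF this filterlim_uminus_at_top_at_bot[THEN filterlim_compose, OF 1]]
    show ?thesis by (simp add: lam_def)
  qed
  then show ?thesis by (simp add: filterlim_uminus_at_bot)
qed

text \<open>
  The boundary value of the \<open>i\<close>-th iterate, up to a nonzero factor, when \<open>b j\<close> is the boundary value of \<open>G j\<close>: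
  with \<open>b j = \<beta>(\<Lambda>^j F)\<close> it is \<open>\<beta>\<close> applied to \<open>\<Lambda>^j \<Prod> (\<Lambda> - k (m - k)) F\<close>, the product being over \<open>k < i\<close>.
\<close>

fun bseq :: "nat \<Rightarrow> (nat \<Rightarrow> complex) \<Rightarrow> nat \<Rightarrow> nat \<Rightarrow> complex" where
  "bseq m b 0 j = b j"
| "bseq m b (Suc i) j = bseq m b i (Suc j) + coef_b m i *\<^sub>R bseq m b i j"

context ray_ode
begin

context
  fixes p assumes mp: "m + 1 = 2 * p" and p: "p \<ge> 1"
begin

text \<open>
  For \<open>2 p = m + 1\<close> the iterate \<open>p\<close> is the first that need not be bounded. Its first-order exponent is zero, and
  \<open>sinh t\<close> times it raises the exponent to one.
\<close>

lemma bd_sinh_H: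
  assumes "i \<le> p" shows "bd T t0 (\<lambda>q t. sinh t *\<^sub>R H i j q t)"
proof (cases "i < p")
  case True
  then show ?thesis using mp by (intro bd_scaleR bd_H_below) (auto intro!: continuous_intros)
next
  case False
  then obtain i' where i: "i = Suc i'" "p = Suc i'" using assms p by (cases p) auto
  obtain C where C: "\<forall>q\<in>T. norm (H i j q t0) \<le> C" using H_bounded_t0 by metis
  have ca0: "ca i' = 0" using mp i by (simp add: coef_a_def)
  have R: "bd T t0 (\<lambda>q t. sinh t *\<^sub>R (H i' (Suc j) q t + cb i' *\<^sub>R H i' j q t))"
    using mp i by (intro bd_scaleR bd_add bd_const_scaleR bd_H_below) (auto intro!: continuous_intros)
  have sh: "(sinh has_real_derivative cosh t) (at t)" for t :: real by (auto intro!: derivative_eq_intros)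
  show ?thesis
  proof (rule bd_first_order[OF order_refl has_vector_derivative_scaleR[OF sh H_derivative] _ R])
    fix q t assume "q \<in> T" and t: "(0::real) < t"
    have e: "sinh t *\<^sub>R (sinh t *\<^sub>R H (Suc i) j q t) = - (H i' (Suc j) q t + cb i' *\<^sub>R H i' j q t)"
      using H_eq[OF t, of i' j q] by (simp add: ca0 i power2_eq_square del: Hseq.simps)
    show "sinh t *\<^sub>R (sinh t *\<^sub>R (sinh t *\<^sub>R H (Suc i) j q t) + cosh t *\<^sub>R H i j q t)
        = (real 1 * cosh t) *\<^sub>R (sinh t *\<^sub>R H i j q t) - sinh t *\<^sub>R (H i' (Suc j) q t + cb i' *\<^sub>R H i' j q t)"
      unfolding e by (simp add: scaleR_right_distrib scaleR_right_diff_distrib mult_ac del: Hseq.simps)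
  next
    show "norm (sinh t0 *\<^sub>R H i j q t0) \<le> sinh t0 * C" if "q \<in> T" for q
      using C that t0 by (auto intro!: mult_left_mono simp del: Hseq.simps)
  qed
qed

lemma bd_sinh_sq_H: "bd T t0 (\<lambda>q t. ((sinh t)\<^sup>2 ^ k) *\<^sub>R H (p + k) j q t)" if "k \<ge> 1" for k j
proof -
  have cs: "continuous_on {0..t0} (sinh :: real \<Rightarrow> real)" "continuous_on {0..t0} (cosh :: real \<Rightarrow> real)"
    by (auto intro!: continuous_intros)
  obtain p' where p': "p = Suc p'" using p by (cases p) auto
  have step: "bd T t0 (\<lambda>q t. ((sinh t)\<^sup>2 ^ Suc k) *\<^sub>R H (p + Suc k) j q t)"
    if a: "\<And>j. bd T t0 (\<lambda>q t. ((sinh t)\<^sup>2 ^ k) *\<^sub>R H (p' + k) j q t)"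
      and b: "bd T t0 (\<lambda>q t. (ca (p' + k) * (sinh t)\<^sup>2 ^ k) *\<^sub>R H (p + k) j q t)" for k j
  proof (rule bd_cong)
    show "bd T t0 (\<lambda>q t. - (((sinh t)\<^sup>2 ^ k) *\<^sub>R H (p' + k) (Suc j) q t
        + cosh t *\<^sub>R ((ca (p' + k) * (sinh t)\<^sup>2 ^ k) *\<^sub>R H (p + k) j q t)
        + cb (p' + k) *\<^sub>R (((sinh t)\<^sup>2 ^ k) *\<^sub>R H (p' + k) j q t)))"
      by (intro bd_minus bd_add bd_const_scaleR bd_scaleR[OF cs(2)] a b)
    fix q t assume "q \<in> T" "0 < t" "t \<le> t0"
    have "(sinh t)\<^sup>2 ^ Suc k *\<^sub>R H (p + Suc k) j q t = (sinh t)\<^sup>2 ^ k *\<^sub>R ((sinh t)\<^sup>2 *\<^sub>R H (Suc (Suc (p' + k))) j q t)"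
      by (simp add: p' mult.commute del: Hseq.simps)
    then show "- (((sinh t)\<^sup>2 ^ k) *\<^sub>R H (p' + k) (Suc j) q t
        + cosh t *\<^sub>R ((ca (p' + k) * (sinh t)\<^sup>2 ^ k) *\<^sub>R H (p + k) j q t)
        + cb (p' + k) *\<^sub>R (((sinh t)\<^sup>2 ^ k) *\<^sub>R H (p' + k) j q t))
      = (sinh t)\<^sup>2 ^ Suc k *\<^sub>R H (p + Suc k) j q t"
      unfolding H_eq[OF \<open>0 < t\<close>]
      by (simp add: p' scaleR_right_distrib scaleR_right_diff_distrib mult_ac del: Hseq.simps)
  qed
  have z: "ca p' = 0" using mp p' by (simp add: coef_a_def)
  have s0: "bd T t0 (\<lambda>q t. ((sinh t)\<^sup>2 ^ 0) *\<^sub>R H (p' + 0) j q t)" for j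
    using bd_H_below[of p' j] mp p' by simp
  have 1: "bd T t0 (\<lambda>q t. ((sinh t)\<^sup>2 ^ Suc 0) *\<^sub>R H (p + Suc 0) j q t)" for j
  proof (rule step[OF s0])
    show "bd T t0 (\<lambda>q t. (ca (p' + 0) * (sinh t)\<^sup>2 ^ 0) *\<^sub>R H (p + 0) j q t)"
      by (rule bdI[of _ _ _ 0]) (simp add: z)
  qed
  have 2: "bd T t0 (\<lambda>q t. ((sinh t)\<^sup>2 ^ Suc (Suc 0)) *\<^sub>R H (p + Suc (Suc 0)) j q t)" for j
  proof (rule step)
    show "bd T t0 (\<lambda>q t. (sinh t)\<^sup>2 ^ Suc 0 *\<^sub>R H (p' + Suc 0) j q t)" for j
      using bd_scaleR[OF cs(1) bd_sinh_H[OF order_refl, of j]] by (simp add: p' power2_eq_square del: Hseq.simps)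
    show "bd T t0 (\<lambda>q t. (ca (p' + Suc 0) * (sinh t)\<^sup>2 ^ Suc 0) *\<^sub>R H (p + Suc 0) j q t)"
      using bd_const_scaleR[OF 1, of "ca (p' + Suc 0)" j] by (simp del: Hseq.simps)
  qed
  have "bd T t0 (\<lambda>q t. ((sinh t)\<^sup>2 ^ Suc l) *\<^sub>R H (p + Suc l) j q t) \<and>
      bd T t0 (\<lambda>q t. ((sinh t)\<^sup>2 ^ Suc (Suc l)) *\<^sub>R H (p + Suc (Suc l)) j q t)" for l j
  proof (induction l arbitrary: j)
    case 0 then show ?case using 1 2 by blast
  next
    case (Suc l)
    have "bd T t0 (\<lambda>q t. ((sinh t)\<^sup>2 ^ Suc (Suc (Suc l))) *\<^sub>R H (p + Suc (Suc (Suc l))) j q t)"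
    proof (rule step)
      fix j
      have "bd T t0 (\<lambda>q t. (sinh t)\<^sup>2 *\<^sub>R (((sinh t)\<^sup>2 ^ Suc l) *\<^sub>R H (p + Suc l) j q t))"
        by (intro bd_scaleR[OF _ conjunct1[OF Suc.IH]] continuous_intros)
      then show "bd T t0 (\<lambda>q t. (sinh t)\<^sup>2 ^ Suc (Suc l) *\<^sub>R H (p' + Suc (Suc l)) j q t)"
        by (simp add: p' del: Hseq.simps)
    next
      show "bd T t0 (\<lambda>q t. (ca (p' + Suc (Suc l)) * (sinh t)\<^sup>2 ^ Suc (Suc l)) *\<^sub>R H (p + Suc (Suc l)) j q t)"
        using bd_const_scaleR[OF conjunct2[OF Suc.IH], of "ca (p' + Suc (Suc l))" j] by (simp del: Hseq.simps)
    qed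
    then show ?case using Suc.IH by blast
  qed
  then show ?thesis using that by (metis Suc_le_D One_nat_def)
qed

text \<open>
  All terms other than the extreme one carry enough powers of \<open>cosh t - 1\<close>, which is comparable with
  \<open>sinh\<^sup>2 t\<close>.
\<close>

lemma lead_bd:
  assumes "lead (\<lambda>i. H i j) p c f"
  shows "bd T t0 (\<lambda>q t. f q t - c *\<^sub>R H p j q t)"
proof -
  have "q = p \<Longrightarrow> bd T t0 (\<lambda>r t. f r t - c *\<^sub>R H p j r t)" if "lead (\<lambda>i. H i j) q c f" for q c f
    using that
proof (induction rule: lead.induct)
  case (mono i k q)
  have cx: "continuous_on {0..t0} (\<lambda>t. (cosh t - 1) ^ l :: real)"
    "continuous_on {0..t0} (\<lambda>t. inverse (cosh t + 1) ^ l :: real)" for l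
    by (auto intro!: continuous_intros) (metis add_pos_pos cosh_real_pos less_irrefl zero_less_one)
  have x: "cosh t - 1 = inverse (cosh t + 1) * (sinh t)\<^sup>2" for t :: real
  proof -
    have "cosh t + 1 \<noteq> 0" using cosh_real_pos[of t] by linarith
    moreover have "(sinh t)\<^sup>2 = (cosh t - 1) * (cosh t + 1)"
      using hyperbolic_pythagoras[of t] by (simp add: algebra_simps power2_eq_square)
    ultimately show ?thesis by simp
  qed
  consider "k = 0" "i = p" | "i < p" | "i = p" "k \<ge> 1" | l where "i = p + l" "l \<ge> 1" "l \<le> k"
  proof -
    consider "i < p" | "i = p" "k = 0" | "i = p" "k \<ge> 1" | "i > p" by linarith
    then show thesis
    proof cases
      case 4
      then show thesis using mono by (intro that(4)[of "i - p"]) auto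
    qed (use that in auto)
  qed
  then show ?case
  proof cases
    case 1
    then show ?thesis by (intro bdI[of _ _ _ 0]) (simp add: mono)
  next
    case 2
    then show ?thesis using bd_scaleR[OF cx(1) bd_H_below[of i j]] mp by (simp add: mono)
  next
    case 3
    have "bd T t0 (\<lambda>q t. (cosh t - 1) ^ (k - 1) *\<^sub>R (inverse (cosh t + 1) ^ 1 *\<^sub>R (sinh t *\<^sub>R (sinh t *\<^sub>R H p j q t))))"
      by (intro bd_scaleR[OF cx(1)] bd_scaleR[OF cx(2)] bd_scaleR[OF _ bd_sinh_H])
        (auto intro!: continuous_intros)
    moreover have eq: "(cosh t - 1) ^ (k - 1) *\<^sub>R (inverse (cosh t + 1) ^ 1 *\<^sub>R (sinh t *\<^sub>R (sinh t *\<^sub>R H p j q t)))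
        = (cosh t - 1) ^ k *\<^sub>R H p j q t" for q t
    proof -
      have "(cosh t - 1) ^ k = (cosh t - 1) ^ (k - 1) * (cosh t - 1)"
        using 3 by (cases k) auto
      then show ?thesis unfolding x[of t] by (simp add: power2_eq_square mult_ac del: Hseq.simps)
    qed
    ultimately have "bd T t0 (\<lambda>q t. (cosh t - 1) ^ k *\<^sub>R H p j q t)" by (simp only: eq)
    then show ?thesis using 3 by (simp add: mono del: Hseq.simps)
  next
    case 4
    have "bd T t0 (\<lambda>q t. (cosh t - 1) ^ (k - l) *\<^sub>R (inverse (cosh t + 1) ^ l *\<^sub>R (((sinh t)\<^sup>2 ^ l) *\<^sub>R H (p + l) j q t)))"
      by (intro bd_scaleR[OF cx(1)] bd_scaleR[OF cx(2)] bd_sinh_sq_H 4)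
    moreover have eq: "(cosh t - 1) ^ (k - l) *\<^sub>R (inverse (cosh t + 1) ^ l *\<^sub>R (((sinh t)\<^sup>2 ^ l) *\<^sub>R H (p + l) j q t))
        = (cosh t - 1) ^ k *\<^sub>R H i j q t" for q t
    proof -
      have "(cosh t - 1) ^ k = (cosh t - 1) ^ (k - l) * (cosh t - 1) ^ l"
        using 4 by (simp flip: power_add)
      also have "(cosh t - 1) ^ l = inverse (cosh t + 1) ^ l * (sinh t)\<^sup>2 ^ l"
        by (subst x) (simp add: power_mult_distrib)
      finally show ?thesis by (simp add: 4 mult_ac del: Hseq.simps)
    qed
    ultimately have "bd T t0 (\<lambda>q t. (cosh t - 1) ^ k *\<^sub>R H i j q t)" by (simp only: eq)
    then show ?thesis using 4 by (simp add: mono del: Hseq.simps)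
  qed
next
  case (add q c f d g)
  have "bd T t0 (\<lambda>q t. (f q t - c *\<^sub>R H p j q t) + (g q t - d *\<^sub>R H p j q t))"
    using add by (intro bd_add) auto
  then show ?case by (simp add: scaleR_left_distrib algebra_simps del: Hseq.simps)
next
  case (scale e q c f)
  have "bd T t0 (\<lambda>q t. e *\<^sub>R (f q t - c *\<^sub>R H p j q t))"
    using scale by (intro bd_const_scaleR) auto
  then show ?case by (simp add: scaleR_right_diff_distrib del: Hseq.simps)
qed
  then show ?thesis using assms by simp
qed

lemma limit_sinh_bd:
  assumes q: "q \<in> T" and f: "bd T t0 f"
  shows "((\<lambda>t. sinh t *\<^sub>R f q t) \<longlongrightarrow> 0) (at_right 0)"
proof -
  obtain M where M: "0 \<le> M" "\<forall>q\<in>T. \<forall>t\<in>{0<..t0}. norm (f q t) \<le> M" by (rule bdE[OF f])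
  show ?thesis
  proof (rule Lim_null_comparison)
    show "\<forall>\<^sub>F t in at_right 0. norm (sinh t *\<^sub>R f q t) \<le> sinh t * M"
      by (rule eventually_at_rightI[of 0 t0]) (use M q t0 in \<open>auto intro!: mult_left_mono\<close>)
    have "((\<lambda>t::real. sinh t * M) \<longlongrightarrow> sinh 0 * M) (at_right 0)" by (intro tendsto_intros)
    then show "((\<lambda>t::real. sinh t * M) \<longlongrightarrow> 0) (at_right 0)" by simp
  qed
qed

text \<open>
  As \<open>t \<rightarrow> 0\<close> the recursion, multiplied by \<open>sinh\<^sup>2\<close>, becomes \<open>a\<^sub>i H\<^sub>i\<^sub>+\<^sub>1 = - (H\<^sub>i(\<Lambda>) + b\<^sub>i H\<^sub>i)\<close>, and the coefficient
  \<open>a\<^sub>i = 2 i + 1 - m\<close> is nonzero below the critical index.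
\<close>

lemma odd_boundary_values:
  assumes q: "q \<in> T" and b: "\<And>j. (G j q \<longlongrightarrow> b j) (at_right 0)" and i: "i < p"
  shows "\<exists>c. c \<noteq> 0 \<and> (\<forall>j. (H i j q \<longlongrightarrow> c *\<^sub>R bseq m b i j) (at_right 0))"
  using i
proof (induction i)
  case 0
  have "H 0 j q = G j q" for j by (rule ext) simp
  then show ?case using b by (intro exI[of _ 1]) simp
next
  case (Suc i)
  from Suc.IH[OF Suc_lessD[OF Suc.prems]] obtain c where c: "c \<noteq> 0" "\<forall>j. (H i j q \<longlongrightarrow> c *\<^sub>R bseq m b i j) (at_right 0)"
    by (elim exE conjE) (rule that)
  have ca: "ca i \<noteq> 0" using Suc.prems mp unfolding coef_a_def by simp
  have "(H (Suc i) j q \<longlongrightarrow> (- c / ca i) *\<^sub>R bseq m b (Suc i) j) (at_right 0)" for j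
  proof -
    let ?r = "\<lambda>t. inverse (ca i * cosh t) *\<^sub>R (- H i (Suc j) q t - cb i *\<^sub>R H i j q t
        - sinh t *\<^sub>R (sinh t *\<^sub>R H (Suc (Suc i)) j q t))"
    have "((\<lambda>t. sinh t *\<^sub>R (sinh t *\<^sub>R H (Suc (Suc i)) j q t)) \<longlongrightarrow> 0) (at_right 0)"
      by (rule limit_sinh_bd[OF q bd_sinh_H]) (use Suc.prems in simp)
    then have lim: "(?r \<longlongrightarrow> inverse (ca i * cosh 0) *\<^sub>R (- (c *\<^sub>R bseq m b i (Suc j)) - cb i *\<^sub>R (c *\<^sub>R bseq m b i j) - 0)) (at_right 0)"
      using c ca by (intro tendsto_intros) auto
    have eqL: "inverse (ca i * cosh 0) *\<^sub>R (- (c *\<^sub>R bseq m b i (Suc j)) - cb i *\<^sub>R (c *\<^sub>R bseq m b i j) - 0)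
        = (- c / ca i) *\<^sub>R bseq m b (Suc i) j"
      using ca by (simp add: scaleR_conv_of_real field_simps)
    have ev: "\<forall>\<^sub>F t in at_right 0. ?r t = H (Suc i) j q t"
    proof (rule eventually_at_rightI[of 0 1])
      fix t :: real assume "t \<in> {0<..<1}"
      then have t: "t > 0" by simp
      have n: "ca i * cosh t \<noteq> 0" using ca by simp
      have "sinh t *\<^sub>R (sinh t *\<^sub>R H (Suc (Suc i)) j q t) =
          - H i (Suc j) q t - (ca i * cosh t) *\<^sub>R H (Suc i) j q t - cb i *\<^sub>R H i j q t"
        using H_eq[OF t, of i j q] by (simp add: power2_eq_square del: Hseq.simps)
      then have "- H i (Suc j) q t - cb i *\<^sub>R H i j q t - sinh t *\<^sub>R (sinh t *\<^sub>R H (Suc (Suc i)) j q t)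
          = (ca i * cosh t) *\<^sub>R H (Suc i) j q t" by (simp del: Hseq.simps)
      then show "?r t = H (Suc i) j q t"
        by (simp only: scaleR_scaleR left_inverse[OF n] scaleR_one)
    qed simp
    show ?thesis using Lim_transform_eventually[OF lim ev] unfolding eqL .
  qed
  then show ?case using c ca by (intro exI[of _ "- c / ca i"]) auto
qed

text \<open>
  At the critical index the coefficient \<open>2 i + 1 - m\<close> vanishes and the recursion reads \<open>H' = - R / sinh t\<close>, where
  \<open>R\<close> tends to a nonzero multiple of \<open>bseq m b p 0\<close>. So \<open>H\<close> grows like that number times \<open>lam\<close>, unless it is zero;
  and the derivative of order \<open>2 p\<close> is a positive multiple of \<open>H\<close> up to bounded terms.
\<close>

theorem odd_log_term_vanishes:
  assumes q: "q \<in> T" and b: "\<And>j. (G j q \<longlongrightarrow> b j) (at_right 0)"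
    and g0: "\<And>t. t > 0 \<Longrightarrow> g 0 t = G 0 q t"
    and g: "\<And>k t. t > 0 \<Longrightarrow> (g k has_vector_derivative g (Suc k) t) (at t)"
    and small: "((\<lambda>t. inverse (lam t) *\<^sub>R g (2 * p) t) \<longlongrightarrow> 0) (at_right 0)"
  shows "bseq m b p 0 = 0"
proof -
  obtain p' where p': "p = Suc p'" using p by (cases p) auto
  have dH: "(H i 0 r has_vector_derivative sinh t *\<^sub>R H (Suc i) 0 r t) (at t)" if "r \<in> {q}" "t > 0" for i r t
    using H_derivative[of q t i 0] q that by simp
  have lead_k: "\<exists>c f. 1 \<le> c \<and> lead (\<lambda>i. H i 0) k c f \<and> (\<forall>t>0. g (2 * k) t = f q t)" for k
  proof (induction k)
    case 0
    have "lead (\<lambda>i. H i 0) 0 (if (0::nat) = 0 \<and> (0::nat) = 0 then 1 else 0) (\<lambda>r t. ((cosh t - 1) ^ 0) *\<^sub>R H 0 0 r t)"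
      by (rule lead.mono) simp
    then show ?case
      by (intro exI[of _ 1] exI[of _ "\<lambda>r t. ((cosh t - 1) ^ 0) *\<^sub>R H 0 0 r t"]) (simp add: g0)
  next
    case (Suc k)
    then obtain c f where f: "1 \<le> c" "lead (\<lambda>i. H i 0) k c f" "\<forall>t>0. g (2 * k) t = f q t"
      by (elim exE conjE) (rule that)
    have "\<exists>f1 f2 c'. c \<le> c' \<and> lead (\<lambda>i. H i 0) (Suc k) c' f2 \<and>
      (\<forall>r\<in>{q}. \<forall>t>0. (f r has_vector_derivative f1 r t) (at t) \<and> (f1 r has_vector_derivative f2 r t) (at t))"
      by (rule lead_second_derivative[OF dH f(2)])
    then obtain f1 f2 c' where f2: "c \<le> c'" "lead (\<lambda>i. H i 0) (Suc k) c' f2"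
      "\<forall>r\<in>{q}. \<forall>t>0. (f r has_vector_derivative f1 r t) (at t) \<and> (f1 r has_vector_derivative f2 r t) (at t)"
      by (elim exE conjE) (rule that)
    have uniq: "g (Suc l) t = w' t"
      if w: "\<And>t. t > 0 \<Longrightarrow> g l t = w t" "\<And>t. t > 0 \<Longrightarrow> (w has_vector_derivative w' t) (at t)" and t: "t > 0" for l w w' t
    proof (rule vector_derivative_unique_at[OF g[OF t]])
      show "(g l has_vector_derivative w' t) (at t)"
        by (rule has_vector_derivative_transform_within_open[where S="{0<..}" and f=w])
          (use w t in auto)
    qed
    have 1: "g (Suc (2 * k)) t = f1 q t" if "t > 0" for t
      by (rule uniq[where w="f q", OF _ _ that]) (use f(3) f2(3) in auto)
    have "g (Suc (Suc (2 * k))) t = f2 q t" if "t > 0" for t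
      by (rule uniq[where w="f1 q", OF 1 _ that]) (use f2(3) in auto)
    then show ?case using f(1) f2(1,2) by (intro exI[of _ c'] exI[of _ f2]) auto
  qed
  obtain c f where f: "1 \<le> c" "lead (\<lambda>i. H i 0) p c f" "\<forall>t>0. g (2 * p) t = f q t"
    using lead_k[of p] by (elim exE conjE) (rule that)
  obtain M1 where M1: "0 \<le> M1" "\<forall>q\<in>T. \<forall>t\<in>{0<..t0}. norm (f q t - c *\<^sub>R H p 0 q t) \<le> M1"
    by (rule bdE[OF lead_bd[OF f(2)]])
  define R where "R t = H p' (Suc 0) q t + cb p' *\<^sub>R H p' 0 q t" for t
  have dR: "(R has_vector_derivative sinh t *\<^sub>R (H p (Suc 0) q t + cb p' *\<^sub>R H p 0 q t)) (at t)" if "t > 0" for t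
  proof -
    have "(R has_vector_derivative sinh t *\<^sub>R H p (Suc 0) q t + cb p' *\<^sub>R (sinh t *\<^sub>R H p 0 q t)) (at t)"
      unfolding R_def p'
      by (intro has_vector_derivative_add bounded_linear.has_vector_derivative[OF bounded_linear_scaleR_right] H_derivative q that)
    then show ?thesis by (simp add: scaleR_right_distrib mult.commute del: Hseq.simps)
  qed
  have "bd T t0 (\<lambda>q t. sinh t *\<^sub>R H p (Suc 0) q t + cb p' *\<^sub>R (sinh t *\<^sub>R H p 0 q t))"
    by (intro bd_add bd_const_scaleR bd_sinh_H) auto
  then obtain M where M: "0 \<le> M" "\<forall>q\<in>T. \<forall>t\<in>{0<..t0}. norm (sinh t *\<^sub>R H p (Suc 0) q t + cb p' *\<^sub>R (sinh t *\<^sub>R H p 0 q t)) \<le> M"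
    by (rule bdE)
  have R'M: "norm (sinh t *\<^sub>R (H p (Suc 0) q t + cb p' *\<^sub>R H p 0 q t)) \<le> M" if "0 < t" "t \<le> t0" for t
    using M(2) q that by (simp add: scaleR_right_distrib mult.commute del: Hseq.simps)
  obtain k where k: "k \<noteq> 0" "\<forall>j. (H p' j q \<longlongrightarrow> k *\<^sub>R bseq m b p' j) (at_right 0)"
    using odd_boundary_values[OF q b, of p'] p' by auto
  let ?R0 = "k *\<^sub>R bseq m b p 0"
  have "(R \<longlongrightarrow> k *\<^sub>R bseq m b p' (Suc 0) + cb p' *\<^sub>R (k *\<^sub>R bseq m b p' 0)) (at_right 0)"
    unfolding R_def[abs_def] using k(2) by (intro tendsto_intros) auto
  then have Rlim: "(R \<longlongrightarrow> ?R0) (at_right 0)" by (simp add: p' scaleR_right_distrib mult.commute)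
  have RR0: "norm (R t - ?R0) \<le> M * sinh t" if t: "0 < t" "t \<le> t0" for t
  proof (rule tendsto_upperbound)
    show "((\<lambda>s. norm (R t - R s)) \<longlongrightarrow> norm (R t - ?R0)) (at_right 0)"
      by (intro tendsto_intros Rlim)
    show "\<forall>\<^sub>F s in at_right 0. norm (R t - R s) \<le> M * sinh t"
    proof (rule eventually_at_rightI[of 0 t])
      fix s assume s: "s \<in> {0<..<t}"
      have "norm (R t - R s) \<le> M * sinh t - M * sinh s"
      proof (rule norm_diff_le_of_derivative[OF _ dR])
        fix x assume x: "x \<in> {s..t}"
        show "((\<lambda>x. M * sinh x) has_real_derivative M * cosh x) (at x)" by (auto intro!: derivative_eq_intros)
        have "M * 1 \<le> M * cosh x" using M cosh_real_ge_1 by (intro mult_left_mono) auto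
        then show "norm (sinh x *\<^sub>R (H p (Suc 0) q x + cb p' *\<^sub>R H p 0 q x)) \<le> M * cosh x"
          using R'M[of x] x s t by (simp del: Hseq.simps)
      qed (use s in auto)
      also have "\<dots> \<le> M * sinh t" using M s by simp
      finally show "norm (R t - R s) \<le> M * sinh t" .
    qed (use t in simp)
  qed simp
  (* H p 0 without its logarithmic part; its derivative is bounded because R - ?R0 = O(sinh) *)
  define z where "z t = H p 0 q t + lam t *\<^sub>R ?R0" for t
  have dz: "(z has_vector_derivative inverse (sinh t) *\<^sub>R (?R0 - R t)) (at t)" if t: "t > 0" for t
  proof -
    have ca0: "ca p' = 0" using mp p' by (simp add: coef_a_def)
    have "(z has_vector_derivative sinh t *\<^sub>R H (Suc p) 0 q t + (lam t *\<^sub>R 0 + inverse (sinh t) *\<^sub>R ?R0)) (at t)"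
      unfolding z_def
      by (intro has_vector_derivative_add H_derivative q t has_vector_derivative_scaleR[OF lam_derivative[OF t]] has_vector_derivative_const)
    moreover have "sinh t *\<^sub>R H (Suc p) 0 q t = - (inverse (sinh t) *\<^sub>R R t)"
    proof -
      have "(sinh t)\<^sup>2 *\<^sub>R H (Suc p) 0 q t = - R t"
        unfolding p' H_eq[OF t] by (simp add: ca0 R_def del: Hseq.simps)
      then have "inverse (sinh t) *\<^sub>R ((sinh t)\<^sup>2 *\<^sub>R H (Suc p) 0 q t) = inverse (sinh t) *\<^sub>R (- R t)" by simp
      moreover have "inverse (sinh t) * (sinh t)\<^sup>2 = sinh t"
        using sinh_pos[OF t] by (simp add: power2_eq_square field_simps)
      ultimately show ?thesis by (simp only: scaleR_scaleR scaleR_minus_right)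
    qed
    ultimately show ?thesis by (simp add: scaleR_right_diff_distrib)
  qed
  have zb: "norm (z t) \<le> norm (z t0) + M * t0" if t: "0 < t" "t \<le> t0" for t
  proof -
    have "norm (z t0 - z t) \<le> M * (t0 - t)"
    proof (rule mv_bound[OF t(2) dz])
      fix x assume x: "x \<in> {t..t0}"
      then have sp: "sinh x > 0" using t by simp
      have "inverse (sinh x) * norm (R x - ?R0) \<le> inverse (sinh x) * (M * sinh x)"
        using RR0[of x] x t sp by (intro mult_left_mono) auto
      also have "inverse (sinh x) * (M * sinh x) = M" using sp by (simp add: field_simps)
      finally show "norm (inverse (sinh x) *\<^sub>R (?R0 - R x)) \<le> M"
        unfolding norm_scaleR norm_minus_commute[of ?R0] using sp by simp
    qed (use t in auto)
    also have "\<dots> \<le> M * t0" using M t by (intro mult_left_mono) auto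
    finally show ?thesis using norm_triangle_ineq4[of "z t0" "z t0 - z t"] by simp
  qed
  have "c * norm ?R0 \<le> 0"
  proof (rule tendsto_lowerbound)
    let ?C = "M1 + c * (norm (z t0) + M * t0)"
    have il: "((\<lambda>t. inverse (lam t)) \<longlongrightarrow> 0) (at_right 0)"
      by (rule filterlim_compose[OF tendsto_inverse_0 filterlim_mono[OF lam_at_bot at_bot_le_at_infinity order_refl]])
    show "((\<lambda>t. norm (inverse (lam t) *\<^sub>R g (2 * p) t) + \<bar>inverse (lam t)\<bar> * ?C) \<longlongrightarrow> 0) (at_right 0)"
      using tendsto_add[OF tendsto_norm_zero[OF small] tendsto_mult_right[OF tendsto_rabs_zero[OF il], of ?C]] by simp
    have "\<forall>\<^sub>F t in at_right 0. lam t < 0" using lam_at_bot unfolding filterlim_at_bot_dense by blast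
    moreover have "\<forall>\<^sub>F t in at_right 0. t \<in> {0<..<t0}" using t0 by (intro eventually_at_rightI[of 0 t0]) auto
    ultimately show "\<forall>\<^sub>F t in at_right 0. c * norm ?R0 \<le> norm (inverse (lam t) *\<^sub>R g (2 * p) t) + \<bar>inverse (lam t)\<bar> * ?C"
    proof eventually_elim
      fix t assume l: "lam t < 0" and t: "t \<in> {0<..<t0}"
      have dec: "(c * lam t) *\<^sub>R ?R0 = c *\<^sub>R z t - g (2 * p) t + (f q t - c *\<^sub>R H p 0 q t)"
        using f(3) t by (simp add: z_def scaleR_right_distrib mult_ac del: Hseq.simps)
      have "norm ((c * lam t) *\<^sub>R ?R0) \<le> norm (c *\<^sub>R z t) + norm (g (2 * p) t) + norm (f q t - c *\<^sub>R H p 0 q t)"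
        unfolding dec by (rule order_trans[OF norm_triangle_ineq add_right_mono[OF norm_triangle_ineq4]])
      also have "\<dots> \<le> c * (norm (z t0) + M * t0) + norm (g (2 * p) t) + M1"
        using zb[of t] M1(2) q t f(1) by (intro add_mono) (auto intro!: mult_left_mono simp del: Hseq.simps)
      finally have "\<bar>inverse (lam t)\<bar> * norm ((c * lam t) *\<^sub>R ?R0) \<le> \<bar>inverse (lam t)\<bar> * (norm (g (2 * p) t) + ?C)"
        by (intro mult_left_mono) auto
      moreover have "\<bar>inverse (lam t)\<bar> * norm ((c * lam t) *\<^sub>R ?R0) = c * norm ?R0"
        using l f(1) by (simp add: abs_mult)
      moreover have "norm (inverse (lam t) *\<^sub>R g (2 * p) t) + \<bar>inverse (lam t)\<bar> * ?C
          = \<bar>inverse (lam t)\<bar> * (norm (g (2 * p) t) + ?C)" unfolding norm_scaleR by (rule distrib_left[symmetric])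
      ultimately show "c * norm ?R0 \<le> norm (inverse (lam t) *\<^sub>R g (2 * p) t) + \<bar>inverse (lam t)\<bar> * ?C"
        by (simp only:)
    qed
  qed simp
  then have "norm ?R0 \<le> 0" using f(1) by (simp add: mult_le_0_iff)
  then have "?R0 = 0" by (simp only: norm_le_zero_iff)
  then show ?thesis using k(1) by simp
qed

end

end

section \<open>Composition with functions of one variable\<close>

lemma partial_compose_real:
  fixes w :: "'a::euclidean_space \<Rightarrow> real"
  assumes "(g has_real_derivative g') (at (w x))" "w differentiable (at x)"
  shows "partial b (\<lambda>x. g (w x)) x = g' * partial b w x"
    and "(\<lambda>x. g (w x)) differentiable (at x)"
proof -
  have "(w has_derivative frechet_derivative w (at x)) (at x)"
    using assms(2) frechet_derivative_works by blast
  from diff_chain_at[OF this assms(1)[unfolded has_field_derivative_def]]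
  have d: "((\<lambda>x. g (w x)) has_derivative (\<lambda>h. g' * frechet_derivative w (at x) h)) (at x)"
    by (simp add: comp_def)
  show "partial b (\<lambda>x. g (w x)) x = g' * partial b w x"
    using has_derivative_partial[OF d] by (simp add: partial_def)
  show "(\<lambda>x. g (w x)) differentiable (at x)" using d by (rule differentiableI)
qed

lemma second_partial_compose_real:
  fixes w :: "'a::euclidean_space \<Rightarrow> real"
  assumes U: "open U" "x \<in> U" and w: "smooth_on U w" and b: "b \<in> Basis"
    and g1: "\<And>y. y \<in> U \<Longrightarrow> (g has_real_derivative g1 (w y)) (at (w y))"
    and g2: "(g1 has_real_derivative g2) (at (w x))"
  shows "partial b (partial b (\<lambda>x. g (w x))) x = g2 * (partial b w x)\<^sup>2 + g1 (w x) * partial b (partial b w) x"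
    and "partial b (\<lambda>x. g (w x)) differentiable (at x)"
proof -
  have wd: "w differentiable (at y)" if "y \<in> U" for y by (rule smooth_on_differentiable[OF w that])
  have pd: "partial b w differentiable (at x)"
    by (rule smooth_on_differentiable[OF smooth_on_partial[OF w b] U(2)])
  have eq: "partial b (\<lambda>x. g (w x)) y = g1 (w y) * partial b w y" if "y \<in> U" for y
    by (rule partial_compose_real(1)[OF g1[OF that] wd[OF that]])
  note gw = partial_compose_real[OF g2 wd[OF U(2)]]
  have "partial b (partial b (\<lambda>x. g (w x))) x = partial b (\<lambda>y. g1 (w y) * partial b w y) x"
    by (rule partial_cong_open[OF U eq])
  also have "\<dots> = g1 (w x) * partial b (partial b w) x + (g2 * partial b w x) * partial b w x"
    using partial_mult[OF gw(2) pd, of b] gw(1)[of b] by simp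
  finally show "partial b (partial b (\<lambda>x. g (w x))) x = g2 * (partial b w x)\<^sup>2 + g1 (w x) * partial b (partial b w) x"
    by (simp add: power2_eq_square)
  have "(\<lambda>y. g1 (w y) * partial b w y) differentiable (at x)"
    by (rule differentiable_bilinear[OF bounded_bilinear_mult gw(2) pd])
  then show "partial b (\<lambda>x. g (w x)) differentiable (at x)"
    by (rule differentiable_cong_open[OF U eq[symmetric], rotated])
qed

lemma hyp_laplacian_compose_real:
  fixes w :: "'a::euclidean_space \<Rightarrow> real"
  assumes U: "open U" "x \<in> U" and w: "smooth_on U w"
    and g1: "\<And>y. y \<in> U \<Longrightarrow> (g has_real_derivative g1 (w y)) (at (w y))"
    and g2: "(g1 has_real_derivative g2) (at (w x))"
  shows "hyp_laplacian (\<lambda>x. g (w x)) x =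
    g2 * ((1 - (norm x)\<^sup>2)\<^sup>2 * (\<Sum>b\<in>Basis. (partial b w x)\<^sup>2)) + g1 (w x) * hyp_laplacian w x"
proof -
  have "laplacian (\<lambda>x. g (w x)) x = g2 * (\<Sum>b\<in>Basis. (partial b w x)\<^sup>2) + g1 (w x) * laplacian w x"
    unfolding laplacian_def
    by (simp add: second_partial_compose_real(1)[OF U w _ g1 g2] sum.distrib sum_distrib_left)
  moreover have "normal_deriv (\<lambda>x. g (w x)) x = g1 (w x) * normal_deriv w x"
    unfolding normal_deriv_def
    by (simp add: partial_compose_real(1)[OF g1[OF U(2)] smooth_on_differentiable[OF w U(2)]]
        sum_distrib_left mult_ac)
  ultimately show ?thesis by (simp add: hyp_laplacian_def algebra_simps)
qed

section \<open>Functions of the hyperbolic distance\<close>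

text \<open>
  \<open>sinh\<^sup>2 (d / 2)\<close> for the hyperbolic distance \<open>d\<close> of the Poincare ball.
\<close>

definition cdist :: "'a::euclidean_space \<Rightarrow> 'a \<Rightarrow> real" where
  "cdist x y = ((x - y) \<bullet> (x - y)) / ((1 - x \<bullet> x) * (1 - y \<bullet> y))"

lemma ball_inner: "(y::'a::euclidean_space) \<in> ball 0 1 \<longleftrightarrow> y \<bullet> y < 1"
  by (simp add: dist_norm norm_eq_sqrt_inner)

lemma norm_less_1_inner: "norm (y::'a::euclidean_space) < 1 \<longleftrightarrow> y \<bullet> y < 1"
  by (simp add: norm_eq_sqrt_inner)

lemma smooth_on_fst: "smooth_on U (fst :: 'a::euclidean_space \<times> 'b::euclidean_space \<Rightarrow> 'a)"
  and smooth_on_snd: "smooth_on U (snd :: 'a::euclidean_space \<times> 'b::euclidean_space \<Rightarrow> 'b)"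
  by (intro smooth_on_linear bounded_linear_fst bounded_linear_snd)+

lemma smooth_on_cdist_pair:
  "smooth_on (ball 0 1 \<times> ball 0 1) (\<lambda>z::'a::euclidean_space \<times> 'a. cdist (fst z) (snd z))"
proof -
  have o: "open (ball 0 1 \<times> ball 0 1 :: ('a \<times> 'a) set)" by (intro open_Times open_ball)
  show ?thesis unfolding cdist_def
    by (intro smooth_on_divide smooth_on_mult smooth_on_inner smooth_on_diff smooth_on_const o smooth_on_fst smooth_on_snd)
      (auto simp: norm_less_1_inner mem_Times_iff intro!: mult_pos_pos)
qed

lemma smooth_on_cdist:
  assumes "(x::'a::euclidean_space) \<in> ball 0 1" shows "smooth_on (ball 0 1) (cdist x)"
proof -
  have "x \<bullet> x < 1" using assms ball_inner by blast
  then show ?thesis unfolding cdist_def[abs_def]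
    by (intro smooth_on_divide smooth_on_mult smooth_on_inner smooth_on_diff smooth_on_const open_ball
        smooth_on_linear[OF bounded_linear_ident] smooth_on_norm_sq)
      (auto simp: norm_less_1_inner intro!: mult_pos_pos)
qed

lemma partial_inverse_power_defect:
  fixes y :: "'a::euclidean_space"
  assumes y: "y \<in> ball 0 1" and k: "k > 0"
  shows "partial b (\<lambda>y. inverse ((1 - y \<bullet> y) ^ k)) y = 2 * real k * (y \<bullet> b) * inverse ((1 - y \<bullet> y) ^ Suc k)"
    and "(\<lambda>y. inverse ((1 - y \<bullet> y) ^ k)) differentiable (at y)"
proof -
  have n: "1 - y \<bullet> y \<noteq> 0" using y by (auto simp: norm_less_1_inner)
  have "((\<lambda>s. inverse (s ^ k)) has_real_derivative - real k * inverse (s ^ Suc k)) (at s)" if "s \<noteq> 0" for s :: real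
  proof -
    obtain l where l: "k = Suc l" using k by (cases k) auto
    have "((\<lambda>s. inverse (s ^ k)) has_real_derivative - (real k * s ^ (k - 1) * inverse (s ^ k * s ^ k))) (at s)"
      using that by (auto intro!: derivative_eq_intros)
    moreover have e: "- (real k * s ^ (k - 1) * inverse (s ^ k * s ^ k)) = - real k * inverse (s ^ Suc k)"
      using that by (simp add: l field_simps)
    ultimately show ?thesis by (simp only: e)
  qed
  note g = this[OF n]
  have d: "((\<lambda>y. 1 - y \<bullet> y) has_derivative (\<lambda>h. 0 - (y \<bullet> h + h \<bullet> y))) (at y)"
    by (intro derivative_intros)
  have p: "partial b (\<lambda>y. 1 - y \<bullet> y) y = - 2 * (y \<bullet> b)"
    using has_derivative_partial[OF d] by (simp add: inner_commute)
  note c = partial_compose_real[OF g differentiableI[OF d]]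
  show "partial b (\<lambda>y. inverse ((1 - y \<bullet> y) ^ k)) y = 2 * real k * (y \<bullet> b) * inverse ((1 - y \<bullet> y) ^ Suc k)"
    using c(1)[of b] p by simp
  show "(\<lambda>y. inverse ((1 - y \<bullet> y) ^ k)) differentiable (at y)" by (rule c(2))
qed

lemma partial_sq_dist:
  "partial b (\<lambda>y. (x - y) \<bullet> (x - y)) y = 2 * ((y - x) \<bullet> (b::'a::euclidean_space))"
  "(\<lambda>y. (x - y) \<bullet> (x - y)) differentiable (at y)"
proof -
  have d: "((\<lambda>y. (x - y) \<bullet> (x - y)) has_derivative (\<lambda>h. (x - y) \<bullet> (0 - h) + (0 - h) \<bullet> (x - y))) (at y)"
    by (intro derivative_intros)
  show "partial b (\<lambda>y. (x - y) \<bullet> (x - y)) y = 2 * ((y - x) \<bullet> b)"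
    using has_derivative_partial[OF d] by (simp add: inner_diff_left inner_diff_right inner_commute)
  show "(\<lambda>y. (x - y) \<bullet> (x - y)) differentiable (at y)" using d by (rule differentiableI)
qed

lemma partial_affine:
  "partial b (\<lambda>y. (y - x) \<bullet> c) y = (b::'a::euclidean_space) \<bullet> c"
  "(\<lambda>y. (y - x) \<bullet> c) differentiable (at y)"
proof -
  have d: "((\<lambda>y. (y - x) \<bullet> c) has_derivative (\<lambda>h. (h - 0) \<bullet> c)) (at y)"
    by (intro derivative_intros)
  show "partial b (\<lambda>y. (y - x) \<bullet> c) y = b \<bullet> c" using has_derivative_partial[OF d] by simp
  show "(\<lambda>y. (y - x) \<bullet> c) differentiable (at y)" using d by (rule differentiableI)
qed

lemma partial_cmult_real:
  fixes f :: "'a::euclidean_space \<Rightarrow> real"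
  assumes "f differentiable (at y)"
  shows "partial b (\<lambda>y. k * f y) y = k * partial b f y"
  using partial_compose_linear[OF bounded_linear_mult_right assms] .

text \<open>
  The expression behind both \<open>cdist\<close>, where \<open>A = 1 - |x|\<^sup>2\<close>, and the Poisson kernel, where \<open>|x| = 1\<close> and \<open>A = 1\<close>: the
  kernel is \<open>sq_quot 1 \<xi> x\<close> to the power \<open>1 - n\<close>. Keeping \<open>A\<close> free allows one computation for the two.
\<close>

definition sq_quot :: "real \<Rightarrow> 'a::euclidean_space \<Rightarrow> 'a \<Rightarrow> real" where
  "sq_quot A x y = ((x - y) \<bullet> (x - y)) / (A * (1 - y \<bullet> y))"

lemma sq_quot_partial_inverse:
  fixes x y :: "'a::euclidean_space"
  assumes y: "y \<in> ball 0 1"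
  shows "partial b (sq_quot A x) y = inverse A *
    (((x - y) \<bullet> (x - y)) * (2 * (y \<bullet> b) * inverse ((1 - y \<bullet> y) ^ 2)) + 2 * ((y - x) \<bullet> b) * inverse ((1 - y \<bullet> y) ^ 1))"
proof -
  note iv = partial_inverse_power_defect[OF y, of 1, simplified]
  have e: "sq_quot A x = (\<lambda>y. inverse A * (((x - y) \<bullet> (x - y)) * inverse (1 - y \<bullet> y)))"
    by (simp add: sq_quot_def[abs_def] divide_inverse mult_ac)
  have "partial b (sq_quot A x) y = inverse A * partial b (\<lambda>y. ((x - y) \<bullet> (x - y)) * inverse (1 - y \<bullet> y)) y"
    unfolding e by (intro partial_cmult_real differentiable_bilinear[OF bounded_bilinear_mult] partial_sq_dist iv)
  also have "partial b (\<lambda>y. ((x - y) \<bullet> (x - y)) * inverse (1 - y \<bullet> y)) y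
      = ((x - y) \<bullet> (x - y)) * partial b (\<lambda>y. inverse (1 - y \<bullet> y)) y + partial b (\<lambda>y. (x - y) \<bullet> (x - y)) y * inverse (1 - y \<bullet> y)"
    by (intro partial_mult partial_sq_dist iv)
  finally show ?thesis unfolding iv(1) partial_sq_dist(1) by (simp add: numeral_2_eq_2)
qed

lemma sq_quot_partial:
  fixes x y :: "'a::euclidean_space"
  assumes y: "y \<in> ball 0 1"
  shows "partial b (sq_quot A x) y = 2 * ((y - x) \<bullet> b) / (A * (1 - y \<bullet> y))
     + 2 * ((x - y) \<bullet> (x - y)) * (y \<bullet> b) / (A * (1 - y \<bullet> y)\<^sup>2)"
proof -
  have "inverse A * (P * (2 * v * inverse (r ^ 2)) + 2 * w * inverse (r ^ 1)) = 2 * w / (A * r) + 2 * P * v / (A * r\<^sup>2)"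
    for A P v w r :: real by (simp add: divide_inverse algebra_simps)
  then show ?thesis unfolding sq_quot_partial_inverse[OF y] .
qed

lemma sq_quot_partial2:
  fixes x y :: "'a::euclidean_space"
  assumes y: "y \<in> ball 0 1" and b: "b \<in> Basis"
  shows "partial b (partial b (sq_quot A x)) y =
     (2 / (1 - y \<bullet> y) + 8 * ((y - x) \<bullet> b) * (y \<bullet> b) / (1 - y \<bullet> y)\<^sup>2
     + 2 * ((x - y) \<bullet> (x - y)) / (1 - y \<bullet> y)\<^sup>2
     + 8 * ((x - y) \<bullet> (x - y)) * (y \<bullet> b)\<^sup>2 / (1 - y \<bullet> y) ^ 3) / A"
proof -
  let ?iA = "inverse A" and ?P = "\<lambda>y. (x - y) \<bullet> (x - y)" and ?i = "\<lambda>k y. inverse ((1 - y \<bullet> y) ^ k)"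
  note iv1 = partial_inverse_power_defect[OF y, of 1, simplified power_one_right]
  note iv2 = partial_inverse_power_defect[OF y, of 2]
  have c0: "partial b (\<lambda>y. y \<bullet> b) y = b \<bullet> b" "(\<lambda>y. y \<bullet> b) differentiable (at y)"
    using partial_affine[where x=0 and c=b] by simp_all
  have d2: "(\<lambda>y. (2 * (y \<bullet> b)) * ?i 2 y) differentiable (at y)"
    by (intro differentiable_bilinear[OF bounded_bilinear_mult] c0 iv2 differentiable_const) auto
  have d1: "(\<lambda>y. (2 * ((y - x) \<bullet> b)) * ?i 1 y) differentiable (at y)"
    by (rule differentiable_bilinear[OF bounded_bilinear_mult differentiable_bilinear[OF bounded_bilinear_mult differentiable_const partial_affine(2)]])
      (rule partial_inverse_power_defect(2)[OF y], simp)
  have e1: "partial b (\<lambda>y. (2 * (y \<bullet> b)) * ?i 2 y) y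
      = (2 * (y \<bullet> b)) * (2 * real 2 * (y \<bullet> b) * ?i (Suc 2) y) + (2 * (b \<bullet> b)) * ?i 2 y"
  proof -
    have "partial b (\<lambda>y. (2 * (y \<bullet> b)) * ?i 2 y) y = (2 * (y \<bullet> b)) * partial b (?i 2) y + partial b (\<lambda>y. 2 * (y \<bullet> b)) y * ?i 2 y"
      by (rule partial_mult) (auto intro!: differentiable_bilinear[OF bounded_bilinear_mult] c0 iv2)
    then show ?thesis using iv2(1) partial_cmult_real[OF c0(2), of b 2] c0(1) by simp
  qed
  have e2: "partial b (\<lambda>y. (2 * ((y - x) \<bullet> b)) * ?i 1 y) y
      = (2 * ((y - x) \<bullet> b)) * (2 * (y \<bullet> b) * ?i 2 y) + (2 * (b \<bullet> b)) * ?i 1 y"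
  proof -
    have "partial b (\<lambda>y. (2 * ((y - x) \<bullet> b)) * ?i 1 y) y = (2 * ((y - x) \<bullet> b)) * partial b (?i 1) y
        + partial b (\<lambda>y. 2 * ((y - x) \<bullet> b)) y * ?i 1 y"
      by (rule partial_mult)
        (use partial_inverse_power_defect[OF y, of 1] in \<open>auto intro!: differentiable_bilinear[OF bounded_bilinear_mult] partial_affine\<close>)
    then show ?thesis
      using partial_inverse_power_defect(1)[OF y, of 1 b]
      by (simp add: partial_cmult_real[OF partial_affine(2)] partial_affine(1) numeral_2_eq_2)
  qed
  have "partial b (partial b (sq_quot A x)) y = partial b (\<lambda>y. ?iA * (?P y * ((2 * (y \<bullet> b)) * ?i 2 y) + (2 * ((y - x) \<bullet> b)) * ?i 1 y)) y"
    by (rule partial_cong_open[OF open_ball y]) (simp only: sq_quot_partial_inverse)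
  also have "\<dots> = ?iA * partial b (\<lambda>y. ?P y * ((2 * (y \<bullet> b)) * ?i 2 y) + (2 * ((y - x) \<bullet> b)) * ?i 1 y) y"
    by (intro partial_cmult_real differentiable_add differentiable_bilinear[OF bounded_bilinear_mult] partial_sq_dist d2 d1)
  also have "partial b (\<lambda>y. ?P y * ((2 * (y \<bullet> b)) * ?i 2 y) + (2 * ((y - x) \<bullet> b)) * ?i 1 y) y
      = partial b (\<lambda>y. ?P y * ((2 * (y \<bullet> b)) * ?i 2 y)) y + partial b (\<lambda>y. (2 * ((y - x) \<bullet> b)) * ?i 1 y) y"
    by (intro partial_add differentiable_bilinear[OF bounded_bilinear_mult] partial_sq_dist d2 d1)
  also have "partial b (\<lambda>y. ?P y * ((2 * (y \<bullet> b)) * ?i 2 y)) y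
      = ?P y * partial b (\<lambda>y. (2 * (y \<bullet> b)) * ?i 2 y) y + partial b ?P y * ((2 * (y \<bullet> b)) * ?i 2 y)"
    by (intro partial_mult partial_sq_dist d2)
  finally have f: "partial b (partial b (sq_quot A x)) y = ?iA * (?P y * ((2 * (y \<bullet> b)) * (2 * real 2 * (y \<bullet> b) * ?i (Suc 2) y) + (2 * (b \<bullet> b)) * ?i 2 y)
      + 2 * ((y - x) \<bullet> b) * ((2 * (y \<bullet> b)) * ?i 2 y)
      + ((2 * ((y - x) \<bullet> b)) * (2 * (y \<bullet> b) * ?i 2 y) + (2 * (b \<bullet> b)) * ?i 1 y))"
    unfolding e1 e2 partial_sq_dist(1) .
  have alg: "inverse A * (P * ((2 * v) * (2 * real 2 * v * inverse (r ^ Suc 2)) + (2 * 1) * inverse (r ^ 2))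
      + 2 * w * ((2 * v) * inverse (r ^ 2)) + ((2 * w) * (2 * v * inverse (r ^ 2)) + (2 * 1) * inverse (r ^ 1)))
    = (2 / r + 8 * w * v / r\<^sup>2 + 2 * P / r\<^sup>2 + 8 * P * v\<^sup>2 / r ^ 3) / A" for A P v w r :: real
    by (simp add: divide_inverse algebra_simps power2_eq_square numeral_3_eq_3)
  have bb: "b \<bullet> b = 1" using b by simp
  show ?thesis unfolding f bb by (rule alg)
qed

lemma sq_quot_identities:
  fixes x y :: "'a::euclidean_space"
  assumes A: "A \<noteq> 0" and y: "y \<in> ball 0 1"
  shows "(1 - (norm y)\<^sup>2)\<^sup>2 * (\<Sum>b\<in>Basis. (partial b (sq_quot A x) y)\<^sup>2) = 4 * sq_quot A x y * ((1 - x \<bullet> x) / A + sq_quot A x y)"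
    and "hyp_laplacian (sq_quot A x) y = 2 * real DIM('a) * ((1 - x \<bullet> x) / A + 2 * sq_quot A x y)"
proof -
  define a where "a = 1 - x \<bullet> x"
  define r where "r = 1 - y \<bullet> y"
  define P where "P = (x - y) \<bullet> (x - y)"
  define q where "q = (y - x) \<bullet> y"
  have pos: "A \<noteq> 0" "r > 0" using A y by (auto simp: r_def norm_less_1_inner)
  have rel: "r + 2 * q - P = a"
    by (simp add: r_def q_def P_def a_def inner_diff_left inner_diff_right inner_commute)
  have yy: "y \<bullet> y = 1 - r" by (simp add: r_def)
  have c: "sq_quot A x y = P / (A * r)" by (simp add: sq_quot_def r_def P_def)
  have ny: "(norm y)\<^sup>2 = 1 - r" by (simp add: r_def power2_norm_eq_inner)
  have s1: "(\<Sum>b\<in>Basis. ((y - x) \<bullet> b)\<^sup>2) = P"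
    using euclidean_inner[of "y - x" "y - x"]
    by (simp add: P_def power2_eq_square inner_diff_left inner_diff_right inner_commute)
  have s2: "(\<Sum>b\<in>Basis. ((y - x) \<bullet> b) * (y \<bullet> b)) = q"
    using euclidean_inner[of "y - x" y] by (simp add: q_def)
  have s3: "(\<Sum>b\<in>Basis. (y \<bullet> b)\<^sup>2) = 1 - r"
    using euclidean_inner[of y y] yy by (simp add: power2_eq_square)
  have p1: "partial b (sq_quot A x) y = (2 * ((y - x) \<bullet> b) / r + 2 * P * (y \<bullet> b) / r\<^sup>2) / A" for b
    unfolding sq_quot_partial[OF y] r_def[symmetric] P_def[symmetric]
    using pos by (simp add: field_simps)
  have p2: "partial b (partial b (sq_quot A x)) y = (2 / r + 8 * (((y - x) \<bullet> b) * (y \<bullet> b)) / r\<^sup>2 + 2 * P / r\<^sup>2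
     + 8 * P * (y \<bullet> b)\<^sup>2 / r ^ 3) / A" if "b \<in> Basis" for b
    unfolding sq_quot_partial2[OF y that] r_def[symmetric] P_def[symmetric] by simp
  have "(\<Sum>b\<in>Basis. (partial b (sq_quot A x) y)\<^sup>2)
      = (\<Sum>b\<in>Basis. 4 / (r\<^sup>2 * A\<^sup>2) * ((y - x) \<bullet> b)\<^sup>2 + 8 * P / (r ^ 3 * A\<^sup>2) * (((y - x) \<bullet> b) * (y \<bullet> b))
         + 4 * P\<^sup>2 / (r ^ 4 * A\<^sup>2) * (y \<bullet> b)\<^sup>2)"
    unfolding p1 using pos
    by (intro sum.cong refl) (simp add: field_simps power2_eq_square power3_eq_cube power4_eq_xxxx)
  also have "\<dots> = 4 / (r\<^sup>2 * A\<^sup>2) * P + 8 * P / (r ^ 3 * A\<^sup>2) * q + 4 * P\<^sup>2 / (r ^ 4 * A\<^sup>2) * (1 - r)"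
    unfolding sum.distrib sum_distrib_left[symmetric] s1 s2 s3 ..
  finally have S: "(\<Sum>b\<in>Basis. (partial b (sq_quot A x) y)\<^sup>2) =
     4 / (r\<^sup>2 * A\<^sup>2) * P + 8 * P / (r ^ 3 * A\<^sup>2) * q + 4 * P\<^sup>2 / (r ^ 4 * A\<^sup>2) * (1 - r)" .
  show "(1 - (norm y)\<^sup>2)\<^sup>2 * (\<Sum>b\<in>Basis. (partial b (sq_quot A x) y)\<^sup>2) = 4 * sq_quot A x y * ((1 - x \<bullet> x) / A + sq_quot A x y)"
  proof -
    have "(1 - (norm y)\<^sup>2)\<^sup>2 * (\<Sum>b\<in>Basis. (partial b (sq_quot A x) y)\<^sup>2)
        = 4 * P * (r * (r + 2 * q - P) + P) / (r\<^sup>2 * A\<^sup>2)"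
      unfolding S ny using pos
      by (simp add: divide_simps) (simp add: algebra_simps eval_nat_numeral)
    also have "\<dots> = 4 * sq_quot A x y * ((1 - x \<bullet> x) / A + sq_quot A x y)"
      unfolding rel c a_def[symmetric] using pos by (simp add: divide_simps) (simp add: algebra_simps power2_eq_square)
    finally show ?thesis .
  qed
  have L: "laplacian (sq_quot A x) y = (2 * real DIM('a) / r + 8 * q / r\<^sup>2 + 2 * real DIM('a) * P / r\<^sup>2
      + 8 * P * (1 - r) / r ^ 3) / A"
  proof -
    have "laplacian (sq_quot A x) y = (\<Sum>b\<in>Basis. (2 / r / A + 2 * P / r\<^sup>2 / A) + 8 / r\<^sup>2 / A * (((y - x) \<bullet> b) * (y \<bullet> b))
     + 8 * P / r ^ 3 / A * (y \<bullet> b)\<^sup>2)"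
      unfolding laplacian_def by (intro sum.cong refl) (simp add: p2 add_divide_distrib)
    also have "\<dots> = real DIM('a) * (2 / r / A + 2 * P / r\<^sup>2 / A) + 8 / r\<^sup>2 / A * q + 8 * P / r ^ 3 / A * (1 - r)"
      unfolding sum.distrib sum_distrib_left[symmetric] s2 s3 by (simp add: algebra_simps)
    finally show ?thesis by (simp add: add_divide_distrib algebra_simps)
  qed
  have N: "normal_deriv (sq_quot A x) y = (2 * q / r + 2 * P * (1 - r) / r\<^sup>2) / A"
  proof -
    have "normal_deriv (sq_quot A x) y = (\<Sum>b\<in>Basis. 2 / r / A * (((y - x) \<bullet> b) * (y \<bullet> b)) + 2 * P / r\<^sup>2 / A * (y \<bullet> b)\<^sup>2)"
    proof -
      have "v * ((2 * w / r + 2 * P * v / r\<^sup>2) / A) = 2 / r / A * (w * v) + 2 * P / r\<^sup>2 / A * v\<^sup>2" for v w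
        by (simp add: add_divide_distrib algebra_simps power2_eq_square)
      then show ?thesis unfolding normal_deriv_def p1 real_scaleR_def by (intro sum.cong refl)
    qed
    also have "\<dots> = 2 / r / A * q + 2 * P / r\<^sup>2 / A * (1 - r)"
      unfolding sum.distrib sum_distrib_left[symmetric] s2 s3 ..
    finally show ?thesis by (simp add: add_divide_distrib)
  qed
  have "hyp_laplacian (sq_quot A x) y = 2 * real DIM('a) * (r * (r + 2 * q - P) + 2 * P) / (r * A)"
    unfolding hyp_laplacian_def L N ny using pos
    by (simp add: divide_simps) (simp add: algebra_simps eval_nat_numeral)
  also have "\<dots> = 2 * real DIM('a) * ((1 - x \<bullet> x) / A + 2 * sq_quot A x y)"
    unfolding rel c a_def[symmetric] using pos by (simp add: field_simps)
  finally show "hyp_laplacian (sq_quot A x) y = 2 * real DIM('a) * ((1 - x \<bullet> x) / A + 2 * sq_quot A x y)" .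
qed

text \<open>
  The hyperbolic Laplacian of a function of the distance reduces to an ordinary differential operator in the
  variable \<open>cdist\<close>, and these are its coefficients.
\<close>

lemma cdist_identities:
  fixes x y :: "'a::euclidean_space"
  assumes x: "x \<in> ball 0 1" and y: "y \<in> ball 0 1"
  shows "(1 - (norm y)\<^sup>2)\<^sup>2 * (\<Sum>b\<in>Basis. (partial b (cdist x) y)\<^sup>2) = 4 * cdist x y * (1 + cdist x y)"
    and "hyp_laplacian (cdist x) y = 2 * real DIM('a) * (1 + 2 * cdist x y)"
proof -
  have A: "1 - x \<bullet> x \<noteq> 0" using x ball_inner[of x] by simp
  have e: "cdist x = sq_quot (1 - x \<bullet> x) x" by (rule ext) (simp add: cdist_def sq_quot_def)
  show "(1 - (norm y)\<^sup>2)\<^sup>2 * (\<Sum>b\<in>Basis. (partial b (cdist x) y)\<^sup>2) = 4 * cdist x y * (1 + cdist x y)"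
    and "hyp_laplacian (cdist x) y = 2 * real DIM('a) * (1 + 2 * cdist x y)"
    using sq_quot_identities[OF A y] A unfolding e by simp_all
qed

lemma antiderivative_of_flat_start:
  fixes f :: "real \<Rightarrow> real"
  assumes f: "continuous_on UNIV f" and a: "a > 0" and z: "\<And>c. c \<le> a \<Longrightarrow> f c = 0"
  shows "((\<lambda>c. integral {0..c} f) has_real_derivative f c) (at c)"
proof (cases "c < a")
  case True
  have i0: "0 = integral {0..s} f" if "s \<in> {..<a}" for s
    using integral_cong[of "{0..s}" f "\<lambda>_. 0"] z that by simp
  have "((\<lambda>c. integral {0..c} f) has_real_derivative 0) (at c)"
    by (rule has_field_derivative_transform_within_open[OF DERIV_const open_lessThan _ i0])
      (use True in simp_all)
  then show ?thesis using z True by simp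
next
  case False
  then have c: "c > 0" "c < c + 1" using a by auto
  have "((\<lambda>c. integral {0..c} f) has_real_derivative f c) (at c within {0..c + 1})"
    by (rule integral_has_real_derivative[OF continuous_on_subset[OF f]]) (use c in auto)
  moreover have "at c within {0..c + 1} = at c" by (rule at_within_Icc_at) (use c in auto)
  ultimately show ?thesis by simp
qed

text \<open>
  The derivative of the radial function \<open>h\<close> for which \<open>D (h \<circ> cdist)\<close> equals a prescribed multiple of \<open>psi'\<close>: the
  radial operator is \<open>4 W^(1 - n/2) d/dc (W^(n/2) d/dc)\<close> with \<open>W = c (1 + c)\<close>, so one integration is explicit.
\<close>

definition hypint_h1 :: "nat \<Rightarrow> (real \<Rightarrow> real) \<Rightarrow> real \<Rightarrow> real" where
  "hypint_h1 n psi c = (c * (1 + c)) powr (- real n / 2) * psi c"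

definition hypint_h2 :: "nat \<Rightarrow> (real \<Rightarrow> real) \<Rightarrow> (real \<Rightarrow> real) \<Rightarrow> real \<Rightarrow> real" where
  "hypint_h2 n psi psi' c = (- real n / 2) * (1 + 2 * c) * (c * (1 + c)) powr (- real n / 2 - 1) * psi c
     + (c * (1 + c)) powr (- real n / 2) * psi' c"

lemma hypint_h1_derivative:
  assumes psi: "\<And>c. (psi has_real_derivative psi' c) (at c)" and a: "a > 0"
    and z: "\<And>c. c \<le> a \<Longrightarrow> psi c = 0" and z': "\<And>c. c \<le> a \<Longrightarrow> psi' c = 0"
  shows "(hypint_h1 n psi has_real_derivative hypint_h2 n psi psi' c) (at c)"
proof (cases "c < a")
  case True
  have "(hypint_h1 n psi has_real_derivative 0) (at c)"
    by (rule has_field_derivative_transform_within_open[where S="{..<a}" and f="\<lambda>_. 0"])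
      (use True z in \<open>auto simp: hypint_h1_def\<close>)
  then show ?thesis using True z z' by (simp add: hypint_h2_def)
next
  case False
  then have c: "c > 0" using a by simp
  then have w: "c * (1 + c) > 0" by simp
  have "((\<lambda>c. c * (1 + c)) has_real_derivative (1 + 2 * c)) (at c)"
    by (auto intro!: derivative_eq_intros)
  from DERIV_chain2[OF has_real_derivative_powr[OF w, of "- real n / 2"] this]
  have "((\<lambda>c. (c * (1 + c)) powr (- real n / 2)) has_real_derivative
      (- real n / 2) * (c * (1 + c)) powr (- real n / 2 - 1) * (1 + 2 * c)) (at c)" .
  from DERIV_mult[OF this psi]
  show ?thesis unfolding hypint_h1_def[abs_def] hypint_h2_def by (simp add: mult_ac)
qed

lemma hypint_combination:
  assumes "\<And>c. c \<le> 0 \<Longrightarrow> psi c = 0" "\<And>c. c \<le> 0 \<Longrightarrow> psi' c = 0"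
  shows "4 * c * (1 + c) * hypint_h2 n psi psi' c + 2 * real n * (1 + 2 * c) * hypint_h1 n psi c
    = 4 * (c * (1 + c)) powr (1 - real n / 2) * psi' c"
proof (cases "c > 0")
  case True
  define W where "W = c * (1 + c)"
  have W: "W > 0" using True by (simp add: W_def)
  have 1: "W * W powr (- real n / 2 - 1) = W powr (- real n / 2)"
    using W powr_mult_base[of W "- real n / 2 - 1"] by simp
  have 2: "W * W powr (- real n / 2) = W powr (1 - real n / 2)"
    using W powr_mult_base[of W "- real n / 2"] by simp
  have "4 * c * (1 + c) * hypint_h2 n psi psi' c + 2 * real n * (1 + 2 * c) * hypint_h1 n psi c
    = - (2 * real n * (1 + 2 * c) * psi c) * (W * W powr (- real n / 2 - 1)) + 4 * psi' c * (W * W powr (- real n / 2))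
      + 2 * real n * (1 + 2 * c) * psi c * W powr (- real n / 2)"
    unfolding hypint_h1_def hypint_h2_def W_def[symmetric]
    by (simp add: W_def algebra_simps)
  also have "\<dots> = 4 * W powr (1 - real n / 2) * psi' c" unfolding 1 2 by simp
  finally show ?thesis by (simp add: W_def)
qed (use assms in \<open>simp add: hypint_h1_def hypint_h2_def\<close>)

lemma cdist_ge_1_near_boundary:
  fixes x y :: "'a::euclidean_space"
  assumes x: "norm x \<le> R0" "R0 < 1" and y: "norm y < 1" "norm y > 1 - (1 - R0)\<^sup>2 / 8"
  shows "cdist x y \<ge> 1"
proof -
  define d where "d = 1 - R0"
  have d: "0 < d" "d \<le> 1" using x order_trans[OF norm_ge_zero x(1)] by (auto simp: d_def)
  have dd: "d\<^sup>2 \<le> d" using d by (simp add: power2_eq_square mult_left_le)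
  have ny: "norm y > 1 - d\<^sup>2 / 8" using y by (simp add: d_def)
  have "norm (x - y) \<ge> 7 / 8 * d"
    using norm_triangle_ineq2[of y x] x ny dd by (simp add: d_def norm_minus_commute)
  then have 1: "(norm (x - y))\<^sup>2 \<ge> (7 / 8 * d)\<^sup>2" using d by (intro power_mono) auto
  have 2: "(7 / 8 * d)\<^sup>2 \<ge> d\<^sup>2 / 4" by (simp add: power2_eq_square)
  have 3: "1 - y \<bullet> y \<le> d\<^sup>2 / 4"
  proof -
    have "1 - y \<bullet> y = (1 - norm y) * (1 + norm y)"
      by (simp add: algebra_simps power2_norm_eq_inner[symmetric] power2_eq_square)
    also have "\<dots> \<le> (d\<^sup>2 / 8) * 2" using y ny by (intro mult_mono) auto
    finally show ?thesis by simp
  qed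
  have xp: "0 < 1 - x \<bullet> x" "1 - x \<bullet> x \<le> 1" and yp: "0 < 1 - y \<bullet> y"
    using x y by (auto simp flip: norm_less_1_inner)
  have 4: "(1 - x \<bullet> x) * (1 - y \<bullet> y) \<le> 1 - y \<bullet> y" using mult_right_mono[OF xp(2), of "1 - y \<bullet> y"] yp by simp
  have "(1 - x \<bullet> x) * (1 - y \<bullet> y) \<le> (x - y) \<bullet> (x - y)"
    unfolding power2_norm_eq_inner[symmetric, of "x - y"] by (rule order_trans[OF 4 order_trans[OF 3 order_trans[OF 2 1]]])
  then show ?thesis using xp yp by (simp add: cdist_def)
qed

lemma continuous_on_local_zero:
  fixes f :: "real \<Rightarrow> real"
  assumes "a > 0" "\<And>c. c \<le> a \<Longrightarrow> f c = 0" "continuous_on {0<..} f"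
  shows "continuous_on UNIV f"
proof -
  have "continuous_on {..<a} f"
    by (rule continuous_on_eq[OF continuous_on_const[of _ 0]]) (use assms(2) in auto)
  then have "continuous_on ({..<a} \<union> {0<..}) f"
    using assms(3) by (intro continuous_on_open_Un) auto
  moreover have "{..<a} \<union> {0<..} = (UNIV :: real set)" using assms(1) by auto
  ultimately show ?thesis by simp
qed

section \<open>A mean value formula and interior regularity\<close>

text \<open>
  For \<open>k = n\<close> this is the hyperbolic volume density, with respect to which \<open>D\<close> is symmetric:
  \<open>(1 - |y|\<^sup>2)^(- n) D u\<close> is the divergence of \<open>(1 - |y|\<^sup>2)^(2 - n)\<close> times the gradient of \<open>u\<close>.
\<close>

definition wpow :: "nat \<Rightarrow> 'a::euclidean_space \<Rightarrow> real" where
  "wpow k y = inverse ((1 - y \<bullet> y) ^ k)"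

lemma wpow_facts:
  fixes y :: "'a::euclidean_space"
  assumes "y \<in> ball 0 1"
  shows "partial b (wpow k) y = 2 * real k * (y \<bullet> b) * wpow (Suc k) y"
    and "wpow k differentiable (at y)"
    and "wpow k y = wpow (Suc k) y * (1 - (norm y)\<^sup>2)"
proof -
  have e: "wpow k = (\<lambda>y::'a. inverse ((1 - y \<bullet> y) ^ k))" by (rule ext) (simp add: wpow_def)
  have "partial b (wpow k) y = 2 * real k * (y \<bullet> b) * wpow (Suc k) y \<and> wpow k differentiable (at y)"
  proof (cases "k = 0")
    case True
    then show ?thesis unfolding e by simp
  next
    case False
    then show ?thesis unfolding e using partial_inverse_power_defect(1)[OF assms, of k b] partial_inverse_power_defect(2)[OF assms, of k]
      by (simp add: wpow_def)
  qed
  then show "partial b (wpow k) y = 2 * real k * (y \<bullet> b) * wpow (Suc k) y" "wpow k differentiable (at y)" by auto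
  have "1 - y \<bullet> y \<noteq> 0" using assms by (auto simp: norm_less_1_inner)
  then show "wpow k y = wpow (Suc k) y * (1 - (norm y)\<^sup>2)"
    by (simp add: wpow_def power2_norm_eq_inner)
qed

lemma continuous_on_wpow: "continuous_on (ball 0 1) (wpow k)"
  unfolding wpow_def[abs_def]
  by (intro continuous_intros) (auto simp: norm_less_1_inner)

lemma Ck_on_2_facts:
  fixes u :: "'a::euclidean_space \<Rightarrow> complex"
  assumes "Ck_on 2 U u" "x \<in> U"
  shows "u differentiable (at x)" "b \<in> Basis \<Longrightarrow> partial b u differentiable (at x)"
    "continuous_on U u" "b \<in> Basis \<Longrightarrow> continuous_on U (partial b u)"
    "b \<in> Basis \<Longrightarrow> continuous_on U (partial b (partial b u))"
proof -
  have *: "(enat (length bs) < 2 \<longrightarrow> (\<forall>x\<in>U. foldr partial bs u differentiable (at x))) \<and>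
        (enat (length bs) \<le> 2 \<longrightarrow> continuous_on U (foldr partial bs u))" if "bs \<in> lists Basis" for bs
    using assms(1) that unfolding Ck_on_def by metis
  have l: "enat 0 < 2" "enat (Suc 0) < 2" "enat 0 \<le> 2" "enat (Suc 0) \<le> 2" "enat (Suc (Suc 0)) \<le> 2"
    by (simp_all add: numeral_eq_enat)
  show "u differentiable (at x)" "continuous_on U u" using *[of "[]"] assms(2) l by auto
  show "b \<in> Basis \<Longrightarrow> partial b u differentiable (at x)" "b \<in> Basis \<Longrightarrow> continuous_on U (partial b u)"
    using *[of "[b]"] assms(2) l by auto
  show "b \<in> Basis \<Longrightarrow> continuous_on U (partial b (partial b u))"
    using *[of "[b, b]"] l by auto
qed

lemma partial_of_real:
  fixes f :: "'a::euclidean_space \<Rightarrow> real"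
  assumes "f differentiable (at x)"
  shows "partial b (\<lambda>x. complex_of_real (f x)) x = complex_of_real (partial b f x)"
    and "(\<lambda>x. complex_of_real (f x)) differentiable (at x)"
proof -
  show "partial b (\<lambda>x. complex_of_real (f x)) x = complex_of_real (partial b f x)"
    by (rule partial_compose_linear[OF bounded_linear_of_real assms])
  obtain f' where "(f has_derivative f') (at x)" using assms unfolding differentiable_def by (elim exE)
  from bounded_linear.has_derivative[OF bounded_linear_of_real this]
  show "(\<lambda>x. complex_of_real (f x)) differentiable (at x)" by (rule differentiableI)
qed

lemma integral_cball_eq_lborel:
  fixes g :: "'a::euclidean_space \<Rightarrow> complex"
  assumes "\<And>x. x \<notin> cball 0 R \<Longrightarrow> g x = 0"
  shows "(LINT x|restrict_space lborel (cball 0 R). g x) = (LINT x|lborel. g x)"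
  using assms by (subst integral_restrict_space)
    (auto simp: indicator_def intro!: Bochner_Integration.integral_cong)

text \<open>
  Green's formula for \<open>u\<close> and the radial function \<open>h \<circ> cdist x\<close>, which has compact support and is constant near
  \<open>x\<close>. Hence the integral of \<open>u\<close> against a radial kernel about \<open>x\<close> depends on the total mass of the kernel only.
  The radius \<open>R1\<close> is chosen so that all kernels with \<open>|x| \<le> R0\<close> live in one ball.
\<close>

lemma green_against_cdist:
  fixes u :: "'a::euclidean_space \<Rightarrow> complex"
  assumes n: "DIM('a) \<ge> 2" and u: "Ck_on 2 (ball 0 1) u" and Du: "\<And>y. y \<in> ball 0 1 \<Longrightarrow> hyp_laplacian u y = 0"
    and x: "norm x \<le> R0" "R0 < 1" and R1: "R1 = 1 - (1 - R0)\<^sup>2 / 8"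
    and a: "a > 0" and psi: "\<And>c. (psi has_real_derivative psi' c) (at c)" and psi'c: "continuous_on UNIV psi'"
    and z: "\<And>c. c \<le> a \<or> 1 \<le> c \<Longrightarrow> psi c = 0" and z': "\<And>c. c \<le> a \<or> 1 \<le> c \<Longrightarrow> psi' c = 0"
  shows "(LINT y|restrict_space lborel (cball 0 R1). complex_of_real (wpow DIM('a) y) * u y *
    complex_of_real ((cdist x y * (1 + cdist x y)) powr (1 - real DIM('a) / 2) * psi' (cdist x y))) = 0"
proof -
  let ?n = "DIM('a)" and ?B = "ball 0 1 :: 'a set"
  let ?h1 = "hypint_h1 ?n psi" and ?h2 = "hypint_h2 ?n psi psi'"
  let ?M = "restrict_space lborel (cball 0 R1) :: 'a measure"
  have xB: "x \<in> ?B" using x by simp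
  have R1b: "R1 < 1" "0 < R1"
  proof -
    have "0 \<le> R0" using x order_trans[OF norm_ge_zero x(1)] by simp
    then have "(1 - R0)\<^sup>2 \<le> 1" "(1 - R0)\<^sup>2 > 0" using x by (auto simp: power_le_one)
    then show "R1 < 1" "0 < R1" unfolding R1 by auto
  qed
  have subB: "cball 0 R1 \<subseteq> ?B" using R1b by auto
  have h1: "(?h1 has_real_derivative ?h2 c) (at c)" for c
    by (rule hypint_h1_derivative[OF psi a]) (use z z' in auto)
  have h1z: "?h1 c = 0" if "c \<le> a \<or> 1 \<le> c" for c using z[OF that] by (simp add: hypint_h1_def)
  have h1c: "continuous_on UNIV ?h1"
    using h1 by (meson DERIV_isCont continuous_at_imp_continuous_on)
  have psic: "continuous_on UNIV psi"
    using psi by (meson DERIV_isCont continuous_at_imp_continuous_on)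
  have h2c: "continuous_on UNIV ?h2"
  proof (rule continuous_on_local_zero[OF a])
    show "?h2 c = 0" if "c \<le> a" for c using that z z' by (simp add: hypint_h2_def)
    show "continuous_on {0<..} ?h2"
      unfolding hypint_h2_def[abs_def]
      by (intro continuous_intros continuous_on_subset[OF psic] continuous_on_subset[OF psi'c]) auto
  qed
  (* the constant makes h vanish for c >= 1, that is, away from x *)
  define h where "h c = integral {0..c} ?h1 - integral {0..1} ?h1" for c
  have h: "(h has_real_derivative ?h1 c) (at c)" for c
    unfolding h_def[abs_def]
    using DERIV_diff[OF antiderivative_of_flat_start[OF h1c a] DERIV_const[of "integral {0..1} ?h1"]] h1z by simp
  have hz: "h c = 0" if "1 \<le> c" for c
  proof -
    have "integral {0..1} ?h1 + integral {1..c} ?h1 = integral {0..c} ?h1"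
      by (rule Henstock_Kurzweil_Integration.integral_combine)
        (use that in \<open>auto intro!: integrable_continuous_real continuous_on_subset[OF h1c]\<close>)
    moreover have "integral {1..c} ?h1 = integral {1..c} (\<lambda>_. 0)" using h1z by (intro integral_cong) auto
    ultimately show ?thesis by (simp add: h_def)
  qed
  let ?w = "cdist x"
  have ws: "smooth_on ?B ?w" by (rule smooth_on_cdist[OF xB])
  let ?v = "\<lambda>y. h (?w y)"
  note v2 = second_partial_compose_real[OF open_ball _ ws _ h h1]
  have vd: "?v differentiable (at y)" "partial b ?v y = ?h1 (?w y) * partial b ?w y" if "y \<in> ?B" for y b
    using partial_compose_real[OF h smooth_on_differentiable[OF ws that]] by auto
  let ?V = "{y::'a. norm y > R1}"
  have oV: "open ?V" by (intro open_Collect_less continuous_intros)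
  have wV: "?w y \<ge> 1" if "y \<in> ?V" "y \<in> ?B" for y
    using cdist_ge_1_near_boundary[OF x, of y] that R1 by simp
  have vV: "?v y = 0" "partial b ?v y = 0" if "y \<in> ?V" "y \<in> ?B" for y b
    using hz wV[OF that] h1z vd(2)[OF that(2)] by auto
  define e where "e b y = complex_of_real (wpow (?n - 2) y) *
     (u y * complex_of_real (partial b ?v y) - complex_of_real (?v y) * partial b u y)" for b y
  define e' where "e' b y = complex_of_real (wpow (?n - 2) y) *
       (u y * complex_of_real (partial b (partial b ?v) y) - complex_of_real (?v y) * partial b (partial b u) y)
     + complex_of_real (2 * real (?n - 2) * (y \<bullet> b) * wpow (Suc (?n - 2)) y) *
       (u y * complex_of_real (partial b ?v y) - complex_of_real (?v y) * partial b u y)" for b y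
  have ed: "e b differentiable (at y)" "partial b (e b) y = e' b y" if y: "y \<in> ?B" and b: "b \<in> Basis" for b y
  proof -
    note uf = Ck_on_2_facts[OF u y]
    note d1 = partial_of_real[OF wpow_facts(2)[OF y, of "?n - 2"]]
    note d2 = partial_of_real[OF v2(2)[OF y b]]
    note d3 = partial_of_real[OF vd(1)[OF y]]
    note dm = differentiable_bilinear[OF bounded_bilinear_mult]
    have d4: "(\<lambda>y. u y * complex_of_real (partial b ?v y) - complex_of_real (?v y) * partial b u y) differentiable (at y)"
      by (intro differentiable_diff dm uf d2 d3 b)
    show "e b differentiable (at y)" unfolding e_def[abs_def] by (rule dm[OF d1(2) d4])
    have p4: "partial b (\<lambda>y. u y * complex_of_real (partial b ?v y) - complex_of_real (?v y) * partial b u y) y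
      = (u y * complex_of_real (partial b (partial b ?v) y) + partial b u y * complex_of_real (partial b ?v y))
       - (complex_of_real (?v y) * partial b (partial b u) y + complex_of_real (partial b ?v y) * partial b u y)"
      using partial_diff[OF dm[OF uf(1) d2(2)] dm[OF d3(2) uf(2)[OF b]], of b]
        partial_mult[OF uf(1) d2(2), of b] partial_mult[OF d3(2) uf(2)[OF b], of b] d2(1)[of b] d3(1)[of b] by simp
    show "partial b (e b) y = e' b y"
      unfolding e_def[abs_def] e'_def partial_mult[OF d1(2) d4, of b] d1(1) wpow_facts(1)[OF y] p4
      by (simp add: algebra_simps)
  qed
  have uc: "continuous_on ?B u" "continuous_on ?B (partial b u)" "continuous_on ?B (partial b (partial b u))"
    if "b \<in> Basis" for b
    using Ck_on_2_facts[OF u, of 0] that by auto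
  have wc: "continuous_on ?B ?w" "continuous_on ?B (partial b ?w)" "continuous_on ?B (partial b (partial b ?w))"
    if "b \<in> Basis" for b
    using smooth_on_continuous[OF ws] smooth_on_continuous[OF smooth_on_partial[OF ws that]]
      smooth_on_continuous[OF smooth_on_partial[OF smooth_on_partial[OF ws that] that]] by auto
  have vc: "continuous_on ?B ?v" "continuous_on ?B (partial b ?v)" "continuous_on ?B (partial b (partial b ?v))"
    if b: "b \<in> Basis" for b
  proof -
    have hc: "continuous_on UNIV h" using h by (meson DERIV_isCont continuous_at_imp_continuous_on)
    have cc: "continuous_on ?B (\<lambda>y. g (?w y))" if "continuous_on UNIV g" for g :: "real \<Rightarrow> real"
      by (rule continuous_on_compose2[OF that wc(1)[OF b]]) auto
    show "continuous_on ?B ?v" by (rule cc[OF hc])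
    show "continuous_on ?B (partial b ?v)"
      by (rule continuous_on_eq[where f="\<lambda>y. ?h1 (?w y) * partial b ?w y"])
        (use vd(2) in \<open>auto intro!: continuous_intros cc[OF h1c] wc b\<close>)
    show "continuous_on ?B (partial b (partial b ?v))"
      by (rule continuous_on_eq[where f="\<lambda>y. ?h2 (?w y) * (partial b ?w y)\<^sup>2 + ?h1 (?w y) * partial b (partial b ?w) y"])
        (use v2(1)[OF _ b] in \<open>auto intro!: continuous_intros cc[OF h1c] cc[OF h2c] wc b\<close>)
  qed
  have e'c: "continuous_on ?B (e' b)" if "b \<in> Basis" for b
    unfolding e'_def[abs_def]
    by (intro continuous_intros uc[OF that] vc[OF that] continuous_on_wpow)
  define f where "f b y = (if y \<in> ?B then e b y else 0)" for b y
  have fV: "f b y = 0" if "y \<in> ?V" for b y using that vV by (simp add: f_def e_def)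
  have fB: "f b y = e b y" if "y \<in> ?B" for b y using that by (simp add: f_def)
  have cover: "y \<in> ?B \<or> y \<in> ?V" for y using R1b by auto
  have fd: "f b differentiable (at y)" if b: "b \<in> Basis" for b y
    using cover[of y]
  proof
    assume y: "y \<in> ?B"
    show ?thesis by (rule differentiable_cong_open[OF open_ball y fB[symmetric] ed(1)[OF y b]])
  next
    assume y: "y \<in> ?V"
    show ?thesis by (rule differentiable_cong_open[OF oV y fV[symmetric] differentiable_const])
  qed
  have fp: "partial b (f b) y = e' b y" if "y \<in> ?B" "b \<in> Basis" for b y
  proof -
    have "partial b (f b) y = partial b (e b) y" by (rule partial_cong_open[OF open_ball that(1)]) (rule fB)
    then show ?thesis using ed(2)[OF that] by simp
  qed
  have fpV: "partial b (f b) y = 0" if "y \<in> ?V" for b y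
  proof -
    have "partial b (f b) y = partial b (\<lambda>_. 0) y" by (rule partial_cong_open[OF oV that]) (rule fV)
    then show ?thesis by simp
  qed
  have fc: "continuous_on UNIV (partial b (f b))" if b: "b \<in> Basis" for b
  proof -
    have "continuous_on ?B (partial b (f b))"
      by (rule continuous_on_eq[OF e'c[OF b]]) (use fp b in auto)
    moreover have "continuous_on ?V (partial b (f b))"
      by (rule continuous_on_eq[OF continuous_on_const[of _ 0]]) (use fpV in auto)
    ultimately have "continuous_on (?B \<union> ?V) (partial b (f b))" by (intro continuous_on_open_Un oV open_ball)
    moreover have "?B \<union> ?V = UNIV" using R1b by auto
    ultimately show ?thesis by simp
  qed
  have M: "compact_measure ?M (cball 0 R1)" by (rule compact_measure_lborel) simp
  have spM: "space ?M = cball 0 R1" using M by (simp add: compact_measure_def)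
  have e'int: "integrable ?M (e' b)" if "b \<in> Basis" for b
    by (rule compact_measure_integrable[OF M continuous_on_subset[OF e'c[OF that] subB]])
  have e'0: "(LINT y|?M. e' b y) = 0" if b: "b \<in> Basis" for b
  proof -
    have "(LINT y|?M. e' b y) = (LINT y|?M. partial b (f b) y)"
      by (rule Bochner_Integration.integral_cong) (use fp b subB spM in auto)
    also have "\<dots> = (LINT y|lborel. partial b (f b) y)"
      by (rule integral_cball_eq_lborel) (use fpV in auto)
    also have "\<dots> = 0" by (rule integral_partial_eq_0[OF fd[OF b] fc[OF b] fV b]) auto
    finally show ?thesis .
  qed
  let ?k = "\<lambda>y. (?w y * (1 + ?w y)) powr (1 - real ?n / 2) * psi' (?w y)"
  have sum: "(\<Sum>b\<in>Basis. e' b y) = 4 *\<^sub>R (complex_of_real (wpow ?n y) * u y * complex_of_real (?k y))" if y: "y \<in> ?B" for y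
  proof -
    let ?i = "complex_of_real (wpow ?n y)" and ?r = "complex_of_real (1 - (norm y)\<^sup>2)"
    have n2: "Suc (?n - 2) = ?n - 1" "Suc (?n - 1) = ?n" using n by auto
    have i1: "complex_of_real (wpow (?n - 1) y) = ?i * ?r"
      using wpow_facts(3)[OF y, of "?n - 1"] n2 by simp
    have i2: "complex_of_real (wpow (?n - 2) y) = ?i * ?r\<^sup>2"
      using wpow_facts(3)[OF y, of "?n - 2"] n2 i1 by (simp add: power2_eq_square)
    have Dv: "hyp_laplacian ?v y = 4 * ?k y"
    proof -
      have "hyp_laplacian ?v y = ?h2 (?w y) * (4 * ?w y * (1 + ?w y)) + ?h1 (?w y) * (2 * real ?n * (1 + 2 * ?w y))"
        unfolding hyp_laplacian_compose_real[OF open_ball y ws h h1] cdist_identities[OF xB y] ..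
      also have "\<dots> = 4 * ?w y * (1 + ?w y) * ?h2 (?w y) + 2 * real ?n * (1 + 2 * ?w y) * ?h1 (?w y)" by (simp add: mult_ac)
      also have "\<dots> = 4 * (?w y * (1 + ?w y)) powr (1 - real ?n / 2) * psi' (?w y)"
        by (rule hypint_combination) (use a z z' in auto)
      finally show ?thesis by simp
    qed
    have "(\<Sum>b\<in>Basis. e' b y) = ?i * (u y * complex_of_real (hyp_laplacian ?v y) - complex_of_real (?v y) * hyp_laplacian u y)"
    proof -
      have alg: "(\<Sum>b\<in>S. i * (w * (r * A b + k * B b) - v * (r * C b + k * D b)))
        = i * (w * (r * (\<Sum>b\<in>S. A b) + k * (\<Sum>b\<in>S. B b)) - v * (r * (\<Sum>b\<in>S. C b) + k * (\<Sum>b\<in>S. D b)))"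
        for i w r k v :: complex and A B C D and S :: "'a set"
        by (simp only: sum_distrib_left[symmetric] sum_subtractf sum.distrib)
      have eq: "e' b y = ?i * (u y * (?r\<^sup>2 * complex_of_real (partial b (partial b ?v) y) + 2 * complex_of_real (real (?n - 2)) * ?r * (complex_of_real (y \<bullet> b) * complex_of_real (partial b ?v y)))
        - complex_of_real (?v y) * (?r\<^sup>2 * partial b (partial b u) y + 2 * complex_of_real (real (?n - 2)) * ?r * (complex_of_real (y \<bullet> b) * partial b u y)))" for b
        unfolding e'_def n2 of_real_mult i1 i2 by (simp add: algebra_simps)
      have "(\<Sum>b\<in>Basis. e' b y) = ?i * (u y * (?r\<^sup>2 * (\<Sum>b\<in>Basis. complex_of_real (partial b (partial b ?v) y)) + 2 * complex_of_real (real (?n - 2)) * ?r * (\<Sum>b\<in>Basis. complex_of_real (y \<bullet> b) * complex_of_real (partial b ?v y)))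
        - complex_of_real (?v y) * (?r\<^sup>2 * (\<Sum>b\<in>Basis. partial b (partial b u) y) + 2 * complex_of_real (real (?n - 2)) * ?r * (\<Sum>b\<in>Basis. complex_of_real (y \<bullet> b) * partial b u y)))"
        unfolding eq by (rule alg)
      moreover have "real (?n - 2) = real ?n - 2" using n by simp
      ultimately show ?thesis
        by (simp add: hyp_laplacian_def laplacian_def normal_deriv_def scaleR_conv_of_real mult_ac)
    qed
    then show ?thesis unfolding Du[OF y] Dv by (simp add: scaleR_conv_of_real mult_ac)
  qed
  have "0 = (\<Sum>b\<in>Basis. (LINT y|?M. e' b y))" using e'0 by simp
  also have "\<dots> = (LINT y|?M. (\<Sum>b\<in>Basis. e' b y))"
    by (rule Bochner_Integration.integral_sum[symmetric]) (rule e'int)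
  also have "\<dots> = (LINT y|?M. 4 *\<^sub>R (complex_of_real (wpow ?n y) * u y * complex_of_real (?k y)))"
    by (rule Bochner_Integration.integral_cong[OF refl], rule sum) (use subB spM in auto)
  also have "\<dots> = 4 *\<^sub>R (LINT y|?M. complex_of_real (wpow ?n y) * u y * complex_of_real (?k y))"
    by (rule Bochner_Integration.integral_scaleR_right)
  finally show ?thesis by simp
qed

definition bump :: "real \<Rightarrow> real" where "bump c = flat (c - 1/2) * flat (1 - c)"

lemma bump_facts: "0 \<le> bump c" "c \<le> 1/2 \<or> 1 \<le> c \<Longrightarrow> bump c = 0" "1/2 < c \<Longrightarrow> c < 1 \<Longrightarrow> 0 < bump c"
  by (auto simp: bump_def flat_nonneg flat_eq_0 flat_pos)

lemma smooth_on_bump: "smooth_on UNIV bump"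
  unfolding bump_def[abs_def]
  by (intro smooth_on_mult smooth_on_compose_real[OF _ _ smooth_on_flat] smooth_on_diff smooth_on_const
      smooth_on_linear bounded_linear_ident) auto

lemma continuous_on_bump: "continuous_on UNIV bump"
  by (rule smooth_on_continuous[OF smooth_on_bump])

text \<open>
  A smooth radial kernel, supported in \<open>1/2 \<le> cdist \<le> 1\<close>, away from the singularity of the power.
\<close>

definition mollifier :: "nat \<Rightarrow> real \<Rightarrow> real" where
  "mollifier n c = (c * (1 + c)) powr (1 - real n / 2) * bump c"

lemma smooth_on_mollifier: "smooth_on UNIV (mollifier n)"
proof -
  have pos: "smooth_on {0<..} (mollifier n)"
    unfolding mollifier_def[abs_def]
    by (intro smooth_on_mult smooth_on_compose_real[OF _ _ smooth_on_powr] smooth_on_add smooth_on_const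
        smooth_on_linear bounded_linear_ident smooth_on_subset[OF smooth_on_bump]) auto
  have "smooth_on {..<1/2} (mollifier n)"
    by (rule smooth_on_cong[OF _ _ smooth_on_const[of _ 0]]) (auto simp: mollifier_def bump_facts)
  then have "smooth_on ({..<1/2} \<union> {0<..}) (mollifier n)" using pos by (rule smooth_on_Un)
  moreover have "{..<1/2} \<union> {0<..} = (UNIV :: real set)" by auto
  ultimately show ?thesis by simp
qed

lemma mollifier_facts: "0 \<le> mollifier n c" "c \<le> 1/2 \<or> 1 \<le> c \<Longrightarrow> mollifier n c = 0"
  "1/2 < c \<Longrightarrow> c < 1 \<Longrightarrow> 0 < mollifier n c"
  using bump_facts[of c] by (auto simp: mollifier_def intro!: mult_nonneg_nonneg mult_pos_pos)

definition bump_integral :: "real \<Rightarrow> real" where "bump_integral c = integral {0..c} bump"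

lemma bump_integral_facts: "(bump_integral has_real_derivative bump c) (at c)"
  "c \<le> 1/2 \<Longrightarrow> bump_integral c = 0" "1 \<le> c \<Longrightarrow> bump_integral c = bump_integral 1"
proof -
  show "(bump_integral has_real_derivative bump c) (at c)"
    unfolding bump_integral_def[abs_def]
    by (rule antiderivative_of_flat_start[OF continuous_on_bump, of "1/2"]) (auto simp: bump_facts)
  show "bump_integral c = 0" if "c \<le> 1/2"
    unfolding bump_integral_def using integral_cong[of "{0..c}" bump "\<lambda>_. 0"] that by (simp add: bump_facts)
  show "bump_integral c = bump_integral 1" if "1 \<le> c"
  proof -
    have "integral {0..1} bump + integral {1..c} bump = integral {0..c} bump"
      by (rule Henstock_Kurzweil_Integration.integral_combine)
        (use that in \<open>auto intro!: integrable_continuous_real continuous_on_subset[OF continuous_on_bump]\<close>)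
    moreover have "integral {1..c} bump = integral {1..c} (\<lambda>_. 0)"
      using bump_facts(2) by (intro integral_cong) auto
    ultimately show ?thesis by (simp add: bump_integral_def)
  qed
qed

text \<open>
  The mean of \<open>u\<close> over kernels \<open>bump (cdist x y / e)\<close> does not depend on \<open>e\<close>. As \<open>e \<rightarrow> 0\<close> it tends to \<open>u x\<close>, by
  continuity; for \<open>e = 1\<close> it is an integral of a kernel that is smooth in \<open>x\<close>.
\<close>

theorem H_harmonic_imp_smooth:
  fixes u :: "'a::euclidean_space \<Rightarrow> complex"
  assumes n: "DIM('a) \<ge> 2" and H: "H_harmonic u"
  shows "smooth_on (ball 0 1) u"
proof -
  let ?n = "DIM('a)"
  have u: "Ck_on 2 (ball 0 1) u" and Du: "\<And>y. y \<in> ball 0 1 \<Longrightarrow> hyp_laplacian u y = 0"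
    using H by (auto simp: H_harmonic_def)
  have uc: "continuous_on (ball 0 1) u" using Ck_on_2_facts(3)[OF u, of 0] by simp
  have local: "smooth_on (ball 0 R0) u" if R0: "0 < R0" "R0 < 1" for R0
  proof -
    define R1 where "R1 = 1 - (1 - R0)\<^sup>2 / 8"
    have R1b: "R1 < 1" "0 < R1"
    proof -
      have "(1 - R0)\<^sup>2 \<le> 1" "(1 - R0)\<^sup>2 > 0" using R0 by (auto simp: power_le_one)
      then show "R1 < 1" "0 < R1" unfolding R1_def by auto
    qed
    let ?K = "cball 0 R1 :: 'a set" and ?M = "restrict_space lborel (cball 0 R1) :: 'a measure"
    have subB: "?K \<subseteq> ball 0 1" using R1b by auto
    have M: "compact_measure ?M ?K" by (rule compact_measure_lborel) simp
    have spM: "space ?M = ?K" using M by (simp add: compact_measure_def)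
    define J where "J e v x = (LINT y|?M. complex_of_real (wpow ?n y) * v y *
      complex_of_real ((cdist x y * (1 + cdist x y)) powr (1 - real ?n / 2) * (inverse e * bump (cdist x y / e))))"
      for e :: real and v :: "'a \<Rightarrow> complex" and x
    have wc: "continuous_on ?K (wpow ?n)" by (rule continuous_on_subset[OF continuous_on_wpow subB])
    have kc: "continuous_on ?K (\<lambda>y. (cdist x y * (1 + cdist x y)) powr (1 - real ?n / 2) * (inverse e * bump (cdist x y / e)))"
      if x: "x \<in> ball 0 1" and e: "e > 0" for x e
    proof -
      let ?g = "\<lambda>c. (c * (1 + c)) powr (1 - real ?n / 2) * (inverse e * bump (c / e))"
      have "continuous_on UNIV ?g"
      proof (rule continuous_on_local_zero[of "e/2"])
        show "?g c = 0" if "c \<le> e/2" for c using that e by (simp add: bump_facts field_simps)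
        have "continuous_on {0<..} (\<lambda>c. bump (c / e))"
          by (rule continuous_on_compose2[OF continuous_on_bump]) (use e in \<open>auto intro!: continuous_intros\<close>)
        then show "continuous_on {0<..} ?g" by (intro continuous_intros) auto
      qed (use e in simp)
      then show ?thesis
        by (rule continuous_on_compose2[OF _ continuous_on_subset[OF smooth_on_continuous[OF smooth_on_cdist[OF x]] subB]]) simp
    qed
    have int: "integrable ?M (\<lambda>y. complex_of_real (wpow ?n y) * v y *
      complex_of_real ((cdist x y * (1 + cdist x y)) powr (1 - real ?n / 2) * (inverse e * bump (cdist x y / e))))"
      if "x \<in> ball 0 1" "e > 0" "continuous_on (ball 0 1) v" for x e v
      by (intro compact_measure_integrable[OF M] continuous_on_mult continuous_on_of_real wc kc that
          continuous_on_subset[OF that(3) subB])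
    have J_eq: "J e v x = J 1 v x"
      if x: "norm x \<le> R0" and e: "0 < e" "e \<le> 1" and v: "Ck_on 2 (ball 0 1) v"
        and Dv: "\<And>y. y \<in> ball 0 1 \<Longrightarrow> hyp_laplacian v y = 0" for x e v
    proof -
      have xB: "x \<in> ball 0 1" using x R0 by simp
      have vc: "continuous_on (ball 0 1) v" using Ck_on_2_facts(3)[OF v, of 0] by simp
      (* the two kernels have the same mass, so that the difference of their primitives has compact support *)
      let ?psi = "\<lambda>c. bump_integral (c / e) - bump_integral c"
      let ?psi' = "\<lambda>c. inverse e * bump (c / e) - bump c"
      have d: "(?psi has_real_derivative ?psi' c) (at c)" for c
      proof -
        have "((\<lambda>c. c / e) has_real_derivative inverse e) (at c)"
          using e by (auto intro!: derivative_eq_intros simp: divide_inverse)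
        from DERIV_diff[OF DERIV_chain2[OF bump_integral_facts(1) this] bump_integral_facts(1)]
        show ?thesis by (simp add: mult.commute)
      qed
      have c': "continuous_on UNIV ?psi'"
        by (intro continuous_intros continuous_on_bump continuous_on_compose2[OF continuous_on_bump]) (use e in auto)
      have z: "?psi c = 0" if "c \<le> e/2 \<or> 1 \<le> c" for c
      proof (cases "c \<le> e/2")
        case True
        then have "c / e \<le> 1/2" "c \<le> 1/2" using e by (auto simp: field_simps)
        then show ?thesis using bump_integral_facts(2) by simp
      next
        case False
        then have "1 \<le> c / e" "1 \<le> c" using e that by (auto simp: field_simps)
        then show ?thesis using bump_integral_facts(3)[of c] bump_integral_facts(3)[of "c / e"] by simp
      qed
      have z': "?psi' c = 0" if "c \<le> e/2 \<or> 1 \<le> c" for c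
      proof (cases "c \<le> e/2")
        case True
        then have "c / e \<le> 1/2" "c \<le> 1/2" using e by (auto simp: field_simps)
        then show ?thesis using bump_facts(2) by simp
      next
        case False
        then have "1 \<le> c / e" "1 \<le> c" using e that by (auto simp: field_simps)
        then show ?thesis using bump_facts(2) by simp
      qed
      have e2: "e / 2 > 0" using e by simp
      have "0 = (LINT y|?M. complex_of_real (wpow ?n y) * v y *
          complex_of_real ((cdist x y * (1 + cdist x y)) powr (1 - real ?n / 2) * ?psi' (cdist x y)))"
        using green_against_cdist[OF n v Dv x R0(2) R1_def e2 d c' z z'] by simp
      also have "\<dots> = J e v x - J 1 v x"
        unfolding J_def
        by (subst Bochner_Integration.integral_diff[symmetric, OF int[OF xB e(1) vc] int[OF xB zero_less_one vc]])
          (simp add: algebra_simps)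
      finally show ?thesis by simp
    qed
    have one: "Ck_on 2 (ball 0 1) (\<lambda>_::'a. 1::complex)" "hyp_laplacian (\<lambda>_::'a. 1::complex) y = 0" for y
    proof -
      have "foldr partial bs (\<lambda>_::'a. 1::complex) = (\<lambda>_. if bs = [] then 1 else 0)" for bs
        by (induction bs) auto
      then show "Ck_on 2 (ball 0 1) (\<lambda>_::'a. 1::complex)" unfolding Ck_on_def by auto
      show "hyp_laplacian (\<lambda>_::'a. 1::complex) y = 0"
        by (simp add: hyp_laplacian_def laplacian_def normal_deriv_def)
    qed
    define Z where "Z x = (LINT y|?M. wpow ?n y * mollifier ?n (cdist x y))" for x
    have wpos: "wpow ?n y > 0" if "y \<in> ball 0 1" for y :: 'a
      using that by (simp add: wpow_def norm_less_1_inner)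
    have JZ: "J 1 (\<lambda>_. 1) x = complex_of_real (Z x)" for x
      unfolding J_def Z_def by (simp add: mollifier_def flip: of_real_mult integral_complex_of_real)
    have Zpos: "Z x > 0" if x: "norm x < R0" for x
    proof -
      have xB: "x \<in> ball 0 1" using x R0 by simp
      have cc: "continuous_on (ball 0 1) (cdist x)" by (rule smooth_on_continuous[OF smooth_on_cdist[OF xB]])
      let ?A = "{y \<in> ball 0 1. 1/2 < cdist x y \<and> cdist x y < 1}"
      have "open (cdist x -` {1/2<..<1} \<inter> ball 0 1)"
        by (rule continuous_on_open_vimage[THEN iffD1, rule_format, OF _ cc]) auto
      moreover have "cdist x -` {1/2<..<1} \<inter> ball 0 1 = ?A" by auto
      ultimately have oA: "open ?A" by simp
      have neA: "?A \<noteq> {}"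
      proof -
        obtain b :: 'a where b: "b \<in> Basis" using nonempty_Basis by blast
        define y1 where "y1 = ((1 + R1) / 2) *\<^sub>R b"
        have y1: "norm y1 < 1" "norm y1 > R1" using b R1b by (auto simp: y1_def)
        have "cdist x y1 \<ge> 1"
          by (rule cdist_ge_1_near_boundary[of x R0]) (use x y1 R0 R1_def in auto)
        moreover have "cdist x x = 0" by (simp add: cdist_def)
        moreover have "connected (cdist x ` ball 0 1)"
          by (rule connected_continuous_image[OF cc]) simp
        ultimately have "3/4 \<in> cdist x ` ball 0 1"
          using connected_contains_Icc[of "cdist x ` ball 0 1" "cdist x x" "cdist x y1"] xB y1 by auto
        then obtain y where "y \<in> ball 0 1" "cdist x y = 3/4" by (metis imageE)
        then have "y \<in> ?A" by simp
        then show ?thesis by blast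
      qed
      have AK: "?A \<subseteq> ?K"
        using cdist_ge_1_near_boundary[of x R0] x R0 R1_def by force
      have rc: "continuous_on ?K (\<lambda>y. wpow ?n y * mollifier ?n (cdist x y))"
        by (intro continuous_on_mult wc continuous_on_compose2[OF smooth_on_continuous[OF smooth_on_mollifier] continuous_on_subset[OF cc subB]]) auto
      have "integrable ?M (\<lambda>y. complex_of_real (wpow ?n y * mollifier ?n (cdist x y)))"
        by (intro compact_measure_integrable[OF M] continuous_on_of_real rc)
      then have ri: "integrable ?M (\<lambda>y. wpow ?n y * mollifier ?n (cdist x y))"
        by (simp only: complex_of_real_integrable_eq)
      have nn: "AE y in ?M. 0 \<le> wpow ?n y * mollifier ?n (cdist x y)"
        using subB spM wpos by (intro AE_I2 mult_nonneg_nonneg mollifier_facts less_imp_le) auto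
      have "Z x \<noteq> 0"
      proof
        assume "Z x = 0"
        then have "AE y in ?M. wpow ?n y * mollifier ?n (cdist x y) = 0"
          using integral_nonneg_eq_0_iff_AE[OF ri nn] by (simp add: Z_def)
        then have "AE y in lborel. y \<in> ?K \<longrightarrow> wpow ?n y * mollifier ?n (cdist x y) = 0"
          by (simp add: AE_restrict_space_iff)
        then have AE: "AE y in lborel. \<not> y \<in> ?A"
        proof eventually_elim
          fix y assume y: "y \<in> ?K \<longrightarrow> wpow ?n y * mollifier ?n (cdist x y) = 0"
          show "\<not> y \<in> ?A"
          proof
            assume yA: "y \<in> ?A"
            then have "wpow ?n y > 0" "mollifier ?n (cdist x y) > 0" using wpos mollifier_facts(3) by auto
            then show False using y yA AK by auto
          qed
        qed
        have "emeasure lborel ?A = 0"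
          using AE oA by (subst (asm) AE_iff_measurable[where N="?A"]) auto
        then have "?A \<in> null_sets lborel" using oA by (simp add: null_sets_def)
        then have "negligible ?A" by (simp add: negligible_iff_null_sets null_sets_completionI)
        then show False using open_not_negligible[OF oA neA] by simp
      qed
      moreover have "Z x \<ge> 0" unfolding Z_def by (rule integral_nonneg_AE[OF nn])
      ultimately show ?thesis by simp
    qed
    have key: "u x * complex_of_real (Z x) = J 1 u x" if x: "norm x < R0" for x
    proof -
      have xB: "x \<in> ball 0 1" and xle: "norm x \<le> R0" using x R0 by auto
      have "norm (u x * complex_of_real (Z x) - J 1 u x) \<le> eps * Z x" if eps: "eps > 0" for eps
      proof -
        have "isCont u x" using uc xB by (simp add: continuous_on_eq_continuous_at)
        then obtain d where d: "d > 0" "\<And>y. dist y x < d \<Longrightarrow> dist (u y) (u x) < eps"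
          unfolding continuous_at_eps_delta using eps by metis
        (* cdist x y < e implies |x - y|^2 < e <= d^2 / 2, because the denominator of cdist is at most 1 *)
        define e where "e = min 1 (d\<^sup>2 / 2)"
        have e: "0 < e" "e \<le> 1" "e < d\<^sup>2" using d by (auto simp: e_def min_def)
        let ?k = "\<lambda>y. (cdist x y * (1 + cdist x y)) powr (1 - real ?n / 2) * (inverse e * bump (cdist x y / e))"
        have "u x * complex_of_real (Z x) = u x * J e (\<lambda>_. 1) x"
          unfolding JZ[symmetric] J_eq[OF xle e(1,2) one] ..
        also have "\<dots> = J e (\<lambda>_. u x) x"
          unfolding J_def by (simp add: mult_ac flip: Bochner_Integration.integral_mult_right_zero)
        finally have "u x * complex_of_real (Z x) - J 1 u x = J e (\<lambda>_. u x) x - J e u x"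
          using J_eq[OF xle e(1,2) u Du] by simp
        moreover have "J e (\<lambda>_. u x) x - J e u x = (LINT y|?M. complex_of_real (wpow ?n y) * (u x - u y) * complex_of_real (?k y))"
          unfolding J_def
          by (subst Bochner_Integration.integral_diff[symmetric, OF int[OF xB e(1) continuous_on_const] int[OF xB e(1) uc]])
            (simp add: algebra_simps)
        ultimately have diff: "u x * complex_of_real (Z x) - J 1 u x = (LINT y|?M. complex_of_real (wpow ?n y) * (u x - u y) * complex_of_real (?k y))"
          by (rule trans)
        have le: "norm (LINT y|?M. complex_of_real (wpow ?n y) * (u x - u y) * complex_of_real (?k y)) \<le> (LINT y|?M. eps * (wpow ?n y * ?k y))"
        proof (rule order_trans[OF integral_norm_bound integral_mono])
          show "integrable ?M (\<lambda>y. norm (complex_of_real (wpow ?n y) * (u x - u y) * complex_of_real (?k y)))"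
            by (rule integrable_norm[OF int[OF xB e(1)]]) (intro continuous_intros uc)
          have "integrable ?M (\<lambda>y. complex_of_real (wpow ?n y) * 1 * complex_of_real (?k y))"
            by (rule int[OF xB e(1) continuous_on_const])
          then have "integrable ?M (\<lambda>y. complex_of_real (wpow ?n y * ?k y))" by simp
          then show "integrable ?M (\<lambda>y. eps * (wpow ?n y * ?k y))"
            by (intro integrable_mult_right) (simp only: complex_of_real_integrable_eq)
          fix y assume "y \<in> space ?M"
          then have yB: "y \<in> ball 0 1" using subB spM by auto
          have k0: "?k y \<ge> 0" using e by (intro mult_nonneg_nonneg bump_facts) auto
          show "norm (complex_of_real (wpow ?n y) * (u x - u y) * complex_of_real (?k y)) \<le> eps * (wpow ?n y * ?k y)"
          proof (cases "cdist x y < e")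
            case True
            have p: "0 < 1 - x \<bullet> x" "1 - x \<bullet> x \<le> 1" "0 < 1 - y \<bullet> y" "1 - y \<bullet> y \<le> 1"
              using xB yB by (auto simp: norm_less_1_inner)
            have "(x - y) \<bullet> (x - y) < e * ((1 - x \<bullet> x) * (1 - y \<bullet> y))"
              using True p by (simp add: cdist_def pos_divide_less_eq)
            also have "\<dots> \<le> e * 1" using p e by (intro mult_left_mono mult_le_one) auto
            finally have "(norm (x - y))\<^sup>2 < d\<^sup>2" using e by (simp add: power2_norm_eq_inner)
            then have "dist y x < d" using d(1) by (simp add: dist_norm norm_minus_commute power2_less_imp_less)
            then have "norm (u x - u y) \<le> eps" using d(2)[of y] by (simp add: dist_norm norm_minus_commute)
            then have "norm (u x - u y) * (wpow ?n y * ?k y) \<le> eps * (wpow ?n y * ?k y)"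
              using k0 wpos[OF yB] by (intro mult_right_mono) auto
            moreover have "norm (complex_of_real (wpow ?n y) * (u x - u y) * complex_of_real (?k y))
                = norm (u x - u y) * (wpow ?n y * ?k y)"
              using k0 wpos[OF yB] unfolding norm_mult norm_of_real by (simp only: abs_of_pos abs_of_nonneg mult_ac)
            ultimately show ?thesis by (simp only:)
          next
            case False
            then have "1 \<le> cdist x y / e" using e by simp
            then show ?thesis by (simp add: bump_facts)
          qed
        qed
        have right: "(LINT y|?M. eps * (wpow ?n y * ?k y)) = eps * (LINT y|?M. wpow ?n y * ?k y)" by (rule integral_mult_right_zero)
        have Zx: "(LINT y|?M. wpow ?n y * ?k y) = Z x"
        proof -
          have "complex_of_real (LINT y|?M. wpow ?n y * ?k y) = (LINT y|?M. complex_of_real (wpow ?n y * ?k y))"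
            by (rule integral_complex_of_real[symmetric])
          also have "\<dots> = J e (\<lambda>_. 1) x" unfolding J_def by (simp only: mult_1_right of_real_mult)
          also have "\<dots> = complex_of_real (Z x)" unfolding J_eq[OF xle e(1,2) one] JZ ..
          finally show ?thesis by (simp only: of_real_eq_iff)
        qed
        show ?thesis unfolding diff using le unfolding right Zx .
      qed
      note small = this
      have "norm (u x * complex_of_real (Z x) - J 1 u x) \<le> 0 + eps" if "eps > 0" for eps
        using small[of "eps / Z x"] that Zpos[OF x] by simp
      then have "norm (u x * complex_of_real (Z x) - J 1 u x) \<le> 0" by (rule field_le_epsilon)
      then show ?thesis by simp
    qed
    have Js: "smooth_on (ball 0 R0) (J 1 v)" if v: "continuous_on (ball 0 1) v" for v
    proof -
      let ?k = "\<lambda>z::'a \<times> 'a. complex_of_real (mollifier ?n (cdist (fst z) (snd z)))"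
      have "J 1 v = (\<lambda>x. LINT y|?M. (complex_of_real (wpow ?n y) * v y) * ?k (x, y))"
        by (rule ext) (simp only: J_def mollifier_def inverse_1 div_by_1 mult_1_left fst_conv snd_conv)
      moreover have "smooth_on (ball 0 R0) (\<lambda>x. LINT y|?M. (complex_of_real (wpow ?n y) * v y) * ?k (x, y))"
      proof (rule smooth_on_integral[OF M])
        show "continuous_on ?K (\<lambda>y. complex_of_real (wpow ?n y) * v y)"
          by (intro continuous_on_mult continuous_on_of_real wc continuous_on_subset[OF v subB])
        show "open (ball 0 1 \<times> ball 0 1 :: ('a \<times> 'a) set)" by (intro open_Times open_ball)
        show "ball 0 R0 \<times> ?K \<subseteq> ball 0 1 \<times> ball 0 1" using subB R0 by auto
        show "smooth_on (ball 0 1 \<times> ball 0 1) ?k"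
          by (intro smooth_on_of_real smooth_on_compose_real[OF _ smooth_on_cdist_pair smooth_on_mollifier] open_Times open_ball) simp
      qed simp
      ultimately show ?thesis by simp
    qed
    have Zs: "smooth_on (ball 0 R0) Z"
    proof (rule smooth_on_cong[OF open_ball])
      show "smooth_on (ball 0 R0) (\<lambda>x. Re (J 1 (\<lambda>_. 1) x))"
        by (intro smooth_on_compose_linear[OF open_ball bounded_linear_Re] Js continuous_on_const)
      show "Re (J 1 (\<lambda>_. 1) x) = Z x" for x by (simp add: JZ)
    qed
    show ?thesis
    proof (rule smooth_on_cong[OF open_ball])
      show "smooth_on (ball 0 R0) (\<lambda>x. J 1 u x * complex_of_real (inverse (Z x)))"
        by (intro smooth_on_mult[OF open_ball] Js uc smooth_on_of_real[OF open_ball] smooth_on_inverse[OF open_ball Zs]) (simp add: Zpos)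
      fix x assume "x \<in> ball (0::'a) R0"
      then have x: "norm x < R0" by simp
      show "J 1 u x * complex_of_real (inverse (Z x)) = u x"
        unfolding key[OF x, symmetric] using Zpos[OF x] by simp
    qed
  qed
  show ?thesis unfolding smooth_on_alt
  proof (intro ballI)
    fix bs x assume bs: "bs \<in> lists (Basis::'a set)" and x: "x \<in> ball (0::'a) 1"
    have "smooth_on (ball 0 ((1 + norm x) / 2)) u" by (rule local) (use x in \<open>auto intro: add_pos_nonneg\<close>)
    moreover have "x \<in> ball 0 ((1 + norm x) / 2)" using x by simp
    ultimately show "foldr partial bs u differentiable (at x)" using bs unfolding smooth_on_alt by blast
  qed
qed

section \<open>Homogeneous polynomials on the sphere\<close>

text \<open>
  Words of length \<open>d\<close> in the basis vectors index the products of \<open>d\<close> coordinates. A polynomial has several such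
  descriptions, but the rotation fields act on words by antisymmetric matrices, which fails for monomials
  with the standard normalisation.
\<close>

fun words :: "nat \<Rightarrow> 'a::euclidean_space list set" where
  "words 0 = {[]}"
| "words (Suc d) = (\<lambda>(b, w). b # w) ` (Basis \<times> words d)"

fun monomial :: "'a::euclidean_space list \<Rightarrow> 'a \<Rightarrow> complex" where
  "monomial [] x = 1"
| "monomial (b # w) x = complex_of_real (x \<bullet> b) * monomial w x"

lemma finite_words: "finite (words d :: 'a::euclidean_space list set)"
  by (induction d) auto

lemma sum_words_Suc:
  "(\<Sum>w\<in>words (Suc d). f w) = (\<Sum>b\<in>Basis. \<Sum>w\<in>words d. f (b # w))"
proof -
  have i: "inj_on (\<lambda>(b, w). b # w) (Basis \<times> words d)" by (auto simp: inj_on_def)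
  have "(\<Sum>w\<in>words (Suc d). f w) = sum (f \<circ> (\<lambda>(b, w). b # w)) (Basis \<times> words d)"
    unfolding words.simps by (rule sum.reindex[OF i])
  also have "\<dots> = (\<Sum>b\<in>Basis. \<Sum>w\<in>words d. f (b # w))"
    by (simp add: sum.cartesian_product case_prod_unfold o_def)
  finally show ?thesis .
qed

lemma smooth_on_monomial: "open U \<Longrightarrow> smooth_on U (monomial w)"
proof (induction w)
  case Nil
  have "monomial [] = (\<lambda>x::'a. 1)" by (rule ext) simp
  then show ?case by simp
next
  case (Cons b w)
  have "monomial (b # w) = (\<lambda>x. complex_of_real (x \<bullet> b) * monomial w x)" by (rule ext) simp
  then show ?case using Cons by (auto intro!: smooth_on_mult smooth_on_of_real)
qed

lemma rot_component:
  assumes "b \<in> Basis" "c \<in> Basis" "k \<in> Basis"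
  shows "rot b c (\<lambda>x. complex_of_real (x \<bullet> k)) x =
    (if k = c then complex_of_real (x \<bullet> b) else 0) - (if k = b then complex_of_real (x \<bullet> c) else 0)"
proof -
  have "bounded_linear (\<lambda>x. complex_of_real (x \<bullet> k))"
    by (rule bounded_linear_compose[OF bounded_linear_of_real bounded_linear_inner_left])
  from partial_linear[OF this] show ?thesis
    using assms by (auto simp: rot_def inner_Basis scaleR_conv_of_real)
qed

lemma rot_monomial_Cons:
  assumes "b \<in> Basis" "c \<in> Basis" "k \<in> Basis"
  shows "rot b c (monomial (k # w)) =
    (\<lambda>x. complex_of_real (x \<bullet> k) * rot b c (monomial w) x
      + ((if k = c then complex_of_real (x \<bullet> b) else 0) - (if k = b then complex_of_real (x \<bullet> c) else 0)) * monomial w x)"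
proof
  fix x :: 'a
  have e: "monomial (k # w) = (\<lambda>x. complex_of_real (x \<bullet> k) * monomial w x)" by (rule ext) simp
  show "rot b c (monomial (k # w)) x = complex_of_real (x \<bullet> k) * rot b c (monomial w) x
      + ((if k = c then complex_of_real (x \<bullet> b) else 0) - (if k = b then complex_of_real (x \<bullet> c) else 0)) * monomial w x"
    unfolding e rot_component[OF assms, symmetric]
    by (rule rot_mult)
      (use smooth_on_differentiable[OF smooth_on_monomial[OF open_UNIV]]
        smooth_on_differentiable[OF smooth_on_of_real[OF open_UNIV smooth_on_component]] in auto)
qed

text \<open>
  Only linearity on smooth functions is available for boundary distributions, which are limits that need not
  exist for other functions.
\<close>

definition near_linear :: "(('a::euclidean_space \<Rightarrow> complex) \<Rightarrow> complex) \<Rightarrow> bool" where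
  "near_linear l \<longleftrightarrow> (\<forall>f g. smooth_on UNIV f \<longrightarrow> smooth_on UNIV g \<longrightarrow> l (\<lambda>x. f x + g x) = l f + l g) \<and>
     (\<forall>f a. smooth_on UNIV f \<longrightarrow> l (\<lambda>x. a * f x) = a * l f)"

lemma near_linear_add: "near_linear l \<Longrightarrow> smooth_on UNIV f \<Longrightarrow> smooth_on UNIV g \<Longrightarrow> l (\<lambda>x. f x + g x) = l f + l g"
  unfolding near_linear_def by simp

lemma near_linear_scale: "near_linear l \<Longrightarrow> smooth_on UNIV f \<Longrightarrow> l (\<lambda>x. a * f x) = a * l f"
  unfolding near_linear_def by simp

lemma near_linear_zero: "near_linear l \<Longrightarrow> l (\<lambda>x. 0) = 0"
  using near_linear_scale[of l "\<lambda>x. 0" 0] by simp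

lemma near_linear_sum:
  assumes l: "near_linear l" and "finite I" "\<And>i. i \<in> I \<Longrightarrow> smooth_on UNIV (f i)"
  shows "l (\<lambda>x. \<Sum>i\<in>I. f i x) = (\<Sum>i\<in>I. l (f i))"
  using assms(2,3)
proof (induction I rule: finite_induct)
  case empty
  then show ?case using near_linear_zero[OF l] by simp
next
  case (insert i I)
  then show ?case using near_linear_add[OF l, of "f i" "\<lambda>x. \<Sum>i\<in>I. f i x"]
    by (simp add: smooth_on_sum)
qed

lemma near_linear_mult:
  assumes l: "near_linear l" and h: "smooth_on UNIV h"
  shows "near_linear (\<lambda>f. l (\<lambda>x. h x * f x))"
  unfolding near_linear_def
proof (intro conjI allI impI)
  fix f g :: "'a \<Rightarrow> complex" assume "smooth_on UNIV f" "smooth_on UNIV g"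
  then show "l (\<lambda>x. h x * (f x + g x)) = l (\<lambda>x. h x * f x) + l (\<lambda>x. h x * g x)"
    unfolding distrib_left by (intro near_linear_add[OF l] smooth_on_mult h open_UNIV)
next
  fix f and a :: complex assume "smooth_on UNIV (f :: 'a \<Rightarrow> complex)"
  then show "l (\<lambda>x. h x * (a * f x)) = a * l (\<lambda>x. h x * f x)"
    unfolding mult.left_commute[of _ a] by (intro near_linear_scale[OF l] smooth_on_mult h open_UNIV)
qed

text \<open>
  A rotation field acts on a word by replacing one letter at a time, \<open>c\<close> by \<open>b\<close> and \<open>b\<close> by \<open>- c\<close>. For words of length
  one this is an antisymmetric matrix; the action on longer words is a sum of such matrices on the tensor
  factors. The induction needs two functionals, and multiplies both by the first letter.
\<close>

lemma rot_antisymmetric: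
  fixes l m :: "('a::euclidean_space \<Rightarrow> complex) \<Rightarrow> complex"
  assumes l: "near_linear l" and m: "near_linear m" and b: "b \<in> Basis" and c: "c \<in> Basis"
  shows "(\<Sum>w\<in>words d. cnj (l (monomial w)) * m (rot b c (monomial w)))
       = - (\<Sum>w\<in>words d. cnj (l (rot b c (monomial w))) * m (monomial w))"
  using l m
proof (induction d arbitrary: l m)
  case 0
  have e: "monomial [] = (\<lambda>x::'a. 1)" by (rule ext) simp
  have r: "rot b c (\<lambda>x::'a. 1::complex) = (\<lambda>x. 0)" by (rule ext) (simp add: rot_def)
  show ?case using near_linear_zero[OF 0(1)] near_linear_zero[OF 0(2)] by (simp add: e r del: monomial.simps)
next
  case (Suc d)
  let ?x = "\<lambda>k f x::'a. complex_of_real (x \<bullet> k) * (f x :: complex)"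
  have sx: "smooth_on UNIV (\<lambda>x::'a. complex_of_real (x \<bullet> k))" for k
    by (rule smooth_on_of_real) auto
  have sm: "smooth_on UNIV (monomial w :: 'a \<Rightarrow> complex)" for w by (rule smooth_on_monomial) simp
  have sr: "smooth_on UNIV (rot b c (monomial w))" for w by (rule smooth_on_rot[OF open_UNIV sm b c])
  have sxm: "smooth_on UNIV (?x k (monomial w))" "smooth_on UNIV (?x k (rot b c (monomial w)))" for k w
    by (intro smooth_on_mult open_UNIV sx sm sr)+
  have cons: "monomial (k # w) = ?x k (monomial w)" for k :: 'a and w by (rule ext) simp
  have exp: "p (rot b c (monomial (k # w))) = p (?x k (rot b c (monomial w)))
      + ((if k = c then p (?x b (monomial w)) else 0) - (if k = b then p (?x c (monomial w)) else 0))"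
    if p: "near_linear p" and k: "k \<in> Basis" for p k w
  proof -
    let ?r = "\<lambda>x. ((if k = c then complex_of_real (x \<bullet> b) else 0) - (if k = b then complex_of_real (x \<bullet> c) else 0)) * monomial w x"
    have r: "?r = (\<lambda>x. (if k = c then 1 else 0) * ?x b (monomial w) x + (- (if k = b then 1 else 0)) * ?x c (monomial w) x)"
      by (rule ext) (simp add: algebra_simps)
    have s1: "smooth_on UNIV (\<lambda>x. a * ?x k (monomial w) x)" for a k
      by (intro smooth_on_mult[OF open_UNIV smooth_on_const] sxm)
    have "p ?r = (if k = c then p (?x b (monomial w)) else 0) - (if k = b then p (?x c (monomial w)) else 0)"
      unfolding r near_linear_add[OF p s1 s1] near_linear_scale[OF p sxm(1)] by simp
    moreover have "smooth_on UNIV ?r" unfolding r by (intro smooth_on_add open_UNIV s1)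
    ultimately show ?thesis
      unfolding rot_monomial_Cons[OF b c k] using near_linear_add[OF p sxm(2)] by simp
  qed
  have IH: "(\<Sum>w\<in>words d. cnj (l (?x k (monomial w))) * m (?x k (rot b c (monomial w))))
       = - (\<Sum>w\<in>words d. cnj (l (?x k (rot b c (monomial w)))) * m (?x k (monomial w)))" for k
    by (rule Suc.IH[OF near_linear_mult[OF Suc.prems(1) sx] near_linear_mult[OF Suc.prems(2) sx]])
  have delta: "(\<Sum>k\<in>Basis. \<Sum>w\<in>W. A k w + ((if k = c then P k w else 0) - (if k = b then Q k w else 0)))
      = (\<Sum>k\<in>Basis. \<Sum>w\<in>W. A k w) + ((\<Sum>w\<in>W. P c w) - (\<Sum>w\<in>W. Q b w))"
    for W :: "'a list set" and A P Q :: "'a \<Rightarrow> 'a list \<Rightarrow> complex"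
  proof -
    have pull: "(\<Sum>k\<in>Basis. \<Sum>w\<in>W. if k = e then P k w else 0) = (\<Sum>w\<in>W. P e w)"
      if "e \<in> Basis" for e and P :: "'a \<Rightarrow> 'a list \<Rightarrow> complex"
    proof -
      have "(\<Sum>k\<in>Basis. \<Sum>w\<in>W. if k = e then P k w else 0) = (\<Sum>k\<in>Basis. if k = e then (\<Sum>w\<in>W. P k w) else 0)"
        by (rule sum.cong) auto
      then show ?thesis using that by (simp add: sum.delta)
    qed
    show ?thesis by (simp only: sum.distrib sum_subtractf pull[OF b] pull[OF c])
  qed
  let ?E = "\<lambda>w. cnj (l (?x c (monomial w))) * m (?x b (monomial w)) - cnj (l (?x b (monomial w))) * m (?x c (monomial w))"
  have "(\<Sum>w\<in>words (Suc d). cnj (l (monomial w)) * m (rot b c (monomial w)))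
     = (\<Sum>k\<in>Basis. \<Sum>w\<in>words d. cnj (l (?x k (monomial w))) * m (?x k (rot b c (monomial w)))
        + ((if k = c then cnj (l (?x k (monomial w))) * m (?x b (monomial w)) else 0)
          - (if k = b then cnj (l (?x k (monomial w))) * m (?x c (monomial w)) else 0)))"
    unfolding sum_words_Suc
    by (intro sum.cong refl, simp only: exp[OF Suc.prems(2)], simp only: cons, simp add: ring_distribs)
  also have "\<dots> = (\<Sum>k\<in>Basis. \<Sum>w\<in>words d. cnj (l (?x k (monomial w))) * m (?x k (rot b c (monomial w))))
      + (\<Sum>w\<in>words d. ?E w)"
    unfolding delta sum_subtractf[symmetric] ..
  finally have L: "(\<Sum>w\<in>words (Suc d). cnj (l (monomial w)) * m (rot b c (monomial w)))
    = (\<Sum>k\<in>Basis. \<Sum>w\<in>words d. cnj (l (?x k (monomial w))) * m (?x k (rot b c (monomial w)))) + (\<Sum>w\<in>words d. ?E w)" .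
  have "(\<Sum>w\<in>words (Suc d). cnj (l (rot b c (monomial w))) * m (monomial w))
     = (\<Sum>k\<in>Basis. \<Sum>w\<in>words d. cnj (l (?x k (rot b c (monomial w)))) * m (?x k (monomial w))
        + ((if k = c then cnj (l (?x b (monomial w))) * m (?x k (monomial w)) else 0)
          - (if k = b then cnj (l (?x c (monomial w))) * m (?x k (monomial w)) else 0)))"
    unfolding sum_words_Suc
    by (intro sum.cong refl, simp only: exp[OF Suc.prems(1)], simp only: cons, simp add: ring_distribs)
  also have "\<dots> = (\<Sum>k\<in>Basis. \<Sum>w\<in>words d. cnj (l (?x k (rot b c (monomial w)))) * m (?x k (monomial w)))
      - (\<Sum>w\<in>words d. ?E w)"
    unfolding delta by (simp add: sum_subtractf)
  finally have R: "(\<Sum>w\<in>words (Suc d). cnj (l (rot b c (monomial w))) * m (monomial w))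
    = (\<Sum>k\<in>Basis. \<Sum>w\<in>words d. cnj (l (?x k (rot b c (monomial w)))) * m (?x k (monomial w))) - (\<Sum>w\<in>words d. ?E w)" .
  show ?case unfolding L R IH by (simp add: sum_negf)
qed

lemma near_linear_rot:
  assumes l: "near_linear l" and b: "b \<in> Basis" "c \<in> Basis"
  shows "near_linear (\<lambda>f. l (rot b c f))"
proof -
  have 1: "rot b c (\<lambda>x. f x + g x) = (\<lambda>x. rot b c f x + rot b c g x)"
    if "smooth_on UNIV f" "smooth_on UNIV g" for f g :: "'a \<Rightarrow> complex"
    using smooth_on_differentiable[OF that(1)] smooth_on_differentiable[OF that(2)]
    by (intro ext) (simp add: rot_def partial_add scaleR_right_distrib)
  have 2: "rot b c (\<lambda>x. a * f x) = (\<lambda>x. a * rot b c f x)" if "smooth_on UNIV f" for f :: "'a \<Rightarrow> complex" and a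
    using smooth_on_differentiable[OF that]
    by (intro ext) (simp add: rot_def partial_compose_linear[OF bounded_linear_mult_right] right_diff_distrib)
  show ?thesis
    unfolding near_linear_def
    by (simp add: 1 2 near_linear_add[OF l] near_linear_scale[OF l] smooth_on_rot b)
qed

lemma near_linear_sph_lap_eq:
  assumes l: "near_linear l" and f: "smooth_on UNIV f"
  shows "l (sph_lap f) = (1/2) * (\<Sum>b\<in>Basis. \<Sum>c\<in>Basis. l (rot b c (rot b c f)))"
proof -
  have s: "smooth_on UNIV (rot b c (rot b c f))" if "b \<in> Basis" "c \<in> Basis" for b c
    by (intro smooth_on_rot open_UNIV f that)
  have "sph_lap f = (\<lambda>x. (1/2) * (\<Sum>b\<in>Basis. \<Sum>c\<in>Basis. rot b c (rot b c f) x))"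
    by (rule ext) (simp add: sph_lap_def scaleR_conv_of_real)
  then have "l (sph_lap f) = (1/2) * l (\<lambda>x. \<Sum>b\<in>Basis. \<Sum>c\<in>Basis. rot b c (rot b c f) x)"
    using near_linear_scale[OF l, of "\<lambda>x. \<Sum>b\<in>Basis. \<Sum>c\<in>Basis. rot b c (rot b c f) x" "1/2"]
    by (simp add: smooth_on_sum s)
  also have "l (\<lambda>x. \<Sum>b\<in>Basis. \<Sum>c\<in>Basis. rot b c (rot b c f) x) = (\<Sum>b\<in>Basis. \<Sum>c\<in>Basis. l (rot b c (rot b c f)))"
    by (subst near_linear_sum[OF l]) (auto intro!: smooth_on_sum s sum.cong near_linear_sum[OF l])
  finally show ?thesis .
qed

lemma near_linear_sph_lap:
  assumes l: "near_linear l"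
  shows "near_linear (\<lambda>f. l (sph_lap f))"
proof -
  have r: "near_linear (\<lambda>f. l (rot b c (rot b c f)))" if "b \<in> Basis" "c \<in> Basis" for b c
    by (rule near_linear_rot[OF near_linear_rot[OF l that] that])
  have s: "smooth_on UNIV f \<Longrightarrow> l (sph_lap f) = (1/2) * (\<Sum>b\<in>Basis. \<Sum>c\<in>Basis. l (rot b c (rot b c f)))" for f
    by (rule near_linear_sph_lap_eq[OF l])
  show ?thesis
    unfolding near_linear_def
    by (simp add: s smooth_on_add smooth_on_mult near_linear_add[OF r] near_linear_scale[OF r]
        sum.distrib sum_distrib_left algebra_simps cong: sum.cong)
qed

text \<open>
  \<open>\<Lambda>\<close> is half a sum of squares of antisymmetric matrices. Testing it with a functional instead of an inner
  product of functions makes the result applicable to boundary values.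
\<close>

theorem sph_lap_negative:
  fixes l :: "('a::euclidean_space \<Rightarrow> complex) \<Rightarrow> complex"
  assumes l: "near_linear l"
  shows "\<exists>r\<ge>0. (\<Sum>w\<in>words d. cnj (l (monomial w)) * l (sph_lap (monomial w))) = - complex_of_real r"
proof -
  let ?r = "(1/2) * (\<Sum>b\<in>(Basis::'a set). \<Sum>c\<in>(Basis::'a set). \<Sum>w\<in>words d. (norm (l (rot b c (monomial w))))\<^sup>2)"
  have sm: "smooth_on UNIV (monomial w :: 'a \<Rightarrow> complex)" for w by (rule smooth_on_monomial) simp
  have "(\<Sum>w\<in>words d. cnj (l (monomial w)) * l (sph_lap (monomial w)))
     = (1/2) * (\<Sum>b\<in>Basis. \<Sum>c\<in>Basis. \<Sum>w\<in>words d. cnj (l (monomial w)) * l (rot b c (rot b c (monomial w))))"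
    unfolding near_linear_sph_lap_eq[OF l sm]
    by (simp add: sum_distrib_left sum_distrib_right mult_ac sum.swap[of _ "words d"])
  also have "\<dots> = (1/2) * (\<Sum>b\<in>Basis. \<Sum>c\<in>Basis. - (\<Sum>w\<in>words d. complex_of_real ((norm (l (rot b c (monomial w))))\<^sup>2)))"
  proof -
    have "(\<Sum>w\<in>words d. cnj (l (monomial w)) * l (rot b c (rot b c (monomial w))))
        = - (\<Sum>w\<in>words d. complex_of_real ((norm (l (rot b c (monomial w))))\<^sup>2))"
      if "b \<in> Basis" "c \<in> Basis" for b c
      using rot_antisymmetric[OF l near_linear_rot[OF l that] that, of d]
      by (simp only: complex_norm_square mult.commute)
    then show ?thesis by (simp cong: sum.cong)
  qed
  also have "\<dots> = - complex_of_real ?r" by (simp add: sum_negf)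
  finally show ?thesis by (intro exI[of _ ?r] conjI mult_nonneg_nonneg sum_nonneg) auto
qed

text \<open>
  If \<open>l\<close> is an eigenvector of the negative semidefinite \<open>\<Lambda>\<close> with a positive eigenvalue, it vanishes.
\<close>

lemma peel_sph_lap:
  fixes l :: "('a::euclidean_space \<Rightarrow> complex) \<Rightarrow> complex"
  assumes l: "near_linear l" and c: "c > 0"
    and z: "\<And>w. w \<in> words d \<Longrightarrow> l (\<lambda>x. sph_lap (monomial w) x - complex_of_real c * monomial w x) = 0"
    and w: "w \<in> words d"
  shows "l (monomial w) = 0"
proof -
  have sm: "smooth_on UNIV (monomial w :: 'a \<Rightarrow> complex)" for w by (rule smooth_on_monomial) simp
  have e: "l (sph_lap (monomial w)) = complex_of_real c * l (monomial w)" if "w \<in> words d" for w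
  proof -
    have "l (\<lambda>x. sph_lap (monomial w) x + (- complex_of_real c) * monomial w x)
        = l (sph_lap (monomial w)) + (- complex_of_real c) * l (monomial w)"
      using near_linear_add[OF l smooth_on_sph_lap[OF open_UNIV sm] smooth_on_mult[OF open_UNIV smooth_on_const sm]]
        near_linear_scale[OF l sm] by metis
    then show ?thesis using z[OF that] by simp
  qed
  obtain r where r: "r \<ge> 0" "(\<Sum>w\<in>words d. cnj (l (monomial w)) * l (sph_lap (monomial w))) = - complex_of_real r"
    using sph_lap_negative[OF l, of d] by auto
  have "(\<Sum>w\<in>words d. cnj (l (monomial w)) * l (sph_lap (monomial w)))
      = complex_of_real (c * (\<Sum>w\<in>words d. (norm (l (monomial w)))\<^sup>2))"
  proof -
    have "complex_of_real ((norm z)\<^sup>2) = cnj z * z" for z using complex_norm_square[of z] by (simp only: mult.commute)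
    then show ?thesis by (simp only: sum_distrib_left of_real_mult of_real_sum) (intro sum.cong refl, simp add: e)
  qed
  then have "complex_of_real (c * (\<Sum>w\<in>words d. (norm (l (monomial w)))\<^sup>2)) = complex_of_real (- r)"
    using r(2) by simp
  then have "c * (\<Sum>w\<in>words d. (norm (l (monomial w)))\<^sup>2) = - r" by (simp only: of_real_eq_iff)
  then have "c * (\<Sum>w\<in>words d. (norm (l (monomial w)))\<^sup>2) \<le> 0" using r(1) by simp
  then have "(\<Sum>w\<in>words d. (norm (l (monomial w)))\<^sup>2) \<le> 0" using c by (simp add: mult_le_0_iff)
  then have "(\<Sum>w\<in>words d. (norm (l (monomial w)))\<^sup>2) = 0" by (intro antisym sum_nonneg) auto
  then show ?thesis using w by (simp add: sum_nonneg_eq_0_iff[OF finite_words])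
qed

section \<open>Boundary limits along rays\<close>

lemma smooth_near_UNIV: "smooth_on UNIV F \<Longrightarrow> smooth_near F"
  unfolding smooth_near_def by (intro exI[of _ UNIV]) auto

lemma smooth_near_smooth_on_sphere: "smooth_near F \<Longrightarrow> smooth_on_sphere F"
  unfolding smooth_near_def smooth_on_sphere_def by blast

lemma smooth_on_sphere_extension:
  assumes "smooth_on_sphere \<Phi>"
  obtains F where "smooth_near F" "\<forall>\<zeta>\<in>sphere 0 1. F \<zeta> = \<Phi> \<zeta>"
proof -
  from assms obtain U F where "open U" "sphere 0 1 \<subseteq> U" "smooth_on U F" and e: "\<forall>\<zeta>\<in>sphere 0 1. F \<zeta> = \<Phi> \<zeta>"
    unfolding smooth_on_sphere_def by (elim exE conjE) (rule that)
  then have "smooth_near F" unfolding smooth_near_def by (intro exI conjI)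
  then show ?thesis using e by (rule that)
qed

lemma sphere_pairing_cong:
  "(\<And>\<zeta>. \<zeta> \<in> sphere 0 1 \<Longrightarrow> F \<zeta> = \<Phi> \<zeta>) \<Longrightarrow> sphere_pairing w F = sphere_pairing w \<Phi>"
  unfolding sphere_pairing_def
  by (intro ext Bochner_Integration.integral_cong) (simp_all add: space_sphere_measure)

lemma filterlim_exp_minus: "filterlim (\<lambda>t::real. exp (- t)) (at_left 1) (at_right 0)"
  unfolding filterlim_at
proof
  show "\<forall>\<^sub>F t in at_right (0::real). exp (- t) \<in> {..<1} \<and> exp (- t) \<noteq> 1"
    by (rule eventually_at_right_less[THEN eventually_mono]) auto
  have "((\<lambda>t::real. exp (- t)) \<longlongrightarrow> exp (- 0)) (at_right 0)" by (intro tendsto_intros)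
  then show "((\<lambda>t::real. exp (- t)) \<longlongrightarrow> 1) (at_right 0)" by simp
qed

lemma filterlim_minus_ln: "filterlim (\<lambda>r::real. - ln r) (at_right 0) (at_left 1)"
  unfolding filterlim_at
proof
  have "\<forall>\<^sub>F r in at_left (1::real). r \<in> {0<..<1}"
    by (rule eventually_at_left_real) simp
  then show "\<forall>\<^sub>F r in at_left (1::real). - ln r \<in> {0<..} \<and> - ln r \<noteq> 0"
    by (rule eventually_mono) auto
  have "((\<lambda>r::real. - ln r) \<longlongrightarrow> - ln 1) (at_left 1)" by (intro tendsto_intros) auto
  then show "((\<lambda>r::real. - ln r) \<longlongrightarrow> 0) (at_left 1)" by simp
qed

lemma pairing_tendsto_iff:
  "(pairing w F \<longlongrightarrow> L) (at_right 0) \<longleftrightarrow> (sphere_pairing w F \<longlongrightarrow> L) (at_left 1)"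
proof
  assume "(pairing w F \<longlongrightarrow> L) (at_right 0)"
  from filterlim_compose[OF this filterlim_minus_ln]
  have "((\<lambda>r. pairing w F (- ln r)) \<longlongrightarrow> L) (at_left 1)" .
  moreover have "\<forall>\<^sub>F r in at_left (1::real). r \<in> {0<..<1}"
    by (rule eventually_at_left_real) simp
  then have "\<forall>\<^sub>F r in at_left 1. pairing w F (- ln r) = sphere_pairing w F r"
    by (rule eventually_mono) (simp add: pairing_def)
  ultimately show "(sphere_pairing w F \<longlongrightarrow> L) (at_left 1)" by (simp only: tendsto_cong)
next
  assume "(sphere_pairing w F \<longlongrightarrow> L) (at_left 1)"
  from filterlim_compose[OF this filterlim_exp_minus]
  show "(pairing w F \<longlongrightarrow> L) (at_right 0)" by (simp add: pairing_def[abs_def])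
qed

lemma has_boundary_distribution_pairing:
  "has_boundary_distribution w \<longleftrightarrow> (\<forall>F. smooth_near F \<longrightarrow> (\<exists>L. (pairing w F \<longlongrightarrow> L) (at_right 0)))"
proof
  assume "has_boundary_distribution w"
  then show "\<forall>F. smooth_near F \<longrightarrow> (\<exists>L. (pairing w F \<longlongrightarrow> L) (at_right 0))"
    unfolding has_boundary_distribution_def pairing_tendsto_iff using smooth_near_smooth_on_sphere by blast
next
  assume *: "\<forall>F. smooth_near F \<longrightarrow> (\<exists>L. (pairing w F \<longlongrightarrow> L) (at_right 0))"
  show "has_boundary_distribution w" unfolding has_boundary_distribution_def
  proof (intro allI impI)
    fix \<Phi> :: "'a \<Rightarrow> complex" assume "smooth_on_sphere \<Phi>"
    then obtain F where F: "smooth_near F" "\<forall>\<zeta>\<in>sphere 0 1. F \<zeta> = \<Phi> \<zeta>" by (rule smooth_on_sphere_extension)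
    have "sphere_pairing w F = sphere_pairing w \<Phi>" by (rule sphere_pairing_cong) (use F in auto)
    then show "\<exists>L. (sphere_pairing w \<Phi> \<longlongrightarrow> L) (at_left 1)"
      using * F(1) unfolding pairing_tendsto_iff by metis
  qed
qed

lemma smooth_on_normal_deriv_pow: "open U \<Longrightarrow> smooth_on U u \<Longrightarrow> smooth_on U ((normal_deriv ^^ k) u)"
  by (induction k) (auto intro: smooth_on_normal_deriv)

lemma pairing_normal_deriv_chain:
  assumes u: "smooth_on (ball 0 1) u" and F: "smooth_near F" and t: "t > 0"
  shows "((\<lambda>t. (- 1) ^ k * pairing ((normal_deriv ^^ k) u) F t) has_vector_derivative
    (- 1) ^ Suc k * pairing ((normal_deriv ^^ Suc k) u) F t) (at t)"
  using has_vector_derivative_mult_right[OF pairing_derivative[OF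
      smooth_on_normal_deriv_pow[OF open_ball u, of k] smooth_near_continuous[OF F] t], of "(- 1) ^ k"]
  by simp

lemma bounded_of_limit_at_right:
  fixes f :: "real \<Rightarrow> complex"
  assumes L: "(f \<longlongrightarrow> L) (at_right 0)" and c: "continuous_on {0<..} f"
  shows "\<exists>M. \<forall>t\<in>{0<..t0}. norm (f t) \<le> M"
proof -
  have "\<forall>\<^sub>F t in at_right 0. dist (f t) L < 1" using L by (rule tendstoD) simp
  then obtain d where d: "d > 0" "\<And>t. 0 < t \<Longrightarrow> t < d \<Longrightarrow> dist (f t) L < 1"
    unfolding eventually_at_right_field by auto
  have "continuous_on {d/2..t0} f" by (rule continuous_on_subset[OF c]) (use d in auto)
  then obtain B where B: "\<forall>t\<in>{d/2..t0}. norm (f t) \<le> B"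
    by (rule continuous_on_compact_bound) (rule compact_Icc, rule that)
  have "norm (f t) \<le> max B (norm L + 1)" if "t \<in> {0<..t0}" for t
  proof (cases "t < d")
    case True
    then have "norm (f t - L) < 1" using d(2)[of t] that by (simp add: dist_norm)
    then show ?thesis using norm_triangle_ineq2[of "f t" L] by linarith
  next
    case False
    then show ?thesis using B that d(1) by (intro max.coboundedI1) auto
  qed
  then show ?thesis by blast
qed

text \<open>
  A boundary distribution bounds the pairings with \<open>\<Lambda>^j F\<close> for all \<open>j\<close>, as these are test functions as well.
\<close>

lemma pairing_ray_ode:
  fixes u :: "'a::euclidean_space \<Rightarrow> complex"
  assumes n: "DIM('a) \<ge> 2" and u: "smooth_on (ball 0 1) u"
    and D: "\<And>x. x \<in> ball 0 1 \<Longrightarrow> hyp_laplacian u x = 0"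
    and bd: "has_boundary_distribution u" and F: "smooth_near F"
  shows "ray_ode (DIM('a) - 2) (UNIV :: unit set) 1
    (\<lambda>j _. pairing u ((sph_lap ^^ j) F)) (\<lambda>j _ t. - pairing (normal_deriv u) ((sph_lap ^^ j) F) t)
    (\<lambda>j _. pairing (normal_deriv (normal_deriv u)) ((sph_lap ^^ j) F))"
proof
  have nu: "smooth_on (ball 0 1) (normal_deriv u)" by (rule smooth_on_normal_deriv[OF open_ball u])
  have Fj: "smooth_near ((sph_lap ^^ j) F)" for j by (rule smooth_near_sph_lap_pow[OF F])
  fix j t q assume t: "t > (0::real)"
  show d: "(pairing u ((sph_lap ^^ j) F) has_vector_derivative - pairing (normal_deriv u) ((sph_lap ^^ j) F) t) (at t)"
    by (rule pairing_derivative[OF u smooth_near_continuous[OF Fj] t])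
  show "((\<lambda>t. - pairing (normal_deriv u) ((sph_lap ^^ j) F) t) has_vector_derivative
      pairing (normal_deriv (normal_deriv u)) ((sph_lap ^^ j) F) t) (at t)"
    using has_vector_derivative_minus[OF pairing_derivative[OF nu smooth_near_continuous[OF Fj[of j]] t]] by simp
  have "real (DIM('a) - 2) = real DIM('a) - 2" using n by simp
  then show "sinh t *\<^sub>R (pairing (normal_deriv (normal_deriv u)) ((sph_lap ^^ j) F) t + pairing u ((sph_lap ^^ Suc j) F) t) =
      (real (DIM('a) - 2) * cosh t) *\<^sub>R - pairing (normal_deriv u) ((sph_lap ^^ j) F) t"
    using pairing_equation[OF u D Fj[of j] t] by (simp add: add_eq_0_iff2)
next
  fix j
  have Fj: "smooth_near ((sph_lap ^^ j) F)" for j by (rule smooth_near_sph_lap_pow[OF F])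
  have c: "continuous_on {0<..} (pairing u ((sph_lap ^^ j) F))"
    using pairing_derivative[OF u smooth_near_continuous[OF Fj[of j]]]
    by (intro continuous_at_imp_continuous_on ballI) (auto intro: has_vector_derivative_continuous)
  obtain L where "(pairing u ((sph_lap ^^ j) F) \<longlongrightarrow> L) (at_right 0)"
    using bd Fj unfolding has_boundary_distribution_pairing by blast
  from bounded_of_limit_at_right[OF this c, of 1]
  show "bd (UNIV :: unit set) 1 (\<lambda>_. pairing u ((sph_lap ^^ j) F))" unfolding bd_def by simp
next
  show "\<exists>C. \<forall>q\<in>(UNIV :: unit set). norm (- pairing (normal_deriv u) ((sph_lap ^^ j) F) 1) \<le> C" for j
    by (intro exI[of _ "norm (- pairing (normal_deriv u) ((sph_lap ^^ j) F) 1)"]) simp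
qed simp

text \<open>
  The next derivative is bounded near the boundary, so the present one converges.
\<close>

theorem even_dim_boundary_distribution:
  fixes u :: "'a::euclidean_space \<Rightarrow> complex"
  assumes n: "even DIM('a)" "DIM('a) \<ge> 3" and H: "H_harmonic u" and bd: "has_boundary_distribution u"
  shows "has_boundary_distribution ((normal_deriv ^^ k) u)"
  unfolding has_boundary_distribution_pairing
proof (intro allI impI)
  fix F :: "'a \<Rightarrow> complex" assume F: "smooth_near F"
  have n2: "DIM('a) \<ge> 2" using n by simp
  have u: "smooth_on (ball 0 1) u" by (rule H_harmonic_imp_smooth[OF n2 H])
  have D: "hyp_laplacian u x = 0" if "x \<in> ball 0 1" for x using H that by (simp add: H_harmonic_def)
  define g where "g k t = (- 1) ^ k * pairing ((normal_deriv ^^ k) u) F t" for k t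
  have g: "(g k has_vector_derivative g (Suc k) t) (at t)" if "t > 0" for k t
    unfolding g_def by (rule pairing_normal_deriv_chain[OF u F that])
  have n4: "DIM('a) \<ge> 4" using n by presburger
  have "bd (UNIV :: unit set) 1 (\<lambda>_. g k)" for k
    by (rule ray_ode.even_all_derivatives_bounded[OF pairing_ray_ode[OF n2 u D bd F], where j = 0 and g = "\<lambda>k _. g k"])
      (use n n4 g in \<open>auto simp: g_def[of 0]\<close>)
  then obtain M where M: "\<forall>t\<in>{0<..1}. norm (g (Suc k) t) \<le> M" unfolding bd_def by auto
  have "\<exists>L. (g k \<longlongrightarrow> L) (at_right 0)"
    by (rule limit_of_bounded_derivative[of 1 _ "g (Suc k)" M]) (use g M in auto)
  then obtain L where "(g k \<longlongrightarrow> L) (at_right 0)" ..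
  then have "((\<lambda>t. (- 1) ^ k * g k t) \<longlongrightarrow> (- 1) ^ k * L) (at_right 0)" by (intro tendsto_intros)
  moreover have "(\<lambda>t. (- 1) ^ k * g k t) = pairing ((normal_deriv ^^ k) u) F"
    by (rule ext) (simp add: g_def flip: power_add mult.assoc mult_2)
  ultimately show "\<exists>L. (pairing ((normal_deriv ^^ k) u) F \<longlongrightarrow> L) (at_right 0)" by auto
qed

section \<open>Solutions that stay bounded at the centre\<close>

text \<open>
  The quotient \<open>K / sinh^m\<close> is nondecreasing; a positive value would make \<open>K\<close> grow like \<open>sinh^m\<close> towards the centre
  of the ball.
\<close>

lemma nonpos_of_growth:
  fixes K K1 :: "real \<Rightarrow> real"
  assumes m: "m \<ge> (1::nat)" and d: "\<And>t. t > 0 \<Longrightarrow> (K has_real_derivative K1 t) (at t)"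
    and ineq: "\<And>t. t > 0 \<Longrightarrow> sinh t * K1 t \<ge> real m * cosh t * K t"
    and bound: "\<And>t. t \<ge> 1 \<Longrightarrow> K t \<le> C" and t: "t > 0"
  shows "K t \<le> 0"
proof (rule ccontr)
  assume "\<not> K t \<le> 0"
  define Y where "Y s = K s / sinh s ^ m" for s
  have Yd: "\<exists>D. (Y has_real_derivative D) (at s) \<and> D \<ge> 0" if s: "s > 0" for s
  proof -
    have p: "sinh s > 0" using s by simp
    have "(Y has_real_derivative (K1 s * sinh s ^ m - K s * (real m * (cosh s * sinh s ^ (m - 1)))) / (sinh s ^ m * sinh s ^ m)) (at s)"
      unfolding Y_def[abs_def] by (rule derivative_eq_intros d[OF s] refl | use p in simp)+
    moreover have "K1 s * sinh s ^ m - K s * (real m * (cosh s * sinh s ^ (m - 1)))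
        = sinh s ^ (m - 1) * (sinh s * K1 s - real m * cosh s * K s)"
      using m by (cases m) (auto simp: algebra_simps)
    moreover have "\<dots> \<ge> 0" using ineq[OF s] p by simp
    ultimately show ?thesis using p by (metis divide_nonneg_nonneg mult_nonneg_nonneg zero_le_power less_imp_le)
  qed
  have Yt: "Y t > 0" using \<open>\<not> K t \<le> 0\<close> t by (simp add: Y_def)
  have "\<forall>\<^sub>F s in at_top. max 1 (C / Y t) < sinh (s::real)"
    by (rule filterlim_at_top_dense[THEN iffD1, rule_format, OF sinh_real_at_top])
  moreover have "\<forall>\<^sub>F s in at_top. max 1 t \<le> (s::real)" by (rule eventually_ge_at_top)
  ultimately have "\<forall>\<^sub>F s in at_top. max 1 (C / Y t) < sinh (s::real) \<and> max 1 t \<le> s" by (rule eventually_conj)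
  from eventually_happens'[OF trivial_limit_at_top_linorder this]
  obtain s :: real where "max 1 (C / Y t) < sinh s" "max 1 t \<le> s" by (elim exE conjE) (rule that)
  then have s: "1 < sinh s" "C / Y t < sinh s" "1 \<le> s" "t \<le> s" by auto
  have "Y t \<le> Y s" by (rule DERIV_nonneg_imp_nondecreasing[OF s(4)]) (use Yd t in auto)
  then have "Y t * sinh s ^ m \<le> K s" using s by (simp add: Y_def pos_le_divide_eq)
  also have "\<dots> \<le> C" by (rule bound[OF s(3)])
  also have "C < Y t * sinh s" using s(2) Yt by (simp add: pos_divide_less_eq mult.commute)
  also have "\<dots> \<le> Y t * sinh s ^ m" using s(1) m Yt by (intro mult_left_mono self_le_power) auto
  finally show False by simp
qed

text \<open>
  The solutions are the multiples of \<open>sinh^m\<close>, and only zero is bounded for large \<open>t\<close>.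
\<close>

lemma first_order_zero:
  fixes y y' :: "real \<Rightarrow> complex"
  assumes m: "m \<ge> (1::nat)" and d: "\<And>t. t > 0 \<Longrightarrow> (y has_vector_derivative y' t) (at t)"
    and eq: "\<And>t. t > 0 \<Longrightarrow> sinh t *\<^sub>R y' t = (real m * cosh t) *\<^sub>R y t"
    and bound: "\<And>t. t \<ge> 1 \<Longrightarrow> norm (y t) \<le> C" and t: "t > 0"
  shows "y t = 0"
proof -
  have "y t \<bullet> y t \<le> 0"
  proof (rule nonpos_of_growth[of "2 * m" "\<lambda>t. y t \<bullet> y t" "\<lambda>t. 2 * (y t \<bullet> y' t)" "C * C"])
    show "((\<lambda>t. y t \<bullet> y t) has_real_derivative 2 * (y t \<bullet> y' t)) (at t)" if "t > 0" for t
      using bounded_bilinear.has_vector_derivative[OF bounded_bilinear_inner d[OF that] d[OF that]]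
      by (simp add: has_real_derivative_iff_has_vector_derivative inner_commute)
    show "sinh t * (2 * (y t \<bullet> y' t)) \<ge> real (2 * m) * cosh t * (y t \<bullet> y t)" if "t > 0" for t
    proof -
      have "sinh t * (y t \<bullet> y' t) = y t \<bullet> (sinh t *\<^sub>R y' t)" by simp
      also have "\<dots> = real m * cosh t * (y t \<bullet> y t)" unfolding eq[OF that] by simp
      finally show ?thesis by simp
    qed
    show "y t \<bullet> y t \<le> C * C" if "t \<ge> 1" for t
      using mult_mono[OF bound[OF that] bound[OF that] order_trans[OF norm_ge_zero bound[OF that]] norm_ge_zero]
      by (simp add: dot_square_norm power2_eq_square)
  qed (use m t in auto)
  then show ?thesis by (metis inner_ge_zero inner_eq_zero_iff order_antisym)
qed

lemma pairing_bounded_at_centre: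
  fixes v F :: "'a::euclidean_space \<Rightarrow> complex"
  assumes v: "continuous_on (ball 0 1) v" and F: "continuous_on (sphere 0 1) F"
  shows "\<exists>C. \<forall>t\<ge>1. norm (pairing v F t) \<le> C"
proof -
  have "continuous_on (cball 0 (exp (- 1))) v"
  proof (rule continuous_on_subset[OF v], rule subsetI)
    fix x :: 'a assume "x \<in> cball 0 (exp (- 1))"
    moreover have "exp (- 1) < (1::real)" by simp
    ultimately show "x \<in> ball 0 1" unfolding mem_ball_0 mem_cball_0 by (rule le_less_trans)
  qed
  then obtain B where B: "\<forall>x\<in>cball 0 (exp (- 1)). norm (v x) \<le> B"
    by (rule continuous_on_compact_bound) (rule compact_cball, rule that)
  obtain B' where B': "\<forall>x\<in>sphere 0 1. norm (F x) \<le> B'"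
    by (rule continuous_on_compact_bound[OF F compact_sphere]) (rule that)
  have "norm (pairing v F t) \<le> (LINT z|(sphere_measure :: 'a measure). B * B')" if t: "t \<ge> 1" for t
    unfolding pairing_alt
  proof (rule order_trans[OF integral_norm_bound integral_mono])
    have "integrable sphere_measure (\<lambda>z. ray v z t * F z)"
      by (intro integrable_sphere continuous_intros ray_continuous_on_sphere v F) (use t in simp)
    then show "integrable sphere_measure (\<lambda>z. norm (ray v z t * F z))" by (rule integrable_norm)
    have "finite_measure (sphere_measure :: 'a measure)"
      using compact_measure_sphere unfolding compact_measure_def by blast
    then show "integrable (sphere_measure :: 'a measure) (\<lambda>z. B * B')" by (rule finite_measure.integrable_const)
    fix z :: 'a assume "z \<in> space sphere_measure"
    then have z: "norm z = 1" "z \<in> sphere 0 1" by (auto simp: space_sphere_measure)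
    have "exp (- t) *\<^sub>R z \<in> cball 0 (exp (- 1))" using z t by simp
    then have 1: "norm (v (exp (- t) *\<^sub>R z)) \<le> B" by (rule B[rule_format])
    then have "0 \<le> B" by (rule order_trans[OF norm_ge_zero])
    then show "norm (ray v z t * F z) \<le> B * B'"
      unfolding ray_def norm_mult using 1 B' z by (intro mult_mono) auto
  qed
  then show ?thesis by blast
qed

section \<open>Separation of points on the sphere by monomials\<close>

lemma continuous_on_monomial: "continuous_on S (monomial w)"
  using smooth_on_continuous[OF smooth_on_monomial[OF open_UNIV]] continuous_on_subset by blast

lemma continuous_on_real_polynomial: "real_polynomial_function p \<Longrightarrow> continuous_on S p"
  by (induction rule: real_polynomial_function.induct) (auto intro: continuous_intros linear_continuous_on)

text \<open>
  The functions \<open>g\<close> orthogonal to all words form a set that is stable under multiplication by coordinates,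
  hence by polynomials.
\<close>

lemma integral_real_polynomial_eq_0:
  fixes g :: "'a::euclidean_space \<Rightarrow> complex" and p :: "'a \<Rightarrow> real"
  assumes "real_polynomial_function p" "continuous_on (sphere 0 1) g"
    and "\<And>w. w \<in> lists Basis \<Longrightarrow> (LINT x|sphere_measure. g x * monomial w x) = 0"
    and "w \<in> lists Basis"
  shows "(LINT x|sphere_measure. g x * complex_of_real (p x) * monomial w x) = 0"
  using assms
proof (induction arbitrary: g w rule: real_polynomial_function.induct)
  case (linear f)
  have e: "f x = (\<Sum>b\<in>Basis. (x \<bullet> b) * f b)" for x
  proof -
    have "f x = f (\<Sum>b\<in>Basis. (x \<bullet> b) *\<^sub>R b)" by (simp add: euclidean_representation)
    then show ?thesis
      by (simp add: linear_sum[OF bounded_linear.linear[OF linear.hyps]] linear_scale[OF bounded_linear.linear[OF linear.hyps]])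
  qed
  have "(LINT x|sphere_measure. g x * complex_of_real (f x) * monomial w x)
     = (LINT x|sphere_measure. (\<Sum>b\<in>Basis. complex_of_real (f b) * (g x * monomial (b # w) x)))"
  proof (rule Bochner_Integration.integral_cong[OF refl])
    show "g x * complex_of_real (f x) * monomial w x = (\<Sum>b\<in>Basis. complex_of_real (f b) * (g x * monomial (b # w) x))" for x
      by (subst e) (simp add: sum_distrib_left sum_distrib_right mult_ac)
  qed
  also have "\<dots> = (\<Sum>b\<in>Basis. (LINT x|sphere_measure. complex_of_real (f b) * (g x * monomial (b # w) x)))"
    by (intro Bochner_Integration.integral_sum integrable_sphere continuous_intros linear.prems(1) continuous_on_monomial)
  also have "\<dots> = (\<Sum>b\<in>Basis. complex_of_real (f b) * (LINT x|sphere_measure. g x * monomial (b # w) x))"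
    by (intro sum.cong refl integral_mult_right_zero)
  also have "\<dots> = 0"
  proof (rule sum.neutral, rule ballI)
    fix b :: 'a assume b: "b \<in> Basis"
    have "(LINT x|sphere_measure. g x * monomial (b # w) x) = 0"
      by (rule linear.prems(2)) (use b linear.prems(3) in simp)
    then show "complex_of_real (f b) * (LINT x|sphere_measure. g x * monomial (b # w) x) = 0" by simp
  qed
  finally show ?case .
next
  case (const c)
  have "(LINT x|sphere_measure. g x * complex_of_real c * monomial w x)
     = (LINT x|sphere_measure. complex_of_real c * (g x * monomial w x))" by (simp add: mult_ac)
  also have "\<dots> = complex_of_real c * (LINT x|sphere_measure. g x * monomial w x)" by (rule integral_mult_right_zero)
  finally show ?case using const by simp
next
  case (add f h)
  note c = continuous_on_real_polynomial[OF add.hyps(1)] continuous_on_real_polynomial[OF add.hyps(2)]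
  have "(LINT x|sphere_measure. g x * complex_of_real (f x + h x) * monomial w x)
     = (LINT x|sphere_measure. g x * complex_of_real (f x) * monomial w x + g x * complex_of_real (h x) * monomial w x)"
    by (simp add: ring_distribs)
  also have "\<dots> = (LINT x|sphere_measure. g x * complex_of_real (f x) * monomial w x)
      + (LINT x|sphere_measure. g x * complex_of_real (h x) * monomial w x)"
    by (intro Bochner_Integration.integral_add integrable_sphere continuous_intros add.prems(1) continuous_on_monomial c)
  also have "\<dots> = 0" using add.IH(1)[OF add.prems] add.IH(2)[OF add.prems] by simp
  finally show ?case .
next
  case (mult f h)
  have c: "continuous_on (sphere 0 1) (\<lambda>x. g x * complex_of_real (f x))"
    by (intro continuous_intros mult.prems(1) continuous_on_real_polynomial mult.hyps)
  have "(LINT x|sphere_measure. g x * complex_of_real (f x) * complex_of_real (h x) * monomial w x) = 0"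
    by (rule mult.IH(2)[OF c mult.IH(1)[OF mult.prems(1,2)] mult.prems(3)])
  then show ?case by (simp add: mult.assoc)
qed

text \<open>
  By the Stone-Weierstrass theorem \<open>cnj f\<close> is a uniform limit of polynomials on the sphere, so \<open>f\<close> is orthogonal
  to itself.
\<close>

lemma monomials_separate:
  fixes f :: "'a::euclidean_space \<Rightarrow> complex"
  assumes f: "continuous_on (sphere 0 1) f"
    and 0: "\<And>w. w \<in> lists Basis \<Longrightarrow> (LINT x|sphere_measure. f x * monomial w x) = 0"
    and z: "z \<in> sphere 0 1"
  shows "f z = 0"
proof -
  let ?I = "LINT x|sphere_measure. f x * cnj (f x)"
  define C where "C = (LINT x|sphere_measure. norm (f x))"
  have poly: "(LINT x|sphere_measure. f x * complex_of_real (p x)) = 0" if "real_polynomial_function p" for p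
    using integral_real_polynomial_eq_0[OF that f 0, of "[]"] by simp
  have nf: "integrable sphere_measure (\<lambda>x. norm (f x))" by (rule integrable_norm[OF integrable_sphere[OF f]])
  have C0: "C \<ge> 0" unfolding C_def by (rule Bochner_Integration.integral_nonneg) simp
  have app: "norm ?I \<le> (2 * e) * C" if e: "e > 0" for e
  proof -
    have "continuous_on (sphere 0 1) (\<lambda>x. Re (f x))" "continuous_on (sphere 0 1) (\<lambda>x. Im (f x))"
      by (intro continuous_intros f)+
    then obtain p q where p: "real_polynomial_function p" "\<And>x. x \<in> sphere 0 1 \<Longrightarrow> \<bar>Re (f x) - p x\<bar> < e"
      and q: "real_polynomial_function q" "\<And>x. x \<in> sphere 0 1 \<Longrightarrow> \<bar>Im (f x) - q x\<bar> < e"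
      using Stone_Weierstrass_real_polynomial_function[OF compact_sphere _ e] by metis
    let ?r = "\<lambda>x. cnj (f x) - (complex_of_real (p x) - \<i> * complex_of_real (q x))"
    note c = continuous_on_real_polynomial[OF p(1), of "sphere 0 1"] continuous_on_real_polynomial[OF q(1), of "sphere 0 1"]
    have "(LINT x|sphere_measure. f x * ?r x)
       = (LINT x|sphere_measure. f x * cnj (f x) - (f x * complex_of_real (p x) - \<i> * (f x * complex_of_real (q x))))"
      by (simp add: algebra_simps)
    also have "\<dots> = ?I - ((LINT x|sphere_measure. f x * complex_of_real (p x)) - (LINT x|sphere_measure. \<i> * (f x * complex_of_real (q x))))"
      by (subst Bochner_Integration.integral_diff, (intro integrable_sphere Bochner_Integration.integrable_diff continuous_intros f c)+)
        (subst Bochner_Integration.integral_diff, (intro integrable_sphere continuous_intros f c)+, rule refl)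
    also have "\<dots> = ?I" unfolding integral_mult_right_zero poly[OF p(1)] poly[OF q(1)] by simp
    finally have "norm ?I = norm (LINT x|sphere_measure. f x * ?r x)" by (rule arg_cong[OF sym])
    also have "\<dots> \<le> (LINT x|sphere_measure. (2 * e) * norm (f x))"
    proof (rule order_trans[OF integral_norm_bound integral_mono])
      show "integrable sphere_measure (\<lambda>x. norm (f x * ?r x))"
        by (intro integrable_norm integrable_sphere continuous_intros f c)
      show "integrable sphere_measure (\<lambda>x. (2 * e) * norm (f x))" by (rule integrable_mult_right[OF nf])
      fix x :: 'a assume "x \<in> space sphere_measure"
      then have x: "x \<in> sphere 0 1" by (simp add: space_sphere_measure)
      have "norm (?r x) \<le> \<bar>Re (?r x)\<bar> + \<bar>Im (?r x)\<bar>" by (rule cmod_le)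
      also have "\<dots> \<le> 2 * e" using p(2)[OF x] q(2)[OF x] by simp
      finally show "norm (f x * ?r x) \<le> (2 * e) * norm (f x)"
        unfolding norm_mult by (subst mult.commute) (rule mult_right_mono, simp_all)
    qed
    also have "\<dots> = (2 * e) * C" unfolding C_def by (rule integral_mult_right_zero)
    finally show ?thesis .
  qed
  have "norm ?I \<le> 0 + e" if e: "e > 0" for e
  proof -
    have "norm ?I \<le> (2 * (e / (2 * (C + 1)))) * C" by (rule app) (use e C0 in simp)
    also have "\<dots> = e * (C / (C + 1))" unfolding times_divide_eq_right mult_divide_mult_cancel_left_if by simp
    also have "\<dots> \<le> e * 1" using e C0 by (intro mult_left_mono) auto
    finally show ?thesis by simp
  qed
  then have "norm ?I \<le> 0" by (rule field_le_epsilon)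
  then have "?I = 0" by simp
  from sphere_integral_eq_0[OF f this z] show ?thesis .
qed

section \<open>Boundary values that vanish\<close>

lemma near_linear_pairing:
  assumes u: "continuous_on (ball 0 1) u" and t: "t > 0"
  shows "near_linear (\<lambda>F. pairing u F t)"
proof -
  have i: "integrable sphere_measure (\<lambda>z. ray u z t * F z)" if "smooth_on UNIV F" for F
    by (intro integrable_sphere continuous_on_mult ray_continuous_on_sphere[OF u t]
        continuous_on_subset[OF smooth_on_continuous[OF that]]) simp
  show ?thesis unfolding near_linear_def
  proof (intro conjI allI impI)
    show "pairing u (\<lambda>x. f x + g x) t = pairing u f t + pairing u g t" if "smooth_on UNIV f" "smooth_on UNIV g" for f g
      unfolding pairing_alt distrib_left by (rule Bochner_Integration.integral_add[OF i[OF that(1)] i[OF that(2)]])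
    show "pairing u (\<lambda>x. a * f x) t = a * pairing u f t" for f a
      unfolding pairing_alt mult.left_commute[of _ a] by (rule integral_mult_right_zero)
  qed
qed

lemma near_linear_limit:
  assumes l: "\<And>t. t > 0 \<Longrightarrow> near_linear (\<lambda>F. l F t)"
    and lim: "\<And>F. smooth_on UNIV F \<Longrightarrow> (l F \<longlongrightarrow> \<beta> F) (at_right (0::real))"
  shows "near_linear \<beta>"
  unfolding near_linear_def
proof (intro conjI allI impI)
  have pos: "\<forall>\<^sub>F t in at_right (0::real). 0 < t" by (rule eventually_at_right_less)
  fix f g :: "'a \<Rightarrow> complex" assume s: "smooth_on UNIV f" "smooth_on UNIV g"
  have "((\<lambda>t. l f t + l g t) \<longlongrightarrow> \<beta> f + \<beta> g) (at_right 0)" by (intro tendsto_add lim s)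
  moreover have "\<forall>\<^sub>F t in at_right 0. l f t + l g t = l (\<lambda>x. f x + g x) t"
    by (rule eventually_mono[OF pos]) (rule near_linear_add[OF l s, symmetric])
  ultimately have "(l (\<lambda>x. f x + g x) \<longlongrightarrow> \<beta> f + \<beta> g) (at_right 0)" by (rule Lim_transform_eventually)
  then show "\<beta> (\<lambda>x. f x + g x) = \<beta> f + \<beta> g"
    by (rule tendsto_unique[OF trivial_limit_at_right_real lim[OF smooth_on_add[OF open_UNIV s]]])
next
  have pos: "\<forall>\<^sub>F t in at_right (0::real). 0 < t" by (rule eventually_at_right_less)
  fix f :: "'a \<Rightarrow> complex" and a assume s: "smooth_on UNIV f"
  have "((\<lambda>t. a * l f t) \<longlongrightarrow> a * \<beta> f) (at_right 0)" by (intro tendsto_mult_left lim s)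
  moreover have "\<forall>\<^sub>F t in at_right 0. a * l f t = l (\<lambda>x. a * f x) t"
    by (rule eventually_mono[OF pos]) (rule near_linear_scale[OF l s, symmetric])
  ultimately have "(l (\<lambda>x. a * f x) \<longlongrightarrow> a * \<beta> f) (at_right 0)" by (rule Lim_transform_eventually)
  then show "\<beta> (\<lambda>x. a * f x) = a * \<beta> f"
    by (rule tendsto_unique[OF trivial_limit_at_right_real lim[OF smooth_on_mult[OF open_UNIV smooth_on_const s]]])
qed

lemma near_linear_sph_lap_pow: "near_linear \<beta> \<Longrightarrow> near_linear (\<lambda>F. \<beta> ((sph_lap ^^ j) F))"
proof (induction j)
  case (Suc j)
  then show ?case using near_linear_sph_lap[of "\<lambda>F. \<beta> ((sph_lap ^^ j) F)"]
    by (simp only: funpow_Suc_right o_def)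
qed simp

lemma near_linear_lincomb:
  "near_linear l \<Longrightarrow> near_linear m \<Longrightarrow> near_linear (\<lambda>F. l F + c *\<^sub>R m F)"
  unfolding near_linear_def by (simp add: algebra_simps scaleR_conv_of_real)

lemma near_linear_bseq:
  assumes "near_linear \<beta>"
  shows "near_linear (\<lambda>F. bseq m (\<lambda>j. \<beta> ((sph_lap ^^ j) F)) i j)"
proof (induction i arbitrary: j)
  case 0
  show ?case using near_linear_sph_lap_pow[OF assms, of j] by simp
next
  case (Suc i)
  show ?case unfolding bseq.simps by (rule near_linear_lincomb[OF Suc Suc])
qed

lemma bseq_shift:
  "bseq m (\<lambda>j. \<beta> ((sph_lap ^^ j) F)) i (Suc j) = bseq m (\<lambda>j. \<beta> ((sph_lap ^^ j) (sph_lap F))) i j"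
  by (induction i arbitrary: j) (simp_all add: funpow_swap1)

text \<open>
  The recursion for \<open>bseq\<close> adds a factor \<open>\<Lambda> - i (m - i)\<close> at step \<open>i\<close>, and \<open>i (m - i) > 0\<close> for \<open>0 < i < p\<close>. The factors
  are removed from the outside in, until only the factor \<open>\<Lambda>\<close> of step \<open>0\<close> is left.
\<close>

lemma sph_lap_boundary_value_eq_0:
  fixes \<beta> :: "('a::euclidean_space \<Rightarrow> complex) \<Rightarrow> complex"
  assumes \<beta>: "near_linear \<beta>" and mp: "m + 1 = 2 * p" "p \<ge> 1"
    and z: "\<And>F. smooth_on UNIV F \<Longrightarrow> bseq m (\<lambda>j. \<beta> ((sph_lap ^^ j) F)) p 0 = 0"
    and w: "w \<in> words d"
  shows "\<beta> (sph_lap (monomial w)) = 0"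
proof -
  define B where "B i F = bseq m (\<lambda>j. \<beta> ((sph_lap ^^ j) F)) i 0" for i F
  have B: "near_linear (B i)" for i unfolding B_def by (rule near_linear_bseq[OF \<beta>])
  have B_Suc: "B (Suc i) F = B i (sph_lap F) + complex_of_real (coef_b m i) * B i F" for i F
    unfolding B_def bseq.simps bseq_shift by (simp add: scaleR_conv_of_real)
  have sm: "smooth_on UNIV (monomial w :: 'a \<Rightarrow> complex)" for w by (rule smooth_on_monomial) simp
  have "\<forall>w\<in>words d. B 1 (monomial w) = 0"
  proof (rule inc_induct[OF mp(2)])
    show "\<forall>w\<in>words d. B p (monomial w) = 0" unfolding B_def using z sm by blast
  next
    fix i assume i: "1 \<le> i" "i < p" and IH: "\<forall>w\<in>words d. B (Suc i) (monomial w) = 0"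
    have c: "- coef_b m i > 0" unfolding coef_b_def using i mp by (simp add: mult_less_0_iff)
    show "\<forall>w\<in>words d. B i (monomial w) = 0"
    proof
      fix w :: "'a list" assume w: "w \<in> words d"
      show "B i (monomial w) = 0"
      proof (rule peel_sph_lap[OF B c _ w])
        fix v :: "'a list" assume v: "v \<in> words d"
        have "B i (\<lambda>x. sph_lap (monomial v) x + complex_of_real (coef_b m i) * monomial v x)
            = B i (sph_lap (monomial v)) + complex_of_real (coef_b m i) * B i (monomial v)"
          unfolding near_linear_scale[OF B sm, symmetric]
          by (rule near_linear_add[OF B smooth_on_sph_lap[OF open_UNIV sm] smooth_on_mult[OF open_UNIV smooth_on_const sm]])
        then show "B i (\<lambda>x. sph_lap (monomial v) x - complex_of_real (- coef_b m i) * monomial v x) = 0"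
          using IH v B_Suc by simp
      qed
    qed
  qed
  then have "B (Suc 0) (monomial w) = 0" using w by simp
  then show ?thesis unfolding B_Suc by (simp add: B_def coef_b_def)
qed

text \<open>
  For the sum \<open>E\<close> of the squares of the pairings with all words of length \<open>d\<close>, half the derivative, \<open>K\<close>, satisfies
  \<open>sinh t K' \<ge> m cosh t K\<close>: the term with \<open>\<Lambda>\<close> has a sign because \<open>\<Lambda>\<close> is negative. As \<open>K\<close> is bounded at the centre it
  is nonpositive, so \<open>E\<close> decreases from its boundary value zero.
\<close>

lemma pairing_zero_of_boundary_zero:
  fixes u :: "'a::euclidean_space \<Rightarrow> complex"
  assumes n: "DIM('a) \<ge> 3" and u: "smooth_on (ball 0 1) u"
    and D: "\<And>x. x \<in> ball 0 1 \<Longrightarrow> hyp_laplacian u x = 0"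
    and lim: "\<And>w. w \<in> words d \<Longrightarrow> (pairing u (sph_lap (monomial w)) \<longlongrightarrow> 0) (at_right 0)"
    and w: "w \<in> words d" and t: "t > 0"
  shows "pairing u (sph_lap (monomial w)) t = 0"
proof -
  define m where "m = DIM('a) - 2"
  have m: "m \<ge> 1" "real DIM('a) - 2 = real m" using n by (auto simp: m_def)
  have sm: "smooth_on UNIV (monomial w :: 'a \<Rightarrow> complex)" for w by (rule smooth_on_monomial) simp
  define P where "P w = sph_lap (monomial w :: 'a \<Rightarrow> complex)" for w
  have sP: "smooth_on UNIV (P w)" for w unfolding P_def by (rule smooth_on_sph_lap[OF open_UNIV sm])
  have nP: "smooth_near (P w)" and cP: "continuous_on (sphere 0 1) (P w)" for w
    using smooth_near_UNIV[OF sP] smooth_near_continuous by auto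
  have nu: "smooth_on (ball 0 1) (normal_deriv u)" by (rule smooth_on_normal_deriv[OF open_ball u])
  define a where "a w t = pairing u (P w) t" for w t
  define a1 where "a1 w t = - pairing (normal_deriv u) (P w) t" for w t
  define a2 where "a2 w t = pairing (normal_deriv (normal_deriv u)) (P w) t" for w t
  define aL where "aL w t = pairing u (sph_lap (P w)) t" for w t
  have da: "(a w has_vector_derivative a1 w t) (at t)" if "t > 0" for w t
    unfolding a_def[abs_def] a1_def by (rule pairing_derivative[OF u cP that])
  have da1: "(a1 w has_vector_derivative a2 w t) (at t)" if "t > 0" for w t
    using has_vector_derivative_minus[OF pairing_derivative[OF nu cP that, of w]]
    unfolding a1_def[abs_def] a2_def by simp
  have ode: "sinh t *\<^sub>R a2 w t = (real m * cosh t) *\<^sub>R a1 w t - sinh t *\<^sub>R aL w t" if "t > 0" for w t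
    using pairing_equation[OF u D nP that, of w] unfolding a1_def a2_def aL_def m(2)
    by (simp add: algebra_simps eq_neg_iff_add_eq_0)
  (* the energy, half its derivative, and the derivative of that *)
  define E where "E t = (\<Sum>w\<in>words d. a w t \<bullet> a w t)" for t
  define K where "K t = (\<Sum>w\<in>words d. a w t \<bullet> a1 w t)" for t
  define K1 where "K1 t = (\<Sum>w\<in>words d. a1 w t \<bullet> a1 w t + a w t \<bullet> a2 w t)" for t
  have dE: "(E has_real_derivative 2 * K t) (at t)" if "t > 0" for t
    unfolding E_def[abs_def] K_def sum_distrib_left has_real_derivative_iff_has_vector_derivative
  proof (rule has_vector_derivative_sum)
    show "((\<lambda>t. a w t \<bullet> a w t) has_vector_derivative 2 * (a w t \<bullet> a1 w t)) (at t)" for w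
      using bounded_bilinear.has_vector_derivative[OF bounded_bilinear_inner da[OF that, of w] da[OF that, of w]]
      by (simp add: inner_commute)
  qed
  have dK: "(K has_real_derivative K1 t) (at t)" if "t > 0" for t
    unfolding K_def[abs_def] K1_def has_real_derivative_iff_has_vector_derivative
  proof (rule has_vector_derivative_sum)
    show "((\<lambda>t. a w t \<bullet> a1 w t) has_vector_derivative a1 w t \<bullet> a1 w t + a w t \<bullet> a2 w t) (at t)" for w
      using bounded_bilinear.has_vector_derivative[OF bounded_bilinear_inner da[OF that, of w] da1[OF that, of w]]
      by (simp add: add.commute)
  qed
  have neg: "(\<Sum>w\<in>words d. a w t \<bullet> aL w t) \<le> 0" if t: "t > 0" for t
  proof -
    have l: "near_linear (\<lambda>F. pairing u (sph_lap F) t)"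
      by (rule near_linear_sph_lap[OF near_linear_pairing[OF smooth_on_continuous[OF u] t]])
    have "\<exists>r\<ge>0. (\<Sum>w\<in>words d. cnj (a w t) * aL w t) = - complex_of_real r"
      unfolding a_def aL_def P_def by (rule sph_lap_negative[OF l])
    then obtain r where r: "r \<ge> 0" "(\<Sum>w\<in>words d. cnj (a w t) * aL w t) = - complex_of_real r"
      by (elim exE conjE) (rule that)
    have "(\<Sum>w\<in>words d. a w t \<bullet> aL w t) = Re (\<Sum>w\<in>words d. cnj (a w t) * aL w t)"
      by (simp add: inner_complex_def)
    then show ?thesis using r by simp
  qed
  have growth: "sinh t * K1 t \<ge> real m * cosh t * K t" if t: "t > 0" for t
  proof -
    have "sinh t * K1 t = (\<Sum>w\<in>words d. sinh t * (a1 w t \<bullet> a1 w t) + a w t \<bullet> (sinh t *\<^sub>R a2 w t))"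
      by (simp add: K1_def sum_distrib_left distrib_left)
    also have "\<dots> = sinh t * (\<Sum>w\<in>words d. a1 w t \<bullet> a1 w t) + real m * cosh t * K t
        - sinh t * (\<Sum>w\<in>words d. a w t \<bullet> aL w t)"
      unfolding ode[OF t] by (simp add: K_def inner_diff_right sum.distrib sum_subtractf sum_distrib_left algebra_simps)
    finally have e: "sinh t * K1 t = sinh t * (\<Sum>w\<in>words d. a1 w t \<bullet> a1 w t) + real m * cosh t * K t
        - sinh t * (\<Sum>w\<in>words d. a w t \<bullet> aL w t)" .
    have "0 \<le> sinh t * (\<Sum>w\<in>words d. a1 w t \<bullet> a1 w t)" using t by (intro mult_nonneg_nonneg sum_nonneg) auto
    moreover have "sinh t * (\<Sum>w\<in>words d. a w t \<bullet> aL w t) \<le> 0" using t neg[OF t] by (intro mult_nonneg_nonpos) auto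
    ultimately show ?thesis unfolding e by linarith
  qed
  have bound: "\<exists>C. \<forall>t\<ge>1. K t \<le> C"
  proof -
    have "\<forall>w. \<exists>C. \<forall>t\<ge>1. norm (a w t) \<le> C"
      unfolding a_def by (intro allI pairing_bounded_at_centre smooth_on_continuous[OF u] cP)
    from choice[OF this] obtain A where A': "\<forall>w. \<forall>t\<ge>1. norm (a w t) \<le> A w" by (elim exE) (rule that)
    have "\<forall>w. \<exists>C. \<forall>t\<ge>1. norm (a1 w t) \<le> C"
      unfolding a1_def norm_minus_cancel by (intro allI pairing_bounded_at_centre smooth_on_continuous[OF nu] cP)
    from choice[OF this] obtain A1 where A1': "\<forall>w. \<forall>t\<ge>1. norm (a1 w t) \<le> A1 w" by (elim exE) (rule that)
    have A: "norm (a w t) \<le> A w" and A1: "norm (a1 w t) \<le> A1 w" if "t \<ge> 1" for w t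
      using A' A1' that by auto
    have "K t \<le> (\<Sum>w\<in>words d. A w * A1 w)" if t: "t \<ge> 1" for t
      unfolding K_def
    proof (rule sum_mono)
      fix w
      have "a w t \<bullet> a1 w t \<le> norm (a w t) * norm (a1 w t)" by (rule norm_cauchy_schwarz)
      also have "\<dots> \<le> A w * A1 w"
        by (rule mult_mono[OF A[OF t] A1[OF t] order_trans[OF norm_ge_zero A[OF t]] norm_ge_zero])
      finally show "a w t \<bullet> a1 w t \<le> A w * A1 w" .
    qed
    then show ?thesis by blast
  qed
  then obtain C where C': "\<forall>t\<ge>1. K t \<le> C" by (elim exE) (rule that)
  have C: "K t \<le> C" if "t \<ge> 1" for t using C' that by simp
  have K0: "K t \<le> 0" if "t > 0" for t by (rule nonpos_of_growth[OF m(1) dK growth C that])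
  have mono: "E t \<le> E s" if "0 < s" "s \<le> t" for s t
  proof (rule DERIV_nonpos_imp_nonincreasing[OF that(2)])
    fix x assume "s \<le> x"
    then have x: "x > 0" using that(1) by simp
    show "\<exists>y. (E has_real_derivative y) (at x) \<and> y \<le> 0"
      using dE[OF x] K0[OF x] by (intro exI[of _ "2 * K x"] conjI) auto
  qed
  have "(E \<longlongrightarrow> (\<Sum>w\<in>(words d :: 'a list set). 0 \<bullet> (0::complex))) (at_right 0)"
    unfolding E_def[abs_def] a_def P_def
  proof (rule tendsto_sum)
    fix w :: "'a list" assume w: "w \<in> words d"
    show "((\<lambda>t. pairing u (sph_lap (monomial w)) t \<bullet> pairing u (sph_lap (monomial w)) t) \<longlongrightarrow> 0 \<bullet> (0::complex)) (at_right 0)"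
      by (rule tendsto_inner[OF lim[OF w] lim[OF w]])
  qed
  then have E0: "(E \<longlongrightarrow> 0) (at_right 0)" by simp
  have "\<forall>\<^sub>F s in at_right 0. E t \<le> E s"
    by (rule eventually_mono[OF eventually_at_right_real[OF t]]) (rule mono, auto)
  from tendsto_lowerbound[OF E0 this trivial_limit_at_right_real] have "E t \<le> 0" .
  moreover have "E t \<ge> 0" unfolding E_def by (intro sum_nonneg) simp
  ultimately have "E t = 0" by simp
  then show ?thesis using w unfolding E_def
    by (simp add: sum_nonneg_eq_0_iff[OF finite_words] a_def P_def)
qed

text \<open>
  Without the term \<open>\<Lambda>\<close> the derivative of a pairing solves a first-order equation whose bounded solutions
  vanish. So \<open>u(exp (- t) \<zeta>) - u(exp (- s) \<zeta>)\<close> is orthogonal to all polynomials, and \<open>s \<rightarrow> \<infinity>\<close> gives \<open>u 0\<close>.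
\<close>

lemma constant_of_pairing_zero:
  fixes u :: "'a::euclidean_space \<Rightarrow> complex"
  assumes n: "DIM('a) \<ge> 3" and u: "smooth_on (ball 0 1) u"
    and D: "\<And>x. x \<in> ball 0 1 \<Longrightarrow> hyp_laplacian u x = 0"
    and z: "\<And>w t. w \<in> lists Basis \<Longrightarrow> t > 0 \<Longrightarrow> pairing u (sph_lap (monomial w)) t = 0"
    and x: "x \<in> ball 0 1"
  shows "u x = u 0"
proof -
  define m where "m = DIM('a) - 2"
  have m: "m \<ge> 1" "real DIM('a) - 2 = real m" using n by (auto simp: m_def)
  have sm: "smooth_near (monomial w :: 'a \<Rightarrow> complex)" for w
    by (rule smooth_near_UNIV[OF smooth_on_monomial]) simp
  have uc: "continuous_on (ball 0 1) u" by (rule smooth_on_continuous[OF u])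
  have nu: "smooth_on (ball 0 1) (normal_deriv u)" by (rule smooth_on_normal_deriv[OF open_ball u])
  have d0: "pairing (normal_deriv u) (monomial w) t = 0" if w: "w \<in> lists Basis" and t: "t > 0" for w t
  proof -
    from pairing_bounded_at_centre[OF smooth_on_continuous[OF nu] smooth_near_continuous[OF sm[of w]]]
    obtain C where C': "\<forall>t\<ge>1. norm (pairing (normal_deriv u) (monomial w) t) \<le> C" by (elim exE) (rule that)
    have C: "norm (pairing (normal_deriv u) (monomial w) t) \<le> C" if "t \<ge> 1" for t using C' that by simp
    show ?thesis
    proof (rule first_order_zero[OF m(1) pairing_derivative[OF nu smooth_near_continuous[OF sm]] _ C t])
      fix t :: real assume t: "t > 0"
      show "sinh t *\<^sub>R - pairing (normal_deriv (normal_deriv u)) (monomial w) t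
          = (real m * cosh t) *\<^sub>R pairing (normal_deriv u) (monomial w) t"
        using pairing_equation[OF u D sm t, of w] z[OF w t] unfolding m(2) by (simp add: add_eq_0_iff2 minus_equation_iff)
    qed
  qed
  have const: "pairing u (monomial w) t = pairing u (monomial w) s"
    if w: "w \<in> lists Basis" and ts: "t > 0" "s > 0" for w t s
  proof -
    have d: "(pairing u (monomial w) has_vector_derivative 0) (at r)" if r: "r > 0" for r
      using pairing_derivative[OF u smooth_near_continuous[OF sm[of w]] r] unfolding d0[OF w r] minus_zero .
    have le: "pairing u (monomial w) b = pairing u (monomial w) a" if "0 < a" "a \<le> b" for a b
    proof -
      have "norm (pairing u (monomial w) b - pairing u (monomial w) a) \<le> 0 * (b - a)"
        by (rule mv_bound[OF that(2), of _ "\<lambda>_. 0"]) (use that in \<open>simp_all add: d\<close>)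
      then show ?thesis by simp
    qed
    show ?thesis using le[of t s] le[of s t] ts by (cases "t \<le> s") simp_all
  qed
  have ray_const: "ray u \<zeta> t = ray u \<zeta> s" if \<zeta>: "\<zeta> \<in> sphere 0 1" and ts: "t > 0" "s > 0" for \<zeta> t s
  proof -
    note c = ray_continuous_on_sphere[OF uc ts(1)] ray_continuous_on_sphere[OF uc ts(2)]
    have "(LINT x|sphere_measure. (ray u x t - ray u x s) * monomial w x) = 0" if "w \<in> lists Basis" for w
    proof -
      have "(LINT x|sphere_measure. (ray u x t - ray u x s) * monomial w x)
          = pairing u (monomial w) t - pairing u (monomial w) s"
        unfolding pairing_alt left_diff_distrib
        by (intro Bochner_Integration.integral_diff integrable_sphere continuous_on_mult c continuous_on_monomial)
      then show ?thesis using const[OF that ts] by simp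
    qed
    from monomials_separate[OF continuous_on_diff[OF c] this \<zeta>] show ?thesis by simp
  qed
  show ?thesis
  proof (cases "x = 0")
    case False
    define \<zeta> where "\<zeta> = x /\<^sub>R norm x"
    have \<zeta>: "\<zeta> \<in> sphere 0 1" using False by (simp add: \<zeta>_def)
    have e: "u x = ray u \<zeta> (- ln (norm x))" using False by (simp add: ray_def \<zeta>_def)
    have p: "- ln (norm x) > 0" using False x by simp
    have "((\<lambda>s. exp (- s) *\<^sub>R \<zeta>) \<longlongrightarrow> 0 *\<^sub>R \<zeta>) at_top"
      by (intro tendsto_scaleR tendsto_const filterlim_compose[OF exp_at_bot] filterlim_uminus_at_bot_at_top)
    moreover have "isCont u 0" using uc by (simp add: continuous_on_eq_continuous_at)
    ultimately have "((\<lambda>s. ray u \<zeta> s) \<longlongrightarrow> u 0) at_top"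
      unfolding ray_def by (intro isCont_tendsto_compose[of 0 u]) auto
    moreover have "\<forall>\<^sub>F s in at_top. ray u \<zeta> s = u x"
      by (rule eventually_mono[OF eventually_gt_at_top[of 0]]) (unfold e, rule ray_const[OF \<zeta> _ p])
    ultimately have "((\<lambda>s::real. u x) \<longlongrightarrow> u 0) at_top" by (rule Lim_transform_eventually)
    then show ?thesis by (simp add: tendsto_const_iff)
  qed simp
qed

text \<open>
  The comparison function \<open>log (1 / (1 - r))\<close> and \<open>lam\<close> differ by a bounded term and a sign.
\<close>

lemma ln_ratio_limit:
  "((\<lambda>t. - ln (1 - exp (- t)) / lam t) \<longlongrightarrow> - 1) (at_right 0)"
proof -
  have "((\<lambda>t::real. ln (1 + exp (- t))) \<longlongrightarrow> ln (1 + exp (- 0))) (at_right 0)"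
    by (intro tendsto_intros) auto
  from tendsto_divide_0[OF this filterlim_at_bot_imp_at_infinity[OF lam_at_bot]]
  have "((\<lambda>t. - 1 - ln (1 + exp (- t)) / lam t) \<longlongrightarrow> - 1 - 0) (at_right 0)" by (intro tendsto_diff tendsto_const)
  moreover have "\<forall>\<^sub>F t in at_right 0. lam t < 0"
    using lam_at_bot[unfolded filterlim_at_bot_dense] by blast
  then have "\<forall>\<^sub>F t in at_right 0. - 1 - ln (1 + exp (- t)) / lam t = - ln (1 - exp (- t)) / lam t"
    by (rule eventually_mono) (simp add: lam_def field_simps)
  ultimately show ?thesis using Lim_transform_eventually by fastforce
qed

lemma small_o_log_pairing:
  assumes "sphere_pairing w F \<in> o[at_left 1](\<lambda>r. complex_of_real (ln (1 / (1 - r))))"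
  shows "((\<lambda>t. inverse (lam t) *\<^sub>R pairing w F t) \<longlongrightarrow> 0) (at_right 0)"
proof -
  from filterlim_compose[OF smalloD_tendsto[OF assms] filterlim_exp_minus]
  have "((\<lambda>t. pairing w F t / complex_of_real (ln (1 / (1 - exp (- t))))) \<longlongrightarrow> 0) (at_right 0)"
    unfolding pairing_def .
  from tendsto_mult[OF this tendsto_of_real[OF ln_ratio_limit]]
  have "((\<lambda>t. pairing w F t / complex_of_real (ln (1 / (1 - exp (- t)))) * complex_of_real (- ln (1 - exp (- t)) / lam t)) \<longlongrightarrow> 0) (at_right 0)"
    by simp
  moreover have "\<forall>\<^sub>F t in at_right 0. pairing w F t / complex_of_real (ln (1 / (1 - exp (- t)))) * complex_of_real (- ln (1 - exp (- t)) / lam t)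
      = inverse (lam t) *\<^sub>R pairing w F t"
  proof (rule eventually_mono[OF eventually_at_right_less])
    fix t :: real assume "0 < t"
    then have p: "0 < 1 - exp (- t)" "1 - exp (- t) < 1" by auto
    then have e: "ln (1 / (1 - exp (- t))) = - ln (1 - exp (- t))" by (simp add: ln_div)
    have ne: "- ln (1 - exp (- t)) \<noteq> 0" using p by simp
    show "pairing w F t / complex_of_real (ln (1 / (1 - exp (- t)))) * complex_of_real (- ln (1 - exp (- t)) / lam t)
      = inverse (lam t) *\<^sub>R pairing w F t"
      unfolding e using ne by (simp add: scaleR_conv_of_real divide_inverse)
  qed
  ultimately show ?thesis by (rule Lim_transform_eventually)
qed

text \<open>
  The logarithmic term of the derivative of order \<open>n - 1\<close> has to vanish for every test function, and this
  annihilates \<open>\<Lambda>\<close> of all polynomials at the boundary.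
\<close>

theorem odd_dim_small_log_imp_constant:
  fixes u :: "'a::euclidean_space \<Rightarrow> complex"
  assumes n: "odd DIM('a)" "DIM('a) \<ge> 3" and H: "H_harmonic u" and bd: "has_boundary_distribution u"
    and small: "\<And>\<Phi>. smooth_on_sphere \<Phi> \<Longrightarrow> sphere_pairing ((normal_deriv ^^ (DIM('a) - 1)) u) \<Phi>
      \<in> o[at_left 1](\<lambda>r. complex_of_real (ln (1 / (1 - r))))"
  shows "u constant_on ball 0 1"
proof -
  have n2: "DIM('a) \<ge> 2" using n by simp
  have u: "smooth_on (ball 0 1) u" by (rule H_harmonic_imp_smooth[OF n2 H])
  have D: "hyp_laplacian u x = 0" if "x \<in> ball 0 1" for x using H that by (simp add: H_harmonic_def)
  define m where "m = DIM('a) - 2"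
  define p where "p = (DIM('a) - 1) div 2"
  have p2: "DIM('a) - 1 = 2 * p" unfolding p_def using n by presburger
  have mp: "m + 1 = 2 * p" "p \<ge> 1" using p2 n by (auto simp: m_def)
  have "\<forall>F. smooth_near F \<longrightarrow> (\<exists>L. (pairing u F \<longlongrightarrow> L) (at_right 0))"
    using bd unfolding has_boundary_distribution_pairing .
  then have ex: "\<exists>L. (pairing u F \<longlongrightarrow> L) (at_right 0)" if "smooth_near F" for F using that by blast
  define \<beta> where "\<beta> F = Lim (at_right 0) (pairing u F)" for F
  have lim: "(pairing u F \<longlongrightarrow> \<beta> F) (at_right 0)" if F: "smooth_near F" for F
  proof -
    obtain L where L: "(pairing u F \<longlongrightarrow> L) (at_right 0)" using ex[OF F] ..
    then show ?thesis unfolding \<beta>_def using tendsto_Lim[OF trivial_limit_at_right_real L] by simp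
  qed
  have lin: "near_linear \<beta>"
    by (rule near_linear_limit[OF near_linear_pairing[OF smooth_on_continuous[OF u]] lim[OF smooth_near_UNIV]])
  have vanish: "bseq m (\<lambda>j. \<beta> ((sph_lap ^^ j) F)) p 0 = 0" if F: "smooth_on UNIV F" for F
  proof -
    have Fn: "smooth_near F" by (rule smooth_near_UNIV[OF F])
    define g where "g k t = (- 1) ^ k * pairing ((normal_deriv ^^ k) u) F t" for k t
    have sm: "((\<lambda>t. inverse (lam t) *\<^sub>R pairing ((normal_deriv ^^ (2 * p)) u) F t) \<longlongrightarrow> 0) (at_right 0)"
      using small_o_log_pairing[OF small[OF smooth_near_smooth_on_sphere[OF Fn]]] unfolding p2 .
    show ?thesis
    proof (rule ray_ode.odd_log_term_vanishes[OF pairing_ray_ode[OF n2 u D bd Fn, folded m_def] mp(1) mp(2) UNIV_I])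
      show "(pairing u ((sph_lap ^^ j) F) \<longlongrightarrow> \<beta> ((sph_lap ^^ j) F)) (at_right 0)" for j
        by (rule lim[OF smooth_near_sph_lap_pow[OF Fn]])
      show "g 0 t = pairing u ((sph_lap ^^ 0) F) t" for t by (simp add: g_def)
      show "(g k has_vector_derivative g (Suc k) t) (at t)" if "t > 0" for k t
        unfolding g_def by (rule pairing_normal_deriv_chain[OF u Fn that])
      show "((\<lambda>t. inverse (lam t) *\<^sub>R g (2 * p) t) \<longlongrightarrow> 0) (at_right 0)" using sm by (simp add: g_def)
    qed
  qed
  have z: "pairing u (sph_lap (monomial w)) t = 0" if w: "w \<in> lists Basis" and t: "t > 0" for w t
  proof -
    have w': "w \<in> words (length w)" using w by (induction w) auto
    show ?thesis
    proof (rule pairing_zero_of_boundary_zero[OF n(2) u D _ w' t])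
      fix v :: "'a list" assume v: "v \<in> words (length w)"
      have "smooth_near (sph_lap (monomial v) :: 'a \<Rightarrow> complex)"
        by (rule smooth_near_sph_lap[OF smooth_near_UNIV[OF smooth_on_monomial[OF open_UNIV]]])
      from lim[OF this] have "(pairing u (sph_lap (monomial v)) \<longlongrightarrow> \<beta> (sph_lap (monomial v))) (at_right 0)" .
      moreover have "\<beta> (sph_lap (monomial v)) = 0"
        by (rule sph_lap_boundary_value_eq_0[OF lin mp _ v]) (rule vanish)
      ultimately show "(pairing u (sph_lap (monomial v)) \<longlongrightarrow> 0) (at_right 0)" by (simp only:)
    qed
  qed
  show ?thesis unfolding constant_on_def
    by (intro exI[of _ "u 0"] ballI constant_of_pairing_zero[OF n(2) u D z])
qed

lemma normal_deriv_pow_constant: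
  assumes c: "\<And>x. x \<in> ball 0 1 \<Longrightarrow> u x = c" and x: "x \<in> ball 0 1"
  shows "(normal_deriv ^^ k) u x = (if k = 0 then c else 0)"
  using x
proof (induction k arbitrary: x)
  case 0
  then show ?case using c by simp
next
  case (Suc k)
  have "partial b ((normal_deriv ^^ k) u) x = partial b (\<lambda>_. if k = 0 then c else 0) x" for b
    by (rule partial_cong_open[OF open_ball Suc.prems]) (rule Suc.IH)
  then show ?case by (simp add: normal_deriv_def[of "(normal_deriv ^^ k) u"])
qed

lemma constant_imp_boundary_distribution:
  assumes u: "u constant_on ball 0 1" and k: "k \<noteq> 0"
  shows "has_boundary_distribution ((normal_deriv ^^ k) u)"
  unfolding has_boundary_distribution_pairing
proof (intro allI impI exI)
  fix F :: "'a \<Rightarrow> complex"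
  obtain c where c: "\<And>x. x \<in> ball 0 1 \<Longrightarrow> u x = c" using u unfolding constant_on_def by blast
  have "\<forall>\<^sub>F t in at_right 0. pairing ((normal_deriv ^^ k) u) F t = 0"
  proof (rule eventually_mono[OF eventually_at_right_less])
    fix t :: real assume t: "0 < t"
    have "pairing ((normal_deriv ^^ k) u) F t = (LINT z|(sphere_measure::'a measure). 0)"
      unfolding pairing_alt ray_def
      by (intro Bochner_Integration.integral_cong refl)
        (use normal_deriv_pow_constant[of u c, OF c ray_in_ball[OF _ t]] k in \<open>simp add: space_sphere_measure\<close>)
    then show "pairing ((normal_deriv ^^ k) u) F t = 0" by simp
  qed
  then show "(pairing ((normal_deriv ^^ k) u) F \<longlongrightarrow> 0) (at_right 0)" by (rule tendsto_eventually)
qed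

lemma filterlim_log_at_left: "filterlim (\<lambda>r::real. ln (1 / (1 - r))) at_top (at_left 1)"
proof -
  have "filterlim (\<lambda>r::real. 1 - r) (at_right 0) (at_left 1)"
    unfolding filterlim_at
  proof
    have "\<forall>\<^sub>F r in at_left (1::real). r \<in> {0<..<1}" by (rule eventually_at_left_real) simp
    then show "\<forall>\<^sub>F r in at_left (1::real). 1 - r \<in> {0<..} \<and> 1 - r \<noteq> 0" by (rule eventually_mono) auto
    have "((\<lambda>r::real. 1 - r) \<longlongrightarrow> 1 - 1) (at_left 1)" by (intro tendsto_intros)
    then show "((\<lambda>r::real. 1 - r) \<longlongrightarrow> 0) (at_left 1)" by simp
  qed
  from filterlim_compose[OF ln_at_top filterlim_compose[OF filterlim_inverse_at_top_right this]]
  show ?thesis by (simp add: divide_inverse)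
qed

lemma boundary_distribution_imp_small_log:
  assumes "has_boundary_distribution w" "smooth_on_sphere \<Phi>"
  shows "sphere_pairing w \<Phi> \<in> o[at_left 1](\<lambda>r. complex_of_real (ln (1 / (1 - r))))"
proof (rule smalloI_tendsto)
  obtain L where L: "(sphere_pairing w \<Phi> \<longlongrightarrow> L) (at_left 1)"
    using assms unfolding has_boundary_distribution_def by blast
  show "((\<lambda>r. sphere_pairing w \<Phi> r / complex_of_real (ln (1 / (1 - r)))) \<longlongrightarrow> 0) (at_left 1)"
    by (rule tendsto_divide_0[OF L filterlim_compose[OF filterlim_of_real_at_infinity filterlim_log_at_left]])
  have "\<forall>\<^sub>F r in at_left (1::real). 0 < ln (1 / (1 - r))"
    by (rule filterlim_at_top_dense[THEN iffD1, rule_format, OF filterlim_log_at_left])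
  then show "\<forall>\<^sub>F r in at_left (1::real). complex_of_real (ln (1 / (1 - r))) \<noteq> 0"
    by (rule eventually_mono) simp
qed

section \<open>The hyperbolic Poisson integral\<close>

text \<open>
  The Poisson kernel as a function of both variables on an open set, with values in the complex numbers; on
  this domain it is smooth, so that differentiation under the integral sign applies.
\<close>

definition poisson_pair :: "'a::euclidean_space \<times> 'a \<Rightarrow> complex" where
  "poisson_pair z = complex_of_real ((1 - fst z \<bullet> fst z) ^ (DIM('a) - 1) *
     inverse (1 + fst z \<bullet> fst z - 2 * (fst z \<bullet> snd z)) ^ (DIM('a) - 1))"

definition poisson_dom :: "('a::euclidean_space \<times> 'a) set" where
  "poisson_dom = {z. 0 < 1 + fst z \<bullet> fst z - 2 * (fst z \<bullet> snd z)}"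

lemma open_poisson_dom: "open poisson_dom"
  unfolding poisson_dom_def by (intro open_Collect_less continuous_intros)

lemma sphere_defect:
  fixes x \<xi> :: "'a::euclidean_space"
  assumes "\<xi> \<in> sphere 0 1"
  shows "1 + x \<bullet> x - 2 * (x \<bullet> \<xi>) = (\<xi> - x) \<bullet> (\<xi> - x)"
proof -
  have "\<xi> \<bullet> \<xi> = 1" using assms by (simp add: dot_square_norm)
  then show ?thesis by (simp add: inner_diff_left inner_diff_right inner_commute)
qed

lemma sphere_defect_pos:
  fixes x \<xi> :: "'a::euclidean_space"
  assumes "x \<in> ball 0 1" "\<xi> \<in> sphere 0 1"
  shows "0 < (\<xi> - x) \<bullet> (\<xi> - x)"
  using assms by auto

lemma ball_sphere_poisson_dom: "ball 0 1 \<times> sphere 0 1 \<subseteq> poisson_dom"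
proof
  fix z :: "'a \<times> 'a" assume "z \<in> ball 0 1 \<times> sphere 0 1"
  then have z: "fst z \<in> ball 0 1" "snd z \<in> sphere 0 1" by (simp_all add: mem_Times_iff)
  show "z \<in> poisson_dom"
    unfolding poisson_dom_def mem_Collect_eq sphere_defect[OF z(2)] by (rule sphere_defect_pos[OF z])
qed

lemma smooth_on_poisson_pair: "smooth_on poisson_dom poisson_pair"
  unfolding poisson_pair_def[abs_def]
  by (intro smooth_on_of_real smooth_on_mult smooth_on_power smooth_on_inverse smooth_on_diff smooth_on_add
      smooth_on_const smooth_on_inner smooth_on_fst smooth_on_snd open_poisson_dom) (simp add: poisson_dom_def)

lemma hyp_poisson_pair: "hyp_poisson \<phi> = (\<lambda>x. LINT \<xi>|sphere_measure. \<phi> \<xi> * poisson_pair (x, \<xi>))"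
  unfolding hyp_poisson_def[abs_def] hyp_poisson_kernel_def poisson_pair_def
  by (simp add: power2_norm_eq_inner divide_inverse power_mult_distrib)

lemma smooth_on_hyp_poisson:
  "continuous_on (sphere 0 1) F \<Longrightarrow> smooth_on (ball 0 1) (hyp_poisson F)"
  unfolding hyp_poisson_pair
  by (rule smooth_on_integral[OF compact_measure_sphere _ open_ball open_poisson_dom
      ball_sphere_poisson_dom smooth_on_poisson_pair])

lemma partial_slice:
  fixes f :: "'a::euclidean_space \<times> 'b::euclidean_space \<Rightarrow> 'c::real_normed_vector"
  assumes "f differentiable (at (x, y))"
  shows "partial (b, 0) f (x, y) = partial b (\<lambda>x. f (x, y)) x"
proof -
  obtain D where D: "(f has_derivative D) (at (x, y))" using assms unfolding differentiable_def ..
  have "((\<lambda>x. (x, y)) has_derivative (\<lambda>h. (h, 0))) (at x)" by (intro derivative_intros)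
  from has_derivative_compose[OF this D]
  have "((\<lambda>x. f (x, y)) has_derivative (\<lambda>h. D (h, 0))) (at x)" .
  then show ?thesis using D by (simp add: has_derivative_partial)
qed

lemma Basis_fst: "b \<in> Basis \<Longrightarrow> (b, 0) \<in> Basis"
  by (simp add: Basis_prod_def)

lemma partial_poisson:
  fixes F :: "'a::euclidean_space \<Rightarrow> complex"
  assumes F: "continuous_on (sphere 0 1) F" and b: "b \<in> Basis" and x: "x \<in> ball 0 1"
  shows "partial b (hyp_poisson F) x = (LINT \<xi>|sphere_measure. F \<xi> * partial (b, 0) poisson_pair (x, \<xi>))"
    and "partial b (partial b (hyp_poisson F)) x =
      (LINT \<xi>|sphere_measure. F \<xi> * partial (b, 0) (partial (b, 0) poisson_pair) (x, \<xi>))"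
proof -
  have 1: "partial b (hyp_poisson F) x = (LINT \<xi>|sphere_measure. F \<xi> * partial (b, 0) poisson_pair (x, \<xi>))"
    if "x \<in> ball 0 1" for x
    unfolding hyp_poisson_pair
    by (rule partial_integral[OF compact_measure_sphere F open_ball open_poisson_dom
      ball_sphere_poisson_dom smooth_on_poisson_pair b that])
  show "partial b (hyp_poisson F) x = (LINT \<xi>|sphere_measure. F \<xi> * partial (b, 0) poisson_pair (x, \<xi>))"
    by (rule 1[OF x])
  have "partial b (partial b (hyp_poisson F)) x = partial b (\<lambda>x. LINT \<xi>|sphere_measure. F \<xi> * partial (b, 0) poisson_pair (x, \<xi>)) x"
    by (rule partial_cong_open[OF open_ball x 1])
  also have "\<dots> = (LINT \<xi>|sphere_measure. F \<xi> * partial (b, 0) (partial (b, 0) poisson_pair) (x, \<xi>))"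
    by (rule partial_integral[OF compact_measure_sphere F open_ball open_poisson_dom
      ball_sphere_poisson_dom smooth_on_partial[OF smooth_on_poisson_pair Basis_fst[OF b]] b x])
  finally show "partial b (partial b (hyp_poisson F)) x =
      (LINT \<xi>|sphere_measure. F \<xi> * partial (b, 0) (partial (b, 0) poisson_pair) (x, \<xi>))" .
qed

lemma poisson_slice_continuous:
  assumes x: "x \<in> ball 0 1" and k: "smooth_on poisson_dom k"
  shows "continuous_on (sphere 0 1) (\<lambda>\<xi>. k (x, \<xi>))"
proof (rule continuous_on_compose2[OF smooth_on_continuous[OF k]])
  show "continuous_on (sphere 0 1) (\<lambda>\<xi>. (x, \<xi>))" by (intro continuous_intros)
  show "Pair x ` sphere 0 1 \<subseteq> poisson_dom" using ball_sphere_poisson_dom x by blast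
qed

lemma has_real_derivative_inverse_power:
  assumes "s > (0::real)"
  shows "((\<lambda>s. inverse s ^ k) has_real_derivative - real k * inverse s ^ Suc k) (at s)"
proof (cases k)
  case (Suc j)
  have d: "(inverse has_real_derivative - (inverse s * inverse s)) (at s)"
    using DERIV_inverse[of s UNIV] assms by (simp add: numeral_2_eq_2)
  show ?thesis using DERIV_power[OF d, of k] Suc by (simp add: algebra_simps)
qed simp

lemma hyp_laplacian_of_real:
  fixes f :: "'a::euclidean_space \<Rightarrow> real"
  assumes U: "open U" "x \<in> U" and f: "smooth_on U f"
  shows "hyp_laplacian (\<lambda>x. complex_of_real (f x)) x = complex_of_real (hyp_laplacian f x)"
proof -
  have 1: "partial b (\<lambda>x. complex_of_real (f x)) y = complex_of_real (partial b f y)" if "y \<in> U" for b y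
    by (rule partial_compose_linear[OF bounded_linear_of_real smooth_on_differentiable[OF f that]])
  have 2: "partial b (partial b (\<lambda>x. complex_of_real (f x))) x = complex_of_real (partial b (partial b f) x)" if "b \<in> Basis" for b
  proof -
    have "partial b (partial b (\<lambda>x. complex_of_real (f x))) x = partial b (\<lambda>x. complex_of_real (partial b f x)) x"
      by (rule partial_cong_open[OF U 1])
    also have "\<dots> = complex_of_real (partial b (partial b f) x)"
      by (rule partial_compose_linear[OF bounded_linear_of_real smooth_on_differentiable[OF smooth_on_partial[OF f that] U(2)]])
    finally show ?thesis .
  qed
  show ?thesis by (simp add: hyp_laplacian_def laplacian_def normal_deriv_def 1[OF U(2)] 2 scaleR_conv_of_real)
qed

lemma hyp_laplacian_cong_open:
  assumes U: "open U" "x \<in> U" and e: "\<And>y. y \<in> U \<Longrightarrow> f y = g y"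
  shows "hyp_laplacian f x = hyp_laplacian g x"
proof -
  have 1: "partial b f y = partial b g y" if "y \<in> U" for b y by (rule partial_cong_open[OF U(1) that e])
  have 2: "partial b (partial b f) x = partial b (partial b g) x" for b by (rule partial_cong_open[OF U 1])
  show ?thesis by (simp add: hyp_laplacian_def laplacian_def normal_deriv_def 1[OF U(2)] 2)
qed

text \<open>
  With \<open>w = sq_quot 1 \<xi>\<close> one has \<open>(1 - |x|\<^sup>2)\<^sup>2 |\<nabla> w|\<^sup>2 = 4 w\<^sup>2\<close> and \<open>D w = 4 n w\<close>, so \<open>w^(- k)\<close> is annihilated exactly
  when \<open>k + 1 = n\<close>.
\<close>

lemma poisson_pair_H_harmonic:
  fixes x \<xi> :: "'a::euclidean_space"
  assumes x: "x \<in> ball 0 1" and \<xi>: "\<xi> \<in> sphere 0 1"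
  shows "hyp_laplacian (\<lambda>x. poisson_pair (x, \<xi>)) x = 0"
proof -
  define k where "k = DIM('a) - 1"
  have n: "real DIM('a) = real k + 1" using DIM_positive[where 'a='a] by (simp add: k_def)
  let ?w = "sq_quot 1 \<xi> :: 'a \<Rightarrow> real"
  have pos: "0 < (\<xi> - y) \<bullet> (\<xi> - y)" "0 < 1 - y \<bullet> y" if "y \<in> ball 0 1" for y
    using sphere_defect_pos[OF that \<xi>] that ball_inner[of y] by simp_all
  have wpos: "?w y > 0" if "y \<in> ball 0 1" for y using pos[OF that] by (simp add: sq_quot_def)
  have ws: "smooth_on (ball 0 1) ?w"
    unfolding sq_quot_def[abs_def]
    by (intro smooth_on_divide smooth_on_mult smooth_on_inner smooth_on_diff smooth_on_const open_ball
        smooth_on_linear[OF bounded_linear_ident] smooth_on_norm_sq) (use pos in simp)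
  have e: "poisson_pair (y, \<xi>) = complex_of_real (inverse (?w y) ^ k)" if "y \<in> ball 0 1" for y
    unfolding poisson_pair_def fst_conv snd_conv sphere_defect[OF \<xi>] sq_quot_def k_def
    by (simp add: power_mult_distrib divide_inverse mult.commute)
  have x1: "1 - \<xi> \<bullet> \<xi> = 0" using \<xi> by (simp add: dot_square_norm)
  have "hyp_laplacian (\<lambda>x. inverse (?w x) ^ k) x
     = (- real k * (- real (Suc k) * inverse (?w x) ^ Suc (Suc k))) * ((1 - (norm x)\<^sup>2)\<^sup>2 * (\<Sum>b\<in>Basis. (partial b ?w x)\<^sup>2))
       + (- real k * inverse (?w x) ^ Suc k) * hyp_laplacian ?w x"
  proof (rule hyp_laplacian_compose_real[OF open_ball x ws])
    show "((\<lambda>s. inverse s ^ k) has_real_derivative - real k * inverse (?w y) ^ Suc k) (at (?w y))" if "y \<in> ball 0 1" for y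
      by (rule has_real_derivative_inverse_power[OF wpos[OF that]])
    show "((\<lambda>s. - real k * inverse s ^ Suc k) has_real_derivative
        - real k * (- real (Suc k) * inverse (?w x) ^ Suc (Suc k))) (at (?w x))"
      by (rule DERIV_cmult[OF has_real_derivative_inverse_power[OF wpos[OF x]]])
  qed
  also have "\<dots> = 4 * real k * real (Suc k) * (inverse (?w x) * ?w x)\<^sup>2 * inverse (?w x) ^ k
     - 4 * real k * real (Suc k) * (inverse (?w x) * ?w x) * inverse (?w x) ^ k"
    unfolding sq_quot_identities[OF one_neq_zero x] x1 n by (simp add: algebra_simps power2_eq_square)
  also have "inverse (?w x) * ?w x = 1" using wpos[OF x] by simp
  finally have z: "hyp_laplacian (\<lambda>x. inverse (?w x) ^ k) x = 0" by simp
  have "hyp_laplacian (\<lambda>x. poisson_pair (x, \<xi>)) x = hyp_laplacian (\<lambda>x. complex_of_real (inverse (?w x) ^ k)) x"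
    by (rule hyp_laplacian_cong_open[OF open_ball x e])
  also have "\<dots> = complex_of_real (hyp_laplacian (\<lambda>x. inverse (?w x) ^ k) x)"
    by (rule hyp_laplacian_of_real[OF open_ball x]) (intro smooth_on_power smooth_on_inverse open_ball ws wpos)
  finally show ?thesis unfolding z by simp
qed

theorem hyp_laplacian_hyp_poisson:
  fixes F :: "'a::euclidean_space \<Rightarrow> complex"
  assumes F: "continuous_on (sphere 0 1) F" and x: "x \<in> ball 0 1"
  shows "hyp_laplacian (hyp_poisson F) x = 0"
proof -
  define k1 where "k1 b \<xi> = partial (b, 0) poisson_pair (x, \<xi>)" for b \<xi>
  define k2 where "k2 b \<xi> = partial (b, 0) (partial (b, 0) poisson_pair) (x, \<xi>)" for b \<xi>
  note s1 = smooth_on_partial[OF smooth_on_poisson_pair Basis_fst]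
  note s2 = smooth_on_partial[OF s1 Basis_fst]
  have c1: "continuous_on (sphere 0 1) (k1 b)" and c2: "continuous_on (sphere 0 1) (k2 b)" if "b \<in> Basis" for b
    unfolding k1_def[abs_def] k2_def[abs_def] by (intro poisson_slice_continuous[OF x] s1 s2 that)+
  let ?A = "complex_of_real ((1 - (norm x)\<^sup>2)\<^sup>2)" and ?B = "complex_of_real (2 * (real DIM('a) - 2) * (1 - (norm x)\<^sup>2))"
  have i1: "integrable sphere_measure (\<lambda>\<xi>. ?B * (complex_of_real (x \<bullet> b) * (F \<xi> * k1 b \<xi>)))"
    and i2: "integrable sphere_measure (\<lambda>\<xi>. ?A * (F \<xi> * k2 b \<xi>))" if "b \<in> Basis" for b
    by (intro integrable_sphere continuous_intros F c1 c2 that)+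
  have z: "(\<Sum>b\<in>Basis. ?A * (F \<xi> * k2 b \<xi>) + ?B * (complex_of_real (x \<bullet> b) * (F \<xi> * k1 b \<xi>))) = 0"
    if \<xi>: "\<xi> \<in> sphere 0 1" for \<xi>
  proof -
    have dom: "(y, \<xi>) \<in> poisson_dom" if "y \<in> ball 0 1" for y using ball_sphere_poisson_dom that \<xi> by blast
    have e1: "partial (b, 0) poisson_pair (y, \<xi>) = partial b (\<lambda>x. poisson_pair (x, \<xi>)) y" if "y \<in> ball 0 1" for b y
      by (rule partial_slice[OF smooth_on_differentiable[OF smooth_on_poisson_pair dom[OF that]]])
    have e2: "k2 b \<xi> = partial b (partial b (\<lambda>x. poisson_pair (x, \<xi>))) x" if "b \<in> Basis" for b
    proof -
      have "k2 b \<xi> = partial b (\<lambda>x. partial (b, 0) poisson_pair (x, \<xi>)) x"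
        unfolding k2_def by (rule partial_slice[OF smooth_on_differentiable[OF s1[OF that] dom[OF x]]])
      also have "\<dots> = partial b (partial b (\<lambda>x. poisson_pair (x, \<xi>))) x"
        by (rule partial_cong_open[OF open_ball x e1])
      finally show ?thesis .
    qed
    have "(\<Sum>b\<in>Basis. ?A * (F \<xi> * k2 b \<xi>) + ?B * (complex_of_real (x \<bullet> b) * (F \<xi> * k1 b \<xi>)))
       = F \<xi> * hyp_laplacian (\<lambda>x. poisson_pair (x, \<xi>)) x"
      unfolding hyp_laplacian_def laplacian_def normal_deriv_def scaleR_conv_of_real
      by (simp add: sum.distrib sum_distrib_left distrib_left e2 k1_def e1[OF x] sum_distrib_right mult_ac cong: sum.cong)
    then show ?thesis unfolding poisson_pair_H_harmonic[OF x \<xi>] by simp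
  qed
  have "hyp_laplacian (hyp_poisson F) x
     = (\<Sum>b\<in>Basis. ?A * (LINT \<xi>|sphere_measure. F \<xi> * k2 b \<xi>) + ?B * (complex_of_real (x \<bullet> b) * (LINT \<xi>|sphere_measure. F \<xi> * k1 b \<xi>)))"
    unfolding hyp_laplacian_def laplacian_def normal_deriv_def scaleR_conv_of_real
    by (simp add: partial_poisson[OF F _ x] k1_def k2_def sum.distrib sum_distrib_left mult_ac cong: sum.cong)
  also have "\<dots> = (\<Sum>b\<in>Basis. (LINT \<xi>|sphere_measure. ?A * (F \<xi> * k2 b \<xi>) + ?B * (complex_of_real (x \<bullet> b) * (F \<xi> * k1 b \<xi>))))"
  proof (rule sum.cong[OF refl])
    fix b :: 'a assume b: "b \<in> Basis"
    show "?A * (LINT \<xi>|sphere_measure. F \<xi> * k2 b \<xi>) + ?B * (complex_of_real (x \<bullet> b) * (LINT \<xi>|sphere_measure. F \<xi> * k1 b \<xi>))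
      = (LINT \<xi>|sphere_measure. ?A * (F \<xi> * k2 b \<xi>) + ?B * (complex_of_real (x \<bullet> b) * (F \<xi> * k1 b \<xi>)))"
      unfolding Bochner_Integration.integral_add[OF i2[OF b] i1[OF b]] integral_mult_right_zero ..
  qed
  also have "\<dots> = (LINT \<xi>|sphere_measure. (\<Sum>b\<in>Basis. ?A * (F \<xi> * k2 b \<xi>) + ?B * (complex_of_real (x \<bullet> b) * (F \<xi> * k1 b \<xi>))))"
    by (rule Bochner_Integration.integral_sum[symmetric]) (intro Bochner_Integration.integrable_add i1 i2)
  also have "\<dots> = (LINT \<xi>|(sphere_measure :: 'a measure). 0)"
    by (intro Bochner_Integration.integral_cong refl z) (simp add: space_sphere_measure)
  finally show ?thesis by simp
qed

text \<open>
  The kernel is invariant under simultaneous rotations of \<open>x\<close> and \<open>\<xi>\<close>. Indeed it is a function of \<open>|x|\<^sup>2\<close> and of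
  the denominator, on which the two rotation fields act with opposite signs.
\<close>

lemma rot_poisson_pair:
  fixes x \<xi> :: "'a::euclidean_space"
  assumes "(x, \<xi>) \<in> poisson_dom" "b \<in> Basis" "c \<in> Basis"
  shows "rot b c (\<lambda>x. poisson_pair (x, \<xi>)) x = - rot b c (\<lambda>\<xi>. poisson_pair (x, \<xi>)) \<xi>"
proof -
  define k where "k = DIM('a) - 1"
  let ?p = "\<lambda>x \<xi>. 1 + x \<bullet> x - 2 * (x \<bullet> \<xi>) :: real" and ?r = "\<lambda>x::'a. (1 - x \<bullet> x) ^ k"
  let ?h = "\<lambda>s::real. inverse s ^ k" and ?h' = "- real k * inverse (1 + x \<bullet> x - 2 * (x \<bullet> \<xi>)) ^ Suc k"
  have p: "0 < ?p x \<xi>" using assms(1) by (simp add: poisson_dom_def)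
  note h = has_real_derivative_inverse_power[OF p, of k]
  have dx: "((\<lambda>x. ?p x \<xi>) has_derivative (\<lambda>v. 2 * (x \<bullet> v) - 2 * (v \<bullet> \<xi>))) (at x)"
    by (auto intro!: derivative_eq_intros simp: inner_commute)
  have d\<xi>: "((\<lambda>\<xi>. ?p x \<xi>) has_derivative (\<lambda>v. - 2 * (x \<bullet> v))) (at \<xi>)"
    by (auto intro!: derivative_eq_intros)
  have px: "partial e (\<lambda>x. ?h (?p x \<xi>)) x = ?h' * partial e (\<lambda>x. ?p x \<xi>) x" for e
    by (rule partial_compose_real(1)[where g = ?h and w = "\<lambda>x. ?p x \<xi>", OF h differentiableI[OF dx]])
  have p\<xi>: "partial e (\<lambda>\<xi>. ?h (?p x \<xi>)) \<xi> = ?h' * partial e (\<lambda>\<xi>. ?p x \<xi>) \<xi>" for e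
    by (rule partial_compose_real(1)[where g = ?h and w = "\<lambda>\<xi>. ?p x \<xi>", OF h differentiableI[OF d\<xi>]])
  have hx: "(\<lambda>x. ?h (?p x \<xi>)) differentiable (at x)"
    by (rule partial_compose_real(2)[where g = ?h and w = "\<lambda>x. ?p x \<xi>", OF h differentiableI[OF dx]])
  have h\<xi>: "(\<lambda>\<xi>. ?h (?p x \<xi>)) differentiable (at \<xi>)"
    by (rule partial_compose_real(2)[where g = ?h and w = "\<lambda>\<xi>. ?p x \<xi>", OF h differentiableI[OF d\<xi>]])
  have dr: "?r differentiable (at x)"
    using smooth_on_differentiable[OF smooth_on_power[OF open_UNIV smooth_on_diff[OF open_UNIV smooth_on_const smooth_on_norm_sq[OF open_UNIV]]]] by blast
  have rx: "rot b c (\<lambda>x. ?h (?p x \<xi>)) x = ?h' * rot b c (\<lambda>x. ?p x \<xi>) x"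
    unfolding rot_def px by (simp add: right_diff_distrib mult_ac)
  have r\<xi>: "rot b c (\<lambda>\<xi>. ?h (?p x \<xi>)) \<xi> = ?h' * rot b c (\<lambda>\<xi>. ?p x \<xi>) \<xi>"
    unfolding rot_def p\<xi> by (simp add: right_diff_distrib mult_ac)
  have rr: "rot b c ?r x = 0"
    by (rule rot_norm_sq) (intro derivative_intros)
  have opp: "rot b c (\<lambda>x. ?p x \<xi>) x = - rot b c (\<lambda>\<xi>. ?p x \<xi>) \<xi>"
    unfolding rot_has_derivative[OF dx] rot_has_derivative[OF d\<xi>]
    by (simp add: inner_diff_left inner_diff_right inner_commute algebra_simps)
  have of_real: "rot b c (\<lambda>y. complex_of_real (f y)) z = complex_of_real (rot b c f z)"
    if "f differentiable (at z)" for f :: "'a \<Rightarrow> real" and z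
    unfolding rot_def partial_compose_linear[OF bounded_linear_of_real that] by (simp add: scaleR_conv_of_real)
  have X: "rot b c (\<lambda>x. ?r x * ?h (?p x \<xi>)) x = ?r x * (?h' * rot b c (\<lambda>x. ?p x \<xi>) x)"
    unfolding rot_mult[OF dr hx] rr rx by simp
  have Y: "rot b c (\<lambda>\<xi>. ?r x * ?h (?p x \<xi>)) \<xi> = ?r x * (?h' * rot b c (\<lambda>\<xi>. ?p x \<xi>) \<xi>)"
    unfolding rot_mult[OF differentiable_const h\<xi>] r\<xi> by (simp add: rot_def)
  have "rot b c (\<lambda>x. poisson_pair (x, \<xi>)) x = complex_of_real (rot b c (\<lambda>x. ?r x * ?h (?p x \<xi>)) x)"
    unfolding poisson_pair_def fst_conv snd_conv k_def[symmetric]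
    by (rule of_real[OF differentiable_bilinear[OF bounded_bilinear_mult dr hx]])
  moreover have "rot b c (\<lambda>\<xi>. poisson_pair (x, \<xi>)) \<xi> = complex_of_real (rot b c (\<lambda>\<xi>. ?r x * ?h (?p x \<xi>)) \<xi>)"
    unfolding poisson_pair_def fst_conv snd_conv k_def[symmetric]
    by (rule of_real[OF differentiable_bilinear[OF bounded_bilinear_mult differentiable_const h\<xi>]])
  ultimately show ?thesis unfolding X Y opp by simp
qed

lemma smooth_near_poisson_pair:
  fixes x :: "'a::euclidean_space"
  assumes x: "x \<in> ball 0 1"
  shows "smooth_near (\<lambda>\<xi>. poisson_pair (x, \<xi>))"
proof -
  let ?U = "{\<xi>. 0 < 1 + x \<bullet> x - 2 * (x \<bullet> \<xi>)}"
  have o: "open ?U" by (intro open_Collect_less continuous_intros)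
  have "smooth_on ?U (\<lambda>\<xi>. poisson_pair (x, \<xi>))"
    unfolding poisson_pair_def fst_conv snd_conv
    by (intro smooth_on_of_real smooth_on_mult smooth_on_power smooth_on_inverse smooth_on_diff
        smooth_on_const smooth_on_inner smooth_on_linear[OF bounded_linear_ident] o) simp
  moreover have "sphere 0 1 \<subseteq> ?U"
  proof
    fix \<xi> :: 'a assume "\<xi> \<in> sphere 0 1"
    then have "(x, \<xi>) \<in> poisson_dom" using ball_sphere_poisson_dom x by blast
    then show "\<xi> \<in> ?U" by (simp add: poisson_dom_def)
  qed
  ultimately show ?thesis unfolding smooth_near_def using o by blast
qed

text \<open>
  By the invariance of the kernel the rotation field passes to the second variable, and from there to \<open>F\<close> by
  parts.
\<close>

theorem rot_hyp_poisson:
  fixes F :: "'a::euclidean_space \<Rightarrow> complex"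
  assumes F: "smooth_near F" and x: "x \<in> ball 0 1" and b: "b \<in> Basis" and c: "c \<in> Basis"
  shows "rot b c (hyp_poisson F) x = hyp_poisson (rot b c F) x"
proof -
  note Fc = smooth_near_continuous[OF F]
  note s1 = smooth_on_partial[OF smooth_on_poisson_pair Basis_fst]
  have i: "integrable sphere_measure (\<lambda>\<xi>. complex_of_real a * (F \<xi> * partial (e, 0) poisson_pair (x, \<xi>)))" if "e \<in> Basis" for e a
    by (intro integrable_sphere continuous_on_mult continuous_on_const Fc poisson_slice_continuous[OF x] s1 that)
  have "rot b c (hyp_poisson F) x
     = complex_of_real (x \<bullet> b) * (LINT \<xi>|sphere_measure. F \<xi> * partial (c, 0) poisson_pair (x, \<xi>))
     - complex_of_real (x \<bullet> c) * (LINT \<xi>|sphere_measure. F \<xi> * partial (b, 0) poisson_pair (x, \<xi>))"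
    unfolding rot_def partial_poisson(1)[OF Fc b x] partial_poisson(1)[OF Fc c x] scaleR_conv_of_real ..
  also have "\<dots> = (LINT \<xi>|sphere_measure. complex_of_real (x \<bullet> b) * (F \<xi> * partial (c, 0) poisson_pair (x, \<xi>))
      - complex_of_real (x \<bullet> c) * (F \<xi> * partial (b, 0) poisson_pair (x, \<xi>)))"
    unfolding Bochner_Integration.integral_diff[OF i[OF c] i[OF b]] integral_mult_right_zero ..
  also have "\<dots> = (LINT \<xi>|sphere_measure. - (F \<xi> * rot b c (\<lambda>\<xi>. poisson_pair (x, \<xi>)) \<xi>))"
  proof (rule Bochner_Integration.integral_cong[OF refl])
    fix \<xi> :: 'a assume "\<xi> \<in> space sphere_measure"
    then have dom: "(x, \<xi>) \<in> poisson_dom" using ball_sphere_poisson_dom x unfolding space_sphere_measure by blast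
    note sl = partial_slice[OF smooth_on_differentiable[OF smooth_on_poisson_pair dom]]
    have "complex_of_real (x \<bullet> b) * (F \<xi> * partial (c, 0) poisson_pair (x, \<xi>))
      - complex_of_real (x \<bullet> c) * (F \<xi> * partial (b, 0) poisson_pair (x, \<xi>)) = F \<xi> * rot b c (\<lambda>x. poisson_pair (x, \<xi>)) x"
      unfolding sl rot_def scaleR_conv_of_real by (simp add: algebra_simps)
    then show "complex_of_real (x \<bullet> b) * (F \<xi> * partial (c, 0) poisson_pair (x, \<xi>))
      - complex_of_real (x \<bullet> c) * (F \<xi> * partial (b, 0) poisson_pair (x, \<xi>)) = - (F \<xi> * rot b c (\<lambda>\<xi>. poisson_pair (x, \<xi>)) \<xi>)"
      unfolding rot_poisson_pair[OF dom b c] by simp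
  qed
  also have "\<dots> = - (LINT \<xi>|sphere_measure. F \<xi> * rot b c (\<lambda>\<xi>. poisson_pair (x, \<xi>)) \<xi>)"
    by (rule Bochner_Integration.integral_minus)
  also have "\<dots> = hyp_poisson (rot b c F) x"
    unfolding hyp_poisson_pair by (rule integral_rot_parts[OF F smooth_near_poisson_pair[OF x] b c, symmetric])
  finally show ?thesis .
qed

lemma sph_lap_hyp_poisson:
  fixes F :: "'a::euclidean_space \<Rightarrow> complex"
  assumes F: "smooth_near F" and x: "x \<in> ball 0 1"
  shows "sph_lap (hyp_poisson F) x = hyp_poisson (sph_lap F) x"
proof -
  have "rot b c (rot b c (hyp_poisson F)) x = (LINT \<xi>|sphere_measure. rot b c (rot b c F) \<xi> * poisson_pair (x, \<xi>))"
    if b: "b \<in> Basis" and c: "c \<in> Basis" for b c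
  proof -
    have "rot b c (rot b c (hyp_poisson F)) x = rot b c (hyp_poisson (rot b c F)) x"
      by (rule rot_cong_open[OF open_ball x]) (rule rot_hyp_poisson[OF F _ b c])
    also have "\<dots> = hyp_poisson (rot b c (rot b c F)) x"
      by (rule rot_hyp_poisson[OF smooth_near_rot[OF F b c] x b c])
    finally show ?thesis unfolding hyp_poisson_pair .
  qed
  moreover have "hyp_poisson (sph_lap F) x = (1/2) *\<^sub>R (\<Sum>b\<in>Basis. \<Sum>c\<in>Basis. (LINT \<xi>|sphere_measure. rot b c (rot b c F) \<xi> * poisson_pair (x, \<xi>)))"
    unfolding hyp_poisson_pair by (rule integral_sph_lap_sum[OF F smooth_near_poisson_pair[OF x]])
  ultimately show ?thesis unfolding sph_lap_def[of "hyp_poisson F"] by (simp cong: sum.cong)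
qed

lemma cball_exp_subset: "cball 0 (exp (- 1)) \<subseteq> (ball 0 1 :: 'a::euclidean_space set)"
proof
  fix x :: 'a assume "x \<in> cball 0 (exp (- 1))"
  moreover have "exp (- 1) < (1::real)" by simp
  ultimately show "x \<in> ball 0 1" unfolding mem_ball_0 mem_cball_0 by (rule le_less_trans)
qed

lemma ray_in_cball: "(z :: 'a::euclidean_space) \<in> sphere 0 1 \<Longrightarrow> t \<ge> 1 \<Longrightarrow> exp (- t) *\<^sub>R z \<in> cball 0 (exp (- 1))"
  by (simp add: dist_norm)

lemma bounded_on_cball:
  fixes f :: "'a::euclidean_space \<Rightarrow> complex"
  assumes "continuous_on (ball 0 1) f"
  obtains B where "\<forall>x\<in>cball 0 (exp (- 1)). norm (f x) \<le> B"
  by (rule continuous_on_compact_bound[OF continuous_on_subset[OF assms cball_exp_subset] compact_cball]) (rule that)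

text \<open>
  \<open>\<P>[1]\<close> is annihilated by rotation fields, so along rays only the first-order part of the equation survives;
  its bounded solutions vanish, and \<open>\<P>[1]\<close> is constant on each ray.
\<close>

lemma ray_hyp_poisson_one_bounded:
  assumes n: "DIM('a::euclidean_space) \<ge> 3"
  shows "\<exists>C. \<forall>z\<in>sphere (0::'a) 1. \<forall>t>0. norm (ray (hyp_poisson (\<lambda>_. 1)) z t) \<le> C"
proof -
  let ?P = "hyp_poisson (\<lambda>_::'a. 1::complex)"
  define m where "m = DIM('a) - 2"
  have m: "m \<ge> 1" "real DIM('a) - 2 = real m" using n by (auto simp: m_def)
  have c1: "continuous_on (sphere 0 1) (\<lambda>_::'a. 1::complex)" by simp
  have s: "smooth_on (ball 0 1) ?P" by (rule smooth_on_hyp_poisson[OF c1])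
  have sN: "smooth_on (ball 0 1) (normal_deriv ?P)" by (rule smooth_on_normal_deriv[OF open_ball s])
  have sL: "sph_lap ?P x = 0" if "x \<in> ball 0 1" for x
  proof -
    have "rot b c (\<lambda>_::'a. 1::complex) = (\<lambda>_. 0)" "rot b c (\<lambda>_::'a. 0::complex) = (\<lambda>_. 0)" for b c
      by (simp_all add: rot_def[abs_def])
    then have "sph_lap (\<lambda>_::'a. 1::complex) = (\<lambda>_. 0)" by (simp add: sph_lap_def[abs_def])
    then show ?thesis
      using sph_lap_hyp_poisson[OF smooth_near_const that, of 1] by (simp add: hyp_poisson_pair)
  qed
  obtain B where B: "\<forall>x\<in>cball 0 (exp (- 1)). norm (?P x) \<le> B"
    by (rule bounded_on_cball[OF smooth_on_continuous[OF s]])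
  obtain B' where B': "\<forall>x\<in>cball 0 (exp (- 1)). norm (normal_deriv ?P x) \<le> B'"
    by (rule bounded_on_cball[OF smooth_on_continuous[OF sN]])
  have "norm (ray ?P z t) \<le> B" if z: "z \<in> sphere 0 1" and t: "t > 0" for z t
  proof -
    have N0: "ray (normal_deriv ?P) z t = 0" if t: "t > 0" for t
    proof (rule first_order_zero[OF m(1) ray_derivative[OF sN z] _ _ t])
      fix t :: real assume t: "t > 0"
      have "ray (sph_lap ?P) z t = 0" unfolding ray_def by (rule sL[OF ray_in_ball[OF z t]])
      then show "sinh t *\<^sub>R - ray (normal_deriv (normal_deriv ?P)) z t = (real m * cosh t) *\<^sub>R ray (normal_deriv ?P) z t"
        using ray_equation[OF s hyp_laplacian_hyp_poisson[OF c1] z t] unfolding m(2)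
        by (simp add: add_eq_0_iff2 minus_equation_iff)
    next
      fix t :: real assume "t \<ge> 1"
      then show "norm (ray (normal_deriv ?P) z t) \<le> B'"
        unfolding ray_def by (rule B'[rule_format, OF ray_in_cball[OF z]])
    qed
    have d: "(ray ?P z has_vector_derivative 0) (at r)" if "r > 0" for r
      using ray_derivative[OF s z that] unfolding N0[OF that] minus_zero .
    have le: "ray ?P z b = ray ?P z a" if "0 < a" "a \<le> b" for a b
    proof -
      have "norm (ray ?P z b - ray ?P z a) \<le> 0 * (b - a)"
        by (rule mv_bound[OF that(2), of _ "\<lambda>_. 0"]) (use that in \<open>simp_all add: d\<close>)
      then show ?thesis by simp
    qed
    have e: "ray ?P z t = ray ?P z 1"
    proof (cases "t \<le> 1")
      case True
      show ?thesis by (rule le[OF t True, symmetric])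
    next
      case False
      show ?thesis by (rule le) (use False in simp_all)
    qed
    have "norm (ray ?P z 1) \<le> B" unfolding ray_def by (rule B[rule_format, OF ray_in_cball[OF z]]) simp
    then show ?thesis unfolding e .
  qed
  then show ?thesis by blast
qed

text \<open>
  The kernel is nonnegative.
\<close>

lemma norm_hyp_poisson_le:
  fixes F :: "'a::euclidean_space \<Rightarrow> complex"
  assumes F: "continuous_on (sphere 0 1) F" and x: "x \<in> ball 0 1"
    and B: "\<And>\<xi>. \<xi> \<in> sphere 0 1 \<Longrightarrow> norm (F \<xi>) \<le> B"
  shows "norm (hyp_poisson F x) \<le> B * norm (hyp_poisson (\<lambda>_. 1) x)"
proof -
  let ?K = "hyp_poisson_kernel x"
  have K: "complex_of_real (?K \<xi>) = poisson_pair (x, \<xi>)" for \<xi>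
    by (simp add: hyp_poisson_kernel_def poisson_pair_def power2_norm_eq_inner divide_inverse power_mult_distrib)
  have Kc: "continuous_on (sphere 0 1) (\<lambda>\<xi>. complex_of_real (?K \<xi>))"
    unfolding K by (rule poisson_slice_continuous[OF x smooth_on_poisson_pair])
  have Ki: "integrable sphere_measure ?K"
    using integrable_sphere[OF Kc] by (simp only: complex_of_real_integrable_eq)
  have K0: "?K \<xi> \<ge> 0" if "\<xi> \<in> sphere 0 1" for \<xi>
    unfolding hyp_poisson_kernel_def power2_norm_eq_inner sphere_defect[OF that]
    using sphere_defect_pos[OF x that] x ball_inner[of x] by (intro zero_le_power divide_nonneg_pos) auto
  have "norm (hyp_poisson F x) \<le> (LINT \<xi>|sphere_measure. B * ?K \<xi>)"
    unfolding hyp_poisson_def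
  proof (rule order_trans[OF integral_norm_bound integral_mono])
    show "integrable sphere_measure (\<lambda>\<xi>. norm (F \<xi> * complex_of_real (?K \<xi>)))"
      by (intro integrable_norm integrable_sphere continuous_on_mult F Kc)
    show "integrable sphere_measure (\<lambda>\<xi>. B * ?K \<xi>)" by (rule integrable_mult_right[OF Ki])
    fix \<xi> :: 'a assume "\<xi> \<in> space sphere_measure"
    then have \<xi>: "\<xi> \<in> sphere 0 1" by (simp add: space_sphere_measure)
    show "norm (F \<xi> * complex_of_real (?K \<xi>)) \<le> B * ?K \<xi>"
      unfolding norm_mult norm_of_real using B[OF \<xi>] K0[OF \<xi>] by (simp add: mult_right_mono)
  qed
  also have "\<dots> = B * (LINT \<xi>|sphere_measure. ?K \<xi>)" by (rule integral_mult_right_zero)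
  also have "(LINT \<xi>|sphere_measure. ?K \<xi>) = norm (hyp_poisson (\<lambda>_. 1) x)"
  proof -
    have "(LINT \<xi>|sphere_measure. ?K \<xi>) \<ge> 0"
      by (rule integral_nonneg_AE, rule AE_I2) (simp add: space_sphere_measure K0)
    then show ?thesis unfolding hyp_poisson_def mult_1_left integral_complex_of_real by simp
  qed
  finally show ?thesis .
qed

lemma hyp_poisson_ray_bounded:
  fixes F :: "'a::euclidean_space \<Rightarrow> complex"
  assumes n: "DIM('a) \<ge> 3" and F: "continuous_on (sphere 0 1) F"
  shows "bd (sphere 0 1) 1 (ray (hyp_poisson F))"
proof -
  obtain B where B: "\<forall>x\<in>sphere 0 1. norm (F x) \<le> B"
    by (rule continuous_on_compact_bound[OF F compact_sphere]) (rule that)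
  obtain C where C: "\<forall>z\<in>sphere (0::'a) 1. \<forall>t>0. norm (ray (hyp_poisson (\<lambda>_. 1)) z t) \<le> C"
    using ray_hyp_poisson_one_bounded[OF n] by (elim exE) (rule that)
  show ?thesis
  proof (rule bdI)
    fix q :: 'a and t :: real assume q: "q \<in> sphere 0 1" and t: "0 < t" "t \<le> 1"
    have "0 \<le> B" using order_trans[OF norm_ge_zero B[rule_format, OF q]] .
    have "norm (ray (hyp_poisson F) q t) \<le> B * norm (ray (hyp_poisson (\<lambda>_. 1)) q t)"
      unfolding ray_def by (rule norm_hyp_poisson_le[OF F ray_in_ball[OF q t(1)]]) (rule B[rule_format])
    also have "\<dots> \<le> B * C" using C q t \<open>0 \<le> B\<close> by (intro mult_left_mono) auto
    finally show "norm (ray (hyp_poisson F) q t) \<le> B * C" .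
  qed
qed

text \<open>
  The system with boundary points as parameters; boundedness is uniform since every \<open>\<Lambda>^j F\<close> is bounded on the
  sphere.
\<close>

lemma hyp_poisson_ray_ode:
  fixes F :: "'a::euclidean_space \<Rightarrow> complex"
  assumes n: "DIM('a) \<ge> 3" and F: "smooth_near F"
  defines "P \<equiv> \<lambda>j. hyp_poisson ((sph_lap ^^ j) F)"
  shows "ray_ode (DIM('a) - 2) (sphere 0 1) 1
    (\<lambda>j. ray (P j)) (\<lambda>j z t. - ray (normal_deriv (P j)) z t)
    (\<lambda>j. ray (normal_deriv (normal_deriv (P j))))"
proof
  have Fj: "smooth_near ((sph_lap ^^ j) F)" for j by (rule smooth_near_sph_lap_pow[OF F])
  have s: "smooth_on (ball 0 1) (P j)" for j
    unfolding P_def by (rule smooth_on_hyp_poisson[OF smooth_near_continuous[OF Fj]])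
  have sN: "smooth_on (ball 0 1) (normal_deriv (P j))" for j by (rule smooth_on_normal_deriv[OF open_ball s])
  have D: "hyp_laplacian (P j) x = 0" if "x \<in> ball 0 1" for j x
    unfolding P_def by (rule hyp_laplacian_hyp_poisson[OF smooth_near_continuous[OF Fj] that])
  {
    fix j :: nat and z :: 'a and t :: real assume z: "z \<in> sphere 0 1" and t: "t > 0"
    show "(ray (P j) z has_vector_derivative - ray (normal_deriv (P j)) z t) (at t)"
      by (rule ray_derivative[OF s z t])
    show "((\<lambda>t. - ray (normal_deriv (P j)) z t) has_vector_derivative ray (normal_deriv (normal_deriv (P j))) z t) (at t)"
      using has_vector_derivative_minus[OF ray_derivative[OF sN z t, of j]] by simp
    have L: "ray (sph_lap (P j)) z t = ray (P (Suc j)) z t"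
      unfolding ray_def P_def using sph_lap_hyp_poisson[OF Fj ray_in_ball[OF z t], of j] by simp
    have "real (DIM('a) - 2) = real DIM('a) - 2" using n by simp
    then show "sinh t *\<^sub>R (ray (normal_deriv (normal_deriv (P j))) z t + ray (P (Suc j)) z t)
        = (real (DIM('a) - 2) * cosh t) *\<^sub>R - ray (normal_deriv (P j)) z t"
      using ray_equation[OF s D z t, of j] unfolding L by (simp add: add_eq_0_iff2)
  }
  show "bd (sphere 0 1) 1 (ray (P j))" for j
    unfolding P_def by (rule hyp_poisson_ray_bounded[OF n smooth_near_continuous[OF Fj]])
  show "\<exists>C. \<forall>z\<in>sphere 0 1. norm (- ray (normal_deriv (P j)) z 1) \<le> C" for j
  proof -
    obtain B where B: "\<forall>x\<in>cball 0 (exp (- 1)). norm (normal_deriv (P j) x) \<le> B"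
      by (rule bounded_on_cball[OF smooth_on_continuous[OF sN]])
    then have "\<forall>z\<in>sphere 0 1. norm (- ray (normal_deriv (P j)) z 1) \<le> B" by (simp add: ray_def)
    then show ?thesis ..
  qed
qed simp

section \<open>Smoothness up to the boundary\<close>

text \<open>
  A neighbourhood of the sphere in the ball, away from the origin, where partial derivatives decompose into
  normal and tangential ones. The inner radius corresponds to \<open>t = 1\<close>.
\<close>

definition shell :: "'a::euclidean_space set" where
  "shell = {x. exp (- 1) < norm x \<and> norm x < 1}"

lemma open_shell: "open shell"
  unfolding shell_def by (intro open_Collect_conj open_Collect_less continuous_intros)

lemma shell_subset: "shell \<subseteq> ball 0 1" "shell \<subseteq> - {0}"
  unfolding shell_def by auto

lemma normal_deriv_hyp_poisson_bounded:
  fixes F :: "'a::euclidean_space \<Rightarrow> complex"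
  assumes n: "DIM('a) \<ge> 3" "even DIM('a)" and F: "smooth_near F"
  shows "\<exists>M. \<forall>x\<in>shell. norm ((normal_deriv ^^ k) (hyp_poisson F) x) \<le> M"
proof -
  define g where "g k z t = (- 1) ^ k * ray ((normal_deriv ^^ k) (hyp_poisson F)) z t" for k z t
  have s: "smooth_on (ball 0 1) ((normal_deriv ^^ k) (hyp_poisson F))" for k
    by (intro smooth_on_normal_deriv_pow open_ball smooth_on_hyp_poisson smooth_near_continuous[OF F])
  have g: "(g k z has_vector_derivative g (Suc k) z t) (at t)" if "z \<in> sphere 0 1" "t > 0" for k z t
    using has_vector_derivative_mult_right[OF ray_derivative[OF s that], of "(- 1) ^ k" k]
    unfolding g_def[abs_def] by simp
  have g0: "g 0 z t = ray (hyp_poisson ((sph_lap ^^ 0) F)) z t" for z t by (simp add: g_def)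
  have n4: "even (DIM('a) - 2)" "DIM('a) - 2 \<ge> 2" using n by presburger+
  have "bd (sphere 0 1) 1 (g k)"
    by (rule ray_ode.even_all_derivatives_bounded[OF hyp_poisson_ray_ode[OF n(1) F] n4 g0 g])
  then obtain M where M: "\<forall>z\<in>sphere 0 1. \<forall>t\<in>{0<..1}. norm (g k z t) \<le> M"
    unfolding bd_def by (elim exE) (rule that)
  have "norm ((normal_deriv ^^ k) (hyp_poisson F) x) \<le> M" if x: "x \<in> shell" for x
  proof -
    define z where "z = x /\<^sub>R norm x"
    have nx: "0 < norm x" "exp (- 1) < norm x" "norm x < 1" using x unfolding shell_def by auto
    have z: "z \<in> sphere 0 1" using nx by (simp add: z_def)
    have "ln (exp (- 1)) \<le> ln (norm x)" using nx by (intro ln_mono) auto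
    then have t: "- ln (norm x) \<in> {0<..1}" using nx by simp
    have e: "exp (- (- ln (norm x))) *\<^sub>R z = x" using nx by (simp add: z_def)
    have "norm (g k z (- ln (norm x))) \<le> M" using M z t by blast
    then show ?thesis unfolding g_def ray_def e by (simp add: norm_mult norm_power)
  qed
  then show ?thesis by blast
qed

lemma normal_deriv_cong_open:
  assumes "open U" "x \<in> U" "\<And>y. y \<in> U \<Longrightarrow> f y = g y"
  shows "normal_deriv f x = normal_deriv g x"
  unfolding normal_deriv_def by (simp only: partial_cong_open[OF assms])

lemma rot_normal_deriv_hyp_poisson:
  fixes F :: "'a::euclidean_space \<Rightarrow> complex"
  assumes F: "smooth_near F" and b: "b \<in> Basis" "c \<in> Basis" and x: "x \<in> ball 0 1"
  shows "rot b c ((normal_deriv ^^ k) (hyp_poisson F)) x = (normal_deriv ^^ k) (hyp_poisson (rot b c F)) x"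
  using x
proof (induction k arbitrary: x)
  case 0
  then show ?case using rot_hyp_poisson[OF F 0 b] by simp
next
  case (Suc k)
  have s: "smooth_on (ball 0 1) ((normal_deriv ^^ k) (hyp_poisson F))"
    by (intro smooth_on_normal_deriv_pow open_ball smooth_on_hyp_poisson smooth_near_continuous[OF F])
  have "rot b c (normal_deriv ((normal_deriv ^^ k) (hyp_poisson F))) x
      = normal_deriv (rot b c ((normal_deriv ^^ k) (hyp_poisson F))) x"
    by (rule rot_normal_deriv_commute[OF open_ball Suc.prems s b])
  also have "\<dots> = normal_deriv ((normal_deriv ^^ k) (hyp_poisson (rot b c F))) x"
    by (rule normal_deriv_cong_open[OF open_ball Suc.prems Suc.IH])
  finally show ?case by simp
qed

text \<open>
  For even \<open>n\<close> these functions are bounded on the shell. In contrast to the set of its generators, the class is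
  closed under partial derivatives.
\<close>

inductive radial_span :: "('a::euclidean_space \<Rightarrow> complex) \<Rightarrow> bool" where
  radial: "smooth_near F \<Longrightarrow> radial_span ((normal_deriv ^^ k) (hyp_poisson F))"
| scale: "smooth_on (- {0}) a \<Longrightarrow> radial_span f \<Longrightarrow> radial_span (\<lambda>x. a x * f x)"
| add: "radial_span f \<Longrightarrow> radial_span g \<Longrightarrow> radial_span (\<lambda>x. f x + g x)"

lemma radial_span_sum:
  assumes "finite I" "\<And>i. i \<in> I \<Longrightarrow> radial_span (f i)"
  shows "radial_span (\<lambda>x. \<Sum>i\<in>I. f i x)"
  using assms
proof (induction I rule: finite_induct)
  case empty
  have "radial_span (\<lambda>x. 0 * (normal_deriv ^^ 0) (hyp_poisson (\<lambda>_. 0)) x)"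
    by (intro radial_span.scale radial_span.radial smooth_on_const smooth_near_const)
  then show ?case by simp
next
  case (insert i I)
  have "radial_span (\<lambda>x. f i x + (\<Sum>i\<in>I. f i x))"
    by (rule radial_span.add[OF insert.prems insert.IH]) (use insert.prems in auto)
  then show ?case using insert.hyps by simp
qed

lemma radial_span_smooth: "radial_span f \<Longrightarrow> smooth_on shell f"
proof (induction rule: radial_span.induct)
  case (radial F k)
  then show ?case
    by (intro smooth_on_subset[OF _ shell_subset(1)] smooth_on_normal_deriv_pow open_ball smooth_on_hyp_poisson
        smooth_near_continuous)
next
  case (scale a f)
  then show ?case by (intro smooth_on_mult[OF open_shell smooth_on_subset[OF _ shell_subset(2)]])
qed (rule smooth_on_add[OF open_shell])

lemma radial_span_bounded:
  assumes "radial_span (f :: 'a::euclidean_space \<Rightarrow> complex)" and n: "DIM('a) \<ge> 3" "even DIM('a)"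
  shows "\<exists>M. \<forall>x\<in>shell. norm (f x) \<le> M"
  using assms(1)
proof (induction rule: radial_span.induct)
  case (radial F k)
  show ?case by (rule normal_deriv_hyp_poisson_bounded[OF n radial])
next
  case (scale a f)
  let ?K = "{x::'a. exp (- 1) \<le> norm x \<and> norm x \<le> 1}"
  have "?K = cball 0 1 - ball 0 (exp (- 1))" by auto
  then have K: "compact ?K" by (simp add: compact_diff)
  have "continuous_on ?K a"
    by (rule continuous_on_subset[OF smooth_on_continuous[OF scale(1)]]) auto
  then obtain A where A: "\<forall>x\<in>?K. norm (a x) \<le> A"
    by (rule continuous_on_compact_bound) (rule K, rule that)
  obtain M where M: "\<forall>x\<in>shell. norm (f x) \<le> M" using scale.IH by (elim exE) (rule that)
  have "norm (a x * f x) \<le> A * M" if x: "x \<in> shell" for x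
  proof -
    have "x \<in> ?K" using x by (simp add: shell_def)
    then have 1: "norm (a x) \<le> A" using A by blast
    then have "0 \<le> A" by (rule order_trans[OF norm_ge_zero])
    then show ?thesis unfolding norm_mult using 1 M x by (intro mult_mono) auto
  qed
  then show ?case by blast
next
  case (add f g)
  obtain M where M: "\<forall>x\<in>shell. norm (f x) \<le> M" using add.IH(1) by (elim exE) (rule that)
  obtain M' where M': "\<forall>x\<in>shell. norm (g x) \<le> M'" using add.IH(2) by (elim exE) (rule that)
  have "norm (f x + g x) \<le> M + M'" if x: "x \<in> shell" for x
    by (rule order_trans[OF norm_triangle_ineq add_mono]) (use M M' x in auto)
  then show ?case by blast
qed

text \<open>
  On generators \<open>|x|\<^sup>2 \<partial>\<^sub>b = x\<^sub>b N + \<Sum>\<^sub>j x\<^sub>j (x\<^sub>j \<partial>\<^sub>b - x\<^sub>b \<partial>\<^sub>j)\<close>, and both \<open>N\<close> and the rotation fields map generators to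
  generators.
\<close>

lemma radial_span_partial:
  fixes f :: "'a::euclidean_space \<Rightarrow> complex"
  assumes "radial_span f" and b: "b \<in> Basis"
  shows "\<exists>g. radial_span g \<and> (\<forall>x\<in>shell. partial b f x = g x)"
  using assms(1)
proof (induction rule: radial_span.induct)
  case (radial F k)
  let ?h = "(normal_deriv ^^ k) (hyp_poisson F)"
  let ?a = "\<lambda>j x. complex_of_real ((x \<bullet> j) / (x \<bullet> x))"
  let ?g = "\<lambda>x. ?a b x * (normal_deriv ^^ Suc k) (hyp_poisson F) x
      + (\<Sum>j\<in>Basis. ?a j x * (normal_deriv ^^ k) (hyp_poisson (rot j b F)) x)"
  have a: "smooth_on (- {0}) (?a j)" for j :: 'a
    by (intro smooth_on_of_real smooth_on_divide smooth_on_component smooth_on_norm_sq) auto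
  have "radial_span ?g"
    by (intro radial_span.add radial_span_sum radial_span.scale radial_span.radial a radial smooth_near_rot b finite_Basis)
  moreover have "partial b ?h x = ?g x" if x: "x \<in> shell" for x
  proof -
    have xB: "x \<in> ball 0 1" and x0: "x \<bullet> x \<noteq> 0" using x shell_subset by auto
    have r: "(normal_deriv ^^ k) (hyp_poisson (rot j b F)) x
        = complex_of_real (x \<bullet> j) * partial b ?h x - complex_of_real (x \<bullet> b) * partial j ?h x" if "j \<in> Basis" for j
      using rot_normal_deriv_hyp_poisson[OF radial that b xB, of k] by (simp add: rot_def scaleR_conv_of_real)
    have xx: "(\<Sum>j\<in>Basis. complex_of_real (x \<bullet> j) * complex_of_real (x \<bullet> j)) = complex_of_real (x \<bullet> x)"
      by (subst (3) euclidean_inner) simp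
    have "(\<Sum>j\<in>Basis. complex_of_real (x \<bullet> j) * (normal_deriv ^^ k) (hyp_poisson (rot j b F)) x)
       = (\<Sum>j\<in>Basis. complex_of_real (x \<bullet> j) * complex_of_real (x \<bullet> j) * partial b ?h x
          - complex_of_real (x \<bullet> b) * (complex_of_real (x \<bullet> j) * partial j ?h x))"
      by (intro sum.cong refl) (simp add: r algebra_simps)
    also have "\<dots> = complex_of_real (x \<bullet> x) * partial b ?h x - complex_of_real (x \<bullet> b) * normal_deriv ?h x"
      unfolding sum_subtractf sum_distrib_left[symmetric] sum_distrib_right[symmetric] xx
      by (simp add: normal_deriv_def[of ?h] scaleR_conv_of_real)
    finally have key: "complex_of_real (x \<bullet> x) * partial b ?h x = complex_of_real (x \<bullet> b) * normal_deriv ?h x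
       + (\<Sum>j\<in>Basis. complex_of_real (x \<bullet> j) * (normal_deriv ^^ k) (hyp_poisson (rot j b F)) x)"
      by simp
    have "partial b ?h x = inverse (complex_of_real (x \<bullet> x)) * (complex_of_real (x \<bullet> x) * partial b ?h x)"
      using x0 by simp
    also have "\<dots> = ?g x"
      unfolding key distrib_left sum_distrib_left by (simp add: divide_inverse mult_ac)
    finally show ?thesis .
  qed
  ultimately show ?case by (intro exI[of _ ?g] conjI ballI)
next
  case (scale a f)
  obtain g where g: "radial_span g" "\<forall>x\<in>shell. partial b f x = g x" using scale.IH by (elim exE conjE) (rule that)
  have "radial_span (\<lambda>x. a x * g x + partial b a x * f x)"
    by (intro radial_span.add radial_span.scale scale g smooth_on_partial b)
  moreover have "partial b (\<lambda>x. a x * f x) x = a x * g x + partial b a x * f x" if x: "x \<in> shell" for x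
  proof -
    have "partial b (\<lambda>x. a x * f x) x = a x * partial b f x + partial b a x * f x"
      by (rule partial_mult[OF smooth_on_differentiable[OF scale(1)] smooth_on_differentiable[OF radial_span_smooth[OF scale(2)] x]])
        (use x shell_subset in auto)
    then show ?thesis using g(2) x by simp
  qed
  ultimately show ?case by (intro exI conjI ballI)
next
  case (add f g)
  obtain f' where f: "radial_span f'" "\<forall>x\<in>shell. partial b f x = f' x" using add.IH(1) by (elim exE conjE) (rule that)
  obtain g' where g: "radial_span g'" "\<forall>x\<in>shell. partial b g x = g' x" using add.IH(2) by (elim exE conjE) (rule that)
  have "partial b (\<lambda>x. f x + g x) x = f' x + g' x" if x: "x \<in> shell" for x
    using partial_add[OF smooth_on_differentiable[OF radial_span_smooth[OF add(1)] x]
        smooth_on_differentiable[OF radial_span_smooth[OF add(2)] x], of b] f(2) g(2) x by simp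
  then show ?case using radial_span.add[OF f(1) g(1)] by (intro exI conjI ballI)
qed

lemma partials_hyp_poisson_bounded:
  fixes F :: "'a::euclidean_space \<Rightarrow> complex"
  assumes n: "DIM('a) \<ge> 3" "even DIM('a)" and F: "smooth_near F" and bs: "bs \<in> lists Basis"
  shows "\<exists>M. \<forall>x\<in>ball 0 1. norm (foldr partial bs (hyp_poisson F) x) \<le> M"
proof -
  have "\<exists>g. radial_span g \<and> (\<forall>x\<in>shell. foldr partial bs (hyp_poisson F) x = g x)"
    using bs
  proof (induction bs)
    case Nil
    show ?case using radial_span.radial[OF F, of 0] by (intro exI[of _ "hyp_poisson F"]) simp
  next
    case (Cons b bs)
    then obtain g where g: "radial_span g" "\<forall>x\<in>shell. foldr partial bs (hyp_poisson F) x = g x" by auto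
    have "b \<in> Basis" using Cons by simp
    from radial_span_partial[OF g(1) this]
    obtain h where h: "radial_span h" "\<forall>x\<in>shell. partial b g x = h x" by (elim exE conjE) (rule that)
    have "foldr partial (b # bs) (hyp_poisson F) x = h x" if x: "x \<in> shell" for x
    proof -
      have "partial b (foldr partial bs (hyp_poisson F)) x = partial b g x"
        by (rule partial_cong_open[OF open_shell x]) (use g(2) in simp)
      then show ?thesis using h(2) x by simp
    qed
    then show ?case using h(1) by (intro exI conjI ballI)
  qed
  then obtain g where g: "radial_span g" "\<forall>x\<in>shell. foldr partial bs (hyp_poisson F) x = g x"
    by (elim exE conjE) (rule that)
  obtain M where M: "\<forall>x\<in>shell. norm (g x) \<le> M" using radial_span_bounded[OF g(1) n] by (elim exE) (rule that)
  have "continuous_on (ball 0 1) (foldr partial bs (hyp_poisson F))"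
    using smooth_on_hyp_poisson[OF smooth_near_continuous[OF F]] bs unfolding Ck_on_def by simp
  then obtain B where B: "\<forall>x\<in>cball 0 (exp (- 1)). norm (foldr partial bs (hyp_poisson F) x) \<le> B"
    by (rule bounded_on_cball)
  have "norm (foldr partial bs (hyp_poisson F) x) \<le> max B M" if x: "x \<in> ball 0 1" for x
  proof (cases "norm x \<le> exp (- 1)")
    case True
    then show ?thesis using B by (intro max.coboundedI1) simp
  next
    case False
    then have "x \<in> shell" using x by (simp add: shell_def)
    then show ?thesis using g(2) M by (intro max.coboundedI2) simp
  qed
  then show ?thesis by blast
qed

text \<open>
  The ball is convex, so bounded first derivatives imply a Lipschitz bound.
\<close>

lemma uniformly_continuous_of_bounded_partials:
  fixes f :: "'a::euclidean_space \<Rightarrow> complex"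
  assumes d: "\<And>x. x \<in> ball 0 1 \<Longrightarrow> f differentiable (at x)"
    and M: "\<And>b x. b \<in> Basis \<Longrightarrow> x \<in> ball 0 1 \<Longrightarrow> norm (partial b f x) \<le> M b"
  shows "uniformly_continuous_on (ball 0 1) f"
proof -
  let ?C = "\<Sum>b\<in>Basis. M b"
  have M0: "M b \<ge> 0" if "b \<in> Basis" for b
    by (rule order_trans[OF norm_ge_zero M[OF that, of 0]]) simp
  have "norm (f x - f y) \<le> ?C * norm (x - y)" if "x \<in> ball 0 1" "y \<in> ball 0 1" for x y
  proof (rule differentiable_bound[OF convex_ball _ _ that])
    fix x :: 'a assume x: "x \<in> ball 0 1"
    show "(f has_derivative (\<lambda>h. \<Sum>b\<in>Basis. (h \<bullet> b) *\<^sub>R partial b f x)) (at x within ball 0 1)"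
      by (rule has_derivative_at_withinI[OF differentiable_has_derivative_partial[OF d[OF x]]])
    show "onorm (\<lambda>h. \<Sum>b\<in>Basis. (h \<bullet> b) *\<^sub>R partial b f x) \<le> ?C"
    proof (rule onorm_le)
      fix h :: 'a
      have "norm (\<Sum>b\<in>Basis. (h \<bullet> b) *\<^sub>R partial b f x) \<le> (\<Sum>b\<in>Basis. M b * norm h)"
      proof (rule order_trans[OF norm_sum sum_mono])
        fix b :: 'a assume b: "b \<in> Basis"
        have "norm ((h \<bullet> b) *\<^sub>R partial b f x) \<le> norm h * M b"
          unfolding norm_scaleR by (rule mult_mono[OF Basis_le_norm[OF b] M[OF b x]]) simp_all
        then show "norm ((h \<bullet> b) *\<^sub>R partial b f x) \<le> M b * norm h" by (simp add: mult.commute)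
      qed
      then show "norm (\<Sum>b\<in>Basis. (h \<bullet> b) *\<^sub>R partial b f x) \<le> ?C * norm h" by (simp add: sum_distrib_right)
    qed
  qed
  then have "?C-lipschitz_on (ball 0 1) f"
    by (intro lipschitz_onI sum_nonneg M0) (simp_all add: dist_norm)
  then show ?thesis by (rule lipschitz_on_uniformly_continuous)
qed

text \<open>
  Each partial derivative has bounded first partial derivatives, hence extends to the closed ball by uniform
  continuity.
\<close>

theorem even_dim_poisson_smooth_on_closure:
  fixes \<phi> :: "'a::euclidean_space \<Rightarrow> complex"
  assumes n: "DIM('a) \<ge> 3" "even DIM('a)" and \<phi>: "smooth_on_sphere \<phi>"
  shows "smooth_on_closure (ball 0 1) (hyp_poisson \<phi>)"
proof -
  obtain F where F: "smooth_near F" "\<forall>\<zeta>\<in>sphere 0 1. F \<zeta> = \<phi> \<zeta>"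
    by (rule smooth_on_sphere_extension[OF \<phi>])
  have eq: "hyp_poisson \<phi> = hyp_poisson F"
    unfolding hyp_poisson_def
    by (intro ext Bochner_Integration.integral_cong refl) (use F(2) in \<open>simp add: space_sphere_measure\<close>)
  have s: "smooth_on (ball 0 1) (hyp_poisson F)"
    by (rule smooth_on_hyp_poisson[OF smooth_near_continuous[OF F(1)]])
  have "\<exists>g. continuous_on (closure (ball 0 1)) g \<and> (\<forall>x\<in>ball 0 1. g x = foldr partial bs (hyp_poisson F) x)"
    if bs: "bs \<in> lists Basis" for bs
  proof -
    let ?f = "foldr partial bs (hyp_poisson F)"
    have "\<forall>b. \<exists>M. b \<in> Basis \<longrightarrow> (\<forall>x\<in>ball 0 1. norm (partial b ?f x) \<le> M)"
    proof
      fix b :: 'a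
      show "\<exists>M. b \<in> Basis \<longrightarrow> (\<forall>x\<in>ball 0 1. norm (partial b ?f x) \<le> M)"
        using partials_hyp_poisson_bounded[OF n F(1), of "b # bs"] bs by (cases "b \<in> Basis") simp_all
    qed
    from choice[OF this] obtain M where M: "\<forall>b. b \<in> Basis \<longrightarrow> (\<forall>x\<in>ball 0 1. norm (partial b ?f x) \<le> M b)"
      by (elim exE) (rule that)
    have "uniformly_continuous_on (ball 0 1) ?f"
    proof (rule uniformly_continuous_of_bounded_partials)
      show "?f differentiable (at x)" if "x \<in> ball 0 1" for x
        using s bs that unfolding smooth_on_alt by blast
      show "norm (partial b ?f x) \<le> M b" if "b \<in> Basis" "x \<in> ball 0 1" for b x using M that by blast
    qed
    then show ?thesis
    proof (rule uniformly_continuous_on_extension_on_closure)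
      fix g assume g: "uniformly_continuous_on (closure (ball 0 1)) g" "\<And>x. x \<in> ball 0 1 \<Longrightarrow> ?f x = g x"
      show "\<exists>g. continuous_on (closure (ball 0 1)) g \<and> (\<forall>x\<in>ball 0 1. g x = ?f x)"
        by (intro exI[of _ g] conjI ballI uniformly_continuous_imp_continuous g(1) g(2)[symmetric])
    qed
  qed
  then show ?thesis unfolding smooth_on_closure_def eq by (intro conjI s ballI)
qed

section \<open>Boundary distributions of normal derivatives\<close>

text \<open>
  The implications between the three assertions of the odd case form a cycle: constants are annihilated by \<open>N\<close>, a
  convergent family is small compared with the logarithm, and smallness compared with the logarithm forces constancy.
\<close>

theorem theorem8:
  assumes "CARD('n::finite) \<ge> 3"
  shows
    "(odd CARD('n) \<longrightarrow>
       (\<forall>u :: real ^ 'n \<Rightarrow> complex.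
          H_harmonic u \<longrightarrow> has_boundary_distribution u \<longrightarrow>
            (u constant_on ball 0 1
               \<longleftrightarrow> has_boundary_distribution ((normal_deriv ^^ (CARD('n) - 1)) u)) \<and>
            (has_boundary_distribution ((normal_deriv ^^ (CARD('n) - 1)) u)
               \<longleftrightarrow> (\<forall>\<Phi>. smooth_on_sphere \<Phi> \<longrightarrow>
                     sphere_pairing ((normal_deriv ^^ (CARD('n) - 1)) u) \<Phi>
                       \<in> o[at_left 1](\<lambda>r. complex_of_real (ln (1 / (1 - r))))))))
     \<and>
     (even CARD('n) \<longrightarrow>
       (\<forall>\<phi> :: real ^ 'n \<Rightarrow> complex.
          smooth_on_sphere \<phi> \<longrightarrow> smooth_on_closure (ball 0 1) (hyp_poisson \<phi>)) \<and>
       (\<forall>u :: real ^ 'n \<Rightarrow> complex.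
          H_harmonic u \<longrightarrow> has_boundary_distribution u \<longrightarrow>
            (\<forall>k. has_boundary_distribution ((normal_deriv ^^ k) u))))"
proof (intro conjI impI allI)
  have dim: "DIM(real ^ 'n) = CARD('n)" by simp
  fix u :: "real ^ 'n \<Rightarrow> complex"
  assume o: "odd CARD('n)" and H: "H_harmonic u" and bd: "has_boundary_distribution u"
  let ?N = "(normal_deriv ^^ (CARD('n) - 1)) u"
  let ?small = "\<forall>\<Phi>. smooth_on_sphere \<Phi> \<longrightarrow>
    sphere_pairing ?N \<Phi> \<in> o[at_left 1](\<lambda>r. complex_of_real (ln (1 / (1 - r))))"
  have 1: "has_boundary_distribution ?N" if "u constant_on ball 0 1"
    by (rule constant_imp_boundary_distribution[OF that]) (use assms in simp)
  have 2: "?small" if "has_boundary_distribution ?N"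
    by (intro allI impI boundary_distribution_imp_small_log[OF that])
  have 3: "u constant_on ball 0 1" if "?small"
    by (rule odd_dim_small_log_imp_constant[OF _ _ H bd]; unfold dim) (use o assms that in auto)
  show "u constant_on ball 0 1 \<longleftrightarrow> has_boundary_distribution ?N"
    and "has_boundary_distribution ?N \<longleftrightarrow> ?small"
    using 1 2 3 by (iprover, iprover)
next
  fix \<phi> :: "real ^ 'n \<Rightarrow> complex"
  assume "even CARD('n)" "smooth_on_sphere \<phi>"
  then show "smooth_on_closure (ball 0 1) (hyp_poisson \<phi>)"
    by (intro even_dim_poisson_smooth_on_closure) (use assms in simp_all)
next
  fix u :: "real ^ 'n \<Rightarrow> complex" and k
  assume "even CARD('n)" "H_harmonic u" "has_boundary_distribution u"
  then show "has_boundary_distribution ((normal_deriv ^^ k) u)"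
    by (intro even_dim_boundary_distribution) (use assms in simp_all)
qed

end
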